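(* Consider the micropolar fluid system on $\mathbb{R}^3$: $$ \begin{cases} \partial_t u-\Delta u+u\cdot\nabla u+\nabla\pi-\nabla\times\omega=0,\\ \partial_t\omega-\Delta\omega+u\cdot\nabla\omega+2\omega-\nabla\operatorname{div}\omega-\nabla\times u=0,\\ \operatorname{div}u=0,\\ (u,\omega)|_{t=0}=(u_0,\omega_0). \end{cases} $$ For $r\in(2,\infty]$ this system is ill-posed in $\dot B^{-1}_{\infty,r}(\mathbb{R}^3)$ in the sense that the solution map is discontinuous at the origin. More precisely, there exist a sequence of initial data $\{f^N\}_{N=1}^\infty\subset\dot{FB}^{-1}_{1,2}(\mathbb{R}^3)$ and a sequence of times $\{t^N\}_{N=1}^\infty$ with $$\|f^N\|_{\dot B^{-1}_{\infty,r}(\mathbb{R}^3)}\to0\quad\text{and}\quad t^N\to0\quad\text{as }N\to\infty,$$ such that the corresponding sequence of solutions $(u,\omega)=(u[f^N],\omega[f^N])\in C([0,\infty);\dot{FB}^{-1}_{1,2}(\mathbb{R}^3))$ to the initial value problem for this system with $(u[f^N],\omega[f^N])(0)=f^N$ satisfies $$\|u[f^N](t^N)\|_{\dot B^{-1}_{\infty,r}(\mathbb{R}^3)}\ge c_0\quad\text{and}\quad\|\omega[f^N](t^N)\|_{\dot B^{-1}_{\infty,r}(\mathbb{R}^3)}\ge c_0,$$ with a positive constant $c_0$ independent of $N$.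
   Context: Unknowns: $u=u(x,t)$ and $\omega=\omega(x,t)$ are vector fields with three components and $\pi=\pi(x,t)$ is a scalar, for $x\in\mathbb{R}^3$, $t>0$. Initial data are pairs $f=(u_0,\omega_0)$ with $\operatorname{div}u_0=0$ (as required by the system); $(u[f],\omega[f])$ denotes the solution with initial data $f$. Fourier transform: $\hat f(\xi)=\mathcal F[f](\xi)=\int_{\mathbb{R}^3}e^{-ix\cdot\xi}f(x)\,dx$. Littlewood-Paley blocks: $\psi\in\mathcal S(\mathbb{R}^3)$ is a fixed nonnegative function supported in $\{3/4\le|\xi|\le 8/3\}$ with $\sum_{j\in\mathbb{Z}}\psi(2^{-j}\xi)=1$ for all $\xi\neq0$; $\Delta_jf=\mathcal F^{-1}(\psi(2^{-j}\xi)\hat f(\xi))$, $j\in\mathbb{Z}$. $\mathcal S'_h(\mathbb{R}^3)=\mathcal S'(\mathbb{R}^3)/\mathcal P(\mathbb{R}^3)$, where $\mathcal P$ is the set of polynomials. Besov spaces: for $s\in\mathbb{R}$, $1\le p,r\le\infty$, $\dot B^s_{p,r}(\mathbb{R}^3)$ is the set of $f\in\mathcal S'_h(\mathbb{R}^3)$ with $\|f\|_{\dot B^s_{p,r}}:=\big(\sum_{j\in\mathbb{Z}}2^{jsr}\|\Delta_jf\|_{L^p}^r\big)^{1/r}<\infty$ (supremum over $j$ of $2^{js}\|\Delta_jf\|_{L^p}$ if $r=\infty$). Fourier-Besov spaces: for $s\in\mathbb{R}$, $1\le p,r\le\infty$, $\dot{FB}^s_{p,r}(\mathbb{R}^3)$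 is the set of $f\in\mathcal S'_h(\mathbb{R}^3)$ with $\hat f\in L^1_{loc}(\mathbb{R}^3)$ and $\|f\|_{\dot{FB}^s_{p,r}}:=\big(\sum_{j\in\mathbb{Z}}2^{jsr}\|\widehat{\Delta_jf}\|_{L^p}^r\big)^{1/r}<\infty$ (supremum over $j$ of $2^{js}\|\widehat{\Delta_jf}\|_{L^p}$ if $r=\infty$). Vector-valued functions belong to these spaces componentwise. Linear semigroup: $\widehat{G(t)f}(\xi)=e^{-t\mathcal A(\xi)}\hat f(\xi)$ for six-component $f=(f_1,f_2)^T$ (each $f_i$ with three components), where $$\mathcal A(\xi)=\begin{bmatrix}|\xi|^2I&\mathcal B(\xi)\\ \mathcal B(\xi)&(|\xi|^2+2)I+\mathcal C(\xi)\end{bmatrix},\quad \mathcal B(\xi)=i\begin{bmatrix}0&\xi_3&-\xi_2\\-\xi_3&0&\xi_1\\ \xi_2&-\xi_1&0\end{bmatrix},\quad \mathcal C(\xi)=(\xi_k\xi_l)_{k,l=1}^3.$$ Solutions are understood as mild solutions: let $\mathbf P=I+\nabla(-\Delta)^{-1}\operatorname{div}$ be the Leray projection (Fourier symbol $(\delta_{kl}-\xi_k\xi_l/|\xi|^2)_{k,l=1}^3$). With $U=(u,\omega)^T$, $U_0=(u_0,\omega_0)^T$, set $\tilde{\mathbf P}\nabla\cdot(U\tilde\otimes U)=(\mathbf P\nabla\cdot(u\otimes u),\ \nabla\cdot(u\otimes\omega))^T$, where $(\nabla\cdot(u\otimes v))_l=\sum_k\partial_k(u_kv_l)$. A mild solution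 is a solution of the integral equation $$U(t)=G(t)U_0-\int_0^tG(t-\tau)\tilde{\mathbf P}\nabla\cdot(U\tilde\otimes U)(\tau)\,d\tau .$$ *)

theory Defs
  imports "HOL-Analysis.Analysis" "HOL-Probability.Essential_Supremum"
begin

section \<open>Schwartz functions and tempered distributions on three-space\<close>

definition pd :: "3 \<Rightarrow> (real^3 \<Rightarrow> complex) \<Rightarrow> real^3 \<Rightarrow> complex" where
  "pd k \<phi> = (\<lambda>x. frechet_derivative \<phi> (at x) (axis k 1))"

primrec pds :: "3 list \<Rightarrow> (real^3 \<Rightarrow> complex) \<Rightarrow> real^3 \<Rightarrow> complex" where
  "pds [] \<phi> = \<phi>"
| "pds (k # ks) \<phi> = pd k (pds ks \<phi>)"

definition schwartz :: "(real^3 \<Rightarrow> complex) \<Rightarrow> bool" where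
  "schwartz \<phi> \<longleftrightarrow>
     (\<forall>ks x. pds ks \<phi> differentiable (at x)) \<and>
     (\<forall>ks N. bounded (range (\<lambda>x. (1 + norm x) ^ N *\<^sub>R pds ks \<phi> x)))"

definition schwartz_norm :: "nat \<Rightarrow> (real^3 \<Rightarrow> complex) \<Rightarrow> real" where
  "schwartz_norm N \<phi> = (\<Sum>ks | length ks \<le> N. SUP x. (1 + norm x) ^ N * cmod (pds ks \<phi> x))"

text \<open>A distribution is a functional on all functions, of which only the values on Schwartz
  functions are meaningful.

  Elements of the space of tempered distributions modulo polynomials are given by representatives.
  The dyadic blocks, hence all norms below, do not see polynomials. A class with a locally
  integrable Fourier transform has exactly one representative whose Fourier transform is a locally
  integrable function (a non-zero polynomial has a Fourier transform supported at the origin),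
  and this is the representative used throughout.\<close>

type_synonym tdist = "(real^3 \<Rightarrow> complex) \<Rightarrow> complex"

definition tempered :: "tdist \<Rightarrow> bool" where
  "tempered T \<longleftrightarrow>
     (\<forall>\<phi> \<eta> a b. schwartz \<phi> \<longrightarrow> schwartz \<eta> \<longrightarrow>
        T (\<lambda>x. a * \<phi> x + b * \<eta> x) = a * T \<phi> + b * T \<eta>) \<and>
     (\<exists>N C. \<forall>\<phi>. schwartz \<phi> \<longrightarrow> cmod (T \<phi>) \<le> C * schwartz_norm N \<phi>)"

definition real_dist :: "tdist \<Rightarrow> bool" where
  "real_dist T \<longleftrightarrow> (\<forall>\<phi>. schwartz \<phi> \<and> (\<forall>x. \<phi> x \<in> \<real>) \<longrightarrow> T \<phi> \<in> \<real>)"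

definition locally_integrable :: "(real^3 \<Rightarrow> complex) \<Rightarrow> bool" where
  "locally_integrable g \<longleftrightarrow> (\<forall>K. compact K \<longrightarrow> set_integrable lborel K g)"

text \<open>The distribution \<open>T\<close> is the locally integrable function \<open>g\<close>. Only compactly supported
  test functions are used, since a locally integrable function can be a tempered distribution
  without being integrable against every Schwartz function.\<close>

definition dist_fun :: "tdist \<Rightarrow> (real^3 \<Rightarrow> complex) \<Rightarrow> bool" where
  "dist_fun T g \<longleftrightarrow> locally_integrable g \<and>
     (\<forall>\<phi> K. schwartz \<phi> \<and> compact K \<and> (\<forall>x. x \<notin> K \<longrightarrow> \<phi> x = 0) \<longrightarrow>
        T \<phi> = (LINT x|lborel. g x * \<phi> x))"

definition dist_deriv :: "3 \<Rightarrow> tdist \<Rightarrow> tdist" where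
  "dist_deriv k T = (\<lambda>\<phi>. - T (pd k \<phi>))"

definition mult_dist :: "(real^3 \<Rightarrow> complex) \<Rightarrow> tdist \<Rightarrow> tdist" where
  "mult_dist m T = (\<lambda>\<phi>. T (\<lambda>x. m x * \<phi> x))"

definition fourier :: "(real^3 \<Rightarrow> complex) \<Rightarrow> real^3 \<Rightarrow> complex" where
  "fourier \<phi> \<xi> = (LINT x|lborel. exp (- \<i> * of_real (x \<bullet> \<xi>)) * \<phi> x)"

definition inv_fourier :: "(real^3 \<Rightarrow> complex) \<Rightarrow> real^3 \<Rightarrow> complex" where
  "inv_fourier \<phi> x =
     of_real (1 / (2 * pi) ^ 3) * (LINT \<xi>|lborel. exp (\<i> * of_real (x \<bullet> \<xi>)) * \<phi> \<xi>)"

definition fourier_dist :: "tdist \<Rightarrow> tdist" where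
  "fourier_dist T = (\<lambda>\<phi>. T (fourier \<phi>))"

definition inv_fourier_dist :: "tdist \<Rightarrow> tdist" where
  "inv_fourier_dist T = (\<lambda>\<phi>. T (inv_fourier \<phi>))"

definition has_fourier :: "tdist \<Rightarrow> (real^3 \<Rightarrow> complex) \<Rightarrow> bool" where
  "has_fourier T h \<longleftrightarrow> tempered T \<and> dist_fun (fourier_dist T) h"


section \<open>Besov and Fourier-Besov norms\<close>

text \<open>The power \<open>x\<^sup>a\<close> on \<open>[0, \<infinity>]\<close>, meant for \<open>a > 0\<close>.\<close>

definition enn_powr :: "ennreal \<Rightarrow> real \<Rightarrow> ennreal" where
  "enn_powr x a = (if x = \<infinity> then \<infinity> else ennreal (enn2real x powr a))"

definition Lnorm :: "ennreal \<Rightarrow> (real^3 \<Rightarrow> complex) \<Rightarrow> ennreal" where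
  "Lnorm p g =
     (if p = \<infinity> then esssup lborel (\<lambda>x. ennreal (cmod (g x)))
      else enn_powr (\<integral>\<^sup>+x. enn_powr (ennreal (cmod (g x))) (enn2real p) \<partial>lborel) (1 / enn2real p))"

text \<open>The infimum is over a single almost-everywhere class of functions, or over the empty set if
  \<open>T\<close> is not a locally integrable function; in the latter case the norm is \<open>\<infinity>\<close>.\<close>

definition dist_Lnorm :: "ennreal \<Rightarrow> tdist \<Rightarrow> ennreal" where
  "dist_Lnorm p T = (INF g \<in> {g. dist_fun T g}. Lnorm p g)"

definition littlewood_paley :: "(real^3 \<Rightarrow> real) \<Rightarrow> bool" where
  "littlewood_paley \<psi> \<longleftrightarrow>
     schwartz (\<lambda>\<xi>. of_real (\<psi> \<xi>)) \<and>
     (\<forall>\<xi>. 0 \<le> \<psi> \<xi>) \<and>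
     (\<forall>\<xi>. \<psi> \<xi> \<noteq> 0 \<longrightarrow> 3/4 \<le> norm \<xi> \<and> norm \<xi> \<le> 8/3) \<and>
     (\<forall>\<xi>. \<xi> \<noteq> 0 \<longrightarrow> ((\<lambda>j::int. \<psi> (2 powi (- j) *\<^sub>R \<xi>)) has_sum 1) UNIV)"

definition LP_block :: "(real^3 \<Rightarrow> real) \<Rightarrow> int \<Rightarrow> tdist \<Rightarrow> tdist" where
  "LP_block \<psi> j T =
     inv_fourier_dist (mult_dist (\<lambda>\<xi>. of_real (\<psi> (2 powi (- j) *\<^sub>R \<xi>))) (fourier_dist T))"

text \<open>The weighted sequence norm with weights \<open>2\<^sup>j\<^sup>s\<close> over all integers \<open>j\<close>.\<close>

definition dyadic_norm :: "real \<Rightarrow> ennreal \<Rightarrow> (int \<Rightarrow> ennreal) \<Rightarrow> ennreal" where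
  "dyadic_norm s r a =
     (if r = \<infinity> then (SUP j. ennreal (2 powr (of_int j * s)) * a j)
      else enn_powr
        (\<Sum>\<^sub>\<infinity>j. ennreal (2 powr (of_int j * s * enn2real r)) * enn_powr (a j) (enn2real r))
        (1 / enn2real r))"

definition besov_norm ::
  "(real^3 \<Rightarrow> real) \<Rightarrow> real \<Rightarrow> ennreal \<Rightarrow> ennreal \<Rightarrow> tdist \<Rightarrow> ennreal" where
  "besov_norm \<psi> s p r T = dyadic_norm s r (\<lambda>j. dist_Lnorm p (LP_block \<psi> j T))"

definition FB_norm ::
  "(real^3 \<Rightarrow> real) \<Rightarrow> real \<Rightarrow> ennreal \<Rightarrow> ennreal \<Rightarrow> tdist \<Rightarrow> ennreal" where
  "FB_norm \<psi> s p r T = dyadic_norm s r (\<lambda>j. dist_Lnorm p (fourier_dist (LP_block \<psi> j T)))"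

definition FB :: "(real^3 \<Rightarrow> real) \<Rightarrow> real \<Rightarrow> ennreal \<Rightarrow> ennreal \<Rightarrow> tdist set" where
  "FB \<psi> s p r = {T. (\<exists>h. has_fourier T h) \<and> FB_norm \<psi> s p r T < \<infinity>}"

text \<open>For vector-valued distributions the norms of the components are added.\<close>

definition vec_besov_norm ::
  "(real^3 \<Rightarrow> real) \<Rightarrow> real \<Rightarrow> ennreal \<Rightarrow> ennreal \<Rightarrow> tdist^'n \<Rightarrow> ennreal" where
  "vec_besov_norm \<psi> s p r F = (\<Sum>i\<in>UNIV. besov_norm \<psi> s p r (F $ i))"

definition vec_FB_norm ::
  "(real^3 \<Rightarrow> real) \<Rightarrow> real \<Rightarrow> ennreal \<Rightarrow> ennreal \<Rightarrow> tdist^'n \<Rightarrow> ennreal" where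
  "vec_FB_norm \<psi> s p r F = (\<Sum>i\<in>UNIV. FB_norm \<psi> s p r (F $ i))"

definition vec_FB :: "(real^3 \<Rightarrow> real) \<Rightarrow> real \<Rightarrow> ennreal \<Rightarrow> ennreal \<Rightarrow> (tdist^'n) set" where
  "vec_FB \<psi> s p r = {F. \<forall>i. F $ i \<in> FB \<psi> s p r}"

definition continuous_into_FB ::
  "(real^3 \<Rightarrow> real) \<Rightarrow> real \<Rightarrow> ennreal \<Rightarrow> ennreal \<Rightarrow> (real \<Rightarrow> tdist^'n) \<Rightarrow> bool" where
  "continuous_into_FB \<psi> s p r U \<longleftrightarrow>
     (\<forall>t\<ge>0. U t \<in> vec_FB \<psi> s p r) \<and>
     (\<forall>t\<^sub>0\<ge>0. ((\<lambda>t. vec_FB_norm \<psi> s p r (U t - U t\<^sub>0)) \<longlongrightarrow> 0) (at t\<^sub>0 within {0..}))"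


section \<open>Mild solutions of the micropolar system\<close>

text \<open>A pair of three-component fields is indexed by the sum type \<open>3 + 3\<close>: the velocity has the
  indices \<open>Inl k\<close> and the micro-rotation the indices \<open>Inr k\<close>.\<close>

definition velocity :: "'a^(3 + 3) \<Rightarrow> 'a^3" where
  "velocity U = (\<chi> k. U $ Inl k)"

definition microrotation :: "'a^(3 + 3) \<Rightarrow> 'a^3" where
  "microrotation U = (\<chi> k. U $ Inr k)"

definition B_sym :: "real^3 \<Rightarrow> complex^3^3" where
  "B_sym \<xi> = (\<chi> k l. \<i> * of_real
     ((vector [vector [0, \<xi>$3, - \<xi>$2],
               vector [- \<xi>$3, 0, \<xi>$1],
               vector [\<xi>$2, - \<xi>$1, 0]] :: real^3^3) $ k $ l))"

definition C_sym :: "real^3 \<Rightarrow> complex^3^3" where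
  "C_sym \<xi> = (\<chi> k l. of_real (\<xi>$k * \<xi>$l))"

definition A_sym :: "real^3 \<Rightarrow> complex^(3 + 3)^(3 + 3)" where
  "A_sym \<xi> = (\<chi> a b. case a of
       Inl k \<Rightarrow> (case b of Inl l \<Rightarrow> of_real ((norm \<xi>)\<^sup>2) * mat 1 $ k $ l
                         | Inr l \<Rightarrow> B_sym \<xi> $ k $ l)
     | Inr k \<Rightarrow> (case b of Inl l \<Rightarrow> B_sym \<xi> $ k $ l
                         | Inr l \<Rightarrow> of_real ((norm \<xi>)\<^sup>2 + 2) * mat 1 $ k $ l + C_sym \<xi> $ k $ l))"

primrec mat_pow :: "complex^'n^'n \<Rightarrow> nat \<Rightarrow> complex^'n^'n" where
  "mat_pow M 0 = mat 1"
| "mat_pow M (Suc n) = M ** mat_pow M n"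

definition mat_exp :: "complex^'n^'n \<Rightarrow> complex^'n^'n" where
  "mat_exp M = (\<Sum>n. (1 / fact n) *\<^sub>R mat_pow M n)"

text \<open>\<open>fourier_mult M F H\<close>: the Fourier transform of \<open>F\<close> is a locally integrable function, and
  \<open>H\<close> is the image of \<open>F\<close> under the Fourier multiplier with matrix symbol \<open>M\<close>. It is a relation
  because a symbol that is not smooth at the origin does not act on all tempered distributions.\<close>

definition fourier_mult :: "(real^3 \<Rightarrow> complex^'n^'n) \<Rightarrow> tdist^'n \<Rightarrow> tdist^'n \<Rightarrow> bool" where
  "fourier_mult M F H \<longleftrightarrow>
     (\<exists>h. (\<forall>i. has_fourier (F $ i) (\<lambda>\<xi>. h \<xi> $ i)) \<and>
          (\<forall>i. has_fourier (H $ i) (\<lambda>\<xi>. (M \<xi> *v h \<xi>) $ i)))"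

definition semigroup_G :: "real \<Rightarrow> tdist^(3 + 3) \<Rightarrow> tdist^(3 + 3) \<Rightarrow> bool" where
  "semigroup_G t = fourier_mult (\<lambda>\<xi>. mat_exp ((- t) *\<^sub>R A_sym \<xi>))"

definition leray :: "tdist^3 \<Rightarrow> tdist^3 \<Rightarrow> bool" where
  "leray = fourier_mult (\<lambda>\<xi>. \<chi> k l. mat 1 $ k $ l - of_real (\<xi>$k * \<xi>$l / (norm \<xi>)\<^sup>2))"

definition divergence_free :: "tdist^3 \<Rightarrow> bool" where
  "divergence_free u \<longleftrightarrow> (\<forall>\<phi>. schwartz \<phi> \<longrightarrow> (\<Sum>k\<in>UNIV. dist_deriv k (u $ k) \<phi>) = 0)"

text \<open>Products of distributions are pointwise products of locally integrable functions, where
  these define tempered distributions.\<close>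

definition dist_product :: "tdist \<Rightarrow> tdist \<Rightarrow> tdist \<Rightarrow> bool" where
  "dist_product S T R \<longleftrightarrow> tempered R \<and>
     (\<exists>g h. dist_fun S g \<and> dist_fun T h \<and> dist_fun R (\<lambda>x. g x * h x))"

text \<open>\<open>div_tensor u v w\<close>: \<open>w\<close> is the divergence of \<open>u \<otimes> v\<close>, contracted with the index of \<open>u\<close>.\<close>

definition div_tensor :: "tdist^3 \<Rightarrow> tdist^3 \<Rightarrow> tdist^3 \<Rightarrow> bool" where
  "div_tensor u v w \<longleftrightarrow>
     (\<exists>p. (\<forall>k l. dist_product (u $ k) (v $ l) (p k l)) \<and>
          (\<forall>l \<phi>. schwartz \<phi> \<longrightarrow> (w $ l) \<phi> = (\<Sum>k\<in>UNIV. dist_deriv k (p k l) \<phi>)))"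

definition nonlinearity :: "tdist^(3 + 3) \<Rightarrow> tdist^(3 + 3) \<Rightarrow> bool" where
  "nonlinearity U N \<longleftrightarrow>
     (\<exists>w. div_tensor (velocity U) (velocity U) w \<and> leray w (velocity N)) \<and>
     div_tensor (velocity U) (microrotation U) (microrotation N)"

text \<open>The nonlinearity only has to make sense at almost every time, and the Duhamel integral is the
  weak integral in the space of tempered distributions.\<close>

definition mild_solution :: "tdist^(3 + 3) \<Rightarrow> (real \<Rightarrow> tdist^(3 + 3)) \<Rightarrow> bool" where
  "mild_solution U\<^sub>0 U \<longleftrightarrow>
     (\<exists>N. (AE \<tau> in lborel. 0 < \<tau> \<longrightarrow> nonlinearity (U \<tau>) (N \<tau>)) \<and>
       (\<forall>t\<ge>0. \<exists>L D. semigroup_G t U\<^sub>0 L \<and>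
          (AE \<tau> in lborel. 0 < \<tau> \<and> \<tau> < t \<longrightarrow> semigroup_G (t - \<tau>) (N \<tau>) (D \<tau>)) \<and>
          (\<forall>a \<phi>. schwartz \<phi> \<longrightarrow>
             set_integrable lborel {0..t} (\<lambda>\<tau>. (D \<tau> $ a) \<phi>) \<and>
             (U t $ a) \<phi> = (L $ a) \<phi> - (LINT \<tau>:{0..t}|lborel. (D \<tau> $ a) \<phi>))))"

end

theory Submission
  imports Defs "HOL-Probability.Characteristic_Functions" "HOL-Probability.Sinc_Integral"
begin

text \<open>The mechanism is a transfer of energy from high to low frequencies. The data consist of \<open>N\<close> wave
  packets at the lacunary frequencies \<open>\<plusminus> 2\<^sup>k\<close>, \<open>N < k \<le> 2 N\<close>, in the third direction. All of them are
  curls, velocity and micro-rotation are equal, and each packet has size \<open>c = \<delta> / sqrt N\<close> in the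
  scaling of \<open>B\<^sup>-\<^sup>1\<close>. A dyadic block sees boundedly many packets, so the norm of the data in
  \<open>B\<^sup>-\<^sup>1\<^bsub>\<infinity>,r\<^esub>\<close> is at most a multiple of \<open>\<delta> N\<^bsup>1/r - 1/2\<^esup>\<close> (\<open>vec_besov_norm_h0\<close>), which tends to zero for
  \<open>r > 2\<close>. The product of a packet with its opposite, on the other hand, lives at frequencies of order one,
  where the linear evolution is inert. Each of the \<open>N\<close> pairs contributes \<open>c\<^sup>2\<close> during its life time of
  order \<open>4\<^sup>-\<^sup>k\<close>, and the contributions have the same sign; hence the second Picard iterate is of
  order \<open>N c\<^sup>2 = \<delta>\<^sup>2\<close> at the central block, for times \<open>t \<ge> 4\<^sup>-\<^sup>N\<close>, in the velocity as well as in the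
  micro-rotation (\<open>main_term_nth\<close>). At the time \<open>2\<^sup>-\<^sup>N\<close> everything else is smaller.

  The solution is constructed on the Fourier side. The Fourier transform of the solution is the fixed
  point of a quadratic map, found by Picard iteration in \<open>L\<^sup>2\<close> in time with values in \<open>L\<^sup>1\<close> in
  frequency. The linear evolution of the data is bounded there by a multiple of \<open>\<delta>\<close>, uniformly in \<open>N\<close>:
  the square of a lacunary sum is comparable to the sum of the squares (\<open>lacunary_square\<close>,
  \<open>mixed_sq_H\<close>). In these estimates the semigroup enters only through its decay \<open>exp (- t \<bar>\<xi>\<bar>\<^sup>2 / 2)\<close>, which
  follows from the coercivity of the symbol (\<open>A_sym_coercive\<close>). To avoid a Banach space of classes of
  functions, the iterates are dominated pointwise by those of a scalar equation with nonnegative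
  kernel, whose limit is a supremum in \<open>[0, \<infinity>]\<close>; this yields convergence at almost every
  frequency (\<open>sol_fixed_point\<close>). Weighted with \<open>1 / \<bar>\<xi>\<bar>\<close>, the same estimates give membership in
  \<open>FB\<^sup>-\<^sup>1\<^bsub>1,2\<^esub>\<close> and continuity in time (\<open>continuous_freq_vec_sol\<close>), and with Fubini's theorem the fixed point
  equation becomes the integral equation of mild solutions (\<open>mild_solution_freq_vec_sol\<close>).

  The inflation is detected by pairing the central block of one component with a test
  function \<open>\<partial>\<^sub>1 \<phi>\<close>, where \<open>\<phi>\<close> is a bump concentrated near the origin, so that its transform is nearly constant
  on the block (\<open>block_pairing_ge\<close>). The pairing is the main term of size \<open>\<delta>\<^sup>2\<close> up to three errors: the third
  and higher Picard iterates, of size \<open>\<delta>\<^sup>3\<close> (\<open>third_order_remainder\<close>), the difference between the linear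
  flow and the heat flow on the packets, of size \<open>2\<^sup>-\<^sup>N \<delta>\<^sup>2\<close> (\<open>bil_linear_minus_bil_heat\<close>), and the action of the
  propagator on low frequencies during the short time, of size \<open>t \<delta>\<^sup>2\<close>
  (\<open>bil_heat_flow_minus_main_term\<close>). A small \<open>\<delta>\<close> and all large \<open>N\<close> leave half of the main
  term (\<open>inflation_parameters\<close>).\<close>


section \<open>Schwartz functions\<close>

lemma pd_eq: "(\<phi> has_derivative D) (at x) \<Longrightarrow> pd k \<phi> x = D (axis k 1)"
  unfolding pd_def by (metis frechet_derivative_at)

lemma pd_add:
  assumes "\<And>x. \<phi> differentiable (at x)" "\<And>x. \<eta> differentiable (at x)"
  shows "pd k (\<lambda>x. \<phi> x + \<eta> x) = (\<lambda>x. pd k \<phi> x + pd k \<eta> x)"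
proof
  fix x
  show "pd k (\<lambda>x. \<phi> x + \<eta> x) x = pd k \<phi> x + pd k \<eta> x"
    using pd_eq[OF has_derivative_add[OF assms[of x, unfolded frechet_derivative_works]]]
    by (simp add: pd_def)
qed

lemma pds_snoc: "pds (ks @ [k]) \<phi> = pds ks (pd k \<phi>)"
  by (induction ks) auto

lemma schwartz_differentiable: "schwartz \<phi> \<Longrightarrow> \<phi> differentiable (at x)"
  unfolding schwartz_def by (metis pds.simps(1))

lemma schwartz_has_derivative:
  "schwartz \<phi> \<Longrightarrow> (\<phi> has_derivative frechet_derivative \<phi> (at x)) (at x)"
  using schwartz_differentiable frechet_derivative_works by blast

lemma schwartz_continuous: "schwartz \<phi> \<Longrightarrow> continuous_on UNIV \<phi>"
  by (simp add: continuous_at_imp_continuous_on differentiable_imp_continuous_within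
      schwartz_differentiable)

lemma schwartz_measurable [measurable_dest]: "schwartz \<phi> \<Longrightarrow> \<phi> \<in> borel_measurable borel"
  by (simp add: borel_measurable_continuous_onI schwartz_continuous)

lemma schwartz_pd: "schwartz \<phi> \<Longrightarrow> schwartz (pd k \<phi>)"
  unfolding schwartz_def by (metis pds_snoc)

lemma schwartz_decay:
  assumes "schwartz \<phi>"
  obtains C where "C \<ge> 0" "\<And>x. (1 + norm x) ^ N * cmod (\<phi> x) \<le> C"
proof -
  have "bounded (range (\<lambda>x. (1 + norm x) ^ N *\<^sub>R pds [] \<phi> x))"
    using assms unfolding schwartz_def by blast
  then obtain C where C: "\<And>x. norm ((1 + norm x) ^ N *\<^sub>R \<phi> x) \<le> C"
    unfolding bounded_iff by auto
  then have "(1 + norm x) ^ N * cmod (\<phi> x) \<le> C" for x by (simp add: power_abs)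
  moreover from this[of 0] have "C \<ge> 0" by (smt (verit) C norm_ge_zero)
  ultimately show thesis using that by blast
qed

text \<open>Coinduction avoids any computation of higher derivatives: it is enough to exhibit a class of
  functions that is closed under first derivatives.\<close>

lemma schwartz_coinduct:
  assumes "Q \<phi>"
    and "\<And>\<phi> x. Q \<phi> \<Longrightarrow> \<phi> differentiable (at x)"
    and "\<And>\<phi> k. Q \<phi> \<Longrightarrow> Q (pd k \<phi>)"
    and "\<And>\<phi> N. Q \<phi> \<Longrightarrow> \<exists>C. \<forall>x. (1 + norm x) ^ N * cmod (\<phi> x) \<le> C"
  shows "schwartz \<phi>"
proof -
  have Q: "Q (pds ks \<phi>)" for ks by (induction ks) (auto intro: assms)
  show ?thesis unfolding schwartz_def
  proof (intro conjI allI)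
    show "pds ks \<phi> differentiable (at x)" for ks x using Q assms by blast
    show "bounded (range (\<lambda>x. (1 + norm x) ^ N *\<^sub>R pds ks \<phi> x))" for ks N
      using assms(4)[OF Q, of N ks] unfolding bounded_iff by (auto simp: power_abs)
  qed
qed

text \<open>Slowly increasing multipliers act on Schwartz functions. The derivatives of a product are
  sums of products, which motivates the following inductive class.\<close>

inductive sums_of_products for G where
  prod: "g \<in> G \<Longrightarrow> schwartz \<eta> \<Longrightarrow> sums_of_products G (\<lambda>x. g x * \<eta> x)"
| plus: "sums_of_products G a \<Longrightarrow> sums_of_products G b \<Longrightarrow> sums_of_products G (\<lambda>x. a x + b x)"

lemma schwartz_multiplier:
  fixes G :: "(real^3 \<Rightarrow> complex) set"
  assumes diff: "\<And>g x. g \<in> G \<Longrightarrow> g differentiable (at x)"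
    and pd: "\<And>g k. g \<in> G \<Longrightarrow> pd k g \<in> G"
    and grow: "\<And>g. g \<in> G \<Longrightarrow> \<exists>C\<ge>0. \<exists>N. \<forall>x. cmod (g x) \<le> C * (1 + norm x) ^ N"
    and "g \<in> G" "schwartz \<eta>"
  shows "schwartz (\<lambda>x. g x * \<eta> x)"
proof (rule schwartz_coinduct[where Q="sums_of_products G"])
  show "sums_of_products G (\<lambda>x. g x * \<eta> x)" using assms by (intro sums_of_products.prod)
  show d: "\<phi> differentiable (at x)" if "sums_of_products G \<phi>" for \<phi> x
    using that by induction (auto intro!: differentiable_mult differentiable_add intro: diff schwartz_differentiable)
  show "sums_of_products G (pd k \<phi>)" if "sums_of_products G \<phi>" for \<phi> k
    using that
  proof induction
    case (prod g \<eta>)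
    have "pd k (\<lambda>x. g x * \<eta> x) = (\<lambda>x. g x * pd k \<eta> x + pd k g x * \<eta> x)"
    proof
      fix x
      have "((\<lambda>x. g x * \<eta> x) has_derivative
          (\<lambda>h. g x * frechet_derivative \<eta> (at x) h + frechet_derivative g (at x) h * \<eta> x)) (at x)"
        using diff[OF prod(1)] schwartz_has_derivative[OF prod(2)]
        by (intro has_derivative_mult) (auto simp: frechet_derivative_works)
      from pd_eq[OF this] show "pd k (\<lambda>x. g x * \<eta> x) x = g x * pd k \<eta> x + pd k g x * \<eta> x"
        by (simp add: pd_def)
    qed
    then show ?case
      using sums_of_products.plus[OF sums_of_products.prod[OF prod(1) schwartz_pd[OF prod(2)]]
          sums_of_products.prod[OF pd[OF prod(1)] prod(2)]] by simp
  next
    case (plus a b)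
    have "pd k (\<lambda>x. a x + b x) = (\<lambda>x. pd k a x + pd k b x)"
      by (intro pd_add d plus)
    then show ?case using sums_of_products.plus[OF plus(3,4)] by simp
  qed
  show "\<exists>C. \<forall>x. (1 + norm x) ^ N * cmod (\<phi> x) \<le> C" if "sums_of_products G \<phi>" for \<phi> N
    using that
  proof (induction)
    case (prod g \<eta>)
    obtain C K where g: "C \<ge> 0" "\<And>x. cmod (g x) \<le> C * (1 + norm x) ^ K"
      using grow[OF prod(1)] by blast
    obtain D where D: "D \<ge> 0" "\<And>x. (1 + norm x) ^ (N + K) * cmod (\<eta> x) \<le> D"
      using schwartz_decay[OF prod(2)] by blast
    have "(1 + norm x) ^ N * cmod (g x * \<eta> x) \<le> C * D" for x
    proof -
      have "(1 + norm x) ^ N * cmod (g x * \<eta> x) \<le> (1 + norm x) ^ N * (C * (1 + norm x) ^ K * cmod (\<eta> x))"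
        using g by (auto simp: norm_mult intro!: mult_left_mono mult_right_mono)
      also have "\<dots> = C * ((1 + norm x) ^ (N + K) * cmod (\<eta> x))"
        by (simp add: power_add algebra_simps)
      also have "\<dots> \<le> C * D" using g D by (intro mult_left_mono) auto
      finally show ?thesis .
    qed
    then show ?case by blast
  next
    case (plus a b)
    then obtain A B where AB: "\<And>x. (1 + norm x) ^ N * cmod (a x) \<le> A"
      "\<And>x. (1 + norm x) ^ N * cmod (b x) \<le> B" by blast
    have "(1 + norm x) ^ N * cmod (a x + b x) \<le> A + B" for x
    proof -
      have "(1 + norm x) ^ N * cmod (a x + b x) \<le> (1 + norm x) ^ N * (cmod (a x) + cmod (b x))"
        by (intro mult_left_mono norm_triangle_ineq) auto
      also have "\<dots> \<le> A + B" using AB[of x] by (simp add: distrib_left)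
      finally show ?thesis .
    qed
    then show ?case by blast
  qed
qed

lemma schwartz_mult:
  assumes "schwartz \<phi>" "schwartz \<eta>"
  shows "schwartz (\<lambda>x. \<phi> x * \<eta> x)"
proof (rule schwartz_multiplier[where G="Collect schwartz"])
  fix g :: "real^3 \<Rightarrow> complex" assume "g \<in> Collect schwartz"
  then have g: "schwartz g" by simp
  obtain C where C: "C \<ge> 0" "\<And>x. (1 + norm x) ^ 0 * cmod (g x) \<le> C"
    using schwartz_decay[OF g] by blast
  then show "\<exists>C\<ge>0. \<exists>N. \<forall>x. cmod (g x) \<le> C * (1 + norm x) ^ N"
    by (intro exI[of _ C] conjI exI[of _ 0]) auto
qed (use assms in \<open>auto intro: schwartz_differentiable schwartz_pd\<close>)

lemma schwartz_affine_mult: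
  assumes "schwartz \<eta>"
  shows "schwartz (\<lambda>x. (a + b * of_real (x \<bullet> v)) * \<eta> x)"
proof (rule schwartz_multiplier[where G="range (\<lambda>(a,b,v) x. a + b * complex_of_real (x \<bullet> v))"])
  have d: "((\<lambda>x. a + b * complex_of_real (x \<bullet> v)) has_derivative (\<lambda>h. b * of_real (h \<bullet> v))) (at x)"
    for a b v and x :: "real^3"
    by (auto intro!: derivative_eq_intros)
  fix g :: "real^3 \<Rightarrow> complex" assume "g \<in> range (\<lambda>(a,b,v) x. a + b * complex_of_real (x \<bullet> v))"
  then obtain a b v where g: "g = (\<lambda>x. a + b * complex_of_real (x \<bullet> v))" by auto
  show "g differentiable at x" for x unfolding g differentiable_def using d by blast
  show "pd k g \<in> range (\<lambda>(a,b,v) x. a + b * complex_of_real (x \<bullet> v))" for k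
    using pd_eq[OF d] unfolding g
    by (intro image_eqI[of _ _ "(b * of_real (axis k 1 \<bullet> v), 0, 0)"]) (auto simp: fun_eq_iff)
  have "cmod (g x) \<le> (cmod a + cmod b * norm v) * (1 + norm x) ^ 1" for x
  proof -
    have "cmod (g x) \<le> cmod a + cmod b * \<bar>x \<bullet> v\<bar>"
      unfolding g using norm_triangle_ineq[of a "b * of_real (x \<bullet> v)"] by (simp add: norm_mult)
    also have "\<dots> \<le> cmod a + cmod b * (norm x * norm v)"
      by (intro add_left_mono mult_left_mono Cauchy_Schwarz_ineq2) auto
    also have "\<dots> \<le> (cmod a + cmod b * norm v) * (1 + norm x) ^ 1"
      by (simp add: algebra_simps)
    finally show ?thesis .
  qed
  then show "\<exists>C\<ge>0. \<exists>N. \<forall>x. cmod (g x) \<le> C * (1 + norm x) ^ N"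
    by (intro exI[of _ "cmod a + cmod b * norm v"] conjI exI[of _ 1]) auto
next
  show "(\<lambda>x. a + b * complex_of_real (x \<bullet> v)) \<in> range (\<lambda>(a,b,v) x. a + b * complex_of_real (x \<bullet> v))"
    by (intro image_eqI[of _ _ "(a, b, v)"]) auto
qed (use assms in auto)

lemma schwartz_cmult: "schwartz \<eta> \<Longrightarrow> schwartz (\<lambda>x. a * \<eta> x)"
  using schwartz_affine_mult[of \<eta> a 0 0] by simp

lemma schwartz_scale:
  assumes "schwartz \<phi>" "c \<noteq> 0"
  shows "schwartz (\<lambda>x. \<phi> (c *\<^sub>R x))"
proof (rule schwartz_coinduct[where Q="\<lambda>\<zeta>. \<exists>\<phi>. schwartz \<phi> \<and> \<zeta> = (\<lambda>x. \<phi> (c *\<^sub>R x))"])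
  show "\<exists>\<phi>'. schwartz \<phi>' \<and> (\<lambda>x. \<phi> (c *\<^sub>R x)) = (\<lambda>x. \<phi>' (c *\<^sub>R x))"
    using assms by blast
  fix \<zeta> :: "real^3 \<Rightarrow> complex"
  assume "\<exists>\<phi>. schwartz \<phi> \<and> \<zeta> = (\<lambda>x. \<phi> (c *\<^sub>R x))"
  then obtain \<phi> where *: "schwartz \<phi>" "\<zeta> = (\<lambda>x. \<phi> (c *\<^sub>R x))" by blast
  have d: "(\<zeta> has_derivative (\<lambda>h. frechet_derivative \<phi> (at (c *\<^sub>R x)) (c *\<^sub>R h))) (at x)" for x
    unfolding * using schwartz_has_derivative[OF *(1), of "c *\<^sub>R x"]
    by (auto intro!: has_derivative_compose[of "\<lambda>x. c *\<^sub>R x"] derivative_eq_intros)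
  then show "\<zeta> differentiable (at x)" for x by (auto simp: differentiable_def)
  have "pd k \<zeta> = (\<lambda>x. of_real c * pd k \<phi> (c *\<^sub>R x))" for k
  proof
    fix x
    have "pd k \<zeta> x = c *\<^sub>R pd k \<phi> (c *\<^sub>R x)"
      using pd_eq[OF d] schwartz_has_derivative[OF *(1), THEN has_derivative_linear]
      by (simp add: pd_def linear_scale)
    then show "pd k \<zeta> x = of_real c * pd k \<phi> (c *\<^sub>R x)" by (simp only: scaleR_conv_of_real)
  qed
  then show "\<exists>\<phi>. schwartz \<phi> \<and> pd k \<zeta> = (\<lambda>x. \<phi> (c *\<^sub>R x))" for k
    using schwartz_cmult[OF schwartz_pd[OF *(1)]]
    by (intro exI[of _ "\<lambda>x. of_real c * pd k \<phi> x"]) auto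
  show "\<exists>C. \<forall>x. (1 + norm x) ^ N * cmod (\<zeta> x) \<le> C" for N
  proof -
    obtain A where A: "A \<ge> 0" "\<And>x. (1 + norm x) ^ N * cmod (\<phi> x) \<le> A"
      using schwartz_decay * by metis
    define D where "D = max 1 (1 / \<bar>c\<bar>)"
    have "(1 + norm x) ^ N * cmod (\<zeta> x) \<le> D ^ N * A" for x
    proof -
      have "1 + norm x \<le> D * (1 + norm (c *\<^sub>R x))"
      proof -
        have "1 / \<bar>c\<bar> * (\<bar>c\<bar> * norm x) \<le> D * (\<bar>c\<bar> * norm x)"
          unfolding D_def by (intro mult_right_mono) auto
        moreover have "1 / \<bar>c\<bar> * (\<bar>c\<bar> * norm x) = norm x" using assms by simp
        moreover have "1 \<le> D" unfolding D_def by simp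
        ultimately show ?thesis by (simp add: distrib_left)
      qed
      then have "(1 + norm x) ^ N \<le> D ^ N * (1 + norm (c *\<^sub>R x)) ^ N"
        by (metis add_nonneg_nonneg norm_ge_zero power_mono power_mult_distrib zero_le_one)
      then have "(1 + norm x) ^ N * cmod (\<zeta> x) \<le> D ^ N * (1 + norm (c *\<^sub>R x)) ^ N * cmod (\<zeta> x)"
        by (intro mult_right_mono) auto
      also have "\<dots> \<le> D ^ N * A"
        unfolding mult.assoc *(2) using A(2)[of "c *\<^sub>R x"]
        by (intro mult_left_mono) (auto simp: D_def)
      finally show ?thesis .
    qed
    then show ?thesis by blast
  qed
qed

lemma schwartz_norm_bound:
  assumes "schwartz \<phi>" "length ks \<le> N"
  shows "(1 + norm x) ^ N * cmod (pds ks \<phi> x) \<le> schwartz_norm N \<phi>"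
proof -
  have bdd: "bdd_above (range (\<lambda>x. (1 + norm x) ^ N * cmod (pds ks \<phi> x)))" for ks
  proof -
    have "bounded (range (\<lambda>x. (1 + norm x) ^ N *\<^sub>R pds ks \<phi> x))"
      using assms unfolding schwartz_def by blast
    then show ?thesis unfolding bounded_iff bdd_above_def by (auto simp: power_abs)
  qed
  have "(1 + norm x) ^ N * cmod (pds ks \<phi> x) \<le> (SUP x. (1 + norm x) ^ N * cmod (pds ks \<phi> x))"
    by (rule cSUP_upper[OF _ bdd]) auto
  also have "\<dots> \<le> schwartz_norm N \<phi>" unfolding schwartz_norm_def
  proof (rule member_le_sum)
    show "finite {ks::3 list. length ks \<le> N}"
      using finite_lists_length_le[of "UNIV :: 3 set"] by simp
    show "0 \<le> (SUP x. (1 + norm x) ^ N * cmod (pds ls \<phi> x))" for ls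
      by (rule cSUP_upper2[OF bdd, of 0]) auto
  qed (use assms in auto)
  finally show ?thesis .
qed


section \<open>Integration over three-space\<close>

lemma integrable_lborel_prod_3:
  fixes f :: "real^3 \<Rightarrow> real \<Rightarrow> complex"
  assumes "\<And>b. b \<in> Basis \<Longrightarrow> integrable lborel (f b)"
  shows "integrable lborel (\<lambda>x. \<Prod>b\<in>Basis. f b (x \<bullet> b))" (is ?int)
    and "(LINT x|lborel. (\<Prod>b\<in>Basis. f b (x \<bullet> b))) = (\<Prod>b\<in>Basis. LINT t|lborel. f b t)" (is ?eq)
proof -
  interpret product_sigma_finite "\<lambda>_::real^3. lborel :: real measure"
    by unfold_locales
  have [measurable]: "f b \<in> borel_measurable borel" if "b \<in> Basis" for b
    using borel_measurable_integrable[OF assms[OF that]] by simp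
  have inner: "(\<Sum>b\<in>Basis. g b *\<^sub>R b) \<bullet> c = g c" if "c \<in> Basis" for g and c :: "real^3"
    using that by simp
  have eq: "(\<lambda>g. \<Prod>b\<in>Basis. f b ((\<Sum>b\<in>Basis. g b *\<^sub>R b) \<bullet> b)) = (\<lambda>g. \<Prod>b\<in>Basis. f b (g b))"
    by (auto intro!: prod.cong ext simp: inner simp del: inner_sum_left_Basis)
  show ?int unfolding lborel_eq[where 'a="real^3"]
    by (subst integrable_distr_eq) (auto simp: eq intro!: product_integrable_prod assms)
  show ?eq unfolding lborel_eq[where 'a="real^3"]
    by (subst integral_distr) (auto simp: eq intro!: product_integral_prod assms)
qed

lemma integrable_inverse_1_plus_square_real: "integrable lborel (\<lambda>x::real. inverse (1 + x\<^sup>2))"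
  using integrable_inverse_1_plus_square unfolding set_integrable_def by simp

lemma Basis_3: "(Basis :: (real^3) set) = range (\<lambda>k. axis k 1)"
  by (auto simp: Basis_vec_def)

lemma prod_Basis_3: "(\<Prod>b\<in>(Basis :: (real^3) set). F b) = (\<Prod>k\<in>UNIV. F (axis k 1))"
  unfolding Basis_3 by (subst prod.reindex) (auto intro!: injI simp: axis_eq_axis)

lemma integrable_prod_inverse_square:
  "integrable lborel (\<lambda>x::real^3. \<Prod>k\<in>UNIV. inverse (1 + (x$k)\<^sup>2))"
proof -
  have "integrable lborel (\<lambda>x::real^3. \<Prod>b\<in>Basis. complex_of_real (inverse (1 + (x \<bullet> b)\<^sup>2)))"
    by (rule integrable_lborel_prod_3) 
      (intro integrable_of_real integrable_inverse_1_plus_square_real)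
  then have "integrable lborel (\<lambda>x::real^3. Re (\<Prod>b\<in>Basis. complex_of_real (inverse (1 + (x \<bullet> b)\<^sup>2))))"
    by (rule integrable_Re)
  then show ?thesis
    unfolding prod_Basis_3 of_real_prod[symmetric] Re_complex_of_real by (simp add: inner_axis)
qed

text \<open>Any exponent above three is integrable; six permits the comparison with a product of functions of
  one variable.\<close>

lemma integrable_weight: "integrable lborel (\<lambda>x::real^3. inverse ((1 + norm x) ^ 6))"
proof (rule Bochner_Integration.integrable_bound[OF integrable_prod_inverse_square])
  have "inverse ((1 + norm x) ^ 6) \<le> (\<Prod>k\<in>UNIV. inverse (1 + (x$k)\<^sup>2))" for x :: "real^3"
  proof -
    have "inverse ((1 + norm x) ^ 6) = (\<Prod>k\<in>(UNIV::3 set). inverse ((1 + norm x)\<^sup>2))"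
      by (simp add: power_inverse flip: power_mult)
    also have "\<dots> \<le> (\<Prod>k\<in>UNIV. inverse (1 + (x$k)\<^sup>2))"
    proof (intro prod_mono conjI le_imp_inverse_le)
      fix k :: 3
      have "(x$k)\<^sup>2 \<le> (norm x)\<^sup>2" using component_le_norm_cart[of x k]
        by (simp add: power2_le_iff_abs_le)
      then show "1 + (x $ k)\<^sup>2 \<le> (1 + norm x)\<^sup>2"
        using norm_ge_zero[of x] by (simp add: power2_sum add_increasing2)
      show "0 < 1 + (x $ k)\<^sup>2" by (simp add: add_pos_nonneg)
    qed auto
    finally show ?thesis .
  qed
  then show "AE x::real^3 in lborel. norm (inverse ((1 + norm x) ^ 6)) \<le> norm (\<Prod>k\<in>UNIV. inverse (1 + (x$k)\<^sup>2))"
    by (intro AE_I2) (smt (verit, best) norm_ge_zero inverse_nonnegative_iff_nonnegative zero_le_power real_norm_def)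
qed auto

lemma integrable_of_decay:
  fixes f :: "real^3 \<Rightarrow> complex"
  assumes [measurable]: "f \<in> borel_measurable borel"
    and "\<And>x. (1 + norm x) ^ 6 * cmod (f x) \<le> C"
  shows "integrable lborel f"
proof (rule Bochner_Integration.integrable_bound[OF integrable_mult_right[OF integrable_weight, of C]])
  have "cmod (f x) \<le> C * inverse ((1 + norm x) ^ 6)" for x
  proof -
    have "(1 + norm x) ^ 6 > 0" by (intro zero_less_power) (simp add: add_pos_nonneg)
    then show ?thesis using assms(2)[of x] by (simp add: field_simps)
  qed
  then show "AE x in lborel. norm (f x) \<le> norm (C * inverse ((1 + norm x) ^ 6))"
    by (intro AE_I2) (metis abs_ge_self order_trans real_norm_def)
qed auto

lemma schwartz_integrable: "schwartz \<phi> \<Longrightarrow> integrable lborel \<phi>"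
  by (metis integrable_of_decay schwartz_decay schwartz_measurable)

lemma nn_integral_lborel_affine:
  fixes f :: "'a::euclidean_space \<Rightarrow> ennreal"
  assumes [measurable]: "f \<in> borel_measurable borel" and c: "c \<noteq> 0"
  shows "(\<integral>\<^sup>+x. f x \<partial>lborel) = ennreal (\<bar>c\<bar> ^ DIM('a)) * (\<integral>\<^sup>+x. f (t + c *\<^sub>R x) \<partial>lborel)"
  by (subst lborel_affine[OF c, of t])
    (simp add: nn_integral_density nn_integral_distr nn_integral_cmult)

lemma lborel_integral_affine:
  fixes f :: "'a::euclidean_space \<Rightarrow> 'b::{banach, second_countable_topology}"
  assumes [measurable]: "f \<in> borel_measurable borel" and c: "c \<noteq> 0"
  shows "(LINT x|lborel. f x) = \<bar>c\<bar> ^ DIM('a) *\<^sub>R (LINT x|lborel. f (t + c *\<^sub>R x))"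
  by (subst lborel_affine[OF c, of t]) (simp add: integral_density integral_distr)

lemma lborel_integrable_affine:
  fixes f :: "'a::euclidean_space \<Rightarrow> 'b::{banach, second_countable_topology}"
  assumes [measurable]: "f \<in> borel_measurable borel" and c: "c \<noteq> 0"
  shows "integrable lborel f \<longleftrightarrow> integrable lborel (\<lambda>x. f (t + c *\<^sub>R x))"
proof -
  have *: "integrable lborel (\<lambda>x. \<bar>c\<bar> ^ DIM('a) *\<^sub>R f (t + c *\<^sub>R x))
      \<longleftrightarrow> integrable lborel (\<lambda>x. f (t + c *\<^sub>R x))" (is "?l \<longleftrightarrow> ?r")
  proof
    assume ?l
    then have "integrable lborel (\<lambda>x. (1 / \<bar>c\<bar> ^ DIM('a)) *\<^sub>R (\<bar>c\<bar> ^ DIM('a) *\<^sub>R f (t + c *\<^sub>R x)))"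
      by (rule integrable_scaleR_right)
    then show ?r using c by simp
  qed auto
  show ?thesis
    by (subst lborel_affine[OF c, of t])
      (use c * in \<open>simp add: integrable_density integrable_distr_eq\<close>)
qed

lemma weight_divide:
  fixes x :: "'a::real_normed_vector"
  assumes "(1 + norm x) ^ n * a \<le> C"
  shows "a \<le> C * inverse ((1 + norm x) ^ n)"
proof -
  have "(1 + norm x) ^ n > 0" by (intro zero_less_power) (simp add: add_pos_nonneg)
  then show ?thesis using assms by (simp add: field_simps)
qed

section \<open>The Fourier transform of Schwartz functions\<close>

abbreviation wave :: "real^3 \<Rightarrow> real^3 \<Rightarrow> complex" where
  "wave \<xi> x \<equiv> exp (\<i> * of_real (\<xi> \<bullet> x))"

lemma fourier_eq_inv_fourier: "fourier \<phi> \<xi> = of_real ((2 * pi) ^ 3) * inv_fourier \<phi> (- \<xi>)"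
  unfolding fourier_def inv_fourier_def by (simp add: inner_commute power_mult_distrib)

lemma inv_fourier_add:
  assumes "integrable lborel \<phi>" "integrable lborel \<eta>"
  shows "inv_fourier (\<lambda>x. a * \<phi> x + b * \<eta> x) \<xi> = a * inv_fourier \<phi> \<xi> + b * inv_fourier \<eta> \<xi>"
proof -
  have *: "integrable lborel (\<lambda>x. wave \<xi> x * \<phi> x)"
    if "integrable lborel \<phi>" for \<phi> :: "real^3 \<Rightarrow> complex"
    using that by (rule Bochner_Integration.integrable_bound) (use that in \<open>auto simp: norm_mult\<close>)
  have "(LINT x|lborel. wave \<xi> x * (a * \<phi> x + b * \<eta> x))
      = (LINT x|lborel. a * (wave \<xi> x * \<phi> x) + b * (wave \<xi> x * \<eta> x))"
    by (intro Bochner_Integration.integral_cong) (auto simp: algebra_simps)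
  also have "\<dots> = a * (LINT x|lborel. wave \<xi> x * \<phi> x)
      + b * (LINT x|lborel. wave \<xi> x * \<eta> x)"
    using *[OF assms(1)] *[OF assms(2)] by (subst Bochner_Integration.integral_add) auto
  finally show ?thesis by (simp add: inv_fourier_def algebra_simps)
qed

lemma inv_fourier_cmult: "inv_fourier (\<lambda>x. a * \<phi> x) \<xi> = a * inv_fourier \<phi> \<xi>"
proof -
  have "(LINT x|lborel. wave \<xi> x * (a * \<phi> x))
      = (LINT x|lborel. a * (wave \<xi> x * \<phi> x))"
    by (intro Bochner_Integration.integral_cong) auto
  then show ?thesis by (simp add: inv_fourier_def)
qed

lemma cmod_inv_fourier_le: "cmod (inv_fourier \<phi> \<xi>) \<le> 1 / (2 * pi) ^ 3 * (LINT x|lborel. cmod (\<phi> x))"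
proof -
  have "cmod (LINT x|lborel. wave \<xi> x * \<phi> x) \<le> (LINT x|lborel. cmod (wave \<xi> x * \<phi> x))"
    by (rule integral_norm_bound)
  also have "\<dots> = (LINT x|lborel. cmod (\<phi> x))" by (simp add: norm_mult)
  finally show ?thesis
    unfolding inv_fourier_def norm_mult norm_of_real by (intro mult_mono) auto
qed

lemma inv_fourier_cnj: "inv_fourier (\<lambda>x. cnj (\<phi> x)) \<xi> = cnj (inv_fourier \<phi> (- \<xi>))"
proof -
  have *: "cnj (wave (- \<xi>) x * \<phi> x) = wave \<xi> x * cnj (\<phi> x)" for x
    by (simp add: exp_cnj)
  have "(LINT x|lborel. wave \<xi> x * cnj (\<phi> x))
      = cnj (LINT x|lborel. wave (- \<xi>) x * \<phi> x)"
    by (simp only: Bochner_Integration.integral_cnj[symmetric] *)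
  then show ?thesis unfolding inv_fourier_def complex_cnj_mult complex_cnj_complex_of_real by simp
qed

lemma borel_measurable_inv_fourier [measurable]:
  assumes [measurable]: "\<phi> \<in> borel_measurable borel"
  shows "inv_fourier \<phi> \<in> borel_measurable borel"
  unfolding inv_fourier_def by measurable

text \<open>The difference quotients have integral zero by
  translation invariance, and they are dominated because the derivative decays.\<close>

lemma schwartz_integral_pd:
  assumes "schwartz \<phi>"
  shows "(LINT x|lborel. pd k \<phi> x) = 0"
proof -
  have meas [measurable]: "\<phi> \<in> borel_measurable borel" "pd k \<phi> \<in> borel_measurable borel"
    using assms schwartz_pd by (auto intro: schwartz_measurable)
  obtain C where C: "C \<ge> 0" "\<And>x. (1 + norm x) ^ 6 * cmod (pd k \<phi> x) \<le> C"
    using schwartz_decay[OF schwartz_pd[OF assms]] by metis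
  define e :: "real^3" where "e = axis k 1"
  have ne: "norm e = 1" unfolding e_def by simp
  define q where "q n x = real (Suc n) *\<^sub>R (\<phi> (x + inverse (real (Suc n)) *\<^sub>R e) - \<phi> x)" for n x
  have lin: "((\<lambda>s. \<phi> (x + s *\<^sub>R e)) has_derivative (\<lambda>h. h *\<^sub>R pd k \<phi> (x + s *\<^sub>R e))) (at s within S)" for x s S
  proof -
    have "((\<lambda>s. \<phi> (x + s *\<^sub>R e)) has_derivative
        (\<lambda>h. frechet_derivative \<phi> (at (x + s *\<^sub>R e)) (h *\<^sub>R e))) (at s within S)"
    proof (rule has_derivative_compose[of "\<lambda>s. x + s *\<^sub>R e"])
      show "((\<lambda>s. x + s *\<^sub>R e) has_derivative (\<lambda>h. h *\<^sub>R e)) (at s within S)"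
        by (auto intro!: derivative_eq_intros)
    qed (rule schwartz_has_derivative[OF assms])
    moreover have "frechet_derivative \<phi> (at (x + s *\<^sub>R e)) (h *\<^sub>R e) = h *\<^sub>R pd k \<phi> (x + s *\<^sub>R e)" for h
      using linear_scale[OF has_derivative_linear[OF schwartz_has_derivative[OF assms]]]
      unfolding pd_def e_def by blast
    ultimately show ?thesis by simp
  qed
  have bound: "cmod (q n x) \<le> 64 * C * inverse ((1 + norm x) ^ 6)" for n x
  proof -
    define s where "s = inverse (real (Suc n))"
    have s: "0 < s" "s \<le> 1" unfolding s_def by (auto simp: field_simps)
    have "cmod (\<phi> (x + s *\<^sub>R e) - \<phi> (x + 0 *\<^sub>R e)) \<le> (64 * C * inverse ((1 + norm x) ^ 6)) * norm (s - 0)"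
    proof (rule differentiable_bound[where S="{0..s}" and f="\<lambda>s. \<phi> (x + s *\<^sub>R e)"])
      fix t assume t: "t \<in> {0..s}"
      have "norm x \<le> norm (x + t *\<^sub>R e) + norm (t *\<^sub>R e)"
        using norm_triangle_ineq[of "x + t *\<^sub>R e" "- t *\<^sub>R e"] by simp
      moreover have "norm (t *\<^sub>R e) \<le> 1" using t s ne by simp
      moreover have "0 \<le> norm (x + t *\<^sub>R e)" by simp
      ultimately have "1 + norm x \<le> 2 * (1 + norm (x + t *\<^sub>R e))" by argo
      then have "(1 + norm x) ^ 6 \<le> 64 * (1 + norm (x + t *\<^sub>R e)) ^ 6"
        using power_mono[of "1 + norm x" "2 * (1 + norm (x + t *\<^sub>R e))" 6] by (simp only: power_mult_distrib) simp
      then have "(1 + norm x) ^ 6 * cmod (pd k \<phi> (x + t *\<^sub>R e)) \<le> 64 * (1 + norm (x + t *\<^sub>R e)) ^ 6 * cmod (pd k \<phi> (x + t *\<^sub>R e))"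
        by (intro mult_right_mono) auto
      also have "\<dots> \<le> 64 * C" using C(2)[of "x + t *\<^sub>R e"] by simp
      finally have "cmod (pd k \<phi> (x + t *\<^sub>R e)) \<le> 64 * C * inverse ((1 + norm x) ^ 6)"
        by (rule weight_divide)
      then show "onorm (\<lambda>h. h *\<^sub>R pd k \<phi> (x + t *\<^sub>R e)) \<le> 64 * C * inverse ((1 + norm x) ^ 6)"
        by (intro onorm_le) (auto simp: mult.commute intro: mult_left_mono)
    qed (use s lin in auto)
    then have "cmod (\<phi> (x + s *\<^sub>R e) - \<phi> x) \<le> 64 * C * inverse ((1 + norm x) ^ 6) * s" using s by simp
    then have "inverse s * cmod (\<phi> (x + s *\<^sub>R e) - \<phi> x) \<le> 64 * C * inverse ((1 + norm x) ^ 6)"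
      using s by (simp add: field_simps)
    moreover have "inverse s = real (Suc n)" by (simp add: s_def)
    ultimately show ?thesis unfolding q_def s_def[symmetric] by simp
  qed
  have lim: "(\<lambda>n. q n x) \<longlonglongrightarrow> pd k \<phi> x" for x
  proof -
    have "((\<lambda>h. norm (\<phi> (x + h *\<^sub>R e) - \<phi> x - h *\<^sub>R pd k \<phi> x) / norm h) \<longlongrightarrow> 0) (at 0)"
      using lin[of x 0 UNIV] unfolding has_derivative_at by simp
    moreover have "filterlim (\<lambda>n. inverse (real (Suc n))) (at 0) sequentially"
      unfolding filterlim_at using LIMSEQ_inverse_real_of_nat by (intro conjI always_eventually) auto
    ultimately have "(\<lambda>n. norm (\<phi> (x + inverse (real (Suc n)) *\<^sub>R e) - \<phi> x - inverse (real (Suc n)) *\<^sub>R pd k \<phi> x)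
        / norm (inverse (real (Suc n)))) \<longlonglongrightarrow> 0"
      by (rule filterlim_compose)
    moreover have "norm (\<phi> (x + inverse (real (Suc n)) *\<^sub>R e) - \<phi> x - inverse (real (Suc n)) *\<^sub>R pd k \<phi> x)
        / norm (inverse (real (Suc n))) = norm (q n x - pd k \<phi> x)" for n
    proof -
      have "q n x - pd k \<phi> x = real (Suc n) *\<^sub>R
          (\<phi> (x + inverse (real (Suc n)) *\<^sub>R e) - \<phi> x - inverse (real (Suc n)) *\<^sub>R pd k \<phi> x)"
        unfolding q_def scaleR_diff_right[of "real (Suc n)"] by (simp del: of_nat_Suc)
      then have "norm (q n x - pd k \<phi> x) = real (Suc n) * norm
          (\<phi> (x + inverse (real (Suc n)) *\<^sub>R e) - \<phi> x - inverse (real (Suc n)) *\<^sub>R pd k \<phi> x)"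
        by (simp del: of_nat_Suc)
      then show ?thesis by (simp add: field_simps del: of_nat_Suc)
    qed
    ultimately have "(\<lambda>n. norm (q n x - pd k \<phi> x)) \<longlonglongrightarrow> 0" by simp
    then show ?thesis by (simp add: tendsto_norm_zero_iff LIM_zero_iff)
  qed
  have "(\<lambda>n. LINT x|lborel. q n x) \<longlonglongrightarrow> (LINT x|lborel. pd k \<phi> x)"
  proof (rule integral_dominated_convergence)
    show "integrable lborel (\<lambda>x::real^3. 64 * C * inverse ((1 + norm x) ^ 6))"
      using integrable_weight by simp
    show "q n \<in> borel_measurable lborel" for n unfolding q_def[abs_def] by measurable
  qed (use lim bound in auto)
  moreover have "(LINT x|lborel. q n x) = 0" for n
  proof -
    have "(LINT x|lborel. \<phi> (x + inverse (real (Suc n)) *\<^sub>R e)) = (LINT x|lborel. \<phi> x)"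
      using lborel_integral_affine[of \<phi> 1 "inverse (real (Suc n)) *\<^sub>R e"] by (simp add: add.commute)
    moreover have "integrable lborel (\<lambda>x. \<phi> (x + inverse (real (Suc n)) *\<^sub>R e))"
      using lborel_integrable_affine[of \<phi> 1 "inverse (real (Suc n)) *\<^sub>R e"] schwartz_integrable[OF assms]
      by (simp add: add.commute)
    ultimately show ?thesis unfolding q_def using schwartz_integrable[OF assms] by simp
  qed
  ultimately show ?thesis by (simp add: LIMSEQ_const_iff)
qed

lemma schwartz_exp_mult:
  assumes "schwartz \<eta>"
  shows "schwartz (\<lambda>x. wave \<xi> x * \<eta> x)"
    and "pd k (\<lambda>x. wave \<xi> x * \<eta> x)
      = (\<lambda>x. wave \<xi> x * pd k \<eta> x + \<i> * of_real (\<xi>$k) * (wave \<xi> x * \<eta> x))"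
proof -
  have d: "((\<lambda>x. c * wave \<xi> x) has_derivative
      (\<lambda>h. c * (wave \<xi> x * (\<i> * of_real (\<xi> \<bullet> h))))) (at x)" for c x
    by (intro has_derivative_mult_right
        has_derivative_compose[OF _ DERIV_exp[unfolded has_field_derivative_def]])
      (auto intro!: derivative_eq_intros)
  show "schwartz (\<lambda>x. wave \<xi> x * \<eta> x)"
  proof (rule schwartz_multiplier[where G="range (\<lambda>c x. c * wave \<xi> x)"])
    fix g :: "real^3 \<Rightarrow> complex" assume "g \<in> range (\<lambda>c x. c * wave \<xi> x)"
    then obtain c where g: "g = (\<lambda>x. c * wave \<xi> x)" by auto
    show "g differentiable at x" for x unfolding g differentiable_def using d by blast
    show "pd k g \<in> range (\<lambda>c x. c * wave \<xi> x)" for k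
      unfolding g using pd_eq[OF d]
      by (intro image_eqI[of _ _ "c * (\<i> * of_real (\<xi> \<bullet> axis k 1))"]) (auto simp: fun_eq_iff)
    show "\<exists>C\<ge>0. \<exists>N. \<forall>x. cmod (g x) \<le> C * (1 + norm x) ^ N"
      unfolding g by (intro exI[of _ "cmod c"] conjI exI[of _ 0]) (auto simp: norm_mult)
  next
    show "(\<lambda>x. wave \<xi> x) \<in> range (\<lambda>c x. c * wave \<xi> x)"
      by (intro image_eqI[of _ _ 1]) auto
  qed (use assms in auto)
  show "pd k (\<lambda>x. wave \<xi> x * \<eta> x)
      = (\<lambda>x. wave \<xi> x * pd k \<eta> x + \<i> * of_real (\<xi>$k) * (wave \<xi> x * \<eta> x))"
  proof
    fix x
    show "pd k (\<lambda>x. wave \<xi> x * \<eta> x) x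
      = wave \<xi> x * pd k \<eta> x + \<i> * of_real (\<xi>$k) * (wave \<xi> x * \<eta> x)"
      using pd_eq[OF has_derivative_mult[OF d[of 1 x] schwartz_has_derivative[OF assms, of x]], of k]
      by (simp add: pd_def inner_axis algebra_simps)
  qed
qed

text \<open>Integration by parts: the product with the character has a derivative of integral zero.\<close>

lemma inv_fourier_pd:
  assumes "schwartz \<phi>"
  shows "inv_fourier (pd k \<phi>) \<xi> = - \<i> * of_real (\<xi>$k) * inv_fourier \<phi> \<xi>"
proof -
  have "0 = (LINT x|lborel. wave \<xi> x * pd k \<phi> x
      + \<i> * of_real (\<xi>$k) * (wave \<xi> x * \<phi> x))"
    using schwartz_integral_pd[OF schwartz_exp_mult(1)[OF assms, of \<xi>], of k]
    unfolding schwartz_exp_mult(2)[OF assms] by simp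
  also have "\<dots> = (LINT x|lborel. wave \<xi> x * pd k \<phi> x)
      + \<i> * of_real (\<xi>$k) * (LINT x|lborel. wave \<xi> x * \<phi> x)"
    using schwartz_integrable[OF schwartz_exp_mult(1)[OF assms, of \<xi>]]
      schwartz_integrable[OF schwartz_exp_mult(1)[OF schwartz_pd[OF assms], of \<xi>]]
    by (subst Bochner_Integration.integral_add) auto
  finally have "(LINT x|lborel. wave \<xi> x * pd k \<phi> x)
      = - (\<i> * of_real (\<xi>$k) * (LINT x|lborel. wave \<xi> x * \<phi> x))"
    by (simp add: eq_neg_iff_add_eq_0)
  then show ?thesis unfolding inv_fourier_def by simp
qed

lemma norm_le_sum_component: "norm (x :: real^3) \<le> (\<Sum>k\<in>UNIV. \<bar>x$k\<bar>)"
  using norm_le_l1_cart[of x] by simp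

lemma inv_fourier_weight_step:
  assumes "schwartz \<phi>"
  shows "(1 + norm \<xi>) * cmod (inv_fourier \<phi> \<xi>)
    \<le> cmod (inv_fourier \<phi> \<xi>) + (\<Sum>k\<in>UNIV. cmod (inv_fourier (pd k \<phi>) \<xi>))"
proof -
  have "norm \<xi> * cmod (inv_fourier \<phi> \<xi>) \<le> (\<Sum>k\<in>UNIV. \<bar>\<xi>$k\<bar>) * cmod (inv_fourier \<phi> \<xi>)"
    by (intro mult_right_mono norm_le_sum_component) auto
  then show ?thesis
    by (simp add: inv_fourier_pd[OF assms] norm_mult sum_distrib_right distrib_right)
qed

text \<open>Each power of the weight is paid for with one derivative of the test function.\<close>

lemma inv_fourier_decay:
  assumes "schwartz \<phi>"
  shows "\<exists>C. \<forall>\<xi>. (1 + norm \<xi>) ^ N * cmod (inv_fourier \<phi> \<xi>) \<le> C"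
  using assms
proof (induction N arbitrary: \<phi>)
  case 0
  then show ?case using cmod_inv_fourier_le by auto
next
  case (Suc N)
  obtain C where C: "\<And>\<xi>. (1 + norm \<xi>) ^ N * cmod (inv_fourier \<phi> \<xi>) \<le> C" using Suc by blast
  have "\<forall>k. \<exists>D. \<forall>\<xi>. (1 + norm \<xi>) ^ N * cmod (inv_fourier (pd k \<phi>) \<xi>) \<le> D"
    using Suc schwartz_pd by blast
  then obtain D where D: "\<And>k \<xi>. (1 + norm \<xi>) ^ N * cmod (inv_fourier (pd k \<phi>) \<xi>) \<le> D k" by metis
  have "(1 + norm \<xi>) ^ Suc N * cmod (inv_fourier \<phi> \<xi>) \<le> C + (\<Sum>k\<in>UNIV. D k)" for \<xi>
  proof -
    have "(1 + norm \<xi>) ^ Suc N * cmod (inv_fourier \<phi> \<xi>) = (1 + norm \<xi>) ^ N * ((1 + norm \<xi>) * cmod (inv_fourier \<phi> \<xi>))"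
      by simp
    also have "\<dots> \<le> (1 + norm \<xi>) ^ N * (cmod (inv_fourier \<phi> \<xi>) + (\<Sum>k\<in>UNIV. cmod (inv_fourier (pd k \<phi>) \<xi>)))"
      by (intro mult_left_mono inv_fourier_weight_step Suc) auto
    also have "\<dots> \<le> C + (\<Sum>k\<in>UNIV. D k)"
      unfolding distrib_left sum_distrib_left by (intro add_mono sum_mono C D)
    finally show ?thesis .
  qed
  then show ?case by blast
qed

text \<open>Since \<open>e\<^sup>i\<^sup>s\<close> differs from \<open>1 + \<i> s\<close> by at most \<open>s\<^sup>2 / 2\<close>, the remainder is quadratic with the second
  moment of \<open>\<phi>\<close> as constant.\<close>

lemma has_derivative_inv_fourier:
  assumes "schwartz \<phi>"
  shows "(inv_fourier \<phi> has_derivative (\<lambda>h. inv_fourier (\<lambda>x. \<i> * of_real (x \<bullet> h) * \<phi> x) \<xi>)) (at \<xi>)"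
proof -
  have lin: "schwartz (\<lambda>x. \<i> * of_real (x \<bullet> h) * \<phi> x)" for h
    using schwartz_affine_mult[OF assms, of 0 \<i> h] by simp
  let ?D = "\<lambda>h. inv_fourier (\<lambda>x. \<i> * of_real (x \<bullet> h) * \<phi> x) \<xi>"
  have int2: "integrable lborel (\<lambda>x. (norm x)\<^sup>2 * cmod (\<phi> x))"
  proof -
    have [measurable]: "\<phi> \<in> borel_measurable borel" by (rule schwartz_measurable[OF assms])
    obtain C where C: "\<And>x. (1 + norm x) ^ 8 * cmod (\<phi> x) \<le> C" using schwartz_decay[OF assms] by metis
    have "integrable lborel (\<lambda>x. complex_of_real ((norm x)\<^sup>2 * cmod (\<phi> x)))"
    proof (rule integrable_of_decay)
      fix x :: "real^3"
      have "(norm x)\<^sup>2 \<le> (1 + norm x)\<^sup>2" by (intro power_mono) auto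
      then have "(1 + norm x) ^ 6 * ((norm x)\<^sup>2 * cmod (\<phi> x)) \<le> (1 + norm x) ^ 6 * ((1 + norm x)\<^sup>2 * cmod (\<phi> x))"
        by (intro mult_left_mono mult_right_mono) auto
      also have "\<dots> = (1 + norm x) ^ 8 * cmod (\<phi> x)" by (simp add: power2_eq_square eval_nat_numeral)
      also have "\<dots> \<le> C" by (rule C)
      finally show "(1 + norm x) ^ 6 * cmod (complex_of_real ((norm x)\<^sup>2 * cmod (\<phi> x))) \<le> C"
        by (simp add: norm_mult norm_power)
    qed measurable
    then show ?thesis using integrable_Re by fastforce
  qed
  define K where "K = 1 / (2 * pi) ^ 3 * (LINT x|lborel. (norm x)\<^sup>2 * cmod (\<phi> x))"
  have quad: "cmod (inv_fourier \<phi> \<eta> - inv_fourier \<phi> \<xi> - ?D (\<eta> - \<xi>)) \<le> K * (norm (\<eta> - \<xi>))\<^sup>2" for \<eta>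
  proof -
    define h where "h = \<eta> - \<xi>"
    let ?E = "\<lambda>\<xi> x. wave \<xi> x"
    have "inv_fourier \<phi> \<eta> - inv_fourier \<phi> \<xi> - ?D h = of_real (1 / (2 * pi) ^ 3) *
        ((LINT x|lborel. ?E \<eta> x * \<phi> x) - (LINT x|lborel. ?E \<xi> x * \<phi> x)
          - (LINT x|lborel. ?E \<xi> x * (\<i> * of_real (x \<bullet> h) * \<phi> x)))"
      unfolding inv_fourier_def by (simp add: algebra_simps)
    also have "\<dots> = of_real (1 / (2 * pi) ^ 3) *
        (LINT x|lborel. ?E \<eta> x * \<phi> x - ?E \<xi> x * \<phi> x - ?E \<xi> x * (\<i> * of_real (x \<bullet> h) * \<phi> x))"
      using schwartz_integrable[OF schwartz_exp_mult(1)[OF assms]]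
        schwartz_integrable[OF schwartz_exp_mult(1)[OF lin]] by simp
    finally have A: "cmod (inv_fourier \<phi> \<eta> - inv_fourier \<phi> \<xi> - ?D h) = 1 / (2 * pi) ^ 3 *
        cmod (LINT x|lborel. ?E \<eta> x * \<phi> x - ?E \<xi> x * \<phi> x - ?E \<xi> x * (\<i> * of_real (x \<bullet> h) * \<phi> x))"
      by (simp only: norm_mult norm_of_real) (simp add: abs_of_pos)
    have "cmod (LINT x|lborel. ?E \<eta> x * \<phi> x - ?E \<xi> x * \<phi> x - ?E \<xi> x * (\<i> * of_real (x \<bullet> h) * \<phi> x))
        \<le> (LINT x|lborel. (norm h)\<^sup>2 * ((norm x)\<^sup>2 * cmod (\<phi> x)))"
    proof (rule Bochner_Integration.integral_norm_bound_integral)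
      show "integrable lborel (\<lambda>x. ?E \<eta> x * \<phi> x - ?E \<xi> x * \<phi> x - ?E \<xi> x * (\<i> * of_real (x \<bullet> h) * \<phi> x))"
        using schwartz_integrable[OF schwartz_exp_mult(1)[OF assms]]
          schwartz_integrable[OF schwartz_exp_mult(1)[OF lin]] by simp
      fix x
      have "?E \<eta> x = ?E \<xi> x * ?E h x"
        unfolding h_def exp_add[symmetric] by (simp add: inner_diff_left algebra_simps)
      then have "?E \<eta> x * \<phi> x - ?E \<xi> x * \<phi> x - ?E \<xi> x * (\<i> * of_real (x \<bullet> h) * \<phi> x)
          = ?E \<xi> x * (?E h x - (1 + \<i> * of_real (h \<bullet> x))) * \<phi> x"
        by (simp add: algebra_simps inner_commute)
      then have "cmod (?E \<eta> x * \<phi> x - ?E \<xi> x * \<phi> x - ?E \<xi> x * (\<i> * of_real (x \<bullet> h) * \<phi> x))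
          = cmod (?E h x - (1 + \<i> * of_real (h \<bullet> x))) * cmod (\<phi> x)"
        by (simp add: norm_mult)
      also have "\<dots> \<le> (\<bar>h \<bullet> x\<bar>\<^sup>2 / 2) * cmod (\<phi> x)"
        using iexp_approx1[of "h \<bullet> x" 1] by (intro mult_right_mono) (auto simp: numeral_2_eq_2)
      also have "\<dots> \<le> ((norm h * norm x)\<^sup>2) * cmod (\<phi> x)"
      proof (intro mult_right_mono)
        have "\<bar>h \<bullet> x\<bar>\<^sup>2 \<le> (norm h * norm x)\<^sup>2" by (intro power_mono Cauchy_Schwarz_ineq2) auto
        then show "\<bar>h \<bullet> x\<bar>\<^sup>2 / 2 \<le> (norm h * norm x)\<^sup>2" by (smt (verit) field_sum_of_halves zero_le_power2)
      qed auto
      finally show "cmod (?E \<eta> x * \<phi> x - ?E \<xi> x * \<phi> x - ?E \<xi> x * (\<i> * of_real (x \<bullet> h) * \<phi> x))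
          \<le> (norm h)\<^sup>2 * ((norm x)\<^sup>2 * cmod (\<phi> x))" by (simp add: power_mult_distrib mult.assoc)
    qed (use int2 in simp)
    also have "(LINT x|lborel. (norm h)\<^sup>2 * ((norm x)\<^sup>2 * cmod (\<phi> x)))
        = (norm h)\<^sup>2 * (LINT x|lborel. (norm x)\<^sup>2 * cmod (\<phi> x))" by simp
    finally have B: "cmod (LINT x|lborel. ?E \<eta> x * \<phi> x - ?E \<xi> x * \<phi> x - ?E \<xi> x * (\<i> * of_real (x \<bullet> h) * \<phi> x))
        \<le> (norm h)\<^sup>2 * (LINT x|lborel. (norm x)\<^sup>2 * cmod (\<phi> x))" .
    have "1 / (2 * pi) ^ 3 * ((norm h)\<^sup>2 * (LINT x|lborel. (norm x)\<^sup>2 * cmod (\<phi> x))) = K * (norm h)\<^sup>2"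
      unfolding K_def by simp
    then show ?thesis unfolding h_def[symmetric] A
      using mult_left_mono[OF B, of "1 / (2 * pi) ^ 3"] by simp
  qed
  show ?thesis
  proof (rule has_derivativeI_sandwich[where e=1 and H="\<lambda>\<eta>. K * norm (\<eta> - \<xi>)"])
    have *: "linear ?D"
    proof (rule linearI)
      fix a b :: "real^3" and r :: real
      have "(\<lambda>x. \<i> * of_real (x \<bullet> (a + b)) * \<phi> x) = (\<lambda>x. 1 * (\<i> * of_real (x \<bullet> a) * \<phi> x) + 1 * (\<i> * of_real (x \<bullet> b) * \<phi> x))"
        by (auto simp: inner_add_right algebra_simps)
      then show "?D (a + b) = ?D a + ?D b"
        using inv_fourier_add[OF schwartz_integrable[OF lin] schwartz_integrable[OF lin], of 1 a 1 b \<xi>] by simp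
      have "(\<lambda>x. \<i> * of_real (x \<bullet> (r *\<^sub>R a)) * \<phi> x) = (\<lambda>x. of_real r * (\<i> * of_real (x \<bullet> a) * \<phi> x))"
        by auto
      then show "?D (r *\<^sub>R a) = r *\<^sub>R ?D a"
        using inv_fourier_cmult[of "of_real r" "\<lambda>x. \<i> * of_real (x \<bullet> a) * \<phi> x" \<xi>] by (simp add: scaleR_conv_of_real)
    qed
    then show "bounded_linear ?D" by (rule linear_conv_bounded_linear[THEN iffD1])
    show "norm (inv_fourier \<phi> \<eta> - inv_fourier \<phi> \<xi> - ?D (\<eta> - \<xi>)) / norm (\<eta> - \<xi>) \<le> K * norm (\<eta> - \<xi>)"
      if "\<eta> \<noteq> \<xi>" for \<eta>
      using quad[of \<eta>] that by (simp add: field_simps power2_eq_square)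
    have "((\<lambda>\<eta>. K * norm (\<eta> - \<xi>)) \<longlongrightarrow> K * norm (\<xi> - \<xi>)) (at \<xi>)" by (intro tendsto_intros)
    then show "((\<lambda>\<eta>. K * norm (\<eta> - \<xi>)) \<longlongrightarrow> 0) (at \<xi>)" by simp
  qed auto
qed

lemma schwartz_inv_fourier:
  assumes "schwartz \<phi>"
  shows "schwartz (inv_fourier \<phi>)"
proof (rule schwartz_coinduct[where Q="\<lambda>\<zeta>. \<exists>\<phi>. schwartz \<phi> \<and> \<zeta> = inv_fourier \<phi>"])
  fix \<zeta> :: "real^3 \<Rightarrow> complex" assume "\<exists>\<phi>. schwartz \<phi> \<and> \<zeta> = inv_fourier \<phi>"
  then obtain \<phi> where \<phi>: "schwartz \<phi>" "\<zeta> = inv_fourier \<phi>" by blast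
  show "\<zeta> differentiable (at x)" for x
    unfolding \<phi> differentiable_def using has_derivative_inv_fourier[OF \<phi>(1)] by blast
  have "schwartz (\<lambda>x. \<i> * of_real (x \<bullet> axis k 1) * \<phi> x)" for k
    using schwartz_affine_mult[OF \<phi>(1), of 0 \<i> "axis k 1"] by simp
  moreover have "pd k \<zeta> = inv_fourier (\<lambda>x. \<i> * of_real (x \<bullet> axis k 1) * \<phi> x)" for k
    unfolding \<phi> by (rule ext, rule pd_eq) (rule has_derivative_inv_fourier[OF \<phi>(1)])
  ultimately show "\<exists>\<phi>. schwartz \<phi> \<and> pd k \<zeta> = inv_fourier \<phi>" for k by blast
  show "\<exists>C. \<forall>x. (1 + norm x) ^ N * cmod (\<zeta> x) \<le> C" for N
    unfolding \<phi> by (rule inv_fourier_decay[OF \<phi>(1)])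
qed (use assms in blast)

lemma schwartz_fourier:
  assumes "schwartz \<phi>"
  shows "schwartz (fourier \<phi>)"
proof -
  have "fourier \<phi> = (\<lambda>\<xi>. of_real ((2 * pi) ^ 3) * inv_fourier \<phi> ((-1) *\<^sub>R \<xi>))"
    by (auto simp: fourier_eq_inv_fourier)
  then show ?thesis
    using schwartz_cmult[OF schwartz_scale[OF schwartz_inv_fourier[OF assms], of "-1"]] by simp
qed

text \<open>The uniformity in the test function is what makes distributions given by their Fourier transform
  tempered. One derivative pays for the factor \<open>1 + \<bar>\<xi>\<bar>\<close>, and six powers of decay for integrability.\<close>

lemma inv_fourier_schwartz_norm_bound:
  "\<exists>K\<ge>0. \<forall>\<phi> \<xi>. schwartz \<phi> \<longrightarrow> (1 + norm \<xi>) * cmod (inv_fourier \<phi> \<xi>) \<le> K * schwartz_norm 6 \<phi>"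
proof -
  define W where "W = (LINT x::real^3|lborel. inverse ((1 + norm x) ^ 6))"
  have W: "W \<ge> 0" unfolding W_def by (intro integral_nonneg_AE) auto
  have 1: "cmod (inv_fourier (pds ks \<phi>) \<xi>) \<le> 1 / (2 * pi) ^ 3 * (W * schwartz_norm 6 \<phi>)"
    if "schwartz \<phi>" "length ks \<le> 6" for \<phi> ks \<xi>
  proof -
    have s: "schwartz (pds ks \<phi>)" using that(1) by (induction ks) (auto intro: schwartz_pd)
    have "(LINT x|lborel. cmod (pds ks \<phi> x)) \<le> (LINT x::real^3|lborel. inverse ((1 + norm x) ^ 6) * schwartz_norm 6 \<phi>)"
    proof (rule integral_mono)
      show "integrable lborel (\<lambda>x. cmod (pds ks \<phi> x))" using schwartz_integrable[OF s] by simp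
      show "integrable lborel (\<lambda>x::real^3. inverse ((1 + norm x) ^ 6) * schwartz_norm 6 \<phi>)"
        using integrable_weight by simp
      show "cmod (pds ks \<phi> x) \<le> inverse ((1 + norm x) ^ 6) * schwartz_norm 6 \<phi>" for x
        using weight_divide[OF schwartz_norm_bound[OF that, of x]] by (simp add: mult.commute)
    qed
    then have "(LINT x|lborel. cmod (pds ks \<phi> x)) \<le> W * schwartz_norm 6 \<phi>"
      unfolding W_def by simp
    then show ?thesis
      by (intro order_trans[OF cmod_inv_fourier_le]) (intro mult_left_mono, auto)
  qed
  have "(1 + norm \<xi>) * cmod (inv_fourier \<phi> \<xi>) \<le> (4 * (1 / (2 * pi) ^ 3 * W)) * schwartz_norm 6 \<phi>"
    if "schwartz \<phi>" for \<phi> \<xi>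
  proof -
    have "(1 + norm \<xi>) * cmod (inv_fourier \<phi> \<xi>)
      \<le> cmod (inv_fourier \<phi> \<xi>) + (\<Sum>k\<in>UNIV. cmod (inv_fourier (pd k \<phi>) \<xi>))"
      by (rule inv_fourier_weight_step[OF that])
    also have "\<dots> \<le> 1 / (2 * pi) ^ 3 * (W * schwartz_norm 6 \<phi>) + (\<Sum>k\<in>(UNIV::3 set). 1 / (2 * pi) ^ 3 * (W * schwartz_norm 6 \<phi>))"
      using 1[OF that, of "[]"] 1[OF that, of "[_]"] by (intro add_mono sum_mono) auto
    finally show ?thesis by simp
  qed
  then show ?thesis using W by (intro exI[of _ "4 * (1 / (2 * pi) ^ 3 * W)"]) auto
qed

section \<open>Fourier inversion\<close>

lemma integrable_pair_bounded_kernel: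
  fixes f :: "'a::euclidean_space \<Rightarrow> complex" and g :: "'b::euclidean_space \<Rightarrow> complex"
  assumes f: "integrable lborel f" and g: "integrable lborel g"
    and k [measurable]: "k \<in> borel_measurable (lborel \<Otimes>\<^sub>M lborel)" and "\<And>x y. cmod (k (x, y)) \<le> 1"
  shows "integrable (lborel \<Otimes>\<^sub>M lborel) (\<lambda>(x, y). k (x, y) * f x * g y)"
proof (rule integrableI_bounded)
  have [measurable]: "f \<in> borel_measurable lborel" "g \<in> borel_measurable lborel"
    using f g by (auto intro: borel_measurable_integrable)
  show "(\<lambda>(x, y). k (x, y) * f x * g y) \<in> borel_measurable (lborel \<Otimes>\<^sub>M lborel)" by measurable
  have "(\<integral>\<^sup>+z. norm (case z of (x, y) \<Rightarrow> k (x, y) * f x * g y) \<partial>(lborel \<Otimes>\<^sub>M lborel))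
      \<le> (\<integral>\<^sup>+z. ennreal (norm (f (fst z))) * ennreal (norm (g (snd z))) \<partial>(lborel \<Otimes>\<^sub>M lborel))"
  proof (rule nn_integral_mono)
    fix z :: "'a \<times> 'b"
    obtain x y where z: "z = (x, y)" by (cases z)
    have "cmod (k (x, y)) * cmod (f x) * cmod (g y) \<le> 1 * cmod (f x) * cmod (g y)"
      using assms(4) by (intro mult_right_mono) auto
    then show "ennreal (norm (case z of (x, y) \<Rightarrow> k (x, y) * f x * g y)) \<le> ennreal (norm (f (fst z))) * ennreal (norm (g (snd z)))"
      by (simp add: z norm_mult flip: ennreal_mult)
  qed
  also have "\<dots> = (\<integral>\<^sup>+x. \<integral>\<^sup>+y. ennreal (norm (f x)) * ennreal (norm (g y)) \<partial>lborel \<partial>lborel)"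
    by (subst lborel.nn_integral_fst[symmetric]) auto
  also have "\<dots> = (\<integral>\<^sup>+x. ennreal (norm (f x)) \<partial>lborel) * (\<integral>\<^sup>+y. ennreal (norm (g y)) \<partial>lborel)"
    by (simp add: nn_integral_cmult nn_integral_multc)
  also have "\<dots> < \<infinity>"
    using f g by (auto simp: integrable_iff_bounded ennreal_mult_less_top)
  finally show "(\<integral>\<^sup>+z. norm (case z of (x, y) \<Rightarrow> k (x, y) * f x * g y) \<partial>(lborel \<Otimes>\<^sub>M lborel)) < \<infinity>" .
qed

definition gauss :: "real^3 \<Rightarrow> real" where
  "gauss \<xi> = exp (- (norm \<xi>)\<^sup>2 / 2)"

lemma gauss_1d:
  "integrable lborel (\<lambda>t::real. exp (\<i> * of_real (s * t)) * of_real (exp (- t\<^sup>2 / 2)))"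
  "(LINT t|lborel. exp (\<i> * of_real (s * t)) * of_real (exp (- t\<^sup>2 / 2))) = of_real (sqrt (2 * pi) * exp (- s\<^sup>2 / 2))"
proof -
  have e: "exp (\<i> * of_real (s * t)) * of_real (exp (- t\<^sup>2 / 2))
      = of_real (sqrt (2 * pi)) * (std_normal_density t *\<^sub>R exp (\<i> * of_real (s * t)))" for t
    by (simp add: std_normal_density_def scaleR_conv_of_real field_simps)
  have "integrable lborel (\<lambda>t. std_normal_density t *\<^sub>R exp (\<i> * of_real (s * t)))"
    by (rule Bochner_Integration.integrable_bound[OF integrable_std_normal_moment[of 0]]) (auto simp: std_normal_density_def)
  then show "integrable lborel (\<lambda>t::real. exp (\<i> * of_real (s * t)) * of_real (exp (- t\<^sup>2 / 2)))"
    unfolding e by (rule integrable_mult_right)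
  have "(LINT t|lborel. std_normal_density t *\<^sub>R exp (\<i> * of_real (s * t))) = of_real (exp (- s\<^sup>2 / 2))"
    using fun_cong[OF char_std_normal_distribution, of s] unfolding char_def
    by (subst (asm) integral_density) auto
  then show "(LINT t|lborel. exp (\<i> * of_real (s * t)) * of_real (exp (- t\<^sup>2 / 2))) = of_real (sqrt (2 * pi) * exp (- s\<^sup>2 / 2))"
    unfolding e integral_mult_right_zero by (simp only: of_real_mult)
qed

lemma gauss_fourier:
  "integrable lborel (\<lambda>\<xi>. wave x \<xi> * of_real (gauss \<xi>))"
  "(LINT \<xi>|lborel. wave x \<xi> * of_real (gauss \<xi>)) = of_real ((sqrt (2 * pi)) ^ 3 * gauss x)"
proof -
  let ?f = "\<lambda>b t. exp (\<i> * of_real ((x \<bullet> b) * t)) * of_real (exp (- t\<^sup>2 / 2))"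
  have n: "- (norm \<xi>)\<^sup>2 / 2 = (\<Sum>b\<in>Basis. - (\<xi> \<bullet> b)\<^sup>2 / 2)" for \<xi> :: "real^3"
    unfolding power2_norm_eq_inner euclidean_inner[of \<xi> \<xi>]
    by (simp add: power2_eq_square sum_negf sum_divide_distrib)
  have g: "gauss \<xi> = (\<Prod>b\<in>Basis. exp (- (\<xi> \<bullet> b)\<^sup>2 / 2))" for \<xi>
    unfolding gauss_def n by (simp add: exp_sum)
  have e: "wave x \<xi> * of_real (gauss \<xi>) = (\<Prod>b\<in>Basis. ?f b (\<xi> \<bullet> b))" for \<xi>
  proof -
    have "\<i> * complex_of_real (x \<bullet> \<xi>) = (\<Sum>b\<in>Basis. \<i> * of_real ((x \<bullet> b) * (\<xi> \<bullet> b)))"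
      unfolding euclidean_inner[of x \<xi>] by (simp add: sum_distrib_left)
    then show ?thesis unfolding g by (simp add: exp_sum prod.distrib)
  qed
  show "integrable lborel (\<lambda>\<xi>. wave x \<xi> * of_real (gauss \<xi>))"
    unfolding e by (rule integrable_lborel_prod_3(1)) (rule gauss_1d)
  have "(LINT \<xi>|lborel. wave x \<xi> * of_real (gauss \<xi>)) = (\<Prod>b\<in>Basis. LINT t|lborel. ?f b t)"
    unfolding e by (rule integrable_lborel_prod_3(2)) (rule gauss_1d)
  also have "\<dots> = of_real ((sqrt (2 * pi)) ^ 3 * gauss x)"
    unfolding gauss_1d(2) g by (simp add: prod.distrib)
  finally show "(LINT \<xi>|lborel. wave x \<xi> * of_real (gauss \<xi>)) = of_real ((sqrt (2 * pi)) ^ 3 * gauss x)" .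
qed

lemma gauss_measurable [measurable]: "gauss \<in> borel_measurable borel"
  unfolding gauss_def by measurable

lemma gauss_pos: "0 < gauss x" and gauss_le_1: "gauss x \<le> 1"
  by (auto simp: gauss_def)

lemma integrable_gauss: "integrable lborel (\<lambda>x. complex_of_real (gauss x))"
  using gauss_fourier(1)[of 0] by simp

text \<open>Inversion by Gaussian regularization: the regularized integral is evaluated with Fubini's
  theorem and becomes the average of \<open>\<phi>\<close> against a concentrating Gaussian.\<close>

theorem inv_fourier_fourier:
  assumes "schwartz \<phi>"
  shows "inv_fourier (fourier \<phi>) x = \<phi> x"
proof -
  let ?E = "\<lambda>\<xi>. wave x \<xi>"
  define \<epsilon> where "\<epsilon> n = inverse (real (Suc n))" for n
  have \<epsilon>: "\<epsilon> n \<noteq> 0" "\<epsilon> n > 0" for n unfolding \<epsilon>_def by auto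
  have \<epsilon>0: "\<epsilon> \<longlonglongrightarrow> 0" unfolding \<epsilon>_def[abs_def] by (rule LIMSEQ_inverse_real_of_nat)
  have [measurable]: "\<phi> \<in> borel_measurable borel" "fourier \<phi> \<in> borel_measurable borel"
    using assms schwartz_fourier by (auto intro: schwartz_measurable)
  have int: "integrable lborel (fourier \<phi>)" by (rule schwartz_integrable[OF schwartz_fourier[OF assms]])
  have cont: "isCont \<phi> y" for y using schwartz_continuous[OF assms] by (simp add: continuous_on_eq_continuous_at)
  have gcont: "isCont gauss y" for y unfolding gauss_def[abs_def] by (intro continuous_intros) auto
  obtain C where C: "\<And>y. cmod (\<phi> y) \<le> C" using schwartz_decay[OF assms, of 0] by auto
  define I where "I n = (LINT \<xi>|lborel. ?E \<xi> * of_real (gauss (\<epsilon> n *\<^sub>R \<xi>)) * fourier \<phi> \<xi>)" for n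
  have "I \<longlonglongrightarrow> (LINT \<xi>|lborel. ?E \<xi> * of_real 1 * fourier \<phi> \<xi>)"
    unfolding I_def[abs_def]
  proof (rule integral_dominated_convergence[where w="\<lambda>\<xi>. cmod (fourier \<phi> \<xi>)"])
    show "AE \<xi> in lborel. (\<lambda>n. ?E \<xi> * of_real (gauss (\<epsilon> n *\<^sub>R \<xi>)) * fourier \<phi> \<xi>) \<longlonglongrightarrow> ?E \<xi> * of_real 1 * fourier \<phi> \<xi>"
    proof (intro AE_I2 tendsto_intros)
      fix \<xi> :: "real^3"
      have "(\<lambda>n. \<epsilon> n *\<^sub>R \<xi>) \<longlonglongrightarrow> 0 *\<^sub>R \<xi>" by (intro tendsto_intros \<epsilon>0)
      then have "(\<lambda>n. gauss (\<epsilon> n *\<^sub>R \<xi>)) \<longlonglongrightarrow> gauss (0 *\<^sub>R \<xi>)"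
        using isCont_tendsto_compose[OF gcont] by blast
      then show "(\<lambda>n. gauss (\<epsilon> n *\<^sub>R \<xi>)) \<longlonglongrightarrow> 1" by (simp add: gauss_def)
    qed
    show "AE \<xi> in lborel. norm (?E \<xi> * of_real (gauss (\<epsilon> n *\<^sub>R \<xi>)) * fourier \<phi> \<xi>) \<le> cmod (fourier \<phi> \<xi>)" for n
      using gauss_pos gauss_le_1 by (intro AE_I2) (auto simp: norm_mult abs_of_pos less_imp_le intro!: mult_left_le_one_le)
  qed (use int in auto)
  then have lim1: "I \<longlonglongrightarrow> of_real ((2 * pi) ^ 3) * inv_fourier (fourier \<phi>) x"
    unfolding inv_fourier_def by simp
  have I: "I n = of_real ((sqrt (2 * pi)) ^ 3) * (LINT w|lborel. \<phi> (x + \<epsilon> n *\<^sub>R w) * of_real (gauss w))" for n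
  proof -
    have meas1: "(\<lambda>z. exp (\<i> * of_real ((x - snd z) \<bullet> fst z))) \<in> borel_measurable (lborel \<Otimes>\<^sub>M (lborel :: (real^3) measure))"
      by measurable
    have gi: "integrable lborel (\<lambda>\<xi>. complex_of_real (gauss (\<epsilon> n *\<^sub>R \<xi>)))"
      using lborel_integrable_affine[of "\<lambda>x. complex_of_real (gauss x)" "\<epsilon> n" 0] integrable_gauss \<epsilon> by simp
    have F: "integrable (lborel \<Otimes>\<^sub>M lborel) (\<lambda>(\<xi>, y). wave (x - y) \<xi> * of_real (gauss (\<epsilon> n *\<^sub>R \<xi>)) * \<phi> y)"
      using integrable_pair_bounded_kernel[OF gi schwartz_integrable[OF assms] meas1] by simp
    have "I n = (LINT \<xi>|lborel. LINT y|lborel. wave (x - y) \<xi> * of_real (gauss (\<epsilon> n *\<^sub>R \<xi>)) * \<phi> y)"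
    proof -
      have "?E \<xi> * of_real (gauss (\<epsilon> n *\<^sub>R \<xi>)) * fourier \<phi> \<xi>
        = (LINT y|lborel. wave (x - y) \<xi> * of_real (gauss (\<epsilon> n *\<^sub>R \<xi>)) * \<phi> y)" for \<xi>
      proof -
        have "wave (x - y) \<xi> = ?E \<xi> * exp (- \<i> * of_real (y \<bullet> \<xi>))" for y
          unfolding exp_add[symmetric] by (simp add: inner_diff_left algebra_simps)
        then have "wave (x - y) \<xi> * of_real (gauss (\<epsilon> n *\<^sub>R \<xi>)) * \<phi> y
           = (?E \<xi> * of_real (gauss (\<epsilon> n *\<^sub>R \<xi>))) * (exp (- \<i> * of_real (y \<bullet> \<xi>)) * \<phi> y)" for y
          by (simp add: mult_ac)
        then show ?thesis unfolding fourier_def by (simp only: integral_mult_right_zero)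
      qed
      then show ?thesis unfolding I_def by simp
    qed
    also have "\<dots> = (LINT y|lborel. LINT \<xi>|lborel. wave (x - y) \<xi> * of_real (gauss (\<epsilon> n *\<^sub>R \<xi>)) * \<phi> y)"
      using lborel_pair.Fubini_integral[OF F] by simp
    also have "\<dots> = (LINT y|lborel. of_real ((sqrt (2 * pi)) ^ 3) * (of_real (inverse (\<epsilon> n) ^ 3 * gauss (inverse (\<epsilon> n) *\<^sub>R (x - y))) * \<phi> y))"
    proof (rule Bochner_Integration.integral_cong[OF refl])
      fix y
      have "(LINT \<xi>|lborel. wave (x - y) \<xi> * of_real (gauss (\<epsilon> n *\<^sub>R \<xi>)))
        = \<bar>inverse (\<epsilon> n)\<bar> ^ 3 *\<^sub>R (LINT \<xi>|lborel. exp (\<i> * of_real ((x - y) \<bullet> (0 + inverse (\<epsilon> n) *\<^sub>R \<xi>))) * of_real (gauss (\<epsilon> n *\<^sub>R (0 + inverse (\<epsilon> n) *\<^sub>R \<xi>))))"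
        using lborel_integral_affine[of "\<lambda>\<xi>. wave (x - y) \<xi> * of_real (gauss (\<epsilon> n *\<^sub>R \<xi>))" "inverse (\<epsilon> n)" 0] \<epsilon>(1)[of n]
        by simp
      also have "(LINT \<xi>|lborel. exp (\<i> * of_real ((x - y) \<bullet> (0 + inverse (\<epsilon> n) *\<^sub>R \<xi>))) * of_real (gauss (\<epsilon> n *\<^sub>R (0 + inverse (\<epsilon> n) *\<^sub>R \<xi>))))
        = (LINT \<xi>|lborel. exp (\<i> * of_real ((inverse (\<epsilon> n) *\<^sub>R (x - y)) \<bullet> \<xi>)) * of_real (gauss \<xi>))"
        using \<epsilon>(1)[of n] by simp
      finally have "(LINT \<xi>|lborel. wave (x - y) \<xi> * of_real (gauss (\<epsilon> n *\<^sub>R \<xi>)))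
        = of_real (inverse (\<epsilon> n) ^ 3 * ((sqrt (2 * pi)) ^ 3 * gauss (inverse (\<epsilon> n) *\<^sub>R (x - y))))"
        unfolding gauss_fourier(2) using \<epsilon>(2)[of n] by (simp add: scaleR_conv_of_real abs_of_pos)
      then show "(LINT \<xi>|lborel. wave (x - y) \<xi> * of_real (gauss (\<epsilon> n *\<^sub>R \<xi>)) * \<phi> y)
        = of_real ((sqrt (2 * pi)) ^ 3) * (of_real (inverse (\<epsilon> n) ^ 3 * gauss (inverse (\<epsilon> n) *\<^sub>R (x - y))) * \<phi> y)"
        by simp
    qed
    also have "\<dots> = of_real ((sqrt (2 * pi)) ^ 3) * (LINT y|lborel. of_real (inverse (\<epsilon> n) ^ 3 * gauss (inverse (\<epsilon> n) *\<^sub>R (x - y))) * \<phi> y)"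
      by (rule integral_mult_right_zero)
    also have "(LINT y|lborel. of_real (inverse (\<epsilon> n) ^ 3 * gauss (inverse (\<epsilon> n) *\<^sub>R (x - y))) * \<phi> y)
      = \<bar>\<epsilon> n\<bar> ^ 3 *\<^sub>R (LINT w|lborel. of_real (inverse (\<epsilon> n) ^ 3 * gauss (inverse (\<epsilon> n) *\<^sub>R (x - (x + \<epsilon> n *\<^sub>R w)))) * \<phi> (x + \<epsilon> n *\<^sub>R w))"
      using lborel_integral_affine[of "\<lambda>y. of_real (inverse (\<epsilon> n) ^ 3 * gauss (inverse (\<epsilon> n) *\<^sub>R (x - y))) * \<phi> y" "\<epsilon> n" x] \<epsilon>(1)[of n]
      by simp
    also have "\<dots> = (LINT w|lborel. \<bar>\<epsilon> n\<bar> ^ 3 *\<^sub>R (of_real (inverse (\<epsilon> n) ^ 3 * gauss (inverse (\<epsilon> n) *\<^sub>R (x - (x + \<epsilon> n *\<^sub>R w)))) * \<phi> (x + \<epsilon> n *\<^sub>R w)))"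
      by (rule Bochner_Integration.integral_scaleR_right[symmetric])
    also have "\<dots> = (LINT w|lborel. \<phi> (x + \<epsilon> n *\<^sub>R w) * of_real (gauss w))"
    proof (rule Bochner_Integration.integral_cong[OF refl])
      fix w
      have "\<bar>\<epsilon> n\<bar> ^ 3 * inverse (\<epsilon> n) ^ 3 = 1" using \<epsilon>[of n] by (simp add: power_inverse)
      moreover have "gauss (inverse (\<epsilon> n) *\<^sub>R (x - (x + \<epsilon> n *\<^sub>R w))) = gauss w"
        using \<epsilon>[of n] by (simp add: gauss_def)
      ultimately show "\<bar>\<epsilon> n\<bar> ^ 3 *\<^sub>R (of_real (inverse (\<epsilon> n) ^ 3 * gauss (inverse (\<epsilon> n) *\<^sub>R (x - (x + \<epsilon> n *\<^sub>R w)))) * \<phi> (x + \<epsilon> n *\<^sub>R w))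
        = \<phi> (x + \<epsilon> n *\<^sub>R w) * of_real (gauss w)"
        by (simp only: scaleR_conv_of_real mult.assoc[symmetric] of_real_mult[symmetric]) (simp add: mult.commute)
    qed
    finally show ?thesis .
  qed
  have "(\<lambda>n. LINT w|lborel. \<phi> (x + \<epsilon> n *\<^sub>R w) * of_real (gauss w)) \<longlonglongrightarrow> (LINT w|lborel. \<phi> x * of_real (gauss w))"
  proof (rule integral_dominated_convergence[where w="\<lambda>w. C * gauss w"])
    show "AE w in lborel. (\<lambda>n. \<phi> (x + \<epsilon> n *\<^sub>R w) * of_real (gauss w)) \<longlonglongrightarrow> \<phi> x * of_real (gauss w)"
    proof (intro AE_I2 tendsto_mult tendsto_const)
      fix w :: "real^3"
      have "(\<lambda>n. x + \<epsilon> n *\<^sub>R w) \<longlonglongrightarrow> x + 0 *\<^sub>R w" by (intro tendsto_intros \<epsilon>0)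
      then show "(\<lambda>n. \<phi> (x + \<epsilon> n *\<^sub>R w)) \<longlonglongrightarrow> \<phi> x" using isCont_tendsto_compose[OF cont] by simp
    qed
    show "integrable lborel (\<lambda>w. C * gauss w)"
      using integrable_Re[OF integrable_gauss] by simp
    show "AE w in lborel. norm (\<phi> (x + \<epsilon> n *\<^sub>R w) * of_real (gauss w)) \<le> C * gauss w" for n
      using C gauss_pos by (intro AE_I2) (auto simp: norm_mult abs_of_pos less_imp_le intro!: mult_right_mono)
  qed auto
  then have "I \<longlonglongrightarrow> of_real ((sqrt (2 * pi)) ^ 3) * (LINT w|lborel. \<phi> x * of_real (gauss w))"
    unfolding I[abs_def] by (intro tendsto_mult tendsto_const)
  moreover have "(LINT w|lborel. of_real (gauss w)) = complex_of_real ((sqrt (2 * pi)) ^ 3)"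
    using gauss_fourier(2)[of 0] by (simp add: gauss_def)
  moreover have "complex_of_real ((sqrt (2 * pi)) ^ 3) * complex_of_real ((sqrt (2 * pi)) ^ 3) = of_real ((2 * pi) ^ 3)"
    unfolding of_real_mult[symmetric] power_mult_distrib[symmetric] by simp
  ultimately have "I \<longlonglongrightarrow> of_real ((2 * pi) ^ 3) * \<phi> x" by (simp add: mult_ac)
  with lim1 have "of_real ((2 * pi) ^ 3) * inv_fourier (fourier \<phi>) x = of_real ((2 * pi) ^ 3) * \<phi> x"
    by (rule LIMSEQ_unique)
  then show ?thesis by simp
qed

section \<open>Distributions given by their Fourier transform\<close>

text \<open>The tempered distribution with Fourier transform \<open>h\<close>.\<close>

definition freq_dist :: "(real^3 \<Rightarrow> complex) \<Rightarrow> tdist" where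
  "freq_dist h = (\<lambda>\<phi>. LINT \<xi>|lborel. h \<xi> * inv_fourier \<phi> \<xi>)"

text \<open>With this weight the pairing with a test function uses the decay of its inverse transform to
  first order only. It covers both integrable \<open>h\<close> and integrable \<open>h / \<bar>\<xi>\<bar>\<close>, hence velocities as well
  as divergences of products.\<close>

definition freq_admissible :: "(real^3 \<Rightarrow> complex) \<Rightarrow> bool" where
  "freq_admissible h \<longleftrightarrow> integrable lborel (\<lambda>\<xi>. h \<xi> / of_real (1 + norm \<xi>))"

lemma freq_admissible_measurable:
  assumes "freq_admissible h"
  shows "h \<in> borel_measurable borel"
proof -
  have [measurable]: "(\<lambda>\<xi>. h \<xi> / of_real (1 + norm \<xi>)) \<in> borel_measurable borel"
    using borel_measurable_integrable[OF assms[unfolded freq_admissible_def]] by simp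
  have "(\<lambda>\<xi>. (h \<xi> / of_real (1 + norm \<xi>)) * of_real (1 + norm \<xi>)) \<in> borel_measurable borel"
    by measurable
  moreover have "(h \<xi> / of_real (1 + norm \<xi>)) * of_real (1 + norm \<xi>) = h \<xi>" for \<xi>
  proof -
    have "1 + norm \<xi> \<noteq> 0" using norm_ge_zero[of \<xi>] by linarith
    then have "complex_of_real (1 + norm \<xi>) \<noteq> 0" unfolding of_real_eq_0_iff .
    then show ?thesis by simp
  qed
  ultimately show ?thesis by simp
qed

lemma freq_admissibleI:
  assumes [measurable]: "h \<in> borel_measurable borel"
    and "(\<integral>\<^sup>+\<xi>. ennreal (cmod (h \<xi>) / norm \<xi>) \<partial>lborel) < \<infinity>"
  shows "freq_admissible h"
  unfolding freq_admissible_def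
proof (rule integrableI_bounded)
  have "AE \<xi> in lborel. \<xi> \<noteq> (0::real^3)" by (rule AE_lborel_singleton)
  then have "(\<integral>\<^sup>+\<xi>. ennreal (norm (h \<xi> / of_real (1 + norm \<xi>))) \<partial>lborel) \<le> (\<integral>\<^sup>+\<xi>. ennreal (cmod (h \<xi>) / norm \<xi>) \<partial>lborel)"
  proof (intro nn_integral_mono_AE, eventually_elim)
    fix \<xi> :: "real^3" assume "\<xi> \<noteq> 0"
    then have "cmod (h \<xi>) / (1 + norm \<xi>) \<le> cmod (h \<xi>) / norm \<xi>"
      by (intro divide_left_mono) (auto intro!: mult_pos_pos add_pos_nonneg)
    moreover have "cmod (complex_of_real (1 + norm \<xi>)) = 1 + norm \<xi>"
      unfolding norm_of_real by simp
    ultimately show "ennreal (norm (h \<xi> / of_real (1 + norm \<xi>))) \<le> ennreal (cmod (h \<xi>) / norm \<xi>)"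
      unfolding norm_divide by (intro ennreal_leI) simp
  qed
  with assms(2) show "(\<integral>\<^sup>+\<xi>. ennreal (norm (h \<xi> / of_real (1 + norm \<xi>))) \<partial>lborel) < \<infinity>"
    by (rule le_less_trans[rotated])
qed measurable

lemma integrable_imp_freq_admissible:
  assumes "integrable lborel h"
  shows "freq_admissible h"
  unfolding freq_admissible_def
proof (rule Bochner_Integration.integrable_bound[OF assms])
  have [measurable]: "h \<in> borel_measurable borel" using borel_measurable_integrable[OF assms] by simp
  show "(\<lambda>\<xi>. h \<xi> / of_real (1 + norm \<xi>)) \<in> borel_measurable lborel" by measurable
  have "cmod (h \<xi> / of_real (1 + norm \<xi>)) \<le> cmod (h \<xi>)" for \<xi> :: "real^3"
  proof -
    have "cmod (complex_of_real (1 + norm \<xi>)) = 1 + norm \<xi>" unfolding norm_of_real by simp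
    then have "cmod (h \<xi> / of_real (1 + norm \<xi>)) = cmod (h \<xi>) / (1 + norm \<xi>)" unfolding norm_divide by simp
    also have "\<dots> \<le> cmod (h \<xi>) / 1" by (intro divide_left_mono) (auto simp: add_pos_nonneg)
    finally show ?thesis by simp
  qed
  then show "AE \<xi> in lborel. norm (h \<xi> / of_real (1 + norm \<xi>)) \<le> norm (h \<xi>)" by simp
qed

lemma freq_dist_integrable:
  assumes h: "freq_admissible h" and "schwartz \<phi>"
  shows "integrable lborel (\<lambda>\<xi>. h \<xi> * inv_fourier \<phi> \<xi>)"
    and "cmod (freq_dist h \<phi>) \<le> (SUP \<xi>. (1 + norm \<xi>) * cmod (inv_fourier \<phi> \<xi>)) * (LINT \<xi>|lborel. cmod (h \<xi> / of_real (1 + norm \<xi>)))"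
proof -
  have [measurable]: "h \<in> borel_measurable borel" by (rule freq_admissible_measurable[OF h])
  have [measurable]: "\<phi> \<in> borel_measurable borel" by (rule schwartz_measurable[OF assms(2)])
  define S where "S = (SUP \<xi>. (1 + norm \<xi>) * cmod (inv_fourier \<phi> \<xi>))"
  obtain C where C: "\<And>\<xi>. (1 + norm \<xi>) * cmod (inv_fourier \<phi> \<xi>) \<le> C"
    using inv_fourier_decay[OF assms(2), of 1] by auto
  have S: "(1 + norm \<xi>) * cmod (inv_fourier \<phi> \<xi>) \<le> S" for \<xi>
    unfolding S_def by (rule cSUP_upper) (use C in \<open>auto intro!: bdd_aboveI2\<close>)
  have b: "cmod (h \<xi> * inv_fourier \<phi> \<xi>) \<le> S * cmod (h \<xi> / of_real (1 + norm \<xi>))" for \<xi>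
  proof -
    have p: "0 < 1 + norm \<xi>" using norm_ge_zero[of \<xi>] by linarith
    have "cmod (complex_of_real (1 + norm \<xi>)) = 1 + norm \<xi>" unfolding norm_of_real by simp
    then have "cmod (h \<xi> * inv_fourier \<phi> \<xi>) = ((1 + norm \<xi>) * cmod (inv_fourier \<phi> \<xi>)) * cmod (h \<xi> / of_real (1 + norm \<xi>))"
      unfolding norm_divide norm_mult using p by (simp add: field_simps)
    also have "\<dots> \<le> S * cmod (h \<xi> / of_real (1 + norm \<xi>))" by (intro mult_right_mono S) auto
    finally show ?thesis .
  qed
  have i: "integrable lborel (\<lambda>\<xi>. S * cmod (h \<xi> / of_real (1 + norm \<xi>)))"
    using h unfolding freq_admissible_def by (intro integrable_mult_right integrable_norm)
  show int: "integrable lborel (\<lambda>\<xi>. h \<xi> * inv_fourier \<phi> \<xi>)"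
    by (rule Bochner_Integration.integrable_bound[OF i])
      (use b in \<open>auto intro!: AE_I2 intro: order_trans[OF _ abs_ge_self]\<close>)
  have "cmod (freq_dist h \<phi>) \<le> (LINT \<xi>|lborel. S * cmod (h \<xi> / of_real (1 + norm \<xi>)))"
    unfolding freq_dist_def by (rule Bochner_Integration.integral_norm_bound_integral[OF int i b])
  then show "cmod (freq_dist h \<phi>) \<le> S * (LINT \<xi>|lborel. cmod (h \<xi> / of_real (1 + norm \<xi>)))" by simp
qed

lemma tempered_freq_dist:
  assumes h: "freq_admissible h"
  shows "tempered (freq_dist h)"
  unfolding tempered_def
proof (intro conjI allI impI)
  fix \<phi> \<eta> :: "real^3 \<Rightarrow> complex" and a b assume s: "schwartz \<phi>" "schwartz \<eta>"
  have "h \<xi> * inv_fourier (\<lambda>x. a * \<phi> x + b * \<eta> x) \<xi> = a * (h \<xi> * inv_fourier \<phi> \<xi>) + b * (h \<xi> * inv_fourier \<eta> \<xi>)" for \<xi>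
    using inv_fourier_add[OF s[THEN schwartz_integrable]] by (simp add: algebra_simps)
  then show "freq_dist h (\<lambda>x. a * \<phi> x + b * \<eta> x) = a * freq_dist h \<phi> + b * freq_dist h \<eta>"
    unfolding freq_dist_def using freq_dist_integrable(1)[OF h] s by simp
next
  obtain K where K: "K \<ge> 0" "\<And>\<phi> \<xi>. schwartz \<phi> \<Longrightarrow> (1 + norm \<xi>) * cmod (inv_fourier \<phi> \<xi>) \<le> K * schwartz_norm 6 \<phi>"
    using inv_fourier_schwartz_norm_bound by blast
  define D where "D = (LINT \<xi>|lborel. cmod (h \<xi> / of_real (1 + norm \<xi>)))"
  have D: "D \<ge> 0" unfolding D_def by simp
  have "cmod (freq_dist h \<phi>) \<le> K * D * schwartz_norm 6 \<phi>" if s: "schwartz \<phi>" for \<phi>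
  proof -
    have "(SUP \<xi>. (1 + norm \<xi>) * cmod (inv_fourier \<phi> \<xi>)) \<le> K * schwartz_norm 6 \<phi>"
      by (rule cSUP_least) (use K(2)[OF s] in auto)
    then have "(SUP \<xi>. (1 + norm \<xi>) * cmod (inv_fourier \<phi> \<xi>)) * D \<le> K * schwartz_norm 6 \<phi> * D"
      by (intro mult_right_mono D)
    with freq_dist_integrable(2)[OF h s] show ?thesis unfolding D_def by (simp add: mult_ac)
  qed
  then show "\<exists>N C. \<forall>\<phi>. schwartz \<phi> \<longrightarrow> cmod (freq_dist h \<phi>) \<le> C * schwartz_norm N \<phi>" by blast
qed

lemma locally_integrable_freq_admissible:
  assumes h: "freq_admissible h"
  shows "locally_integrable h"
  unfolding locally_integrable_def
proof (intro allI impI)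
  fix K :: "(real^3) set" assume "compact K"
  then have K: "K \<in> sets borel" "bounded K" by (auto simp: borel_compact compact_imp_bounded)
  then obtain R where R: "\<And>x. x \<in> K \<Longrightarrow> norm x \<le> R" by (auto simp: bounded_iff)
  have [measurable]: "h \<in> borel_measurable borel" by (rule freq_admissible_measurable[OF h])
  note K(1)[measurable]
  show "set_integrable lborel K h" unfolding set_integrable_def
  proof (rule Bochner_Integration.integrable_bound)
    show "integrable lborel (\<lambda>\<xi>. (1 + R) * cmod (h \<xi> / of_real (1 + norm \<xi>)))"
      using h unfolding freq_admissible_def by (intro integrable_mult_right integrable_norm)
    have "norm (indicator K \<xi> *\<^sub>R h \<xi>) \<le> (1 + R) * cmod (h \<xi> / of_real (1 + norm \<xi>))" if "\<xi> \<in> K" for \<xi>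
    proof -
      have p: "0 < 1 + norm \<xi>" using norm_ge_zero[of \<xi>] by linarith
      have "cmod (complex_of_real (1 + norm \<xi>)) = 1 + norm \<xi>" unfolding norm_of_real by simp
      then have "cmod (h \<xi>) = (1 + norm \<xi>) * cmod (h \<xi> / of_real (1 + norm \<xi>))"
        unfolding norm_divide using p by simp
      also have "\<dots> \<le> (1 + R) * cmod (h \<xi> / of_real (1 + norm \<xi>))"
        using R[OF that] by (intro mult_right_mono) auto
      finally show ?thesis using that by simp
    qed
    then show "AE \<xi> in lborel. norm (indicator K \<xi> *\<^sub>R h \<xi>) \<le> norm ((1 + R) * cmod (h \<xi> / of_real (1 + norm \<xi>)))"
      by (intro AE_I2) (smt (verit, best) indicator_simps(2) norm_ge_zero norm_zero real_norm_def scaleR_zero_left)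
  qed measurable
qed

theorem has_fourier_freq_dist:
  assumes h: "freq_admissible h"
  shows "has_fourier (freq_dist h) h"
  unfolding has_fourier_def dist_fun_def
  using tempered_freq_dist[OF h] locally_integrable_freq_admissible[OF h]
  by (auto simp: fourier_dist_def freq_dist_def inv_fourier_fourier)

lemma real_dist_freq_dist:
  assumes h: "freq_admissible h" and sym: "\<And>\<xi>. h (- \<xi>) = cnj (h \<xi>)"
  shows "real_dist (freq_dist h)"
  unfolding real_dist_def
proof (intro allI impI, elim conjE)
  fix \<phi> :: "real^3 \<Rightarrow> complex" assume s: "schwartz \<phi>" and r: "\<forall>x. \<phi> x \<in> \<real>"
  have [measurable]: "h \<in> borel_measurable borel" "\<phi> \<in> borel_measurable borel"
    using freq_admissible_measurable[OF h] schwartz_measurable[OF s] by auto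
  have c: "cnj (inv_fourier \<phi> (- \<xi>)) = inv_fourier \<phi> \<xi>" for \<xi>
    using inv_fourier_cnj[of \<phi> \<xi>] r by (simp add: Reals_cnj_iff)
  have "freq_dist h \<phi> = (LINT \<xi>|lborel. h (- \<xi>) * inv_fourier \<phi> (- \<xi>))"
    unfolding freq_dist_def
    using lborel_integral_affine[of "\<lambda>\<xi>. h \<xi> * inv_fourier \<phi> \<xi>" "-1" 0] by simp
  also have "\<dots> = (LINT \<xi>|lborel. cnj (h \<xi> * inv_fourier \<phi> \<xi>))"
    unfolding sym complex_cnj_mult by (subst c[symmetric]) simp
  also have "\<dots> = cnj (freq_dist h \<phi>)" unfolding freq_dist_def
    by (rule Bochner_Integration.integral_cnj)
  finally show "freq_dist h \<phi> \<in> \<real>" by (metis Reals_cnj_iff)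
qed

lemma dist_fun_cong:
  assumes "dist_fun S g" "\<And>\<phi>. schwartz \<phi> \<Longrightarrow> T \<phi> = S \<phi>"
  shows "dist_fun T g"
  using assms unfolding dist_fun_def by metis

text \<open>By Fubini's theorem the inverse transform is symmetric for the pairing of two integrable functions.\<close>

lemma dist_fun_freq_dist:
  assumes h: "integrable lborel h"
  shows "dist_fun (freq_dist h) (inv_fourier h)"
  unfolding dist_fun_def
proof (intro conjI allI impI)
  have [measurable]: "h \<in> borel_measurable borel" using borel_measurable_integrable[OF h] by simp
  show "locally_integrable (inv_fourier h)" unfolding locally_integrable_def
  proof (intro allI impI)
    fix K :: "(real^3) set" assume K: "compact K"
    have [measurable]: "K \<in> sets borel" using K by (rule borel_compact)
    define c where "c = 1 / (2 * pi) ^ 3 * (LINT x|lborel. cmod (h x))"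
    have c: "c \<ge> 0" unfolding c_def by (simp add: integral_nonneg_AE)
    have b: "norm (inv_fourier h x) \<le> norm c" for x
      using cmod_inv_fourier_le[of h x] c unfolding c_def by simp
    show "set_integrable lborel K (inv_fourier h)"
      unfolding set_integrable_def
    proof (rule Bochner_Integration.integrable_bound)
      show "integrable lborel (\<lambda>x. indicator K x *\<^sub>R c)"
        using emeasure_compact_finite[OF K] by (auto intro!: integrable_scaleR_left)
      show "AE x in lborel. norm (indicator K x *\<^sub>R inv_fourier h x) \<le> norm (indicator K x *\<^sub>R c)"
        by (intro AE_I2) (auto simp: b[simplified] split: split_indicator)
    qed measurable
  qed
  fix \<phi> :: "real^3 \<Rightarrow> complex" and K :: "(real^3) set"
  assume "schwartz \<phi> \<and> compact K \<and> (\<forall>x. x \<notin> K \<longrightarrow> \<phi> x = 0)"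
  then have s: "schwartz \<phi>" by blast
  have F: "integrable (lborel \<Otimes>\<^sub>M lborel) (\<lambda>(\<xi>, x). wave x \<xi> * h \<xi> * \<phi> x)"
    using integrable_pair_bounded_kernel[OF h schwartz_integrable[OF s], of "\<lambda>z. exp (\<i> * of_real (snd z \<bullet> fst z))"]
    by simp
  have 1: "h \<xi> * (LINT x|lborel. wave \<xi> x * \<phi> x) = (LINT x|lborel. wave x \<xi> * h \<xi> * \<phi> x)" for \<xi>
    by (simp add: inner_commute mult_ac flip: integral_mult_right_zero)
  have 2: "(LINT \<xi>|lborel. wave x \<xi> * h \<xi>) * \<phi> x = (LINT \<xi>|lborel. wave x \<xi> * h \<xi> * \<phi> x)" for x
    by simp
  have "freq_dist h \<phi> = of_real (1 / (2 * pi) ^ 3) * (LINT \<xi>|lborel. h \<xi> * (LINT x|lborel. wave \<xi> x * \<phi> x))"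
    unfolding freq_dist_def inv_fourier_def integral_mult_right_zero[symmetric] by (simp add: mult_ac)
  also have "\<dots> = of_real (1 / (2 * pi) ^ 3) * (LINT x|lborel. (LINT \<xi>|lborel. wave x \<xi> * h \<xi>) * \<phi> x)"
    unfolding 1 2 using lborel_pair.Fubini_integral[OF F] by simp
  also have "\<dots> = (LINT x|lborel. inv_fourier h x * \<phi> x)"
    unfolding inv_fourier_def integral_mult_right_zero[symmetric] by (simp add: mult_ac)
  finally show "freq_dist h \<phi> = (LINT x|lborel. inv_fourier h x * \<phi> x)" .
qed

lemma dist_deriv_freq_dist:
  assumes "schwartz \<phi>"
  shows "dist_deriv k (freq_dist h) \<phi> = freq_dist (\<lambda>\<xi>. \<i> * of_real (\<xi>$k) * h \<xi>) \<phi>"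
proof -
  have "- (LINT \<xi>|lborel. h \<xi> * inv_fourier (pd k \<phi>) \<xi>) = (LINT \<xi>|lborel. - (h \<xi> * inv_fourier (pd k \<phi>) \<xi>))"
    by (rule integral_minus[symmetric])
  then show ?thesis
    by (simp add: dist_deriv_def freq_dist_def inv_fourier_pd[OF assms] mult_ac)
qed

text \<open>The convolution without the factor \<open>(2 \<pi>)\<^sup>-\<^sup>3\<close> that the normalization of the transform puts into the
  convolution theorem.\<close>

definition conv :: "(real^3 \<Rightarrow> complex) \<Rightarrow> (real^3 \<Rightarrow> complex) \<Rightarrow> real^3 \<Rightarrow> complex" where
  "conv g h \<xi> = (LINT \<eta>|lborel. g (\<xi> - \<eta>) * h \<eta>)"

lemma nn_integral_translate_reflect:
  fixes f :: "real^3 \<Rightarrow> ennreal"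
  assumes [measurable]: "f \<in> borel_measurable borel"
  shows "(\<integral>\<^sup>+\<xi>. f (\<xi> - \<eta>) \<partial>lborel) = (\<integral>\<^sup>+\<xi>. f \<xi> \<partial>lborel)"
  using nn_integral_lborel_affine[of f 1 "- \<eta>"] by (simp add: algebra_simps)

lemma integrable_conv_pair:
  fixes g h :: "real^3 \<Rightarrow> complex"
  assumes g: "integrable lborel g" and h: "integrable lborel h"
  shows "integrable (lborel \<Otimes>\<^sub>M lborel) (\<lambda>(\<eta>, \<xi>). wave x \<xi> * (g (\<xi> - \<eta>) * h \<eta>))"
proof (rule integrableI_bounded)
  have [measurable]: "g \<in> borel_measurable borel" "h \<in> borel_measurable borel"
    using borel_measurable_integrable[OF h] borel_measurable_integrable[OF g] by auto
  show "(\<lambda>(\<eta>, \<xi>). wave x \<xi> * (g (\<xi> - \<eta>) * h \<eta>)) \<in> borel_measurable (lborel \<Otimes>\<^sub>M lborel)"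
    by measurable
  have "(\<integral>\<^sup>+z. norm (case z of (\<eta>, \<xi>) \<Rightarrow> wave x \<xi> * (g (\<xi> - \<eta>) * h \<eta>)) \<partial>(lborel \<Otimes>\<^sub>M lborel))
      = (\<integral>\<^sup>+\<eta>. \<integral>\<^sup>+\<xi>. ennreal (norm (g (\<xi> - \<eta>))) * ennreal (norm (h \<eta>)) \<partial>lborel \<partial>lborel)"
    by (subst lborel.nn_integral_fst[symmetric]) (auto simp: norm_mult ennreal_mult)
  also have "\<dots> = (\<integral>\<^sup>+\<eta>. (\<integral>\<^sup>+\<xi>. ennreal (norm (g \<xi>)) \<partial>lborel) * ennreal (norm (h \<eta>)) \<partial>lborel)"
    by (simp add: nn_integral_multc nn_integral_translate_reflect[of "\<lambda>\<xi>. ennreal (norm (g \<xi>))"])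
  also have "\<dots> < \<infinity>"
    using g h by (subst nn_integral_cmult) (auto simp: integrable_iff_bounded ennreal_mult_less_top)
  finally show "(\<integral>\<^sup>+z. norm (case z of (\<eta>, \<xi>) \<Rightarrow> wave x \<xi> * (g (\<xi> - \<eta>) * h \<eta>)) \<partial>(lborel \<Otimes>\<^sub>M lborel)) < \<infinity>" .
qed

lemma integrable_conv:
  assumes "integrable lborel g" "integrable lborel h"
  shows "integrable lborel (conv g h)"
  using lborel_pair.integrable_snd[OF integrable_conv_pair[OF assms, of 0]]
  unfolding conv_def[abs_def] by simp

lemma inv_fourier_conv:
  assumes g: "integrable lborel g" and h: "integrable lborel h"
  shows "inv_fourier g x * inv_fourier h x = inv_fourier (\<lambda>\<xi>. of_real (1 / (2 * pi) ^ 3) * conv g h \<xi>) x"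
proof -
  let ?E = "\<lambda>\<xi>. wave x \<xi>"
  have [measurable]: "g \<in> borel_measurable borel" "h \<in> borel_measurable borel"
    using borel_measurable_integrable[OF h] borel_measurable_integrable[OF g] by auto
  have "(LINT \<xi>|lborel. ?E \<xi> * conv g h \<xi>) = (LINT \<xi>|lborel. LINT \<eta>|lborel. ?E \<xi> * (g (\<xi> - \<eta>) * h \<eta>))"
    unfolding conv_def by simp
  also have "\<dots> = (LINT \<eta>|lborel. LINT \<xi>|lborel. ?E \<xi> * (g (\<xi> - \<eta>) * h \<eta>))"
    using lborel_pair.Fubini_integral[OF integrable_conv_pair[OF assms, of x]] by simp
  also have "\<dots> = (LINT \<eta>|lborel. (LINT \<xi>|lborel. ?E \<xi> * g \<xi>) * (?E \<eta> * h \<eta>))"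
  proof (rule Bochner_Integration.integral_cong[OF refl])
    fix \<eta>
    have "?E \<xi> * (g (\<xi> - \<eta>) * h \<eta>) = ?E (\<xi> - \<eta>) * g (\<xi> - \<eta>) * (?E \<eta> * h \<eta>)" for \<xi>
    proof -
      have "?E \<xi> = ?E (\<xi> - \<eta>) * ?E \<eta>" unfolding exp_add[symmetric] by (simp add: inner_diff_right algebra_simps)
      then show ?thesis by (simp add: mult_ac)
    qed
    then have "(LINT \<xi>|lborel. ?E \<xi> * (g (\<xi> - \<eta>) * h \<eta>)) = (LINT \<xi>|lborel. ?E (\<xi> - \<eta>) * g (\<xi> - \<eta>)) * (?E \<eta> * h \<eta>)"
      by (simp only: integral_mult_left_zero)
    also have "(LINT \<xi>|lborel. ?E (\<xi> - \<eta>) * g (\<xi> - \<eta>)) = (LINT \<xi>|lborel. ?E \<xi> * g \<xi>)"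
      using lborel_integral_affine[of "\<lambda>\<xi>. ?E \<xi> * g \<xi>" 1 "- \<eta>"] by simp
    finally show "(LINT \<xi>|lborel. ?E \<xi> * (g (\<xi> - \<eta>) * h \<eta>)) = (LINT \<xi>|lborel. ?E \<xi> * g \<xi>) * (?E \<eta> * h \<eta>)" .
  qed
  also have "\<dots> = (LINT \<xi>|lborel. ?E \<xi> * g \<xi>) * (LINT \<eta>|lborel. ?E \<eta> * h \<eta>)" by simp
  finally have *: "(LINT \<xi>|lborel. ?E \<xi> * conv g h \<xi>) = (LINT \<xi>|lborel. ?E \<xi> * g \<xi>) * (LINT \<eta>|lborel. ?E \<eta> * h \<eta>)" .
  show ?thesis unfolding inv_fourier_cmult unfolding inv_fourier_def * by (simp add: mult_ac)
qed

lemma dist_product_freq_dist: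
  assumes "integrable lborel g" "integrable lborel h"
  shows "dist_product (freq_dist g) (freq_dist h) (freq_dist (\<lambda>\<xi>. of_real (1 / (2 * pi) ^ 3) * conv g h \<xi>))"
proof -
  have "integrable lborel (\<lambda>\<xi>. of_real (1 / (2 * pi) ^ 3) * conv g h \<xi>)"
    by (intro integrable_mult_right integrable_conv assms)
  then show ?thesis unfolding dist_product_def
    using dist_fun_freq_dist[OF assms(1)] dist_fun_freq_dist[OF assms(2)] dist_fun_freq_dist
      tempered_freq_dist[OF integrable_imp_freq_admissible] inv_fourier_conv[OF assms]
    by (intro conjI exI[of _ "inv_fourier g"] exI[of _ "inv_fourier h"]) auto
qed

section \<open>Dyadic norms of distributions given by their Fourier transform\<close>

lemma enn_powr_1 [simp]: "enn_powr x 1 = x"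
  by (cases x) (auto simp: enn_powr_def)

lemma enn_powr_2: "enn_powr x 2 = x\<^sup>2"
  by (cases x) (auto simp: enn_powr_def ennreal_power top_power_ennreal)

lemma enn_powr_mono:
  assumes "x \<le> y" "0 < a"
  shows "enn_powr x a \<le> enn_powr y a"
proof (cases "y = \<infinity>")
  case False
  then have "x \<noteq> \<infinity>" using assms(1) by (auto simp: top_unique)
  then show ?thesis using False assms
    by (auto simp: enn_powr_def less_top intro!: ennreal_leI powr_mono2 enn2real_mono)
qed (simp add: enn_powr_def)

lemma enn_powr_inverse:
  assumes "0 < a"
  shows "enn_powr (enn_powr x a) (1 / a) = x"
  using assms by (cases x) (auto simp: enn_powr_def powr_powr)

lemma Lnorm_1: "Lnorm 1 g = (\<integral>\<^sup>+x. ennreal (cmod (g x)) \<partial>lborel)"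
  by (simp add: Lnorm_def)

lemma dist_Lnorm_le: "dist_fun T g \<Longrightarrow> dist_Lnorm p T \<le> Lnorm p g"
  unfolding dist_Lnorm_def by (auto intro: INF_lower)

text \<open>Testing bounds the supremum norm from below by duality.\<close>

lemma dist_Lnorm_infty_ge:
  assumes s: "schwartz \<phi>" and K: "compact K" "\<And>x. x \<notin> K \<Longrightarrow> \<phi> x = 0"
    and pos: "0 < (LINT x|lborel. cmod (\<phi> x))"
  shows "ennreal (cmod (T \<phi>)) \<le> dist_Lnorm \<infinity> T * ennreal (LINT x|lborel. cmod (\<phi> x))"
proof -
  define I where "I = (LINT x|lborel. cmod (\<phi> x))"
  have [measurable]: "\<phi> \<in> borel_measurable borel" by (rule schwartz_measurable[OF s])
  have I: "(\<integral>\<^sup>+x. ennreal (cmod (\<phi> x)) \<partial>lborel) = ennreal I"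
    unfolding I_def by (rule nn_integral_eq_integral) (use schwartz_integrable[OF s] in auto)
  have main: "ennreal (cmod (T \<phi>)) \<le> Lnorm \<infinity> g * ennreal I" if g: "dist_fun T g" for g
  proof -
    let ?e = "esssup lborel (\<lambda>x. ennreal (cmod (g x)))"
    have T: "T \<phi> = (LINT x|lborel. g x * \<phi> x)"
      using g s K unfolding dist_fun_def by blast
    have ae: "AE x in lborel. ennreal (cmod (g x)) \<le> ?e" by (rule esssup_AE)
    show ?thesis
    proof (cases "integrable lborel (\<lambda>x. g x * \<phi> x)")
      case True
      have "ennreal (cmod (T \<phi>)) \<le> (\<integral>\<^sup>+x. ennreal (cmod (g x * \<phi> x)) \<partial>lborel)"
        unfolding T by (rule integral_norm_bound_ennreal[OF True])
      also have "\<dots> \<le> (\<integral>\<^sup>+x. ?e * ennreal (cmod (\<phi> x)) \<partial>lborel)"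
        using ae
        by (intro nn_integral_mono_AE, eventually_elim) (simp add: norm_mult ennreal_mult mult_right_mono)
      also have "\<dots> = ?e * ennreal I" by (simp add: nn_integral_cmult I)
      finally show ?thesis by (simp add: Lnorm_def)
    next
      case False
      then show ?thesis unfolding T by (simp add: not_integrable_integral_eq)
    qed
  qed
  have "ennreal (cmod (T \<phi>)) / ennreal I \<le> dist_Lnorm \<infinity> T"
    unfolding dist_Lnorm_def
  proof (rule INF_greatest)
    fix g assume "g \<in> {g. dist_fun T g}"
    then show "ennreal (cmod (T \<phi>)) / ennreal I \<le> Lnorm \<infinity> g"
      using main[of g] pos by (simp add: I_def divide_le_posI_ennreal mult.commute)
  qed
  then have "ennreal (cmod (T \<phi>)) / ennreal I * ennreal I \<le> dist_Lnorm \<infinity> T * ennreal I"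
    by (rule mult_right_mono) simp
  moreover have "ennreal (cmod (T \<phi>)) / ennreal I * ennreal I = ennreal (cmod (T \<phi>))"
    using pos by (simp add: I_def divide_ennreal flip: ennreal_mult)
  ultimately show ?thesis by (simp add: I_def)
qed

lemma LP_block_cong:
  assumes "schwartz (\<lambda>\<xi>. of_real (\<psi> \<xi>))" "\<And>\<phi>. schwartz \<phi> \<Longrightarrow> T \<phi> = S \<phi>" "schwartz \<phi>"
  shows "LP_block \<psi> j T \<phi> = LP_block \<psi> j S \<phi>"
proof -
  have "schwartz (\<lambda>\<xi>. complex_of_real (\<psi> (2 powi (- j) *\<^sub>R \<xi>)))"
    using schwartz_scale[OF assms(1), of "2 powi (- j)"] by simp
  then have "schwartz (fourier (\<lambda>\<xi>. complex_of_real (\<psi> (2 powi (- j) *\<^sub>R \<xi>)) * inv_fourier \<phi> \<xi>))"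
    by (intro schwartz_fourier schwartz_mult schwartz_inv_fourier assms(3))
  then show ?thesis
    unfolding LP_block_def inv_fourier_dist_def mult_dist_def fourier_dist_def by (rule assms(2))
qed

lemma dyadic_norm_ge_0:
  assumes "r > 0"
  shows "a 0 \<le> dyadic_norm s r a"
proof (cases "r = \<infinity>")
  case True
  have "ennreal (2 powr (of_int 0 * s)) * a 0 \<le> (SUP j. ennreal (2 powr (of_int j * s)) * a j)"
    by (rule SUP_upper) auto
  then show ?thesis using True by (simp add: dyadic_norm_def)
next
  case False
  define p where "p = enn2real r"
  have p: "p > 0" using assms False unfolding p_def by (simp add: enn2real_positive_iff less_top)
  let ?f = "\<lambda>j. ennreal (2 powr (of_int j * s * p)) * enn_powr (a j) p"
  have "sum ?f {0} \<le> infsum ?f UNIV" 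
    unfolding nonneg_infsum_complete[of UNIV ?f, OF zero_le] by (intro SUP_upper) auto
  then have "enn_powr (a 0) p \<le> infsum ?f UNIV" by simp
  then have "enn_powr (enn_powr (a 0) p) (1 / p) \<le> enn_powr (infsum ?f UNIV) (1 / p)"
    using p by (intro enn_powr_mono) auto
  then show ?thesis using False by (simp add: dyadic_norm_def p_def[symmetric] enn_powr_inverse[OF p])
qed

lemma dyadic_norm_2_le:
  assumes "\<And>F. finite F \<Longrightarrow> (\<Sum>j\<in>F. ennreal (2 powr (- of_int j)) * a j) \<le> B"
  shows "dyadic_norm (- 1) 2 a \<le> B"
proof -
  have pw: "ennreal (2 powr (of_int j * - 1 * 2)) * (a j)\<^sup>2 = (ennreal (2 powr (- of_int j)) * a j)\<^sup>2" for j :: int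
    unfolding power_mult_distrib ennreal_power[OF powr_ge_zero] by (simp add: powr_realpow[symmetric] powr_powr)
  have "(\<Sum>\<^sub>\<infinity>j. ennreal (2 powr (of_int j * - 1 * 2)) * enn_powr (a j) 2) \<le> B\<^sup>2"
    unfolding enn_powr_2 pw nonneg_infsum_complete[OF zero_le]
  proof (rule SUP_least)
    fix F assume "F \<in> {F. finite F \<and> F \<subseteq> (UNIV :: int set)}"
    then have F: "finite F" by simp
    let ?b = "\<lambda>j. ennreal (2 powr (- of_int j)) * a j"
    have "(\<Sum>j\<in>F. (?b j)\<^sup>2) \<le> (\<Sum>j\<in>F. ?b j * (\<Sum>j\<in>F. ?b j))"
      unfolding power2_eq_square using F by (intro sum_mono mult_left_mono member_le_sum) auto
    also have "\<dots> = (\<Sum>j\<in>F. ?b j)\<^sup>2" by (simp add: sum_distrib_right power2_eq_square)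
    also have "\<dots> \<le> B\<^sup>2" by (intro power_mono assms F) auto
    finally show "(\<Sum>j\<in>F. (?b j)\<^sup>2) \<le> B\<^sup>2" .
  qed
  then have "enn_powr (\<Sum>\<^sub>\<infinity>j. ennreal (2 powr (of_int j * - 1 * 2)) * enn_powr (a j) 2) (1 / 2) \<le> enn_powr (enn_powr B 2) (1 / 2)"
    unfolding enn_powr_2[of B] by (intro enn_powr_mono) auto
  then show ?thesis using enn_powr_inverse[of 2 B] by (simp add: dyadic_norm_def)
qed

lemma dyadic_norm_finite_support_le:
  assumes c: "c \<ge> 0" and J: "finite J" and zero: "\<And>j. j \<notin> J \<Longrightarrow> a j = 0"
    and le: "\<And>j. j \<in> J \<Longrightarrow> ennreal (2 powr (- of_int j)) * a j \<le> ennreal c" and r: "r > 0"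
  shows "dyadic_norm (- 1) r a \<le> ennreal (c * (if r = \<infinity> then 1 else real (card J) powr (1 / enn2real r)))"
proof (cases "r = \<infinity>")
  case True
  have "(SUP j. ennreal (2 powr (of_int j * - 1)) * a j) \<le> ennreal c"
    by (rule SUP_least) (use zero le in \<open>case_tac "j \<in> J"; force\<close>)
  then show ?thesis using True by (simp add: dyadic_norm_def)
next
  case False
  define p where "p = enn2real r"
  have p: "p > 0" using r False unfolding p_def by (simp add: enn2real_positive_iff less_top)
  let ?f = "\<lambda>j. ennreal (2 powr (of_int j * - 1 * p)) * enn_powr (a j) p"
  have f0: "?f j = 0" if "j \<notin> J" for j using zero[OF that] p by (simp add: enn_powr_def)
  have fle: "?f j \<le> ennreal (c powr p)" if "j \<in> J" for j
  proof -
    have "a j \<noteq> \<infinity>" using le[OF that] by (auto simp: ennreal_mult_top top_unique)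
    then obtain x where x: "a j = ennreal x" "x \<ge> 0" by (cases "a j") auto
    have *: "2 powr (- of_int j) * x \<le> c" using le[OF that] x c by (simp flip: ennreal_mult)
    have "?f j = ennreal ((2 powr (- of_int j) * x) powr p)"
      using x by (simp add: enn_powr_def powr_mult powr_powr flip: ennreal_mult)
    also have "\<dots> \<le> ennreal (c powr p)" using * x p by (intro ennreal_leI powr_mono2) auto
    finally show ?thesis .
  qed
  have "infsum ?f UNIV = infsum ?f J" by (rule infsum_cong_neutral) (use f0 in auto)
  also have "\<dots> = sum ?f J" by (rule infsum_finite[OF J])
  also have "\<dots> \<le> (\<Sum>j\<in>J. ennreal (c powr p))" by (intro sum_mono fle)
  also have "\<dots> = ennreal (real (card J) * c powr p)" by (simp add: ennreal_mult ennreal_of_nat_eq_real_of_nat)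
  finally have "infsum ?f UNIV \<le> ennreal (real (card J) * c powr p)" .
  then have "enn_powr (infsum ?f UNIV) (1 / p) \<le> enn_powr (ennreal (real (card J) * c powr p)) (1 / p)"
    using p by (intro enn_powr_mono) auto
  also have "\<dots> = ennreal (c * real (card J) powr (1 / p))"
    using p c by (simp add: enn_powr_def powr_mult powr_powr mult.commute)
  finally show ?thesis using False by (simp add: dyadic_norm_def p_def[symmetric])
qed

locale littlewood_paley_partition =
  fixes \<psi> :: "real^3 \<Rightarrow> real"
  assumes lp: "littlewood_paley \<psi>"
begin

definition \<psi>d :: "int \<Rightarrow> real^3 \<Rightarrow> real" where
  "\<psi>d j \<xi> = \<psi> (2 powi (- j) *\<^sub>R \<xi>)"

lemma schwartz_\<psi>: "schwartz (\<lambda>\<xi>. of_real (\<psi> \<xi>))"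
  using lp unfolding littlewood_paley_def by blast

lemma schwartz_\<psi>d: "schwartz (\<lambda>\<xi>. of_real (\<psi>d j \<xi>))"
  unfolding \<psi>d_def using schwartz_scale[OF schwartz_\<psi>, of "2 powi (- j)"] by simp

lemma \<psi>_nonneg: "0 \<le> \<psi> \<xi>" and \<psi>d_nonneg: "0 \<le> \<psi>d j \<xi>"
  using lp unfolding littlewood_paley_def \<psi>d_def by auto

lemma \<psi>_measurable [measurable]: "\<psi> \<in> borel_measurable borel"
  using measurable_compose[OF schwartz_measurable[OF schwartz_\<psi>] borel_measurable_Re] by simp

lemma \<psi>d_measurable [measurable]: "\<psi>d j \<in> borel_measurable borel"
  unfolding \<psi>d_def[abs_def] by measurable

lemma \<psi>_support: "\<psi> \<xi> \<noteq> 0 \<Longrightarrow> 3/4 \<le> norm \<xi> \<and> norm \<xi> \<le> 8/3"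
  using lp unfolding littlewood_paley_def by blast

lemma \<psi>d_support:
  assumes "\<psi>d j \<xi> \<noteq> 0"
  shows "3/4 * 2 powi j \<le> norm \<xi>" "norm \<xi> \<le> 8/3 * 2 powi j"
proof -
  have p: "(2::real) powi j > 0" by simp
  have "norm ((2::real) powi (- j) *\<^sub>R \<xi>) = norm \<xi> / 2 powi j"
    by (simp add: power_int_minus divide_inverse)
  then have "3/4 \<le> norm \<xi> / 2 powi j" "norm \<xi> / 2 powi j \<le> 8/3"
    using \<psi>_support[OF assms[unfolded \<psi>d_def]] by auto
  then show "3/4 * 2 powi j \<le> norm \<xi>" "norm \<xi> \<le> 8/3 * 2 powi j"
    using p by (auto simp: field_simps)
qed

lemma sum_\<psi>d_le_1:
  assumes "finite F"
  shows "(\<Sum>j\<in>F. \<psi>d j \<xi>) \<le> 1"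
proof (cases "\<xi> = 0")
  case True
  then have "\<psi>d j \<xi> = 0" for j using \<psi>_support[of 0] by (auto simp: \<psi>d_def)
  then show ?thesis by simp
next
  case False
  then have "((\<lambda>j. \<psi>d j \<xi>) has_sum 1) UNIV"
    using lp unfolding littlewood_paley_def \<psi>d_def by blast
  then show ?thesis by (rule finite_sum_le_has_sum) (use assms \<psi>d_nonneg in auto)
qed

lemma \<psi>d_le_1: "\<psi>d j \<xi> \<le> 1"
  using sum_\<psi>d_le_1[of "{j}"] by simp

lemma LP_block_freq_dist:
  assumes "schwartz \<phi>"
  shows "LP_block \<psi> j (freq_dist h) \<phi> = freq_dist (\<lambda>\<xi>. of_real (\<psi>d j \<xi>) * h \<xi>) \<phi>"
  using inv_fourier_fourier[OF schwartz_mult[OF schwartz_\<psi>d schwartz_inv_fourier[OF assms]], of j]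
  by (simp add: LP_block_def inv_fourier_dist_def mult_dist_def fourier_dist_def freq_dist_def
      \<psi>d_def mult_ac)

lemma integrable_\<psi>d_mult:
  assumes h: "freq_admissible h"
  shows "integrable lborel (\<lambda>\<xi>. of_real (\<psi>d j \<xi>) * h \<xi>)"
proof (rule Bochner_Integration.integrable_bound)
  define R where "R = 8/3 * (2::real) powi j"
  have [measurable]: "h \<in> borel_measurable borel" by (rule freq_admissible_measurable[OF h])
  show "integrable lborel (\<lambda>\<xi>. (1 + R) * cmod (h \<xi> / of_real (1 + norm \<xi>)))"
    using h unfolding freq_admissible_def by (intro integrable_mult_right integrable_norm)
  show "(\<lambda>\<xi>. of_real (\<psi>d j \<xi>) * h \<xi>) \<in> borel_measurable lborel" by measurable
  have R0: "0 \<le> R" unfolding R_def by simp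
  have "cmod (of_real (\<psi>d j \<xi>) * h \<xi>) \<le> (1 + R) * cmod (h \<xi> / of_real (1 + norm \<xi>))" for \<xi>
  proof (cases "\<psi>d j \<xi> = 0")
    case True
    then show ?thesis using R0 by simp
  next
    case False
    have p: "0 < 1 + norm \<xi>" using norm_ge_zero[of \<xi>] by linarith
    have "cmod (of_real (\<psi>d j \<xi>) * h \<xi>) \<le> 1 * cmod (h \<xi>)"
      unfolding norm_mult using \<psi>d_le_1[of j \<xi>] \<psi>d_nonneg[of j \<xi>] by (intro mult_right_mono) auto
    also have "cmod (complex_of_real (1 + norm \<xi>)) = 1 + norm \<xi>" unfolding norm_of_real by simp
    then have "1 * cmod (h \<xi>) = (1 + norm \<xi>) * cmod (h \<xi> / of_real (1 + norm \<xi>))"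
      unfolding norm_divide using p by simp
    also have "\<dots> \<le> (1 + R) * cmod (h \<xi> / of_real (1 + norm \<xi>))"
      using \<psi>d_support(2)[OF False] unfolding R_def by (intro mult_right_mono) auto
    finally show ?thesis .
  qed
  then show "AE \<xi> in lborel. norm (of_real (\<psi>d j \<xi>) * h \<xi>) \<le> norm ((1 + R) * cmod (h \<xi> / of_real (1 + norm \<xi>)))"
    by (intro AE_I2) (auto intro: order_trans[OF _ abs_ge_self])
qed

lemma nn_integral_\<psi>d_cmod: "(\<integral>\<^sup>+\<xi>. ennreal (cmod (of_real (\<psi>d j \<xi>) * h \<xi>)) \<partial>lborel) = (\<integral>\<^sup>+\<xi>. ennreal (\<psi>d j \<xi> * cmod (h \<xi>)) \<partial>lborel)"
  using \<psi>d_nonneg by (simp add: norm_mult)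

lemma LP_block_sup_norm_le:
  assumes h: "freq_admissible h"
  shows "dist_Lnorm \<infinity> (LP_block \<psi> j (freq_dist h)) \<le> (\<integral>\<^sup>+\<xi>. ennreal (\<psi>d j \<xi> * cmod (h \<xi>)) \<partial>lborel)"
proof -
  let ?k = "\<lambda>\<xi>. of_real (\<psi>d j \<xi>) * h \<xi>"
  note i = integrable_\<psi>d_mult[OF h, of j]
  have [measurable]: "h \<in> borel_measurable borel" by (rule freq_admissible_measurable[OF h])
  have "dist_fun (LP_block \<psi> j (freq_dist h)) (inv_fourier ?k)"
    by (rule dist_fun_cong[OF dist_fun_freq_dist[OF i] LP_block_freq_dist])
  then have "dist_Lnorm \<infinity> (LP_block \<psi> j (freq_dist h)) \<le> Lnorm \<infinity> (inv_fourier ?k)"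
    by (rule dist_Lnorm_le)
  also have "\<dots> \<le> ennreal (LINT \<xi>|lborel. cmod (?k \<xi>))"
    unfolding Lnorm_def
  proof (simp, rule esssup_I)
    have "1 \<le> (2 * pi) ^ 3" using pi_gt3 by (intro one_le_power) simp
    then have "1 / (2 * pi) ^ 3 \<le> (1::real)" by simp
    then have "cmod (inv_fourier ?k x) \<le> 1 * (LINT \<xi>|lborel. cmod (?k \<xi>))" for x
      by (intro order_trans[OF cmod_inv_fourier_le] mult_right_mono) (auto simp: integral_nonneg_AE)
    then show "AE x in lborel. ennreal (cmod (inv_fourier ?k x)) \<le> ennreal (LINT \<xi>|lborel. cmod (?k \<xi>))"
      by (intro AE_I2 ennreal_leI) simp
  qed measurable
  also have "\<dots> = (\<integral>\<^sup>+\<xi>. ennreal (cmod (?k \<xi>)) \<partial>lborel)"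
    by (rule nn_integral_eq_integral[symmetric]) (use i in auto)
  finally show ?thesis unfolding nn_integral_\<psi>d_cmod .
qed

text \<open>The distribution is only required to agree with a given one on test functions, because a
  difference of two distributions given by their Fourier transforms is of this form only there.\<close>

lemma LP_block_fourier_norm_le:
  assumes h: "freq_admissible h" and T: "\<And>\<phi>. schwartz \<phi> \<Longrightarrow> T \<phi> = freq_dist h \<phi>"
  shows "dist_Lnorm 1 (fourier_dist (LP_block \<psi> j T)) \<le> (\<integral>\<^sup>+\<xi>. ennreal (\<psi>d j \<xi> * cmod (h \<xi>)) \<partial>lborel)"
proof -
  let ?k = "\<lambda>\<xi>. of_real (\<psi>d j \<xi>) * h \<xi>"
  have k: "freq_admissible ?k"
    by (rule integrable_imp_freq_admissible[OF integrable_\<psi>d_mult[OF h]])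
  have "dist_fun (fourier_dist (freq_dist ?k)) ?k"
    using has_fourier_freq_dist[OF k] by (simp add: has_fourier_def)
  then have "dist_fun (fourier_dist (LP_block \<psi> j T)) ?k"
  proof (rule dist_fun_cong)
    fix \<phi> :: "real^3 \<Rightarrow> complex" assume "schwartz \<phi>"
    then have s: "schwartz (fourier \<phi>)" by (rule schwartz_fourier)
    show "fourier_dist (LP_block \<psi> j T) \<phi> = fourier_dist (freq_dist ?k) \<phi>"
      using LP_block_cong[OF schwartz_\<psi> T s, where j=j] LP_block_freq_dist[OF s, where j=j and h=h]
      by (simp add: fourier_dist_def)
  qed
  from dist_Lnorm_le[OF this, of 1] show ?thesis unfolding Lnorm_1 nn_integral_\<psi>d_cmod .
qed

text \<open>The \<open>\<ell>\<^sup>2\<close> norm over the blocks is at most the \<open>\<ell>\<^sup>1\<close> norm, and \<open>2\<^sup>-\<^sup>j \<le> (8/3) / \<bar>\<xi>\<bar>\<close> on the support of the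
  \<open>j\<close>-th block, so that the blocks sum up to a weighted integral.\<close>

lemma FB_norm_le:
  assumes h: "freq_admissible h" and T: "\<And>\<phi>. schwartz \<phi> \<Longrightarrow> T \<phi> = freq_dist h \<phi>"
  shows "FB_norm \<psi> (- 1) 1 2 T \<le> ennreal (8/3) * (\<integral>\<^sup>+\<xi>. ennreal (cmod (h \<xi>) / norm \<xi>) \<partial>lborel)"
  unfolding FB_norm_def
proof (rule dyadic_norm_2_le)
  fix F :: "int set" assume F: "finite F"
  have [measurable]: "h \<in> borel_measurable borel" by (rule freq_admissible_measurable[OF h])
  have "(\<Sum>j\<in>F. ennreal (2 powr (- of_int j)) * dist_Lnorm 1 (fourier_dist (LP_block \<psi> j T)))
      \<le> (\<Sum>j\<in>F. ennreal (2 powr (- of_int j)) * (\<integral>\<^sup>+\<xi>. ennreal (\<psi>d j \<xi> * cmod (h \<xi>)) \<partial>lborel))"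
    by (intro sum_mono mult_left_mono LP_block_fourier_norm_le h T) auto
  also have "\<dots> = (\<integral>\<^sup>+\<xi>. (\<Sum>j\<in>F. ennreal (2 powr (- of_int j) * (\<psi>d j \<xi> * cmod (h \<xi>)))) \<partial>lborel)"
    using \<psi>d_nonneg by (subst nn_integral_sum) (auto simp: nn_integral_cmult[symmetric] ennreal_mult)
  also have "\<dots> \<le> (\<integral>\<^sup>+\<xi>. ennreal (8/3 * (cmod (h \<xi>) / norm \<xi>)) \<partial>lborel)"
  proof (rule nn_integral_mono)
    fix \<xi> :: "real^3"
    have "2 powr (- of_int j) * (\<psi>d j \<xi> * cmod (h \<xi>)) \<le> \<psi>d j \<xi> * (8/3 * (cmod (h \<xi>) / norm \<xi>))" for j
    proof (cases "\<psi>d j \<xi> = 0")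
      case False
      have "0 < 3/4 * (2::real) powi j" by simp
      then have b: "norm \<xi> > 0" "norm \<xi> \<le> 8/3 * 2 powi j"
        using \<psi>d_support[OF False] by linarith+
      have "2 powr (- of_int j) = inverse ((2::real) powi j)"
        by (simp add: powr_minus powr_real_of_int')
      also have "\<dots> \<le> 8/3 / norm \<xi>" using b by (simp add: field_simps)
      finally have "2 powr (- of_int j) * (\<psi>d j \<xi> * cmod (h \<xi>)) \<le> 8/3 / norm \<xi> * (\<psi>d j \<xi> * cmod (h \<xi>))"
        using \<psi>d_nonneg by (intro mult_right_mono) auto
      then show ?thesis by (simp add: mult_ac)
    qed auto
    then have "(\<Sum>j\<in>F. 2 powr (- of_int j) * (\<psi>d j \<xi> * cmod (h \<xi>))) \<le> (\<Sum>j\<in>F. \<psi>d j \<xi>) * (8/3 * (cmod (h \<xi>) / norm \<xi>))"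
      unfolding sum_distrib_right by (intro sum_mono)
    also have "\<dots> \<le> 1 * (8/3 * (cmod (h \<xi>) / norm \<xi>))"
      by (intro mult_right_mono sum_\<psi>d_le_1 F) auto
    finally show "(\<Sum>j\<in>F. ennreal (2 powr (- of_int j) * (\<psi>d j \<xi> * cmod (h \<xi>)))) \<le> ennreal (8/3 * (cmod (h \<xi>) / norm \<xi>))"
      using \<psi>d_nonneg by (subst sum_ennreal) (auto intro: ennreal_leI)
  qed
  also have "\<dots> = ennreal (8/3) * (\<integral>\<^sup>+\<xi>. ennreal (cmod (h \<xi>) / norm \<xi>) \<partial>lborel)"
    by (subst ennreal_mult) (auto simp: nn_integral_cmult)
  finally show "(\<Sum>j\<in>F. ennreal (2 powr (- of_int j)) * dist_Lnorm 1 (fourier_dist (LP_block \<psi> j T)))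
      \<le> ennreal (8/3) * (\<integral>\<^sup>+\<xi>. ennreal (cmod (h \<xi>) / norm \<xi>) \<partial>lborel)" .
qed

lemma freq_dist_in_FB:
  assumes [measurable]: "h \<in> borel_measurable borel"
    and fin: "(\<integral>\<^sup>+\<xi>. ennreal (cmod (h \<xi>) / norm \<xi>) \<partial>lborel) < \<infinity>"
  shows "freq_dist h \<in> FB \<psi> (- 1) 1 2"
proof -
  have h: "freq_admissible h" by (rule freq_admissibleI[OF assms])
  have "FB_norm \<psi> (- 1) 1 2 (freq_dist h) \<le> ennreal (8/3) * (\<integral>\<^sup>+\<xi>. ennreal (cmod (h \<xi>) / norm \<xi>) \<partial>lborel)"
    by (rule FB_norm_le[OF h refl])
  also have "\<dots> < \<infinity>" using fin by (simp add: ennreal_mult_less_top)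
  finally show ?thesis using has_fourier_freq_dist[OF h] unfolding FB_def by blast
qed

lemma besov_norm_ge:
  assumes s: "schwartz \<phi>" and K: "compact K" "\<And>x. x \<notin> K \<Longrightarrow> \<phi> x = 0" 
    and pos: "0 < (LINT x|lborel. cmod (\<phi> x))" and r: "r > 0"
  shows "ennreal (cmod (LP_block \<psi> 0 T \<phi>)) \<le> besov_norm \<psi> s' \<infinity> r T * ennreal (LINT x|lborel. cmod (\<phi> x))"
proof -
  have "ennreal (cmod (LP_block \<psi> 0 T \<phi>)) \<le> dist_Lnorm \<infinity> (LP_block \<psi> 0 T) * ennreal (LINT x|lborel. cmod (\<phi> x))"
    by (rule dist_Lnorm_infty_ge[OF s K pos])
  also have "\<dots> \<le> besov_norm \<psi> s' \<infinity> r T * ennreal (LINT x|lborel. cmod (\<phi> x))"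
    unfolding besov_norm_def by (intro mult_right_mono dyadic_norm_ge_0 r) auto
  finally show ?thesis .
qed

end

section \<open>The linear semigroup\<close>

lemma mat_pow_entry_bound:
  "cmod (mat_pow M n $ i $ j) \<le> (\<Sum>i\<in>UNIV. \<Sum>j\<in>UNIV. cmod (M $ i $ j)) ^ n"
proof (induction n arbitrary: i j)
  case 0
  then show ?case by (simp add: mat_def)
next
  case (Suc n)
  let ?S = "\<Sum>i\<in>UNIV. \<Sum>j\<in>UNIV. cmod (M $ i $ j)"
  have "cmod (mat_pow M (Suc n) $ i $ j) \<le> (\<Sum>k\<in>UNIV. cmod (M $ i $ k) * cmod (mat_pow M n $ k $ j))"
    by (simp add: matrix_matrix_mult_def norm_mult[symmetric] norm_sum)
  also have "\<dots> \<le> (\<Sum>k\<in>UNIV. cmod (M $ i $ k)) * ?S ^ n"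
    unfolding sum_distrib_right by (intro sum_mono mult_left_mono Suc) auto
  also have "\<dots> \<le> ?S * ?S ^ n"
    using member_le_sum[of i UNIV "\<lambda>i. \<Sum>k\<in>UNIV. cmod (M $ i $ k)"]
    by (intro mult_right_mono) (auto simp: sum_nonneg intro!: zero_le_power)
  finally show ?case by simp
qed

lemma mat_pow_commute: "mat_pow M n ** M = M ** mat_pow M n"
  by (induction n) (auto simp: matrix_mul_assoc[symmetric])

lemma mat_pow_scaleR: "mat_pow (c *\<^sub>R M) n = c ^ n *\<^sub>R mat_pow M n"
  by (induction n)
    (auto simp: vec_eq_iff matrix_matrix_mult_def scaleR_sum_right mult.commute)

text \<open>The entries of \<open>t \<mapsto> exp (t M)\<close> are power series in \<open>t\<close>, so that termwise differentiation of power
  series replaces calculus in the algebra of matrices.\<close>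

definition exp_coeff :: "complex^'n^'n \<Rightarrow> 'n \<Rightarrow> 'n \<Rightarrow> nat \<Rightarrow> complex" where
  "exp_coeff M i j n = mat_pow M n $ i $ j / fact n"

lemma summable_exp_coeff: "summable (\<lambda>n. exp_coeff M i j n * z ^ n)"
proof (rule summable_comparison_test)
  let ?S = "\<Sum>i\<in>UNIV. \<Sum>j\<in>UNIV. cmod (M $ i $ j)"
  show "summable (\<lambda>n. inverse (fact n) * (?S * cmod z) ^ n)" by (rule summable_exp)
  have "norm (exp_coeff M i j n * z ^ n) \<le> inverse (fact n) * (?S * cmod z) ^ n" for n
  proof -
    have "norm (exp_coeff M i j n * z ^ n) = inverse (fact n) * (cmod (mat_pow M n $ i $ j) * cmod z ^ n)"
      by (simp add: exp_coeff_def norm_mult norm_divide norm_power norm_fact divide_inverse norm_inverse)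
    also have "\<dots> \<le> inverse (fact n) * (?S ^ n * cmod z ^ n)"
      by (intro mult_left_mono mult_right_mono mat_pow_entry_bound) auto
    finally show ?thesis by (simp add: power_mult_distrib)
  qed
  then show "\<exists>N. \<forall>n\<ge>N. norm (exp_coeff M i j n * z ^ n) \<le> inverse (fact n) * (?S * cmod z) ^ n" by blast
qed

lemma mat_exp_entry: "mat_exp (t *\<^sub>R M) $ i $ j = (\<Sum>n. exp_coeff M i j n * of_real t ^ n)"
proof -
  let ?X = "\<chi> i j. \<Sum>n. exp_coeff M i j n * of_real t ^ n"
  have "(\<lambda>n. (1 / fact n) *\<^sub>R mat_pow (t *\<^sub>R M) n) sums ?X"
    unfolding sums_def
  proof (intro vec_tendstoI)
    fix i j
    have e: "((1 / fact n) *\<^sub>R mat_pow (t *\<^sub>R M) n) $ i $ j = exp_coeff M i j n * of_real t ^ n" for n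
      by (simp add: mat_pow_scaleR exp_coeff_def scaleR_conv_of_real[where 'a=complex])
    show "(\<lambda>n. (\<Sum>n<n. (1 / fact n) *\<^sub>R mat_pow (t *\<^sub>R M) n) $ i $ j) \<longlonglongrightarrow> ?X $ i $ j"
      using summable_sums[OF summable_exp_coeff[of M i j "of_real t"]]
      unfolding sums_def sum_component e by simp
  qed
  then have "mat_exp (t *\<^sub>R M) = ?X" unfolding mat_exp_def by (rule sums_unique[symmetric])
  then show ?thesis by simp
qed

lemma mat_exp_0: "mat_exp (0 *\<^sub>R M) = mat 1"
proof -
  have "(\<Sum>n. exp_coeff M i j n * (of_real 0 :: complex) ^ n) = exp_coeff M i j 0" for i j
    using powser_zero[of "exp_coeff M i j"] by simp
  then show ?thesis
    unfolding vec_eq_iff mat_exp_entry by (simp add: exp_coeff_def)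
qed

lemma diffs_exp_coeff:
  "diffs (exp_coeff M i j) n = (\<Sum>k\<in>UNIV. M $ i $ k * exp_coeff M k j n)"
  "diffs (exp_coeff M i j) n = (\<Sum>k\<in>UNIV. exp_coeff M i k n * M $ k $ j)"
proof -
  have "fact (Suc n) = (of_nat (Suc n) * fact n :: complex)" by simp
  then have d: "diffs (exp_coeff M i j) n = mat_pow M (Suc n) $ i $ j / fact n"
    unfolding diffs_def exp_coeff_def by (simp del: of_nat_Suc mat_pow.simps fact_Suc)
  have m1: "mat_pow M (Suc n) $ i $ j = (\<Sum>k\<in>UNIV. M $ i $ k * mat_pow M n $ k $ j)"
    by (simp add: matrix_matrix_mult_def)
  have m2: "mat_pow M (Suc n) $ i $ j = (\<Sum>k\<in>UNIV. mat_pow M n $ i $ k * M $ k $ j)"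
    unfolding mat_pow.simps mat_pow_commute[symmetric] by (simp add: matrix_matrix_mult_def)
  show "diffs (exp_coeff M i j) n = (\<Sum>k\<in>UNIV. M $ i $ k * exp_coeff M k j n)"
    unfolding d m1 exp_coeff_def by (simp add: sum_divide_distrib)
  show "diffs (exp_coeff M i j) n = (\<Sum>k\<in>UNIV. exp_coeff M i k n * M $ k $ j)"
    unfolding d m2 exp_coeff_def by (simp add: sum_divide_distrib)
qed

lemma mat_exp_entry_derivative:
  "((\<lambda>t. mat_exp (t *\<^sub>R M) $ i $ j) has_vector_derivative (\<Sum>k\<in>UNIV. M $ i $ k * mat_exp (t *\<^sub>R M) $ k $ j)) (at t)"
  "((\<lambda>t. mat_exp (t *\<^sub>R M) $ i $ j) has_vector_derivative (\<Sum>k\<in>UNIV. mat_exp (t *\<^sub>R M) $ i $ k * M $ k $ j)) (at t)"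
proof -
  have D: "((\<lambda>z. \<Sum>n. exp_coeff M i j n * z ^ n) has_field_derivative (\<Sum>n. diffs (exp_coeff M i j) n * of_real t ^ n)) (at (of_real t))"
    by (rule termdiffs_strong_converges_everywhere[OF summable_exp_coeff])
  have "((\<lambda>t. complex_of_real t) has_vector_derivative 1) (at t)"
    by (auto simp: has_vector_derivative_def scaleR_conv_of_real intro!: derivative_eq_intros)
  from field_vector_diff_chain_at[OF this D]
  have d: "((\<lambda>t. mat_exp (t *\<^sub>R M) $ i $ j) has_vector_derivative (\<Sum>n. diffs (exp_coeff M i j) n * of_real t ^ n)) (at t)"
    unfolding mat_exp_entry by (simp add: o_def)
  have s: "(\<lambda>n. exp_coeff M i j n * of_real t ^ n) sums mat_exp (t *\<^sub>R M) $ i $ j" for i j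
    unfolding mat_exp_entry by (rule summable_sums[OF summable_exp_coeff])
  have "(\<lambda>n. \<Sum>k\<in>UNIV. M $ i $ k * (exp_coeff M k j n * of_real t ^ n)) sums (\<Sum>k\<in>UNIV. M $ i $ k * mat_exp (t *\<^sub>R M) $ k $ j)"
    by (intro sums_sum sums_mult s)
  then have 1: "(\<Sum>n. diffs (exp_coeff M i j) n * of_real t ^ n) = (\<Sum>k\<in>UNIV. M $ i $ k * mat_exp (t *\<^sub>R M) $ k $ j)"
    unfolding diffs_exp_coeff(1) sum_distrib_right mult.assoc by (rule sums_unique[symmetric])
  have "(\<lambda>n. \<Sum>k\<in>UNIV. (exp_coeff M i k n * of_real t ^ n) * M $ k $ j) sums (\<Sum>k\<in>UNIV. mat_exp (t *\<^sub>R M) $ i $ k * M $ k $ j)"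
    by (intro sums_sum sums_mult2 s)
  moreover have "diffs (exp_coeff M i j) n * of_real t ^ n = (\<Sum>k\<in>UNIV. (exp_coeff M i k n * of_real t ^ n) * M $ k $ j)" for n
    unfolding diffs_exp_coeff(2) sum_distrib_right by (intro sum.cong) auto
  ultimately have "(\<lambda>n. diffs (exp_coeff M i j) n * of_real t ^ n) sums (\<Sum>k\<in>UNIV. mat_exp (t *\<^sub>R M) $ i $ k * M $ k $ j)"
    by simp
  then have 2: "(\<Sum>n. diffs (exp_coeff M i j) n * of_real t ^ n) = (\<Sum>k\<in>UNIV. mat_exp (t *\<^sub>R M) $ i $ k * M $ k $ j)"
    by (rule sums_unique[symmetric])
  show "((\<lambda>t. mat_exp (t *\<^sub>R M) $ i $ j) has_vector_derivative (\<Sum>k\<in>UNIV. M $ i $ k * mat_exp (t *\<^sub>R M) $ k $ j)) (at t)"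
    using d unfolding 1 .
  show "((\<lambda>t. mat_exp (t *\<^sub>R M) $ i $ j) has_vector_derivative (\<Sum>k\<in>UNIV. mat_exp (t *\<^sub>R M) $ i $ k * M $ k $ j)) (at t)"
    using d unfolding 2 .
qed

lemma has_vector_derivative_vecI:
  fixes f :: "real \<Rightarrow> complex^'n"
  assumes "\<And>i. ((\<lambda>t. f t $ i) has_vector_derivative f' $ i) (at t within S)"
  shows "(f has_vector_derivative f') (at t within S)"
  unfolding has_vector_derivative_def
proof (subst has_derivative_componentwise_within, rule ballI)
  fix b :: "complex^'n" assume "b \<in> Basis"
  then obtain i u where b: "b = axis i u" "u \<in> Basis" by (auto simp: Basis_vec_def)
  have "((\<lambda>t. f t $ i) has_derivative (\<lambda>h. h *\<^sub>R f' $ i)) (at t within S)"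
    using assms[of i] by (simp add: has_vector_derivative_def)
  then have "((\<lambda>t. f t $ i \<bullet> u) has_derivative (\<lambda>h. (h *\<^sub>R f' $ i) \<bullet> u)) (at t within S)"
    by (rule has_derivative_inner_left)
  then show "((\<lambda>t. f t \<bullet> b) has_derivative (\<lambda>h. (h *\<^sub>R f') \<bullet> b)) (at t within S)"
    by (simp add: b inner_axis)
qed

lemma mat_exp_vec_derivative:
  "((\<lambda>t. mat_exp (t *\<^sub>R M) *v x) has_vector_derivative M *v (mat_exp (t *\<^sub>R M) *v x)) (at t)"
  "((\<lambda>t. mat_exp (t *\<^sub>R M) *v x) has_vector_derivative mat_exp (t *\<^sub>R M) *v (M *v x)) (at t)"
proof -
  have "((\<lambda>t. \<Sum>j\<in>UNIV. mat_exp (t *\<^sub>R M) $ i $ j * x $ j) has_vector_derivative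
      (\<Sum>j\<in>UNIV. (\<Sum>k\<in>UNIV. M $ i $ k * mat_exp (t *\<^sub>R M) $ k $ j) * x $ j)) (at t)" for i
    by (intro has_vector_derivative_sum has_vector_derivative_mult_left mat_exp_entry_derivative(1))
  moreover have "(\<Sum>j\<in>UNIV. (\<Sum>k\<in>UNIV. M $ i $ k * mat_exp (t *\<^sub>R M) $ k $ j) * x $ j)
      = (M *v (mat_exp (t *\<^sub>R M) *v x)) $ i" for i
    unfolding matrix_vector_mul_assoc by (simp add: matrix_vector_mult_def matrix_matrix_mult_def)
  ultimately show "((\<lambda>t. mat_exp (t *\<^sub>R M) *v x) has_vector_derivative M *v (mat_exp (t *\<^sub>R M) *v x)) (at t)"
    by (intro has_vector_derivative_vecI) (simp add: matrix_vector_mult_def)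
  have "((\<lambda>t. \<Sum>j\<in>UNIV. mat_exp (t *\<^sub>R M) $ i $ j * x $ j) has_vector_derivative
      (\<Sum>j\<in>UNIV. (\<Sum>k\<in>UNIV. mat_exp (t *\<^sub>R M) $ i $ k * M $ k $ j) * x $ j)) (at t)" for i
    by (intro has_vector_derivative_sum has_vector_derivative_mult_left mat_exp_entry_derivative(2))
  moreover have "(\<Sum>j\<in>UNIV. (\<Sum>k\<in>UNIV. mat_exp (t *\<^sub>R M) $ i $ k * M $ k $ j) * x $ j)
      = (mat_exp (t *\<^sub>R M) *v (M *v x)) $ i" for i
    unfolding matrix_vector_mul_assoc by (simp add: matrix_vector_mult_def matrix_matrix_mult_def)
  ultimately show "((\<lambda>t. mat_exp (t *\<^sub>R M) *v x) has_vector_derivative mat_exp (t *\<^sub>R M) *v (M *v x)) (at t)"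
    by (intro has_vector_derivative_vecI) (simp add: matrix_vector_mult_def)
qed

definition propagator :: "real \<Rightarrow> real^3 \<Rightarrow> complex^(3+3) \<Rightarrow> complex^(3+3)" where
  "propagator t \<xi> v = mat_exp ((- t) *\<^sub>R A_sym \<xi>) *v v"

lemma propagator_0 [simp]: "propagator 0 \<xi> v = v"
  using mat_exp_0[of "A_sym \<xi>"] by (simp add: propagator_def)

lemma propagator_add: "propagator t \<xi> (v + w) = propagator t \<xi> v + propagator t \<xi> w"
  and propagator_diff: "propagator t \<xi> (v - w) = propagator t \<xi> v - propagator t \<xi> w"
  and propagator_zero [simp]: "propagator t \<xi> 0 = 0"
  by (auto simp: propagator_def matrix_vector_right_distrib matrix_vector_mult_diff_distrib)

lemma propagator_scaleR: "propagator t \<xi> (c *\<^sub>R v) = c *\<^sub>R propagator t \<xi> v"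
  by (simp add: propagator_def vec_eq_iff matrix_vector_mult_def scaleR_sum_right)

lemma sum_UNIV_Plus: "(\<Sum>a\<in>UNIV. f a) = (\<Sum>k\<in>UNIV. f (Inl k)) + (\<Sum>k\<in>UNIV. f (Inr k))"
  for f :: "'a::finite + 'b::finite \<Rightarrow> 'c::comm_monoid_add"
  unfolding UNIV_Plus_UNIV[symmetric] by (subst sum.Plus) auto

lemma A_sym_apply:
  "(A_sym \<xi> *v v) $ Inl 1 = of_real ((norm \<xi>)\<^sup>2) * v $ Inl 1 + \<i> * (of_real (\<xi>$3) * v $ Inr 2 - of_real (\<xi>$2) * v $ Inr 3)"
  "(A_sym \<xi> *v v) $ Inl 2 = of_real ((norm \<xi>)\<^sup>2) * v $ Inl 2 + \<i> * (of_real (\<xi>$1) * v $ Inr 3 - of_real (\<xi>$3) * v $ Inr 1)"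
  "(A_sym \<xi> *v v) $ Inl 3 = of_real ((norm \<xi>)\<^sup>2) * v $ Inl 3 + \<i> * (of_real (\<xi>$2) * v $ Inr 1 - of_real (\<xi>$1) * v $ Inr 2)"
  "(A_sym \<xi> *v v) $ Inr 1 = of_real ((norm \<xi>)\<^sup>2 + 2) * v $ Inr 1 + \<i> * (of_real (\<xi>$3) * v $ Inl 2 - of_real (\<xi>$2) * v $ Inl 3)
     + of_real (\<xi>$1) * (\<Sum>l\<in>UNIV. of_real (\<xi>$l) * v $ Inr l)"
  "(A_sym \<xi> *v v) $ Inr 2 = of_real ((norm \<xi>)\<^sup>2 + 2) * v $ Inr 2 + \<i> * (of_real (\<xi>$1) * v $ Inl 3 - of_real (\<xi>$3) * v $ Inl 1)
     + of_real (\<xi>$2) * (\<Sum>l\<in>UNIV. of_real (\<xi>$l) * v $ Inr l)"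
  "(A_sym \<xi> *v v) $ Inr 3 = of_real ((norm \<xi>)\<^sup>2 + 2) * v $ Inr 3 + \<i> * (of_real (\<xi>$2) * v $ Inl 1 - of_real (\<xi>$1) * v $ Inl 2)
     + of_real (\<xi>$3) * (\<Sum>l\<in>UNIV. of_real (\<xi>$l) * v $ Inr l)"
  by (simp_all add: matrix_vector_mult_def A_sym_def B_sym_def C_sym_def sum_UNIV_Plus sum_3
      vector_3 mat_def algebra_simps)

lemma norm_sq_3: "(norm \<xi>)\<^sup>2 = (\<xi>$1)\<^sup>2 + (\<xi>$2)\<^sup>2 + (\<xi>$3)\<^sup>2" for \<xi> :: "real^3"
  unfolding power2_norm_eq_inner inner_vec_def sum_3 by (simp add: power2_eq_square)

text \<open>The symbol is Hermitian and bounded below by half of the Laplacian. Completing the square,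
  with \<open>v = (a, b)\<close>, \<open>Re \<langle>v, A v\<rangle> - \<bar>\<xi>\<bar>\<^sup>2 \<bar>v\<bar>\<^sup>2 / 2\<close> equals
  \<open>2 \<bar>b + B a / 2\<bar>\<^sup>2 + \<bar>\<xi>\<bar>\<^sup>2 \<bar>b\<bar>\<^sup>2 / 2 + \<bar>\<xi> \<cdot> b\<bar>\<^sup>2 + \<bar>\<xi> \<cdot> a\<bar>\<^sup>2 / 2\<close>.\<close>

lemma A_sym_coercive: "(norm \<xi>)\<^sup>2 / 2 * (norm v)\<^sup>2 \<le> v \<bullet> (A_sym \<xi> *v v)"
proof -
  define x y z where xyz: "x = \<xi>$1" "y = \<xi>$2" "z = \<xi>$3"
  define p1 q1 p2 q2 p3 q3 where a: "p1 = Re (v $ Inl 1)" "q1 = Im (v $ Inl 1)" "p2 = Re (v $ Inl 2)"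
    "q2 = Im (v $ Inl 2)" "p3 = Re (v $ Inl 3)" "q3 = Im (v $ Inl 3)"
  define r1 s1 r2 s2 r3 s3 where b: "r1 = Re (v $ Inr 1)" "s1 = Im (v $ Inr 1)" "r2 = Re (v $ Inr 2)"
    "s2 = Im (v $ Inr 2)" "r3 = Re (v $ Inr 3)" "s3 = Im (v $ Inr 3)"
  have n: "(norm v)\<^sup>2 = p1\<^sup>2 + q1\<^sup>2 + p2\<^sup>2 + q2\<^sup>2 + p3\<^sup>2 + q3\<^sup>2 + r1\<^sup>2 + s1\<^sup>2 + r2\<^sup>2 + s2\<^sup>2 + r3\<^sup>2 + s3\<^sup>2"
    unfolding power2_norm_eq_inner inner_vec_def sum_UNIV_Plus sum_3 a b
    by (simp add: inner_complex_def power2_eq_square)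
  have "v \<bullet> (A_sym \<xi> *v v) - (norm \<xi>)\<^sup>2 / 2 * (norm v)\<^sup>2
    = (x\<^sup>2+y\<^sup>2+z\<^sup>2) / 2 * (r1\<^sup>2 + s1\<^sup>2 + r2\<^sup>2 + s2\<^sup>2 + r3\<^sup>2 + s3\<^sup>2)
      + (x * r1+y * r2+z * r3)\<^sup>2 + (x * s1+y * s2+z * s3)\<^sup>2
      + (x * p1+y * p2+z * p3)\<^sup>2 / 2 + (x * q1+y * q2+z * q3)\<^sup>2 / 2
      + 2 * ((r1 - (z * q2-y * q3)/2)\<^sup>2 + (s1 + (z * p2-y * p3)/2)\<^sup>2
           + (r2 - (x * q3-z * q1)/2)\<^sup>2 + (s2 + (x * p3-z * p1)/2)\<^sup>2
           + (r3 - (y * q1-x * q2)/2)\<^sup>2 + (s3 + (y * p1-x * p2)/2)\<^sup>2)"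
    unfolding n norm_sq_3 unfolding inner_vec_def sum_UNIV_Plus sum_3 A_sym_apply norm_sq_3
      inner_complex_def
    by (simp add: a[symmetric] b[symmetric] xyz[symmetric] sum_3) (simp add: power2_eq_square field_simps)
  also have "\<dots> \<ge> 0" by (intro add_nonneg_nonneg mult_nonneg_nonneg divide_nonneg_nonneg) auto
  finally show ?thesis by linarith
qed

lemma has_vector_derivative_propagator:
  "((\<lambda>t. propagator t \<xi> v) has_vector_derivative - (A_sym \<xi> *v propagator t \<xi> v)) (at t within S)"
  "((\<lambda>t. propagator t \<xi> v) has_vector_derivative - propagator t \<xi> (A_sym \<xi> *v v)) (at t within S)"
proof -
  have m: "(uminus has_vector_derivative - 1) (at t within S)"
    by (auto simp: has_vector_derivative_def intro!: derivative_eq_intros)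
  show "((\<lambda>t. propagator t \<xi> v) has_vector_derivative - (A_sym \<xi> *v propagator t \<xi> v)) (at t within S)"
    using vector_diff_chain_within[OF m has_vector_derivative_at_within[OF mat_exp_vec_derivative(1)[of "A_sym \<xi>" v "- t"]]]
    by (simp add: propagator_def o_def)
  show "((\<lambda>t. propagator t \<xi> v) has_vector_derivative - propagator t \<xi> (A_sym \<xi> *v v)) (at t within S)"
    using vector_diff_chain_within[OF m has_vector_derivative_at_within[OF mat_exp_vec_derivative(2)[of "A_sym \<xi>" v "- t"]]]
    by (simp add: propagator_def o_def)
qed

text \<open>By coercivity \<open>exp (t \<bar>\<xi>\<bar>\<^sup>2) \<bar>exp (- t A) v\<bar>\<^sup>2\<close> has a nonpositive derivative.\<close>

lemma norm_propagator_le: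
  assumes "t \<ge> 0"
  shows "norm (propagator t \<xi> v) \<le> exp (- t * (norm \<xi>)\<^sup>2 / 2) * norm v"
proof -
  define \<rho> where "\<rho> = (norm \<xi>)\<^sup>2"
  let ?u = "\<lambda>t. propagator t \<xi> v"
  let ?g = "\<lambda>t. exp (\<rho> * t) * (?u t \<bullet> ?u t)"
  have "?g t \<le> ?g 0"
  proof (rule DERIV_nonpos_imp_nonincreasing[OF assms])
    fix s :: real
    have d: "(?u has_derivative (\<lambda>h. h *\<^sub>R - (A_sym \<xi> *v ?u s))) (at s)"
      using has_vector_derivative_propagator(1) by (simp add: has_vector_derivative_def)
    have "((\<lambda>t. ?u t \<bullet> ?u t) has_derivative (\<lambda>h. ?u s \<bullet> (h *\<^sub>R - (A_sym \<xi> *v ?u s)) + (h *\<^sub>R - (A_sym \<xi> *v ?u s)) \<bullet> ?u s)) (at s)"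
      by (rule has_derivative_inner[OF d d])
    then have "((\<lambda>t. ?u t \<bullet> ?u t) has_field_derivative - 2 * (?u s \<bullet> (A_sym \<xi> *v ?u s))) (at s)"
      unfolding has_field_derivative_def
      by (rule has_derivative_eq_rhs) (auto simp: inner_commute algebra_simps)
    then have "(?g has_field_derivative (exp (\<rho> * s) * (\<rho> * (?u s \<bullet> ?u s) - 2 * (?u s \<bullet> (A_sym \<xi> *v ?u s))))) (at s)"
      by (auto intro!: derivative_eq_intros simp: algebra_simps)
    moreover have "\<rho> * (?u s \<bullet> ?u s) - 2 * (?u s \<bullet> (A_sym \<xi> *v ?u s)) \<le> 0"
      using A_sym_coercive[of \<xi> "?u s"] by (simp add: \<rho>_def power2_norm_eq_inner)
    ultimately show "\<exists>y. (?g has_real_derivative y) (at s) \<and> y \<le> 0"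
      by (blast intro: mult_nonneg_nonpos exp_ge_zero)
  qed
  then have "exp (\<rho> * t) * (norm (?u t))\<^sup>2 \<le> (norm v)\<^sup>2" by (simp add: power2_norm_eq_inner)
  then have "(norm (?u t))\<^sup>2 \<le> exp (- \<rho> * t) * (norm v)\<^sup>2"
    by (simp add: exp_minus field_simps)
  also have "\<dots> = (exp (- t * \<rho> / 2) * norm v)\<^sup>2"
    by (simp add: power_mult_distrib exp_double[symmetric] mult.commute)
  finally show ?thesis unfolding \<rho>_def by (rule power2_le_imp_le) auto
qed

lemma norm_propagator_le': "t \<ge> 0 \<Longrightarrow> norm (propagator t \<xi> v) \<le> norm v"
  by (rule order_trans[OF norm_propagator_le]) (auto intro!: mult_left_le_one_le)

lemma norm_le_sum_cmod: "norm (x :: complex^'n) \<le> (\<Sum>i\<in>UNIV. cmod (x $ i))"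
  unfolding norm_vec_def by (rule L2_set_le_sum) auto

text \<open>Duhamel's formula compares the propagator with a heat flow \<open>exp (- \<mu> t)\<close>: the two differ by
  the action of \<open>A - \<mu>\<close> on the initial vector, transported by a contraction.\<close>

lemma propagator_compare:
  assumes t: "t \<ge> 0" and \<mu>: "0 \<le> \<mu>" "\<mu> \<le> (norm \<xi>)\<^sup>2"
  shows "norm (propagator t \<xi> v - exp (- \<mu> * t) *\<^sub>R v) \<le> t * exp (- \<mu> * t / 2) * norm (A_sym \<xi> *v v - \<mu> *\<^sub>R v)"
proof -
  let ?w = "A_sym \<xi> *v v - \<mu> *\<^sub>R v"
  define g where "g s = exp (- \<mu> * s) *\<^sub>R propagator (t - s) \<xi> v" for s
  have d: "(g has_vector_derivative exp (- \<mu> * s) *\<^sub>R propagator (t - s) \<xi> ?w) (at s within {0..t})" for s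
  proof -
    have 1: "((\<lambda>s. t - s) has_vector_derivative - 1) (at s within {0..t})"
      by (auto simp: has_vector_derivative_def intro!: derivative_eq_intros)
    have 2: "((\<lambda>s. propagator (t - s) \<xi> v) has_vector_derivative propagator (t - s) \<xi> (A_sym \<xi> *v v)) (at s within {0..t})"
      using vector_diff_chain_within[OF 1 has_vector_derivative_propagator(2)] by (simp add: o_def)
    have 3: "((\<lambda>s. exp (- \<mu> * s)) has_field_derivative - \<mu> * exp (- \<mu> * s)) (at s within {0..t})"
      by (auto intro!: derivative_eq_intros)
    have "(g has_vector_derivative exp (- \<mu> * s) *\<^sub>R propagator (t - s) \<xi> (A_sym \<xi> *v v) + (- \<mu> * exp (- \<mu> * s)) *\<^sub>R propagator (t - s) \<xi> v) (at s within {0..t})"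
      unfolding g_def by (rule has_vector_derivative_scaleR[OF 3 2])
    then show ?thesis
      by (simp add: propagator_diff propagator_scaleR scaleR_diff_right mult.commute)
  qed
  have "norm (g 0 - g t) \<le> exp (- \<mu> * t / 2) * norm ?w * norm (0 - t)"
  proof (rule differentiable_bound[where S="{0..t}"])
    fix s assume s: "s \<in> {0..t}"
    show "(g has_derivative (\<lambda>h. h *\<^sub>R (exp (- \<mu> * s) *\<^sub>R propagator (t - s) \<xi> ?w))) (at s within {0..t})"
      using d by (simp add: has_vector_derivative_def)
    have "norm (exp (- \<mu> * s) *\<^sub>R propagator (t - s) \<xi> ?w) \<le> exp (- \<mu> * s) * (exp (- (t - s) * (norm \<xi>)\<^sup>2 / 2) * norm ?w)"
      using s norm_propagator_le[of "t - s" \<xi> ?w] by simp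
    also have "\<dots> = exp (- \<mu> * s + - (t - s) * (norm \<xi>)\<^sup>2 / 2) * norm ?w" by (simp only: exp_add mult.assoc)
    also have "\<dots> \<le> exp (- \<mu> * t / 2) * norm ?w"
    proof (intro mult_right_mono)
      have "(t - s) * \<mu> \<le> (t - s) * (norm \<xi>)\<^sup>2" "0 \<le> \<mu> * s" using s \<mu> by (auto intro!: mult_left_mono)
      moreover have "- \<mu> * t / 2 = - (\<mu> * s) / 2 - ((t - s) * \<mu>) / 2" by (simp add: field_simps)
      moreover have "- (t - s) * (norm \<xi>)\<^sup>2 / 2 = - ((t - s) * (norm \<xi>)\<^sup>2) / 2"
        "- \<mu> * s = - (\<mu> * s)" by (simp_all add: algebra_simps)
      ultimately have "- \<mu> * s + - (t - s) * (norm \<xi>)\<^sup>2 / 2 \<le> - \<mu> * t / 2" by linarith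
      then show "exp (- \<mu> * s + - (t - s) * (norm \<xi>)\<^sup>2 / 2) \<le> exp (- \<mu> * t / 2)" by simp
    qed auto
    finally have b: "norm (exp (- \<mu> * s) *\<^sub>R propagator (t - s) \<xi> ?w) \<le> exp (- \<mu> * t / 2) * norm ?w" .
    show "onorm (\<lambda>h. h *\<^sub>R (exp (- \<mu> * s) *\<^sub>R propagator (t - s) \<xi> ?w)) \<le> exp (- \<mu> * t / 2) * norm ?w"
    proof (rule onorm_le)
      fix h :: real
      show "norm (h *\<^sub>R (exp (- \<mu> * s) *\<^sub>R propagator (t - s) \<xi> ?w)) \<le> exp (- \<mu> * t / 2) * norm ?w * norm h"
        using mult_left_mono[OF b, of "\<bar>h\<bar>"] by (simp add: abs_mult mult_ac)
    qed
  qed (use t in auto)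
  then show ?thesis using t by (simp add: g_def mult_ac)
qed

text \<open>For a divergence free micro-rotation the second order part of the symbol is the Laplacian alone.\<close>

lemma A_sym_perturbation_le:
  assumes "(\<Sum>l\<in>UNIV. of_real (\<xi>$l) * v $ Inr l) = 0"
  shows "norm (A_sym \<xi> *v v - (norm \<xi>)\<^sup>2 *\<^sub>R v) \<le> 12 * (1 + norm \<xi>) * norm v"
proof -
  let ?w = "A_sym \<xi> *v v - (norm \<xi>)\<^sup>2 *\<^sub>R v"
  have x: "cmod (of_real (\<xi> $ k) * v $ a) \<le> norm \<xi> * norm v" for k a
    unfolding norm_mult using component_le_norm_cart[of \<xi> k] by (intro mult_mono) (auto intro: Finite_Cartesian_Product.norm_nth_le)
  have y: "cmod (\<i> * (of_real (\<xi> $ k) * v $ a - of_real (\<xi> $ l) * v $ b)) \<le> 2 * norm \<xi> * norm v" for k l a b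
    using norm_triangle_ineq4[of "of_real (\<xi> $ k) * v $ a" "of_real (\<xi> $ l) * v $ b"] x[of k a] x[of l b]
    by (simp add: norm_mult)
  have z: "cmod (2 * v $ a + \<i> * (of_real (\<xi> $ k) * v $ b - of_real (\<xi> $ l) * v $ c)) \<le> 2 * norm v + 2 * norm \<xi> * norm v" for k l a b c
    using norm_triangle_ineq[of "2 * v $ a" "\<i> * (of_real (\<xi> $ k) * v $ b - of_real (\<xi> $ l) * v $ c)"]
      y[of k b l c] Finite_Cartesian_Product.norm_nth_le[of v a] by (simp add: norm_mult)
  have 1: "?w $ Inl 1 = \<i> * (of_real (\<xi> $ 3) * v $ Inr 2 - of_real (\<xi> $ 2) * v $ Inr 3)"
    "?w $ Inl 2 = \<i> * (of_real (\<xi>$1) * v $ Inr 3 - of_real (\<xi>$3) * v $ Inr 1)"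
    "?w $ Inl 3 = \<i> * (of_real (\<xi>$2) * v $ Inr 1 - of_real (\<xi>$1) * v $ Inr 2)"
    "?w $ Inr 1 = 2 * v $ Inr 1 + \<i> * (of_real (\<xi>$3) * v $ Inl 2 - of_real (\<xi>$2) * v $ Inl 3)"
    "?w $ Inr 2 = 2 * v $ Inr 2 + \<i> * (of_real (\<xi>$1) * v $ Inl 3 - of_real (\<xi>$3) * v $ Inl 1)"
    "?w $ Inr 3 = 2 * v $ Inr 3 + \<i> * (of_real (\<xi>$2) * v $ Inl 1 - of_real (\<xi>$1) * v $ Inl 2)"
    using assms by (auto simp: A_sym_apply scaleR_conv_of_real[where 'a=complex] algebra_simps)
  have "norm ?w \<le> (\<Sum>a\<in>UNIV. cmod (?w $ a))" by (rule norm_le_sum_cmod)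
  also have "\<dots> \<le> 12 * norm \<xi> * norm v + 6 * norm v"
    unfolding sum_UNIV_Plus sum_3 1 
    using y[of 3 "Inr 2" 2 "Inr 3"] y[of 1 "Inr 3" 3 "Inr 1"] y[of 2 "Inr 1" 1 "Inr 2"]
      z[of "Inr 1" 3 "Inl 2" 2 "Inl 3"] z[of "Inr 2" 1 "Inl 3" 3 "Inl 1"] z[of "Inr 3" 2 "Inl 1" 1 "Inl 2"]
    by linarith
  also have "\<dots> \<le> 12 * (1 + norm \<xi>) * norm v" by (simp add: algebra_simps)
  finally show ?thesis .
qed

lemma B_sym_entry: "B_sym \<xi> $ k $ l = \<i> * of_real
    (if k = 1 \<and> l = 2 then \<xi>$3 else if k = 1 \<and> l = 3 then - \<xi>$2 else if k = 2 \<and> l = 1 then - \<xi>$3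
     else if k = 2 \<and> l = 3 then \<xi>$1 else if k = 3 \<and> l = 1 then \<xi>$2 else if k = 3 \<and> l = 2 then - \<xi>$1 else 0)"
  using exhaust_3[of k] exhaust_3[of l] by (auto simp: B_sym_def vector_3)

lemma A_sym_entry_bound:
  assumes "norm \<xi> \<le> R"
  shows "cmod (A_sym \<xi> $ a $ b) \<le> 2 * (1 + R)\<^sup>2"
proof -
  have R: "0 \<le> R" using assms norm_ge_zero order_trans by blast
  have sq: "(norm \<xi>)\<^sup>2 \<le> R\<^sup>2" using assms by (intro power_mono) auto
  have e: "2 * (1 + R)\<^sup>2 = 2 + 4 * R + 2 * R\<^sup>2" by (simp add: power2_eq_square algebra_simps)
  have c: "\<bar>\<xi>$k\<bar> \<le> R" for k using component_le_norm_cart[of \<xi> k] assms by simp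
  have m: "cmod (of_real x * mat 1 $ k $ l) \<le> x" if "0 \<le> x" for x and k l :: 3
    using that by (simp add: mat_def)
  have B: "cmod (B_sym \<xi> $ k $ l) \<le> R" for k l
    using c[of 1] c[of 2] c[of 3] R by (auto simp: B_sym_entry norm_mult)
  have "\<bar>\<xi>$k\<bar> * \<bar>\<xi>$l\<bar> \<le> R * R" for k l using c R by (intro mult_mono) auto
  then have C: "cmod (C_sym \<xi> $ k $ l) \<le> R\<^sup>2" for k l
    by (simp add: C_sym_def norm_mult abs_mult power2_eq_square)
  have D: "cmod (of_real ((norm \<xi>)\<^sup>2 + 2) * mat 1 $ k $ l + C_sym \<xi> $ k $ l) \<le> (R\<^sup>2 + 2) + R\<^sup>2" for k l
    using sq C[of k l] m[of "(norm \<xi>)\<^sup>2 + 2" k l]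
      norm_triangle_ineq[of "of_real ((norm \<xi>)\<^sup>2 + 2) * mat 1 $ k $ l" "C_sym \<xi> $ k $ l"] by force
  show ?thesis
  proof (cases a)
    case (Inl k)
    then show ?thesis
    proof (cases b)
      case (Inl l)
      have "cmod (of_real ((norm \<xi>)\<^sup>2) * mat 1 $ k $ l) \<le> R\<^sup>2" using m[of "(norm \<xi>)\<^sup>2" k l] sq by simp
      then show ?thesis using \<open>a = Inl k\<close> Inl R unfolding e
        by (simp add: A_sym_def) (smt (verit) zero_le_power2)
    next
      case (Inr l)
      then show ?thesis using \<open>a = Inl k\<close> B[of k l] R unfolding e
        by (simp add: A_sym_def) (smt (verit) zero_le_power2)
    qed
  next
    case (Inr k)
    then show ?thesis
    proof (cases b)
      case (Inl l)
      then show ?thesis using \<open>a = Inr k\<close> B[of k l] R unfolding e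
        by (simp add: A_sym_def) (smt (verit) zero_le_power2)
    next
      case (Inr l)
      then show ?thesis using \<open>a = Inr k\<close> D[of k l] R unfolding e by (simp add: A_sym_def)
    qed
  qed
qed

lemma A_sym_bound:
  assumes "norm \<xi> \<le> R"
  shows "norm (A_sym \<xi> *v v) \<le> 72 * (1 + R)\<^sup>2 * norm v"
proof -
  have "cmod ((A_sym \<xi> *v v) $ a) \<le> 12 * (1 + R)\<^sup>2 * norm v" for a
  proof -
    have "cmod ((A_sym \<xi> *v v) $ a) \<le> (\<Sum>b\<in>UNIV. cmod (A_sym \<xi> $ a $ b * v $ b))"
      by (simp add: matrix_vector_mult_def norm_sum)
    also have "\<dots> \<le> (\<Sum>b\<in>(UNIV :: (3 + 3) set). 2 * (1 + R)\<^sup>2 * norm v)"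
      unfolding norm_mult by (intro sum_mono mult_mono A_sym_entry_bound assms Finite_Cartesian_Product.norm_nth_le) auto
    finally show ?thesis by simp
  qed
  then have "(\<Sum>a\<in>UNIV. cmod ((A_sym \<xi> *v v) $ a)) \<le> (\<Sum>a\<in>(UNIV :: (3 + 3) set). 12 * (1 + R)\<^sup>2 * norm v)"
    by (rule sum_mono)
  then show ?thesis using norm_le_sum_cmod[of "A_sym \<xi> *v v"] by simp
qed

lemma measurable_vec_nth [measurable (raw)]:
  fixes f :: "'a \<Rightarrow> ('b::euclidean_space)^'n"
  assumes [measurable]: "f \<in> borel_measurable M"
  shows "(\<lambda>x. f x $ i) \<in> borel_measurable M"
  by (rule measurable_compose[OF assms borel_measurable_continuous_onI]) (intro continuous_intros)

lemma measurable_vecI: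
  fixes f :: "'a \<Rightarrow> ('b::euclidean_space)^'n"
  assumes [measurable]: "\<And>i. (\<lambda>x. f x $ i) \<in> borel_measurable M"
  shows "f \<in> borel_measurable M"
  unfolding borel_measurable_euclidean_space[of f]
proof
  fix b :: "'b^'n" assume "b \<in> Basis"
  then obtain i u where b: "b = axis i u" "u \<in> Basis" by (auto simp: Basis_vec_def)
  have "(\<lambda>x. f x \<bullet> b) = (\<lambda>x. f x $ i \<bullet> u)" by (auto simp: b inner_axis)
  then show "(\<lambda>x. f x \<bullet> b) \<in> borel_measurable M" by simp
qed

text \<open>Measurability and symmetry under complex conjugation are read off from the entries of the
  power series.\<close>

lemma A_sym_entry_measurable [measurable]: "(\<lambda>\<xi>. A_sym \<xi> $ a $ b) \<in> borel_measurable borel"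
proof (cases a; cases b)
qed (auto simp: A_sym_def B_sym_entry C_sym_def)

lemma mat_pow_A_sym_measurable [measurable]: "(\<lambda>\<xi>. mat_pow (A_sym \<xi>) n $ a $ b) \<in> borel_measurable borel"
proof (induction n arbitrary: a b)
  case (Suc n)
  note [measurable] = Suc.IH
  show ?case unfolding mat_pow.simps matrix_matrix_mult_def by simp
qed simp

lemma propagator_measurable [measurable (raw)]:
  assumes f [measurable]: "f \<in> borel_measurable M" and g [measurable]: "g \<in> borel_measurable M"
    and [measurable]: "h \<in> borel_measurable M"
  shows "(\<lambda>x. propagator (f x) (g x) (h x)) \<in> borel_measurable M"
proof (rule measurable_vecI)
  fix a
  have [measurable]: "(\<lambda>x. mat_pow (A_sym (g x)) n $ a $ b) \<in> borel_measurable M" for n b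
    using measurable_compose[OF g mat_pow_A_sym_measurable] .
  have "(\<lambda>x. mat_exp ((- f x) *\<^sub>R A_sym (g x)) $ a $ b) \<in> borel_measurable M" for b
    unfolding mat_exp_entry exp_coeff_def by measurable
  then show "(\<lambda>x. propagator (f x) (g x) (h x) $ a) \<in> borel_measurable M"
    unfolding propagator_def matrix_vector_mult_def by simp
qed

text \<open>A field is real if its Fourier transform turns into its conjugate under reflection.\<close>

definition vcnj :: "complex^'n \<Rightarrow> complex^'n" where
  "vcnj v = (\<chi> i. cnj (v $ i))"

lemma A_sym_uminus: "A_sym (- \<xi>) $ a $ b = cnj (A_sym \<xi> $ a $ b)"
  by (cases a; cases b) (auto simp: A_sym_def B_sym_entry C_sym_def mat_def)

lemma mat_pow_A_sym_uminus: "mat_pow (A_sym (- \<xi>)) n $ a $ b = cnj (mat_pow (A_sym \<xi>) n $ a $ b)"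
  by (induction n arbitrary: a b) (auto simp: matrix_matrix_mult_def A_sym_uminus mat_def)

lemma propagator_vcnj: "propagator t (- \<xi>) (vcnj v) = vcnj (propagator t \<xi> v)"
proof -
  have "mat_exp ((- t) *\<^sub>R A_sym (- \<xi>)) $ a $ b = cnj (mat_exp ((- t) *\<^sub>R A_sym \<xi>) $ a $ b)" for a b
    unfolding mat_exp_entry bounded_linear.suminf[OF bounded_linear_cnj summable_exp_coeff]
    by (simp add: exp_coeff_def mat_pow_A_sym_uminus)
  then show ?thesis
    by (simp add: propagator_def vcnj_def vec_eq_iff matrix_vector_mult_def)
qed

section \<open>The positive majorant of the Duhamel operator\<close>

text \<open>The space of the fixed point argument is \<open>L\<^sup>2\<close> in time with values in \<open>L\<^sup>1\<close> in frequency. All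
  estimates concern the square of its norm, for functions with values in \<open>[0, \<infinity>]\<close>.\<close>

definition mixed_sq :: "(real \<Rightarrow> real^3 \<Rightarrow> ennreal) \<Rightarrow> ennreal" where
  "mixed_sq M = (\<integral>\<^sup>+t. (\<integral>\<^sup>+\<xi>. M t \<xi> \<partial>lborel)\<^sup>2 \<partial>lborel)"

definition jointly_measurable :: "(real \<Rightarrow> real^3 \<Rightarrow> 'a::topological_space) \<Rightarrow> bool" where
  "jointly_measurable F \<longleftrightarrow> (\<lambda>(t, \<xi>). F t \<xi>) \<in> borel_measurable borel"

lemma jointly_measurableD:
  assumes "jointly_measurable F" "f \<in> borel_measurable N" "g \<in> borel_measurable N"
  shows "(\<lambda>x. F (f x) (g x)) \<in> borel_measurable N"
proof -
  have "(\<lambda>x. (f x, g x)) \<in> N \<rightarrow>\<^sub>M borel"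
    using measurable_Pair[OF assms(2,3)] by (simp add: borel_prod)
  from measurable_compose[OF this assms(1)[unfolded jointly_measurable_def]] show ?thesis by simp
qed

lemma jointly_measurableI:
  "(\<lambda>z. F (fst z) (snd z)) \<in> borel_measurable (borel \<Otimes>\<^sub>M borel) \<Longrightarrow> jointly_measurable F"
  unfolding jointly_measurable_def borel_prod by (simp add: case_prod_beta')

lemma nn_integral_lborel_pair:
  fixes f :: "'a::euclidean_space \<times> 'b::euclidean_space \<Rightarrow> ennreal"
  assumes "f \<in> borel_measurable (borel \<Otimes>\<^sub>M borel)"
  shows "(\<integral>\<^sup>+z. f z \<partial>lborel) = (\<integral>\<^sup>+x. \<integral>\<^sup>+y. f (x, y) \<partial>lborel \<partial>lborel)"
proof -
  have "f \<in> borel_measurable (lborel \<Otimes>\<^sub>M lborel)" using assms by simp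
  from lborel.nn_integral_fst[OF this] show ?thesis unfolding lborel_prod by simp
qed

lemma nn_integral_lborel_swap:
  fixes f :: "'a::euclidean_space \<Rightarrow> 'b::euclidean_space \<Rightarrow> ennreal"
  assumes "(\<lambda>z. f (fst z) (snd z)) \<in> borel_measurable (borel \<Otimes>\<^sub>M borel)"
  shows "(\<integral>\<^sup>+y. \<integral>\<^sup>+x. f x y \<partial>lborel \<partial>lborel) = (\<integral>\<^sup>+x. \<integral>\<^sup>+y. f x y \<partial>lborel \<partial>lborel)"
proof -
  have "case_prod f \<in> borel_measurable (lborel \<Otimes>\<^sub>M lborel)"
    using assms by (simp add: case_prod_beta')
  from lborel_pair.Fubini'[OF this] show ?thesis by simp
qed

lemma Cauchy_Schwarz_weighted:
  assumes [measurable]: "k \<in> borel_measurable N" "G \<in> borel_measurable N"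
  shows "(\<integral>\<^sup>+z. G z * k z \<partial>N)\<^sup>2 \<le> (\<integral>\<^sup>+z. G z * (k z)\<^sup>2 \<partial>N) * (\<integral>\<^sup>+z. G z \<partial>N)"
  using Cauchy_Schwarz_nn_integral[of k "density N G" "\<lambda>_. 1"]
  by (simp add: nn_integral_density emeasure_density)

lemma sum_sq_le_ennreal: "((a::ennreal) + b)\<^sup>2 \<le> 2 * a\<^sup>2 + 2 * b\<^sup>2"
proof (cases "a = \<infinity> \<or> b = \<infinity>")
  case True
  then show ?thesis by (auto simp: power2_eq_square ennreal_mult_top ennreal_top_mult)
next
  case False
  then obtain x y where xy: "a = ennreal x" "0 \<le> x" "b = ennreal y" "0 \<le> y"
    by (cases a; cases b) auto
  have "(x + y)\<^sup>2 \<le> 2 * x\<^sup>2 + 2 * y\<^sup>2"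
    using zero_le_power2[of "x - y"] by (simp add: power2_eq_square algebra_simps)
  then have "ennreal ((x + y)\<^sup>2) \<le> ennreal (2 * x\<^sup>2 + 2 * y\<^sup>2)" by (rule ennreal_leI)
  moreover have "ennreal ((x + y)\<^sup>2) = (a + b)\<^sup>2"
    using xy by (simp add: ennreal_power ennreal_plus[symmetric] del: ennreal_plus)
  moreover have "ennreal (2 * x\<^sup>2 + 2 * y\<^sup>2) = 2 * a\<^sup>2 + 2 * b\<^sup>2"
    using xy by (simp add: ennreal_power ennreal_mult)
  ultimately show ?thesis by simp
qed

lemma mixed_sq_add:
  assumes [measurable (raw)]: "jointly_measurable M" "jointly_measurable M'"
  shows "mixed_sq (\<lambda>t \<xi>. M t \<xi> + M' t \<xi>) \<le> 2 * mixed_sq M + 2 * mixed_sq M'"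
proof -
  note [measurable (raw)] = jointly_measurableD[OF assms(1)] jointly_measurableD[OF assms(2)]
  have "mixed_sq (\<lambda>t \<xi>. M t \<xi> + M' t \<xi>) \<le> (\<integral>\<^sup>+t. 2 * (\<integral>\<^sup>+\<xi>. M t \<xi> \<partial>lborel)\<^sup>2 + 2 * (\<integral>\<^sup>+\<xi>. M' t \<xi> \<partial>lborel)\<^sup>2 \<partial>lborel)"
    unfolding mixed_sq_def
    by (intro nn_integral_mono) (subst nn_integral_add, auto intro: sum_sq_le_ennreal)
  also have "\<dots> = 2 * mixed_sq M + 2 * mixed_sq M'"
    unfolding mixed_sq_def by (subst nn_integral_add) (auto simp: nn_integral_cmult)
  finally show ?thesis .
qed

lemma mixed_sq_mono:
  assumes "\<And>t \<xi>. M t \<xi> \<le> M' t \<xi>"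
  shows "mixed_sq M \<le> mixed_sq M'"
  unfolding mixed_sq_def by (intro nn_integral_mono power_mono assms) auto

text \<open>A bound for the symbol of the nonlinearity, up to the factor \<open>\<bar>\<xi>\<bar>\<close>.\<close>

definition \<kappa> :: real where "\<kappa> = 108"

lemma \<kappa>_pos: "0 < \<kappa>" by (simp add: \<kappa>_def)

text \<open>An upper bound for the kernel of the Duhamel integral, consisting of the symbol of the
  nonlinearity and the decay of the propagator.\<close>

definition heat_kernel :: "real \<Rightarrow> real^3 \<Rightarrow> real \<Rightarrow> ennreal" where
  "heat_kernel t \<xi> \<tau> =
     (if 0 < \<tau> \<and> \<tau> < t then ennreal (\<kappa> * norm \<xi> * exp (- (t - \<tau>) * (norm \<xi>)\<^sup>2 / 2)) else 0)"

definition majorant :: "(real \<Rightarrow> real^3 \<Rightarrow> ennreal) \<Rightarrow> (real \<Rightarrow> real^3 \<Rightarrow> ennreal) \<Rightarrow> real \<Rightarrow> real^3 \<Rightarrow> ennreal" where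
  "majorant M M' t \<xi> = (\<integral>\<^sup>+y. M (fst y) (\<xi> - snd y) * M' (fst y) (snd y) * heat_kernel t \<xi> (fst y) \<partial>lborel)"

lemma heat_kernel_0: "t \<le> 0 \<or> \<xi> = 0 \<Longrightarrow> heat_kernel t \<xi> \<tau> = 0"
  by (auto simp: heat_kernel_def)

lemma heat_kernel_measurable [measurable (raw)]:
  assumes [measurable]: "f \<in> borel_measurable N" "g \<in> borel_measurable N" "h \<in> borel_measurable N"
  shows "(\<lambda>x. heat_kernel (f x) (g x) (h x)) \<in> borel_measurable N"
  unfolding heat_kernel_def by measurable

lemma jointly_measurable_majorant:
  assumes "jointly_measurable M" "jointly_measurable M'"
  shows "jointly_measurable (majorant M M')"
proof (rule jointly_measurableI)
  note [measurable (raw)] = jointly_measurableD[OF assms(1)] jointly_measurableD[OF assms(2)]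
  show "(\<lambda>z. majorant M M' (fst z) (snd z)) \<in> borel_measurable (borel \<Otimes>\<^sub>M borel)"
    unfolding majorant_def lborel_prod[symmetric] by measurable
qed

lemma majorant_mono:
  assumes "\<And>t \<xi>. M t \<xi> \<le> N t \<xi>" "\<And>t \<xi>. M' t \<xi> \<le> N' t \<xi>"
  shows "majorant M M' t \<xi> \<le> majorant N N' t \<xi>"
  unfolding majorant_def by (intro nn_integral_mono mult_mono assms) auto

lemma majorant_at_0 [simp]: "t \<le> 0 \<Longrightarrow> majorant M M' t \<xi> = 0"
  unfolding majorant_def by (simp add: heat_kernel_0)

text \<open>The derivative in the nonlinearity is compensated by square integrability in time:
  \<open>\<rho> exp (- \<rho> s)\<close> has integral one for each \<open>\<rho> = \<bar>\<xi>\<bar>\<^sup>2\<close>.\<close>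

lemma heat_kernel_sq_integral: "(\<integral>\<^sup>+t. (heat_kernel t \<xi> \<tau>)\<^sup>2 \<partial>lborel) \<le> ennreal (\<kappa>\<^sup>2)"
proof (cases "\<xi> = 0")
  case True
  then show ?thesis by (simp add: heat_kernel_0)
next
  case False
  define \<rho> where "\<rho> = (norm \<xi>)\<^sup>2"
  have \<rho>: "0 < \<rho>" using False by (simp add: \<rho>_def)
  have "(\<integral>\<^sup>+t. (heat_kernel t \<xi> \<tau>)\<^sup>2 \<partial>lborel) \<le> (\<integral>\<^sup>+t. ennreal (\<kappa>\<^sup>2) * ennreal (exponential_density \<rho> (- \<tau> + 1 *\<^sub>R t)) \<partial>lborel)"
  proof (rule nn_integral_mono)
    fix t
    show "(heat_kernel t \<xi> \<tau>)\<^sup>2 \<le> ennreal (\<kappa>\<^sup>2) * ennreal (exponential_density \<rho> (- \<tau> + 1 *\<^sub>R t))"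
    proof (cases "0 < \<tau> \<and> \<tau> < t")
      case True
      have "(\<kappa> * norm \<xi> * exp (- (t - \<tau>) * (norm \<xi>)\<^sup>2 / 2))\<^sup>2 = \<kappa>\<^sup>2 * (\<rho> * exp (- (t - \<tau>) * \<rho>))"
        by (simp add: power_mult_distrib \<rho>_def exp_double[symmetric] mult_ac)
      then show ?thesis using True \<rho>
        by (simp add: heat_kernel_def ennreal_power exponential_density_def \<kappa>_pos less_imp_le flip: ennreal_mult)
    qed (auto simp: heat_kernel_def)
  qed
  also have "\<dots> = ennreal (\<kappa>\<^sup>2) * (\<integral>\<^sup>+t. ennreal (exponential_density \<rho> t) \<partial>lborel)"
    using nn_integral_lborel_affine[of "\<lambda>t. ennreal (exponential_density \<rho> t)" 1 "- \<tau>"]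
    by (subst nn_integral_cmult) auto
  also have "(\<integral>\<^sup>+t. ennreal (exponential_density \<rho> t) \<partial>lborel) = 1"
    using prob_space.emeasure_space_1[OF prob_space_exponential_density[OF \<rho>]]
    by (simp add: emeasure_density)
  finally show ?thesis by simp
qed

abbreviation convolved :: "(real \<Rightarrow> real^3 \<Rightarrow> ennreal) \<Rightarrow> (real \<Rightarrow> real^3 \<Rightarrow> ennreal) \<Rightarrow> real^3 \<Rightarrow> ennreal" where
  "convolved M M' \<xi> \<equiv> \<integral>\<^sup>+y. M (fst y) (\<xi> - snd y) * M' (fst y) (snd y) \<partial>lborel"

text \<open>At fixed time the mass of a convolution is the product of the masses; the Cauchy-Schwarz
  inequality in time does the rest.\<close>

lemma convolution_mass:
  assumes M: "jointly_measurable M" and M': "jointly_measurable M'"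
  shows "(\<integral>\<^sup>+\<xi>. convolved M M' \<xi> \<partial>lborel)\<^sup>2 \<le> mixed_sq M * mixed_sq M'"
proof -
  note [measurable (raw)] = jointly_measurableD[OF M] jointly_measurableD[OF M']
  have "(\<integral>\<^sup>+\<xi>. convolved M M' \<xi> \<partial>lborel)
      = (\<integral>\<^sup>+y. \<integral>\<^sup>+\<xi>. M (fst y) (\<xi> - snd y) * M' (fst y) (snd y) \<partial>lborel \<partial>lborel)"
    by (rule nn_integral_lborel_swap) (auto simp: borel_prod[symmetric])
  also have "\<dots> = (\<integral>\<^sup>+y. (\<integral>\<^sup>+\<xi>. M (fst y) \<xi> \<partial>lborel) * M' (fst y) (snd y) \<partial>lborel)"
  proof (intro nn_integral_cong)
    fix y :: "real \<times> (real^3)"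
    show "(\<integral>\<^sup>+\<xi>. M (fst y) (\<xi> - snd y) * M' (fst y) (snd y) \<partial>lborel) = (\<integral>\<^sup>+\<xi>. M (fst y) \<xi> \<partial>lborel) * M' (fst y) (snd y)"
      by (subst nn_integral_multc) (auto simp: nn_integral_translate_reflect[of "M (fst y)" "snd y"])
  qed
  also have "\<dots> = (\<integral>\<^sup>+\<tau>. (\<integral>\<^sup>+\<xi>. M \<tau> \<xi> \<partial>lborel) * (\<integral>\<^sup>+\<xi>. M' \<tau> \<xi> \<partial>lborel) \<partial>lborel)"
    by (subst nn_integral_lborel_pair) (auto simp: nn_integral_cmult)
  finally have *: "(\<integral>\<^sup>+\<xi>. convolved M M' \<xi> \<partial>lborel)
      = (\<integral>\<^sup>+\<tau>. (\<integral>\<^sup>+\<xi>. M \<tau> \<xi> \<partial>lborel) * (\<integral>\<^sup>+\<xi>. M' \<tau> \<xi> \<partial>lborel) \<partial>lborel)" .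
  show ?thesis unfolding * mixed_sq_def by (rule Cauchy_Schwarz_nn_integral) auto
qed

text \<open>By the Cauchy-Schwarz inequality with the convolution as density, only the square of the kernel has
  to be integrated in time.\<close>

lemma mixed_sq_majorant:
  assumes M: "jointly_measurable M" and M': "jointly_measurable M'"
  shows "mixed_sq (majorant M M') \<le> ennreal (\<kappa>\<^sup>2) * (mixed_sq M * mixed_sq M')"
proof -
  note [measurable (raw)] = jointly_measurableD[OF M] jointly_measurableD[OF M']
  let ?G = "\<lambda>z::(real^3) \<times> (real \<times> (real^3)). M (fst (snd z)) (fst z - snd (snd z)) * M' (fst (snd z)) (snd (snd z))"
  let ?k = "\<lambda>t (z::(real^3) \<times> (real \<times> (real^3))). heat_kernel t (fst z) (fst (snd z))"
  define I where "I = (\<integral>\<^sup>+z. ?G z \<partial>lborel)"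
  have I: "I = (\<integral>\<^sup>+\<xi>. convolved M M' \<xi> \<partial>lborel)"
    unfolding I_def by (subst nn_integral_lborel_pair) (auto simp: borel_prod[symmetric])
  have meas: "?G \<in> borel_measurable lborel" "?k t \<in> borel_measurable lborel" for t
    by (simp_all add: borel_prod[symmetric])
  have "mixed_sq (majorant M M') = (\<integral>\<^sup>+t. (\<integral>\<^sup>+z. ?G z * ?k t z \<partial>lborel)\<^sup>2 \<partial>lborel)"
    unfolding mixed_sq_def majorant_def
    by (subst nn_integral_lborel_pair) (auto simp: borel_prod[symmetric])
  also have "\<dots> \<le> (\<integral>\<^sup>+t. (\<integral>\<^sup>+z. ?G z * (?k t z)\<^sup>2 \<partial>lborel) * I \<partial>lborel)"
    unfolding I_def by (intro nn_integral_mono Cauchy_Schwarz_weighted meas)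
  also have "\<dots> = (\<integral>\<^sup>+t. (\<integral>\<^sup>+z. ?G z * (?k t z)\<^sup>2 \<partial>lborel) \<partial>lborel) * I"
    by (rule nn_integral_multc, rule lborel.borel_measurable_nn_integral)
      (unfold lborel_prod[symmetric], measurable)
  also have "(\<integral>\<^sup>+t. (\<integral>\<^sup>+z. ?G z * (?k t z)\<^sup>2 \<partial>lborel) \<partial>lborel) = (\<integral>\<^sup>+z. (\<integral>\<^sup>+t. ?G z * (?k t z)\<^sup>2 \<partial>lborel) \<partial>lborel)"
    by (rule nn_integral_lborel_swap) (auto simp: borel_prod[symmetric])
  also have "\<dots> \<le> (\<integral>\<^sup>+z. ?G z * ennreal (\<kappa>\<^sup>2) \<partial>lborel)"
    by (intro nn_integral_mono) (subst nn_integral_cmult, auto intro!: mult_left_mono heat_kernel_sq_integral)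
  also have "\<dots> = I * ennreal (\<kappa>\<^sup>2)" unfolding I_def
    by (rule nn_integral_multc) (rule meas)
  finally have "mixed_sq (majorant M M') \<le> I * ennreal (\<kappa>\<^sup>2) * I" by (simp add: mult_right_mono)
  also have "\<dots> = ennreal (\<kappa>\<^sup>2) * I\<^sup>2" by (simp add: power2_eq_square mult_ac)
  also have "\<dots> \<le> ennreal (\<kappa>\<^sup>2) * (mixed_sq M * mixed_sq M')"
    unfolding I by (intro mult_left_mono convolution_mass M M') auto
  finally show ?thesis .
qed

text \<open>The weight is the one of the Fourier-Besov space.\<close>

abbreviation weighted_integral :: "(real^3 \<Rightarrow> ennreal) \<Rightarrow> ennreal" where
  "weighted_integral F \<equiv> \<integral>\<^sup>+\<xi>. F \<xi> * ennreal (1 / norm \<xi>) \<partial>lborel"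

lemma heat_kernel_weighted_le: "heat_kernel t \<xi> \<tau> * ennreal (1 / norm \<xi>) \<le> ennreal \<kappa>"
proof (cases "\<xi> \<noteq> 0 \<and> 0 < \<tau> \<and> \<tau> < t")
  case True
  have "exp (- (t - \<tau>) * (norm \<xi>)\<^sup>2 / 2) \<le> 1" using True by (simp add: mult_nonpos_nonneg)
  then have "\<kappa> * norm \<xi> * exp (- (t - \<tau>) * (norm \<xi>)\<^sup>2 / 2) * (1 / norm \<xi>) \<le> \<kappa>"
    using True \<kappa>_pos by simp
  then show ?thesis using True \<kappa>_pos
    by (simp add: heat_kernel_def ennreal_leI less_imp_le flip: ennreal_mult)
qed (auto simp: heat_kernel_def)

lemma majorant_weighted_bound:
  assumes M: "jointly_measurable M" and M': "jointly_measurable M'"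
  shows "(weighted_integral (majorant M M' t))\<^sup>2 \<le> ennreal (\<kappa>\<^sup>2) * (mixed_sq M * mixed_sq M')"
proof -
  note [measurable (raw)] = jointly_measurableD[OF M] jointly_measurableD[OF M']
  define I where "I = (\<integral>\<^sup>+\<xi>. convolved M M' \<xi> \<partial>lborel)"
  have "(weighted_integral (majorant M M' t))
      = (\<integral>\<^sup>+\<xi>. \<integral>\<^sup>+y. M (fst y) (\<xi> - snd y) * M' (fst y) (snd y) * (heat_kernel t \<xi> (fst y) * ennreal (1 / norm \<xi>)) \<partial>lborel \<partial>lborel)"
    unfolding majorant_def by (subst nn_integral_multc[symmetric]) (auto simp: mult.assoc borel_prod[symmetric])
  also have "\<dots> \<le> (\<integral>\<^sup>+\<xi>. \<integral>\<^sup>+y. M (fst y) (\<xi> - snd y) * M' (fst y) (snd y) * ennreal \<kappa> \<partial>lborel \<partial>lborel)"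
    by (intro nn_integral_mono mult_left_mono heat_kernel_weighted_le) auto
  also have "\<dots> = I * ennreal \<kappa>"
  proof -
    have m: "(\<lambda>\<xi>. convolved M M' \<xi>) \<in> borel_measurable lborel"
      by (rule lborel.borel_measurable_nn_integral) (unfold lborel_prod[symmetric], measurable)
    show ?thesis
      unfolding I_def nn_integral_multc[OF m, symmetric]
      by (simp add: nn_integral_multc borel_prod[symmetric])
  qed
  finally have "(weighted_integral (majorant M M' t))\<^sup>2 \<le> (I * ennreal \<kappa>)\<^sup>2"
    by (intro power_mono) auto
  also have "\<dots> = ennreal (\<kappa>\<^sup>2) * I\<^sup>2"
    by (simp add: power_mult_distrib ennreal_power \<kappa>_def mult.commute)
  also have "\<dots> \<le> ennreal (\<kappa>\<^sup>2) * (mixed_sq M * mixed_sq M')"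
    unfolding I_def by (intro mult_left_mono convolution_mass M M') auto
  finally show ?thesis .
qed

section \<open>The Duhamel operator\<close>

text \<open>The symbol of the nonlinearity as a bilinear function of the values of two Fourier transforms. The
  factor \<open>(2 \<pi>)\<^sup>-\<^sup>3\<close> comes from the convolution theorem.\<close>

definition nl :: "real^3 \<Rightarrow> complex^(3+3) \<Rightarrow> complex^(3+3) \<Rightarrow> complex^(3+3)" where
  "nl \<xi> v w = (\<chi> a. of_real (1 / (2 * pi) ^ 3) * (case a of
      Inl k \<Rightarrow> (\<Sum>l\<in>UNIV. (mat 1 $ k $ l - of_real (\<xi>$k * \<xi>$l / (norm \<xi>)\<^sup>2)) *
          (\<Sum>m\<in>UNIV. \<i> * of_real (\<xi>$m) * (v $ Inl m * w $ Inl l)))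
    | Inr l \<Rightarrow> (\<Sum>m\<in>UNIV. \<i> * of_real (\<xi>$m) * (v $ Inl m * w $ Inr l))))"

lemma leray_entry_bound: "cmod (mat 1 $ k $ l - of_real (\<xi>$k * \<xi>$l / (norm \<xi>)\<^sup>2)) \<le> 2"
  for \<xi> :: "real^3" and k l :: 3
proof -
  have "\<bar>\<xi>$k * \<xi>$l\<bar> \<le> norm \<xi> * norm \<xi>"
    unfolding abs_mult by (intro mult_mono component_le_norm_cart) auto
  then have "\<bar>\<xi>$k * \<xi>$l / (norm \<xi>)\<^sup>2\<bar> \<le> 1"
    by (cases "\<xi> = 0") (auto simp: power2_eq_square divide_le_eq_1)
  then have "cmod (of_real (\<xi>$k * \<xi>$l / (norm \<xi>)\<^sup>2)) \<le> 1" by (simp only: norm_of_real)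
  moreover have "cmod ((mat 1 :: complex^3^3) $ k $ l) \<le> 1" by (simp add: mat_def)
  ultimately show ?thesis
    using norm_triangle_ineq4[of "(mat 1 :: complex^3^3) $ k $ l" "of_real (\<xi>$k * \<xi>$l / (norm \<xi>)\<^sup>2)"] by linarith
qed

lemma norm_nl_le: "norm (nl \<xi> v w) \<le> \<kappa> * norm \<xi> * norm v * norm w"
proof -
  define B where "B = norm \<xi> * norm v * norm w"
  have B: "0 \<le> B" by (simp add: B_def)
  have inner: "cmod (\<Sum>m\<in>UNIV. \<i> * of_real (\<xi>$m) * (v $ Inl m * w $ b)) \<le> 3 * B" for b
  proof -
    have "cmod (\<i> * of_real (\<xi>$m) * (v $ Inl m * w $ b)) \<le> B" for m
    proof -
      have "cmod (\<i> * of_real (\<xi>$m) * (v $ Inl m * w $ b)) = \<bar>\<xi>$m\<bar> * cmod (v $ Inl m) * cmod (w $ b)"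
        by (simp add: norm_mult)
      also have "\<dots> \<le> B" unfolding B_def
        by (intro mult_mono component_le_norm_cart Finite_Cartesian_Product.norm_nth_le) auto
      finally show ?thesis .
    qed
    then have "cmod (\<Sum>m\<in>UNIV. \<i> * of_real (\<xi>$m) * (v $ Inl m * w $ b)) \<le> (\<Sum>m\<in>(UNIV::3 set). B)"
      by (intro order_trans[OF norm_sum] sum_mono)
    then show ?thesis by simp
  qed
  have "1 \<le> (2 * pi) ^ 3" using pi_gt3 by (intro one_le_power) simp
  then have c: "cmod (of_real (1 / (2 * pi) ^ 3)) \<le> 1" unfolding norm_of_real by simp
  have "cmod (nl \<xi> v w $ a) \<le> 18 * B" for a
  proof (cases a)
    case (Inl k)
    have "cmod (\<Sum>l\<in>UNIV. (mat 1 $ k $ l - of_real (\<xi>$k * \<xi>$l / (norm \<xi>)\<^sup>2)) *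
          (\<Sum>m\<in>UNIV. \<i> * of_real (\<xi>$m) * (v $ Inl m * w $ Inl l))) \<le> (\<Sum>l\<in>(UNIV::3 set). 2 * (3 * B))"
      by (intro order_trans[OF norm_sum] sum_mono)
        (simp only: norm_mult, intro mult_mono inner leray_entry_bound, auto)
    then have "cmod (of_real (1 / (2 * pi) ^ 3)) * cmod (\<Sum>l\<in>UNIV. (mat 1 $ k $ l - of_real (\<xi>$k * \<xi>$l / (norm \<xi>)\<^sup>2)) *
          (\<Sum>m\<in>UNIV. \<i> * of_real (\<xi>$m) * (v $ Inl m * w $ Inl l))) \<le> 1 * (18 * B)"
      using c B by (intro mult_mono) auto
    then show ?thesis unfolding nl_def Inl by (simp only: vec_lambda_beta sum.case norm_mult)
  next
    case (Inr l)
    have "cmod (of_real (1 / (2 * pi) ^ 3)) * cmod (\<Sum>m\<in>UNIV. \<i> * of_real (\<xi>$m) * (v $ Inl m * w $ Inr l)) \<le> 1 * (3 * B)"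
      using c B inner by (intro mult_mono) auto
    then have "cmod (nl \<xi> v w $ a) \<le> 1 * (3 * B)" unfolding nl_def Inr by (simp only: vec_lambda_beta sum.case norm_mult)
    then show ?thesis using B by linarith
  qed
  then have "(\<Sum>a\<in>UNIV. cmod (nl \<xi> v w $ a)) \<le> (\<Sum>a\<in>(UNIV::(3+3) set). 18 * B)" by (rule sum_mono)
  then show ?thesis using norm_le_sum_cmod[of "nl \<xi> v w"] by (simp add: B_def \<kappa>_def)
qed

lemma nl_measurable [measurable (raw)]:
  assumes [measurable]: "f \<in> borel_measurable M" "g \<in> borel_measurable M" "h \<in> borel_measurable M"
  shows "(\<lambda>x. nl (f x) (g x) (h x)) \<in> borel_measurable M"
proof (rule measurable_vecI)
  fix a
  show "(\<lambda>x. nl (f x) (g x) (h x) $ a) \<in> borel_measurable M"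
    by (cases a) (auto simp: nl_def)
qed

lemma bounded_bilinear_nl: "bounded_bilinear (nl \<xi>)"
proof
  fix v v' w w' :: "complex^(3+3)" and r :: real
  show "nl \<xi> (v + v') w = nl \<xi> v w + nl \<xi> v' w"
    unfolding vec_eq_iff
  proof
    fix a show "nl \<xi> (v + v') w $ a = (nl \<xi> v w + nl \<xi> v' w) $ a"
      by (cases a) (simp_all add: nl_def distrib_left distrib_right sum.distrib add_divide_distrib)
  qed
  show "nl \<xi> v (w + w') = nl \<xi> v w + nl \<xi> v w'"
    unfolding vec_eq_iff
  proof
    fix a show "nl \<xi> v (w + w') $ a = (nl \<xi> v w + nl \<xi> v w') $ a"
      by (cases a) (simp_all add: nl_def distrib_left distrib_right sum.distrib add_divide_distrib)
  qed
  show "nl \<xi> (r *\<^sub>R v) w = r *\<^sub>R nl \<xi> v w"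
    unfolding vec_eq_iff
  proof
    fix a
    have inner: "(\<Sum>m\<in>UNIV. \<i> * of_real (\<xi>$m) * ((r *\<^sub>R v) $ Inl m * w $ b))
        = of_real r * (\<Sum>m\<in>UNIV. \<i> * of_real (\<xi>$m) * (v $ Inl m * w $ b))" for b
      by (simp add: scaleR_conv_of_real[where 'a=complex] sum_distrib_left mult_ac)
    show "nl \<xi> (r *\<^sub>R v) w $ a = (r *\<^sub>R nl \<xi> v w) $ a"
      unfolding vector_scaleR_component scaleR_conv_of_real[where 'a=complex]
      by (cases a) (simp_all only: nl_def vec_lambda_beta sum.case inner
          mult.left_commute[of _ "of_real r"] sum_distrib_left[symmetric])
  qed
  show "nl \<xi> v (r *\<^sub>R w) = r *\<^sub>R nl \<xi> v w"
    unfolding vec_eq_iff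
  proof
    fix a
    have inner: "(\<Sum>m\<in>UNIV. \<i> * of_real (\<xi>$m) * (v $ Inl m * (r *\<^sub>R w) $ b))
        = of_real r * (\<Sum>m\<in>UNIV. \<i> * of_real (\<xi>$m) * (v $ Inl m * w $ b))" for b
      by (simp add: scaleR_conv_of_real[where 'a=complex] sum_distrib_left mult_ac)
    show "nl \<xi> v (r *\<^sub>R w) $ a = (r *\<^sub>R nl \<xi> v w) $ a"
      unfolding vector_scaleR_component scaleR_conv_of_real[where 'a=complex]
      by (cases a) (simp_all only: nl_def vec_lambda_beta sum.case inner
          mult.left_commute[of _ "of_real r"] sum_distrib_left[symmetric])
  qed
next
  show "\<exists>K. \<forall>v w. norm (nl \<xi> v w) \<le> norm v * norm w * K"
    using norm_nl_le[of \<xi>] by (intro exI[of _ "\<kappa> * norm \<xi>"]) (simp add: mult_ac)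
qed

definition duhamel_kernel :: "real \<Rightarrow> real^3 \<Rightarrow> real \<Rightarrow> complex^(3+3) \<Rightarrow> complex^(3+3) \<Rightarrow> complex^(3+3)" where
  "duhamel_kernel t \<xi> \<tau> v w = (if 0 < \<tau> \<and> \<tau> < t then propagator (t - \<tau>) \<xi> (nl \<xi> v w) else 0)"

text \<open>The time integral and the convolution are taken together as an integral over pairs, which keeps
  all measure theory on one product space.\<close>

definition bil :: "(real \<Rightarrow> real^3 \<Rightarrow> complex^(3+3)) \<Rightarrow> (real \<Rightarrow> real^3 \<Rightarrow> complex^(3+3)) \<Rightarrow> real \<Rightarrow> real^3 \<Rightarrow> complex^(3+3)" where
  "bil F G t \<xi> = (LINT y|lborel. duhamel_kernel t \<xi> (fst y) (F (fst y) (\<xi> - snd y)) (G (fst y) (snd y)))"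

lemma bounded_bilinear_duhamel_kernel: "bounded_bilinear (duhamel_kernel t \<xi> \<tau>)"
proof (cases "0 < \<tau> \<and> \<tau> < t")
  case True
  interpret b: bounded_bilinear "nl \<xi>" by (rule bounded_bilinear_nl)
  show ?thesis
  proof
    fix v v' w w' :: "complex^(3+3)" and r :: real
    show "duhamel_kernel t \<xi> \<tau> (v + v') w = duhamel_kernel t \<xi> \<tau> v w + duhamel_kernel t \<xi> \<tau> v' w"
      using True by (simp add: duhamel_kernel_def b.add_left propagator_add)
    show "duhamel_kernel t \<xi> \<tau> v (w + w') = duhamel_kernel t \<xi> \<tau> v w + duhamel_kernel t \<xi> \<tau> v w'"
      using True by (simp add: duhamel_kernel_def b.add_right propagator_add)
    show "duhamel_kernel t \<xi> \<tau> (r *\<^sub>R v) w = r *\<^sub>R duhamel_kernel t \<xi> \<tau> v w"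
      using True by (simp add: duhamel_kernel_def b.scaleR_left propagator_scaleR)
    show "duhamel_kernel t \<xi> \<tau> v (r *\<^sub>R w) = r *\<^sub>R duhamel_kernel t \<xi> \<tau> v w"
      using True by (simp add: duhamel_kernel_def b.scaleR_right propagator_scaleR)
  next
    show "\<exists>K. \<forall>v w. norm (duhamel_kernel t \<xi> \<tau> v w) \<le> norm v * norm w * K"
    proof -
      obtain K where K: "\<And>v w. norm (nl \<xi> v w) \<le> norm v * norm w * K" using b.bounded by blast
      have "norm (duhamel_kernel t \<xi> \<tau> v w) \<le> norm v * norm w * K" for v w
        using order_trans[OF norm_propagator_le' K] True by (simp add: duhamel_kernel_def)
      then show ?thesis by blast
    qed
  qed
next
  case False
  then have "duhamel_kernel t \<xi> \<tau> = (\<lambda>v w. 0)" by (auto simp: duhamel_kernel_def fun_eq_iff)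
  then show ?thesis by (simp add: bounded_bilinear.zero_left bounded_bilinear_def) (auto intro: exI[of _ 0])
qed

lemma norm_duhamel_kernel_le:
  "ennreal (norm (duhamel_kernel t \<xi> \<tau> v w)) \<le> ennreal (norm v) * ennreal (norm w) * heat_kernel t \<xi> \<tau>"
proof (cases "0 < \<tau> \<and> \<tau> < t")
  case True
  have "norm (duhamel_kernel t \<xi> \<tau> v w) \<le> exp (- (t - \<tau>) * (norm \<xi>)\<^sup>2 / 2) * norm (nl \<xi> v w)"
    using True norm_propagator_le[of "t - \<tau>" \<xi> "nl \<xi> v w"] by (simp add: duhamel_kernel_def)
  also have "\<dots> \<le> exp (- (t - \<tau>) * (norm \<xi>)\<^sup>2 / 2) * (\<kappa> * norm \<xi> * norm v * norm w)"
    by (intro mult_left_mono norm_nl_le) auto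
  also have "\<dots> = norm v * norm w * (\<kappa> * norm \<xi> * exp (- (t - \<tau>) * (norm \<xi>)\<^sup>2 / 2))" by (simp add: mult_ac)
  finally show ?thesis using True \<kappa>_pos
    by (simp add: heat_kernel_def less_imp_le ennreal_leI flip: ennreal_mult del: mult_minus_left)
qed (auto simp: duhamel_kernel_def)

lemma duhamel_kernel_measurable [measurable (raw)]:
  assumes [measurable]: "f \<in> borel_measurable M" "g \<in> borel_measurable M" "h \<in> borel_measurable M"
    "v \<in> borel_measurable M" "w \<in> borel_measurable M"
  shows "(\<lambda>x. duhamel_kernel (f x) (g x) (h x) (v x) (w x)) \<in> borel_measurable M"
  unfolding duhamel_kernel_def by measurable

lemma bil_integrand_measurable:
  assumes "jointly_measurable F" "jointly_measurable G"
  shows "(\<lambda>y. duhamel_kernel t \<xi> (fst y) (F (fst y) (\<xi> - snd y)) (G (fst y) (snd y))) \<in> borel_measurable lborel"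
proof -
  note [measurable (raw)] = jointly_measurableD[OF assms(1)] jointly_measurableD[OF assms(2)]
  show ?thesis unfolding lborel_prod[symmetric] by measurable
qed

lemma jointly_measurable_bil:
  assumes "jointly_measurable F" "jointly_measurable G"
  shows "jointly_measurable (bil F G)"
proof (rule jointly_measurableI)
  note [measurable (raw)] = jointly_measurableD[OF assms(1)] jointly_measurableD[OF assms(2)]
  show "(\<lambda>z. bil F G (fst z) (snd z)) \<in> borel_measurable (borel \<Otimes>\<^sub>M borel)"
    unfolding bil_def
    by (rule lborel.borel_measurable_lebesgue_integral) (unfold lborel_prod[symmetric], measurable)
qed

lemma bil_bound:
  assumes F: "jointly_measurable F" "\<And>t \<xi>. ennreal (norm (F t \<xi>)) \<le> M t \<xi>"
    and G: "jointly_measurable G" "\<And>t \<xi>. ennreal (norm (G t \<xi>)) \<le> M' t \<xi>"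
    and fin: "majorant M M' t \<xi> < \<infinity>"
  shows "integrable lborel (\<lambda>y. duhamel_kernel t \<xi> (fst y) (F (fst y) (\<xi> - snd y)) (G (fst y) (snd y)))"
    and "ennreal (norm (bil F G t \<xi>)) \<le> majorant M M' t \<xi>"
proof -
  have le: "(\<integral>\<^sup>+y. ennreal (norm (duhamel_kernel t \<xi> (fst y) (F (fst y) (\<xi> - snd y)) (G (fst y) (snd y)))) \<partial>lborel) \<le> majorant M M' t \<xi>"
    unfolding majorant_def
    by (intro nn_integral_mono order_trans[OF norm_duhamel_kernel_le] mult_mono F G) auto
  show i: "integrable lborel (\<lambda>y. duhamel_kernel t \<xi> (fst y) (F (fst y) (\<xi> - snd y)) (G (fst y) (snd y)))"
    by (rule integrableI_bounded[OF bil_integrand_measurable[OF F(1) G(1)] le_less_trans[OF le fin]])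
  show "ennreal (norm (bil F G t \<xi>)) \<le> majorant M M' t \<xi>"
    unfolding bil_def by (rule order_trans[OF integral_norm_bound_ennreal[OF i] le])
qed

lemma duhamel_kernel_diff:
  "duhamel_kernel t \<xi> \<tau> v w - duhamel_kernel t \<xi> \<tau> v' w'
    = duhamel_kernel t \<xi> \<tau> (v - v') w + duhamel_kernel t \<xi> \<tau> v' (w - w')"
  by (simp add: bounded_bilinear.diff_left[OF bounded_bilinear_duhamel_kernel]
      bounded_bilinear.diff_right[OF bounded_bilinear_duhamel_kernel])

lemma norm_duhamel_kernel_diff_le:
  "ennreal (norm (duhamel_kernel t \<xi> \<tau> v w - duhamel_kernel t \<xi> \<tau> v' w'))
    \<le> (ennreal (norm (v - v')) * ennreal (norm w) + ennreal (norm v') * ennreal (norm (w - w'))) * heat_kernel t \<xi> \<tau>"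
proof -
  have "ennreal (norm (duhamel_kernel t \<xi> \<tau> v w - duhamel_kernel t \<xi> \<tau> v' w'))
      \<le> ennreal (norm (duhamel_kernel t \<xi> \<tau> (v - v') w)) + ennreal (norm (duhamel_kernel t \<xi> \<tau> v' (w - w')))"
    unfolding duhamel_kernel_diff ennreal_plus[OF norm_ge_zero norm_ge_zero, symmetric]
    by (intro ennreal_leI norm_triangle_ineq)
  also have "\<dots> \<le> ennreal (norm (v - v')) * ennreal (norm w) * heat_kernel t \<xi> \<tau>
      + ennreal (norm v') * ennreal (norm (w - w')) * heat_kernel t \<xi> \<tau>"
    by (intro add_mono norm_duhamel_kernel_le)
  finally show ?thesis by (simp add: distrib_right)
qed

text \<open>This makes the increments of the majorants control those of the iteration. It is stated additively
  to avoid subtraction of possibly infinite quantities.\<close>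

lemma bil_increment:
  assumes F: "jointly_measurable F" "\<And>t \<xi>. ennreal (norm (F t \<xi>)) \<le> M t \<xi>"
    and G: "jointly_measurable G" "\<And>t \<xi>. ennreal (norm (G t \<xi>)) \<le> N t \<xi>"
    and M: "jointly_measurable M" and N: "jointly_measurable N"
    and inc: "\<And>t \<xi>. ennreal (norm (G t \<xi> - F t \<xi>)) + M t \<xi> \<le> N t \<xi>"
  shows "ennreal (norm (bil G G t \<xi> - bil F F t \<xi>)) + majorant M M t \<xi> \<le> majorant N N t \<xi>"
proof (cases "majorant N N t \<xi> < \<infinity>")
  case True
  note [measurable (raw)] = jointly_measurableD[OF M] jointly_measurableD[OF N]
  have MN: "M t \<xi> \<le> N t \<xi>" for t \<xi> using inc[of t \<xi>] by (metis add_increasing order_trans zero_le order_refl)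
  have finM: "majorant M M t \<xi> < \<infinity>" using le_less_trans[OF majorant_mono[OF MN MN] True] .
  let ?k = "\<lambda>H y. duhamel_kernel t \<xi> (fst y) (H (fst y) (\<xi> - snd y)) (H (fst y) (snd y))"
  note iG = bil_bound(1)[OF G G True] and iF = bil_bound(1)[OF F F finM]
  have "ennreal (norm (bil G G t \<xi> - bil F F t \<xi>)) \<le> (\<integral>\<^sup>+y. ennreal (norm (?k G y - ?k F y)) \<partial>lborel)"
    unfolding bil_def Bochner_Integration.integral_diff[OF iG iF, symmetric]
    by (rule integral_norm_bound_ennreal) (intro Bochner_Integration.integrable_diff iG iF)
  then have "ennreal (norm (bil G G t \<xi> - bil F F t \<xi>)) + majorant M M t \<xi>
      \<le> (\<integral>\<^sup>+y. ennreal (norm (?k G y - ?k F y)) \<partial>lborel) + majorant M M t \<xi>" by (rule add_right_mono)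
  also have "\<dots> = (\<integral>\<^sup>+y. ennreal (norm (?k G y - ?k F y)) + M (fst y) (\<xi> - snd y) * M (fst y) (snd y) * heat_kernel t \<xi> (fst y) \<partial>lborel)"
    unfolding majorant_def
  proof (rule nn_integral_add[symmetric])
    show "(\<lambda>y. ennreal (norm (?k G y - ?k F y))) \<in> borel_measurable lborel"
      using bil_integrand_measurable[OF G(1) G(1)] bil_integrand_measurable[OF F(1) F(1)] by measurable
    show "(\<lambda>y. M (fst y) (\<xi> - snd y) * M (fst y) (snd y) * heat_kernel t \<xi> (fst y)) \<in> borel_measurable lborel"
      unfolding lborel_prod[symmetric] by measurable
  qed
  also have "\<dots> \<le> majorant N N t \<xi>" unfolding majorant_def
  proof (rule nn_integral_mono)
    fix y :: "real \<times> (real^3)"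
    let ?\<tau> = "fst y" and ?p = "\<xi> - snd y" and ?q = "snd y"
    let ?d = "\<lambda>p. ennreal (norm (G ?\<tau> p - F ?\<tau> p))"
    have "?d ?p * ennreal (norm (G ?\<tau> ?q)) + ennreal (norm (F ?\<tau> ?p)) * ?d ?q + M ?\<tau> ?p * M ?\<tau> ?q
        \<le> ?d ?p * N ?\<tau> ?q + M ?\<tau> ?p * ?d ?q + M ?\<tau> ?p * M ?\<tau> ?q"
      by (intro add_mono mult_mono F G order_refl) auto
    also have "\<dots> = ?d ?p * N ?\<tau> ?q + M ?\<tau> ?p * (?d ?q + M ?\<tau> ?q)" by (simp add: distrib_left add.assoc)
    also have "\<dots> \<le> ?d ?p * N ?\<tau> ?q + M ?\<tau> ?p * N ?\<tau> ?q" by (intro add_left_mono mult_left_mono inc) auto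
    also have "\<dots> = (?d ?p + M ?\<tau> ?p) * N ?\<tau> ?q" by (simp add: distrib_right)
    also have "\<dots> \<le> N ?\<tau> ?p * N ?\<tau> ?q" by (intro mult_right_mono inc) auto
    finally have *: "?d ?p * ennreal (norm (G ?\<tau> ?q)) + ennreal (norm (F ?\<tau> ?p)) * ?d ?q + M ?\<tau> ?p * M ?\<tau> ?q \<le> N ?\<tau> ?p * N ?\<tau> ?q" .
    have "ennreal (norm (?k G y - ?k F y)) + M ?\<tau> ?p * M ?\<tau> ?q * heat_kernel t \<xi> ?\<tau>
        \<le> (?d ?p * ennreal (norm (G ?\<tau> ?q)) + ennreal (norm (F ?\<tau> ?p)) * ?d ?q) * heat_kernel t \<xi> ?\<tau> + M ?\<tau> ?p * M ?\<tau> ?q * heat_kernel t \<xi> ?\<tau>"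
      by (intro add_right_mono norm_duhamel_kernel_diff_le)
    also have "\<dots> = (?d ?p * ennreal (norm (G ?\<tau> ?q)) + ennreal (norm (F ?\<tau> ?p)) * ?d ?q + M ?\<tau> ?p * M ?\<tau> ?q) * heat_kernel t \<xi> ?\<tau>"
      by (simp add: distrib_right)
    also have "\<dots> \<le> N ?\<tau> ?p * N ?\<tau> ?q * heat_kernel t \<xi> ?\<tau>" by (intro mult_right_mono *) auto
    finally show "ennreal (norm (?k G y - ?k F y)) + M ?\<tau> ?p * M ?\<tau> ?q * heat_kernel t \<xi> ?\<tau> \<le> N ?\<tau> ?p * N ?\<tau> ?q * heat_kernel t \<xi> ?\<tau>" .
  qed
  finally show ?thesis .
next
  case False
  then have "majorant N N t \<xi> = top" by (metis infinity_ennreal_def less_top)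
  then show ?thesis by simp
qed

lemma bil_diff_bound:
  assumes F: "jointly_measurable F" "\<And>t \<xi>. ennreal (norm (F t \<xi>)) \<le> M t \<xi>"
    and G: "jointly_measurable G" "\<And>t \<xi>. ennreal (norm (G t \<xi>)) \<le> M t \<xi>"
    and M: "jointly_measurable M" and D: "jointly_measurable D"
    and diff: "\<And>t \<xi>. ennreal (norm (G t \<xi> - F t \<xi>)) \<le> D t \<xi>"
    and fin: "majorant M M t \<xi> < \<infinity>"
  shows "ennreal (norm (bil G G t \<xi> - bil F F t \<xi>)) \<le> majorant D M t \<xi> + majorant M D t \<xi>"
proof -
  note [measurable (raw)] = jointly_measurableD[OF M] jointly_measurableD[OF D]
  let ?k = "\<lambda>H y. duhamel_kernel t \<xi> (fst y) (H (fst y) (\<xi> - snd y)) (H (fst y) (snd y))"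
  note iG = bil_bound(1)[OF G G fin] and iF = bil_bound(1)[OF F F fin]
  have "ennreal (norm (bil G G t \<xi> - bil F F t \<xi>)) \<le> (\<integral>\<^sup>+y. ennreal (norm (?k G y - ?k F y)) \<partial>lborel)"
    unfolding bil_def Bochner_Integration.integral_diff[OF iG iF, symmetric]
    by (rule integral_norm_bound_ennreal) (intro Bochner_Integration.integrable_diff iG iF)
  also have "\<dots> \<le> (\<integral>\<^sup>+y. D (fst y) (\<xi> - snd y) * M (fst y) (snd y) * heat_kernel t \<xi> (fst y)
      + M (fst y) (\<xi> - snd y) * D (fst y) (snd y) * heat_kernel t \<xi> (fst y) \<partial>lborel)"
    unfolding distrib_right[symmetric]
    by (intro nn_integral_mono order_trans[OF norm_duhamel_kernel_diff_le] mult_right_mono add_mono mult_mono F G diff) auto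
  also have "\<dots> = majorant D M t \<xi> + majorant M D t \<xi>"
    unfolding majorant_def by (rule nn_integral_add) (unfold lborel_prod[symmetric], measurable)
  finally show ?thesis .
qed

section \<open>Picard iteration\<close>

lemma lborel_reflect_snd:
  "distr lborel borel (\<lambda>y. (fst y, - snd y)) = (lborel :: (real \<times> (real^3)) measure)"
proof -
  have 1: "distr (lborel :: real measure) lborel (\<lambda>x. x) = lborel" by (rule distr_id)
  have 2: "distr (lborel :: (real^3) measure) lborel uminus = lborel"
  proof -
    have "distr (lborel :: (real^3) measure) lborel uminus = distr lborel borel uminus"
      by (rule distr_cong) auto
    then show ?thesis
      using lborel_affine[of "-1" "0 :: real^3"] by (simp add: density_1)
  qed
  have "(lborel :: real measure) \<Otimes>\<^sub>M (lborel :: (real^3) measure)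
      = distr (lborel \<Otimes>\<^sub>M lborel) (lborel \<Otimes>\<^sub>M lborel) (\<lambda>(x, y). (x, - y))"
    using pair_measure_distr[of "\<lambda>x. x" "lborel :: real measure" lborel uminus "lborel :: (real^3) measure" lborel]
    unfolding 1 2 by (simp add: sigma_finite_lborel)
  then show ?thesis unfolding lborel_prod
    by (metis (no_types, lifting) case_prod_beta' distr_cong sets_lborel)
qed

lemma nn_integral_reflect_snd:
  fixes f :: "real \<times> (real^3) \<Rightarrow> ennreal"
  assumes "f \<in> borel_measurable borel"
  shows "(\<integral>\<^sup>+y. f (fst y, - snd y) \<partial>lborel) = (\<integral>\<^sup>+y. f y \<partial>lborel)"
  by (subst (2) lborel_reflect_snd[symmetric], subst nn_integral_distr)
    (use assms in \<open>simp_all add: borel_prod[symmetric]\<close>)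

lemma integral_reflect_snd:
  fixes f :: "real \<times> (real^3) \<Rightarrow> complex^'n"
  assumes "f \<in> borel_measurable borel"
  shows "(LINT y|lborel. f (fst y, - snd y)) = (LINT y|lborel. f y)"
  by (subst (2) lborel_reflect_snd[symmetric], subst integral_distr)
    (use assms in \<open>simp_all add: borel_prod[symmetric]\<close>)

lemma vcnj_0 [simp]: "vcnj 0 = 0"
  by (simp add: vcnj_def vec_eq_iff)

lemma vcnj_vcnj [simp]: "vcnj (vcnj v) = v"
  by (simp add: vcnj_def vec_eq_iff)

lemma norm_vcnj [simp]: "norm (vcnj v) = norm v"
  by (simp add: vcnj_def norm_vec_def)

lemma bounded_linear_vcnj: "bounded_linear vcnj"
  by (rule bounded_linear_intro[where K=1]) (auto simp: vcnj_def vec_eq_iff norm_vec_def)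

lemma vcnj_diff: "vcnj (v - w) = vcnj v - vcnj w"
  by (simp add: vcnj_def vec_eq_iff)

lemma nl_vcnj: "nl (- \<xi>) (vcnj v) (vcnj w) = vcnj (nl \<xi> v w)"
  unfolding vec_eq_iff
proof
  fix a show "nl (- \<xi>) (vcnj v) (vcnj w) $ a = vcnj (nl \<xi> v w) $ a"
    by (cases a) (auto simp: nl_def vcnj_def mat_def intro!: sum.cong)
qed

lemma duhamel_kernel_vcnj: "duhamel_kernel t (- \<xi>) \<tau> (vcnj v) (vcnj w) = vcnj (duhamel_kernel t \<xi> \<tau> v w)"
  by (auto simp: duhamel_kernel_def nl_vcnj propagator_vcnj)

lemma bil_vcnj:
  assumes jm: "jointly_measurable F" "jointly_measurable G"
    and F: "\<And>t \<xi>. F t (- \<xi>) = vcnj (F t \<xi>)" and G: "\<And>t \<xi>. G t (- \<xi>) = vcnj (G t \<xi>)"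
  shows "bil F G t (- \<xi>) = vcnj (bil F G t \<xi>)"
proof -
  let ?f = "\<lambda>y. duhamel_kernel t (- \<xi>) (fst y) (F (fst y) (- \<xi> - snd y)) (G (fst y) (snd y))"
  have "bil F G t (- \<xi>) = (LINT y|lborel. ?f (fst y, - snd y))"
    unfolding bil_def using bil_integrand_measurable[OF jm, of t "- \<xi>"]
    by (intro integral_reflect_snd[symmetric]) simp
  also have "\<dots> = (LINT y|lborel. vcnj (duhamel_kernel t \<xi> (fst y) (F (fst y) (\<xi> - snd y)) (G (fst y) (snd y))))"
  proof (rule Bochner_Integration.integral_cong[OF refl])
    fix y :: "real \<times> (real^3)"
    have "F (fst y) (- \<xi> + snd y) = vcnj (F (fst y) (\<xi> - snd y))"
      using F[of "fst y" "\<xi> - snd y"] by (simp add: algebra_simps)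
    then show "?f (fst y, - snd y) = vcnj (duhamel_kernel t \<xi> (fst y) (F (fst y) (\<xi> - snd y)) (G (fst y) (snd y)))"
      by (simp add: G duhamel_kernel_vcnj)
  qed
  also have "\<dots> = vcnj (bil F G t \<xi>)" unfolding bil_def
    by (rule integral_bounded_linear'[OF bounded_linear_vcnj bounded_linear_vcnj]) simp
  finally show ?thesis .
qed

lemma majorant_even:
  assumes jm: "jointly_measurable M" and M: "\<And>t \<xi>. M t (- \<xi>) = M t \<xi>"
  shows "majorant M M t (- \<xi>) = majorant M M t \<xi>"
proof -
  note [measurable (raw)] = jointly_measurableD[OF jm]
  let ?f = "\<lambda>y. M (fst y) (- \<xi> - snd y) * M (fst y) (snd y) * heat_kernel t (- \<xi>) (fst y)"
  have "majorant M M t (- \<xi>) = (\<integral>\<^sup>+y. ?f (fst y, - snd y) \<partial>lborel)"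
    unfolding majorant_def by (intro nn_integral_reflect_snd[symmetric]) (unfold borel_prod[symmetric], measurable)
  also have "\<dots> = majorant M M t \<xi>"
    unfolding majorant_def
  proof (rule nn_integral_cong)
    fix y :: "real \<times> (real^3)"
    have "M (fst y) (- \<xi> + snd y) = M (fst y) (\<xi> - snd y)"
      using M[of "fst y" "\<xi> - snd y"] by (simp add: algebra_simps)
    then show "?f (fst y, - snd y) = M (fst y) (\<xi> - snd y) * M (fst y) (snd y) * heat_kernel t \<xi> (fst y)"
      by (simp add: M heat_kernel_def)
  qed
  finally show ?thesis .
qed

text \<open>Picard iteration \<open>V\<close> for \<open>V = u - B(V, V)\<close> next to the monotone iteration \<open>M\<close> for the scalar
  majorant equation. The increments of \<open>V\<close> are dominated by those of \<open>M\<close>, so boundedness of \<open>M\<close>,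
  which follows from smallness of \<open>a\<close>, is all that is needed for convergence.\<close>

locale picard =
  fixes u :: "real \<Rightarrow> real^3 \<Rightarrow> complex^(3+3)" and a :: "real \<Rightarrow> real^3 \<Rightarrow> ennreal"
  assumes u: "jointly_measurable u" and a: "jointly_measurable a"
    and ua: "\<And>t \<xi>. ennreal (norm (u t \<xi>)) \<le> a t \<xi>" and afin: "\<And>t \<xi>. a t \<xi> < \<infinity>"
    and u_sym: "\<And>t \<xi>. u t (- \<xi>) = vcnj (u t \<xi>)" and a_sym: "\<And>t \<xi>. a t (- \<xi>) = a t \<xi>"
    and small: "ennreal (16 * \<kappa>\<^sup>2) * mixed_sq a \<le> 1"
begin

primrec V :: "nat \<Rightarrow> real \<Rightarrow> real^3 \<Rightarrow> complex^(3+3)" where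
  "V 0 = (\<lambda>t \<xi>. 0)"
| "V (Suc n) = (\<lambda>t \<xi>. u t \<xi> - bil (V n) (V n) t \<xi>)"

primrec M :: "nat \<Rightarrow> real \<Rightarrow> real^3 \<Rightarrow> ennreal" where
  "M 0 = (\<lambda>t \<xi>. 0)"
| "M (Suc n) = (\<lambda>t \<xi>. a t \<xi> + majorant (M n) (M n) t \<xi>)"

lemma jm_V: "jointly_measurable (V n)"
proof (induction n)
  case (Suc n)
  note [measurable (raw)] = jointly_measurableD[OF u] jointly_measurableD[OF jointly_measurable_bil[OF Suc Suc]]
  show ?case unfolding V.simps by (rule jointly_measurableI) measurable
qed (simp add: jointly_measurable_def)

lemma jm_M: "jointly_measurable (M n)"
proof (induction n)
  case (Suc n)
  note [measurable (raw)] = jointly_measurableD[OF a] jointly_measurableD[OF jointly_measurable_majorant[OF Suc Suc]]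
  show ?case unfolding M.simps by (rule jointly_measurableI) measurable
qed (simp add: jointly_measurable_def)

lemma bil_zero: "bil (\<lambda>t \<xi>. 0) (\<lambda>t \<xi>. 0) t \<xi> = 0"
  by (simp add: bil_def bounded_bilinear.zero_left[OF bounded_bilinear_duhamel_kernel])

text \<open>The bound for \<open>V (n + 1)\<close> uses the increment at \<open>n\<close>, and the next increment uses this bound; hence
  the joint induction.\<close>

lemma V_le_M_and_increment:
  "(\<forall>t \<xi>. ennreal (norm (V n t \<xi>)) \<le> M n t \<xi>) \<and>
   (\<forall>t \<xi>. ennreal (norm (V (Suc n) t \<xi> - V n t \<xi>)) + M n t \<xi> \<le> M (Suc n) t \<xi>)"
proof (induction n)
  case 0
  show ?case using ua by (simp add: bil_zero majorant_def)
next
  case (Suc n)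
  have 1: "ennreal (norm (V (Suc n) t \<xi>)) \<le> M (Suc n) t \<xi>" for t \<xi>
  proof -
    have "ennreal (norm (V (Suc n) t \<xi>)) \<le> ennreal (norm (V (Suc n) t \<xi> - V n t \<xi>) + norm (V n t \<xi>))"
      using norm_triangle_ineq[of "V (Suc n) t \<xi> - V n t \<xi>" "V n t \<xi>"] by (intro ennreal_leI) simp
    also have "\<dots> \<le> ennreal (norm (V (Suc n) t \<xi> - V n t \<xi>)) + M n t \<xi>"
      using Suc by (simp add: add_left_mono del: V.simps M.simps)
    also have "\<dots> \<le> M (Suc n) t \<xi>" using Suc by blast
    finally show ?thesis .
  qed
  have 2: "ennreal (norm (V (Suc (Suc n)) t \<xi> - V (Suc n) t \<xi>)) + M (Suc n) t \<xi> \<le> M (Suc (Suc n)) t \<xi>" for t \<xi>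
  proof -
    have "ennreal (norm (bil (V (Suc n)) (V (Suc n)) t \<xi> - bil (V n) (V n) t \<xi>)) + majorant (M n) (M n) t \<xi>
        \<le> majorant (M (Suc n)) (M (Suc n)) t \<xi>"
      by (rule bil_increment[OF jm_V _ jm_V 1 jm_M jm_M]) (use Suc in blast)+
    then have *: "a t \<xi> + (ennreal (norm (bil (V (Suc n)) (V (Suc n)) t \<xi> - bil (V n) (V n) t \<xi>)) + majorant (M n) (M n) t \<xi>)
        \<le> a t \<xi> + majorant (M (Suc n)) (M (Suc n)) t \<xi>" by (rule add_left_mono)
    have "V (Suc (Suc n)) t \<xi> - V (Suc n) t \<xi> = - (bil (V (Suc n)) (V (Suc n)) t \<xi> - bil (V n) (V n) t \<xi>)"
      unfolding V.simps(2)[of "Suc n"] by (subst (3) V.simps(2)) simp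
    then have "ennreal (norm (V (Suc (Suc n)) t \<xi> - V (Suc n) t \<xi>)) = ennreal (norm (bil (V (Suc n)) (V (Suc n)) t \<xi> - bil (V n) (V n) t \<xi>))"
      by (simp only: norm_minus_cancel)
    then show ?thesis using * unfolding M.simps(2)[of "Suc n"] M.simps(2)[of n] by (simp add: add_ac)
  qed
  show ?case using 1 2 by blast
qed

lemma V_le_M: "ennreal (norm (V n t \<xi>)) \<le> M n t \<xi>"
  and increment: "ennreal (norm (V (Suc n) t \<xi> - V n t \<xi>)) + M n t \<xi> \<le> M (Suc n) t \<xi>"
  using V_le_M_and_increment[of n] by (blast, blast)

lemma M_mono: "M n t \<xi> \<le> M (Suc n) t \<xi>"
  using increment[of n t \<xi>] by (metis add_increasing order_trans zero_le order_refl)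

definition Msup :: "real \<Rightarrow> real^3 \<Rightarrow> ennreal" where
  "Msup t \<xi> = (SUP n. M n t \<xi>)"

lemma M_le_Msup: "M n t \<xi> \<le> Msup t \<xi>"
  unfolding Msup_def by (rule SUP_upper) auto

lemma jm_Msup: "jointly_measurable Msup"
proof (rule jointly_measurableI)
  note [measurable (raw)] = jointly_measurableD[OF jm_M]
  show "(\<lambda>z. Msup (fst z) (snd z)) \<in> borel_measurable (borel \<Otimes>\<^sub>M borel)"
    unfolding Msup_def by measurable
qed

lemma Msup_le: "Msup t \<xi> \<le> a t \<xi> + majorant Msup Msup t \<xi>"
  unfolding Msup_def
proof (rule SUP_least)
  fix n
  show "M n t \<xi> \<le> a t \<xi> + majorant (\<lambda>t \<xi>. SUP n. M n t \<xi>) (\<lambda>t \<xi>. SUP n. M n t \<xi>) t \<xi>"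
    by (cases n) (auto intro!: add_left_mono majorant_mono SUP_upper)
qed

lemma a_le_Msup: "a t \<xi> \<le> Msup t \<xi>"
  using M_le_Msup[of 1 t \<xi>] by (simp add: majorant_def)

text \<open>The constant reproduces itself: \<open>2 A + 2 \<kappa>\<^sup>2 (4 A)\<^sup>2 \<le> 4 A\<close> if \<open>16 \<kappa>\<^sup>2 A \<le> 1\<close>.\<close>

lemma mixed_sq_M: "mixed_sq (M n) \<le> 4 * mixed_sq a"
proof (induction n)
  case 0
  then show ?case by (simp add: mixed_sq_def)
next
  case (Suc n)
  have "mixed_sq (M (Suc n)) \<le> 2 * mixed_sq a + 2 * mixed_sq (majorant (M n) (M n))"
    unfolding M.simps by (rule mixed_sq_add[OF a jointly_measurable_majorant[OF jm_M jm_M]])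
  also have "\<dots> \<le> 2 * mixed_sq a + 2 * (ennreal (\<kappa>\<^sup>2) * (mixed_sq (M n) * mixed_sq (M n)))"
    by (intro add_left_mono mult_left_mono mixed_sq_majorant jm_M) auto
  also have "\<dots> \<le> 2 * mixed_sq a + 2 * (ennreal (\<kappa>\<^sup>2) * ((4 * mixed_sq a) * (4 * mixed_sq a)))"
    by (intro add_left_mono mult_left_mono mult_mono Suc) auto
  also have "\<dots> = 2 * mixed_sq a + 2 * (ennreal (16 * \<kappa>\<^sup>2) * mixed_sq a) * mixed_sq a"
    by (simp add: ennreal_mult mult_ac)
  also have "\<dots> \<le> 2 * mixed_sq a + 2 * 1 * mixed_sq a"
    by (intro add_left_mono mult_left_mono mult_right_mono small) auto
  also have "\<dots> = 4 * mixed_sq a" by (simp flip: distrib_right)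
  finally show ?case .
qed

lemma mixed_sq_Msup: "mixed_sq Msup \<le> 4 * mixed_sq a"
proof -
  note [measurable (raw)] = jointly_measurableD[OF jm_M]
  have lim: "(\<lambda>n. (\<integral>\<^sup>+\<xi>. M n t \<xi> \<partial>lborel)\<^sup>2) \<longlonglongrightarrow> (\<integral>\<^sup>+\<xi>. Msup t \<xi> \<partial>lborel)\<^sup>2" for t
  proof -
    have "incseq (\<lambda>n. M n t)" by (intro incseq_SucI le_funI M_mono)
    then have eq: "(\<integral>\<^sup>+\<xi>. Msup t \<xi> \<partial>lborel) = (SUP n. \<integral>\<^sup>+\<xi>. M n t \<xi> \<partial>lborel)"
      unfolding Msup_def by (intro nn_integral_monotone_convergence_SUP) auto
    have "incseq (\<lambda>n. \<integral>\<^sup>+\<xi>. M n t \<xi> \<partial>lborel)" by (intro incseq_SucI nn_integral_mono M_mono)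
    then have "(\<lambda>n. \<integral>\<^sup>+\<xi>. M n t \<xi> \<partial>lborel) \<longlonglongrightarrow> (\<integral>\<^sup>+\<xi>. Msup t \<xi> \<partial>lborel)"
      unfolding eq by (rule LIMSEQ_SUP)
    then show ?thesis unfolding power2_eq_square by (intro tendsto_mult_ennreal) auto
  qed
  have "mixed_sq Msup = (\<integral>\<^sup>+t. liminf (\<lambda>n. (\<integral>\<^sup>+\<xi>. M n t \<xi> \<partial>lborel)\<^sup>2) \<partial>lborel)"
    unfolding mixed_sq_def using lim_imp_Liminf[OF sequentially_bot lim] by simp
  also have "\<dots> \<le> liminf (\<lambda>n. \<integral>\<^sup>+t. (\<integral>\<^sup>+\<xi>. M n t \<xi> \<partial>lborel)\<^sup>2 \<partial>lborel)"
    by (rule nn_integral_liminf) measurable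
  also have "\<dots> \<le> liminf (\<lambda>n::nat. 4 * mixed_sq a)"
    by (intro Liminf_mono always_eventually allI mixed_sq_M[unfolded mixed_sq_def] order_trans[OF mixed_sq_M[unfolded mixed_sq_def]]) (simp add: mixed_sq_def)
  also have "\<dots> = 4 * mixed_sq a" by (rule Liminf_const) simp
  finally show ?thesis .
qed

text \<open>The value 0 is taken where the iteration is not controlled, which is a null set.\<close>

definition sol :: "real \<Rightarrow> real^3 \<Rightarrow> complex^(3+3)" where
  "sol t \<xi> = (if Msup t \<xi> < \<infinity> then lim (\<lambda>n. V n t \<xi>) else 0)"

lemma V_tendsto_sol:
  assumes fin: "Msup t \<xi> < \<infinity>"
  shows "(\<lambda>n. V n t \<xi>) \<longlonglongrightarrow> sol t \<xi>"
proof -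
  let ?d = "\<lambda>n. V (Suc n) t \<xi> - V n t \<xi>"
  have part: "ennreal (\<Sum>i<n. norm (?d i)) \<le> M n t \<xi>" for n
  proof (induction n)
    case (Suc n)
    have "ennreal (\<Sum>i<Suc n. norm (?d i)) = ennreal (norm (?d n)) + ennreal (\<Sum>i<n. norm (?d i))"
      by (simp add: sum_nonneg add.commute del: V.simps)
    also have "\<dots> \<le> ennreal (norm (?d n)) + M n t \<xi>" by (intro add_left_mono Suc)
    also have "\<dots> \<le> M (Suc n) t \<xi>" by (rule increment)
    finally show ?case .
  qed simp
  have "summable (\<lambda>n. norm (?d n))"
  proof (rule summableI_nonneg_bounded)
    fix n
    have "ennreal (\<Sum>i<n. norm (?d i)) \<le> ennreal (enn2real (Msup t \<xi>))"
      using order_trans[OF part M_le_Msup] fin by (simp add: less_top)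
    then show "(\<Sum>i<n. norm (?d i)) \<le> enn2real (Msup t \<xi>)" by (simp add: ennreal_le_iff)
  qed auto
  then have "summable ?d" by (rule summable_norm_cancel)
  then have "(\<lambda>n. \<Sum>i<n. ?d i) \<longlonglongrightarrow> suminf ?d" by (rule summable_LIMSEQ)
  moreover have "(\<Sum>i<n. ?d i) = V n t \<xi>" for n
    using sum_lessThan_telescope[of "\<lambda>n. V n t \<xi>" n] by (simp del: V.simps(2))
  ultimately have "(\<lambda>n. V n t \<xi>) \<longlonglongrightarrow> suminf ?d" by simp
  then show ?thesis unfolding sol_def using fin by (simp add: limI)
qed

lemma sol_le_Msup: "ennreal (norm (sol t \<xi>)) \<le> Msup t \<xi>"
proof (cases "Msup t \<xi> < \<infinity>")
  case True
  have "(\<lambda>n. ennreal (norm (V n t \<xi>))) \<longlonglongrightarrow> ennreal (norm (sol t \<xi>))"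
    by (intro tendsto_ennrealI tendsto_norm V_tendsto_sol True)
  then show ?thesis
    by (rule LIMSEQ_le_const2) (intro exI[of _ 0] allI impI order_trans[OF V_le_M M_le_Msup])
qed (simp add: sol_def)

lemma jm_sol: "jointly_measurable sol"
proof (rule jointly_measurableI)
  note [measurable (raw)] = jointly_measurableD[OF jm_V] jointly_measurableD[OF jm_Msup]
  have [measurable]: "(\<lambda>z. lim (\<lambda>n. V n (fst z) (snd z))) \<in> borel_measurable (borel \<Otimes>\<^sub>M borel)"
    by (rule borel_measurable_lim_metric) measurable
  show "(\<lambda>z. sol (fst z) (snd z)) \<in> borel_measurable (borel \<Otimes>\<^sub>M borel)"
    unfolding sol_def by measurable
qed

lemma V_sym: "V n t (- \<xi>) = vcnj (V n t \<xi>)"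
proof (induction n arbitrary: t \<xi>)
  case (Suc n)
  show ?case unfolding V.simps by (simp add: u_sym bil_vcnj[OF jm_V jm_V Suc Suc] vcnj_diff)
qed (simp add: vcnj_def vec_eq_iff)

lemma M_sym: "M n t (- \<xi>) = M n t \<xi>"
proof (induction n arbitrary: t \<xi>)
  case (Suc n)
  show ?case unfolding M.simps by (simp add: a_sym majorant_even[OF jm_M Suc])
qed simp

lemma sol_sym: "sol t (- \<xi>) = vcnj (sol t \<xi>)"
proof (cases "Msup t \<xi> < \<infinity>")
  case True
  then have "Msup t (- \<xi>) < \<infinity>" by (simp add: Msup_def M_sym)
  then have "(\<lambda>n. vcnj (V n t \<xi>)) \<longlonglongrightarrow> sol t (- \<xi>)" using V_tendsto_sol[of t "- \<xi>"] unfolding V_sym by simp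
  moreover have "(\<lambda>n. vcnj (V n t \<xi>)) \<longlonglongrightarrow> vcnj (sol t \<xi>)"
    by (rule bounded_linear.tendsto[OF bounded_linear_vcnj V_tendsto_sol[OF True]])
  ultimately show ?thesis by (rule LIMSEQ_unique)
next
  case False
  then have "\<not> Msup t (- \<xi>) < \<infinity>" by (simp add: Msup_def M_sym)
  with False show ?thesis by (simp add: sol_def vcnj_def vec_eq_iff)
qed

lemma AE_majorant_Msup_finite:
  assumes "mixed_sq a < \<infinity>"
  shows "AE \<xi> in lborel. majorant Msup Msup t \<xi> < \<infinity>"
proof -
  note [measurable (raw)] = jointly_measurableD[OF jointly_measurable_majorant[OF jm_Msup jm_Msup]]
  have "mixed_sq Msup < \<infinity>" using le_less_trans[OF mixed_sq_Msup] assms by (simp add: ennreal_mult_less_top)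
  then have "ennreal (\<kappa>\<^sup>2) * (mixed_sq Msup * mixed_sq Msup) < \<infinity>" by (simp add: ennreal_mult_less_top)
  then have "(weighted_integral (majorant Msup Msup t))\<^sup>2 < \<infinity>"
    using majorant_weighted_bound[OF jm_Msup jm_Msup] le_less_trans by blast
  then have "(weighted_integral (majorant Msup Msup t)) \<noteq> \<infinity>"
    by (auto simp: power2_eq_square)
  then have "AE \<xi> in lborel. majorant Msup Msup t \<xi> * ennreal (1 / norm \<xi>) \<noteq> \<infinity>"
    by (intro nn_integral_PInf_AE) auto
  moreover have "AE \<xi> in lborel. \<xi> \<noteq> (0::real^3)" by (rule AE_lborel_singleton)
  ultimately show ?thesis
  proof eventually_elim
    case (elim \<xi>)
    then show ?case by (auto simp: ennreal_mult_eq_top_iff less_top[symmetric])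
  qed
qed

text \<open>The passage to the limit in the quadratic term is dominated by the integrand of the majorant. Where
  the kernel or one factor of the majorant vanishes, so does the integrand, even if the other factor
  is infinite.\<close>

theorem sol_fixed_point:
  assumes fin: "majorant Msup Msup t \<xi> < \<infinity>"
  shows "sol t \<xi> = u t \<xi> - bil sol sol t \<xi>"
proof -
  have Mfin: "Msup t \<xi> < \<infinity>"
    using le_less_trans[OF Msup_le] afin[of t \<xi>] fin by simp
  note [measurable (raw)] = jointly_measurableD[OF jm_Msup]
  let ?k = "\<lambda>H y. duhamel_kernel t \<xi> (fst y) (H (fst y) (\<xi> - snd y)) (H (fst y) (snd y))"
  let ?m = "\<lambda>y. Msup (fst y) (\<xi> - snd y) * Msup (fst y) (snd y) * heat_kernel t \<xi> (fst y)"
  have mm: "?m \<in> borel_measurable lborel" unfolding lborel_prod[symmetric] by measurable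
  have "(\<integral>\<^sup>+y. ?m y \<partial>lborel) < \<infinity>" using fin unfolding majorant_def .
  then have ae: "AE y in lborel. ?m y \<noteq> \<infinity>" by (intro nn_integral_PInf_AE mm) simp
  have "(\<lambda>n. bil (V n) (V n) t \<xi>) \<longlonglongrightarrow> bil sol sol t \<xi>"
    unfolding bil_def
  proof (rule integral_dominated_convergence[where w="\<lambda>y. enn2real (?m y)"])
    show "?k sol \<in> borel_measurable lborel" by (rule bil_integrand_measurable[OF jm_sol jm_sol])
    show "?k (V n) \<in> borel_measurable lborel" for n by (rule bil_integrand_measurable[OF jm_V jm_V])
    show "integrable lborel (\<lambda>y. enn2real (?m y))"
    proof (rule integrableI_bounded)
      show "(\<lambda>y. enn2real (?m y)) \<in> borel_measurable lborel" using mm by measurable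
      have "(\<integral>\<^sup>+y. ennreal (norm (enn2real (?m y))) \<partial>lborel) \<le> (\<integral>\<^sup>+y. ?m y \<partial>lborel)"
        by (intro nn_integral_mono) (simp add: ennreal_enn2real_if)
      with \<open>(\<integral>\<^sup>+y. ?m y \<partial>lborel) < \<infinity>\<close> show "(\<integral>\<^sup>+y. ennreal (norm (enn2real (?m y))) \<partial>lborel) < \<infinity>" by simp
    qed
    show "AE y in lborel. norm (?k (V n) y) \<le> enn2real (?m y)" for n
      using ae
    proof eventually_elim
      case (elim y)
      have "ennreal (norm (?k (V n) y)) \<le> ?m y"
        by (intro order_trans[OF norm_duhamel_kernel_le] mult_mono order_trans[OF V_le_M M_le_Msup]) auto
      also have "\<dots> = ennreal (enn2real (?m y))" using elim by (simp add: less_top)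
      finally show ?case by (simp add: ennreal_le_iff)
    qed
    show "AE y in lborel. (\<lambda>n. ?k (V n) y) \<longlonglongrightarrow> ?k sol y"
      using ae
    proof eventually_elim
      case (elim y)
      interpret b: bounded_bilinear "duhamel_kernel t \<xi> (fst y)" by (rule bounded_bilinear_duhamel_kernel)
      consider "heat_kernel t \<xi> (fst y) = 0" | "Msup (fst y) (\<xi> - snd y) = 0" | "Msup (fst y) (snd y) = 0"
        | "Msup (fst y) (\<xi> - snd y) < \<infinity>" "Msup (fst y) (snd y) < \<infinity>"
        using elim by (auto simp: less_top ennreal_mult_eq_top_iff)
      then show ?case
      proof cases
        case 1
        have "duhamel_kernel t \<xi> (fst y) v w = 0" for v w
          using norm_duhamel_kernel_le[of t \<xi> "fst y" v w] by (simp add: 1)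
        then show ?thesis by simp
      next
        case 2
        then have "V n (fst y) (\<xi> - snd y) = 0" "sol (fst y) (\<xi> - snd y) = 0" for n
          using order_trans[OF V_le_M M_le_Msup, of n "fst y" "\<xi> - snd y"] sol_le_Msup[of "fst y" "\<xi> - snd y"] by auto
        then show ?thesis by (simp add: b.zero_left)
      next
        case 3
        then have "V n (fst y) (snd y) = 0" "sol (fst y) (snd y) = 0" for n
          using order_trans[OF V_le_M M_le_Msup, of n "fst y" "snd y"] sol_le_Msup[of "fst y" "snd y"] by auto
        then show ?thesis by (simp add: b.zero_right)
      next
        case 4
        then show ?thesis by (intro b.tendsto V_tendsto_sol)
      qed
    qed
  qed
  then have "(\<lambda>n. V (Suc n) t \<xi>) \<longlonglongrightarrow> u t \<xi> - bil sol sol t \<xi>"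
    unfolding V.simps by (intro tendsto_diff tendsto_const)
  moreover have "(\<lambda>n. V (Suc n) t \<xi>) \<longlonglongrightarrow> sol t \<xi>"
    using V_tendsto_sol[OF Mfin] by (rule LIMSEQ_Suc)
  ultimately show ?thesis by (rule LIMSEQ_unique[symmetric])
qed

lemma sol_minus_u_le: "ennreal (norm (sol t \<xi> - u t \<xi>)) \<le> majorant Msup Msup t \<xi>"
proof (cases "majorant Msup Msup t \<xi> < \<infinity>")
  case True
  then have "ennreal (norm (sol t \<xi> - u t \<xi>)) = ennreal (norm (bil sol sol t \<xi>))"
    by (simp add: sol_fixed_point)
  also have "\<dots> \<le> majorant Msup Msup t \<xi>" by (rule bil_bound(2)[OF jm_sol sol_le_Msup jm_sol sol_le_Msup True])
  finally show ?thesis .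
next
  case False
  then have "majorant Msup Msup t \<xi> = top" by (metis infinity_ennreal_def less_top)
  then show ?thesis by simp
qed

text \<open>As \<open>sol - u\<close> is of second order, replacing \<open>u\<close> by \<open>sol\<close> in the arguments of the bilinear operator
  makes an error of third order.\<close>

theorem third_order_remainder:
  assumes fin: "mixed_sq a < \<infinity>"
  shows "(weighted_integral (\<lambda>\<xi>. ennreal (norm (bil sol sol t \<xi> - bil u u t \<xi>))))\<^sup>2
    \<le> ennreal (256 * \<kappa> ^ 4) * mixed_sq a ^ 3"
proof -
  let ?D = "majorant Msup Msup"
  have D: "jointly_measurable ?D" by (rule jointly_measurable_majorant[OF jm_Msup jm_Msup])
  note [measurable (raw)] = jointly_measurableD[OF jointly_measurable_majorant[OF D jm_Msup]]
    jointly_measurableD[OF jointly_measurable_majorant[OF jm_Msup D]]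
  have "AE \<xi> in lborel. ennreal (norm (bil sol sol t \<xi> - bil u u t \<xi>)) * ennreal (1 / norm \<xi>)
      \<le> majorant ?D Msup t \<xi> * ennreal (1 / norm \<xi>) + majorant Msup ?D t \<xi> * ennreal (1 / norm \<xi>)"
    using AE_majorant_Msup_finite[OF fin, of t]
  proof eventually_elim
    case (elim \<xi>)
    show ?case unfolding distrib_right[symmetric]
      by (intro mult_right_mono bil_diff_bound[OF u order_trans[OF ua a_le_Msup] jm_sol sol_le_Msup jm_Msup D sol_minus_u_le elim]) auto
  qed
  then have "(weighted_integral (\<lambda>\<xi>. ennreal (norm (bil sol sol t \<xi> - bil u u t \<xi>))))
     \<le> (weighted_integral (majorant ?D Msup t)) + (weighted_integral (majorant Msup ?D t))"
    by (subst nn_integral_add[symmetric]) (auto intro: nn_integral_mono_AE)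
  then have "(weighted_integral (\<lambda>\<xi>. ennreal (norm (bil sol sol t \<xi> - bil u u t \<xi>))))\<^sup>2
     \<le> ((weighted_integral (majorant ?D Msup t)) + (weighted_integral (majorant Msup ?D t)))\<^sup>2"
    by (rule power_mono) simp
  also have "\<dots> \<le> 2 * (weighted_integral (majorant ?D Msup t))\<^sup>2
      + 2 * (weighted_integral (majorant Msup ?D t))\<^sup>2" by (rule sum_sq_le_ennreal)
  also have "\<dots> \<le> 2 * (ennreal (\<kappa>\<^sup>2) * (mixed_sq ?D * mixed_sq Msup)) + 2 * (ennreal (\<kappa>\<^sup>2) * (mixed_sq Msup * mixed_sq ?D))"
    by (intro add_mono mult_left_mono majorant_weighted_bound D jm_Msup) auto
  also have "\<dots> = (2 + 2) * (ennreal (\<kappa>\<^sup>2) * (mixed_sq ?D * mixed_sq Msup))"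
    by (simp only: distrib_right mult.commute[of "mixed_sq Msup"])
  also have "\<dots> \<le> (2 + 2) * (ennreal (\<kappa>\<^sup>2) * ((ennreal (\<kappa>\<^sup>2) * ((4 * mixed_sq a) * (4 * mixed_sq a))) * (4 * mixed_sq a)))"
    by (intro mult_left_mono mult_mono order_trans[OF mixed_sq_majorant[OF jm_Msup jm_Msup]] mixed_sq_Msup) auto
  also have "\<dots> = ennreal (256 * \<kappa> ^ 4) * mixed_sq a ^ 3"
  proof -
    have "ennreal (256 * \<kappa> ^ 4) = 256 * (ennreal (\<kappa>\<^sup>2) * ennreal (\<kappa>\<^sup>2))"
      by (simp add: ennreal_mult power_add[symmetric] flip: ennreal_mult[of "\<kappa>\<^sup>2" "\<kappa>\<^sup>2"])
    moreover have "(2 + 2) * (c * ((c * ((4 * A) * (4 * A))) * (4 * A))) = ((2 + 2) * 4 * 4 * 4) * (c * c) * (A * A * A)"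
      for c A :: ennreal by (simp only: mult_ac)
    ultimately show ?thesis by (simp add: power3_eq_cube)
  qed
  finally show ?thesis .
qed

end

section \<open>Mild solutions\<close>

text \<open>The extension by zero to negative times allows integrals over the whole time axis.\<close>

definition linear_flow :: "(real^3 \<Rightarrow> complex^(3+3)) \<Rightarrow> real \<Rightarrow> real^3 \<Rightarrow> complex^(3+3)" where
  "linear_flow h t \<xi> = (if t < 0 then 0 else propagator t \<xi> (h \<xi>))"

definition heat_majorant :: "(real^3 \<Rightarrow> complex^(3+3)) \<Rightarrow> real \<Rightarrow> real^3 \<Rightarrow> ennreal" where
  "heat_majorant h t \<xi> = (if t < 0 then 0 else ennreal (exp (- t * (norm \<xi>)\<^sup>2 / 2) * norm (h \<xi>)))"

definition freq_vec :: "(real^3 \<Rightarrow> complex^'n) \<Rightarrow> tdist^'n" where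
  "freq_vec h = (\<chi> i. freq_dist (\<lambda>\<xi>. h \<xi> $ i))"

lemma freq_vec_nth [simp]: "freq_vec h $ i = freq_dist (\<lambda>\<xi>. h \<xi> $ i)"
  by (simp add: freq_vec_def)

definition weighted_mass :: "(real^3 \<Rightarrow> complex^'n) \<Rightarrow> ennreal" where
  "weighted_mass h = (weighted_integral (\<lambda>\<xi>. ennreal (norm (h \<xi>))))"

lemma component_weighted_mass:
  "(\<integral>\<^sup>+\<xi>. ennreal (cmod (h \<xi> $ i) / norm \<xi>) \<partial>lborel) \<le> weighted_mass h"
proof -
  have "cmod (h \<xi> $ i) / norm \<xi> \<le> norm (h \<xi>) * (1 / norm \<xi>)" for \<xi>
    using mult_right_mono[OF Finite_Cartesian_Product.norm_nth_le, of "1 / norm \<xi>" "h \<xi>" i] by simp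
  then show ?thesis unfolding weighted_mass_def
    by (intro nn_integral_mono) (simp add: ennreal_leI flip: ennreal_mult)
qed

lemma freq_admissible_component:
  assumes [measurable]: "h \<in> borel_measurable borel" and "weighted_mass h < \<infinity>"
  shows "freq_admissible (\<lambda>\<xi>. h \<xi> $ i)"
  by (rule freq_admissibleI) (use le_less_trans[OF component_weighted_mass assms(2)] in auto)

lemma freq_dist_sum:
  assumes "\<And>k. k \<in> K \<Longrightarrow> freq_admissible (h k)" "schwartz \<phi>"
  shows "freq_dist (\<lambda>\<xi>. \<Sum>k\<in>K. h k \<xi>) \<phi> = (\<Sum>k\<in>K. freq_dist (h k) \<phi>)"
  unfolding freq_dist_def sum_distrib_right
  by (rule Bochner_Integration.integral_sum) (rule freq_dist_integrable(1)[OF assms(1) assms(2)])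

text \<open>The Fourier transform of the nonlinearity of a field with Fourier transform \<open>F\<close>, assembled
  from convolutions in the order in which products, divergence and projection are taken.\<close>

definition product_hat :: "(real^3 \<Rightarrow> complex^(3+3)) \<Rightarrow> 3+3 \<Rightarrow> 3+3 \<Rightarrow> real^3 \<Rightarrow> complex" where
  "product_hat F a b \<xi> = of_real (1 / (2 * pi) ^ 3) * conv (\<lambda>\<eta>. F \<eta> $ a) (\<lambda>\<eta>. F \<eta> $ b) \<xi>"

definition divergence_hat :: "(real^3 \<Rightarrow> complex^(3+3)) \<Rightarrow> 3+3 \<Rightarrow> real^3 \<Rightarrow> complex" where
  "divergence_hat F b \<xi> = (\<Sum>m\<in>UNIV. \<i> * of_real (\<xi>$m) * product_hat F (Inl m) b \<xi>)"

definition nonlinearity_hat :: "(real^3 \<Rightarrow> complex^(3+3)) \<Rightarrow> real^3 \<Rightarrow> complex^(3+3)" where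
  "nonlinearity_hat F \<xi> = (\<chi> a. case a of
      Inl k \<Rightarrow> (\<Sum>l\<in>UNIV. (mat 1 $ k $ l - of_real (\<xi>$k * \<xi>$l / (norm \<xi>)\<^sup>2)) * divergence_hat F (Inl l) \<xi>)
    | Inr l \<Rightarrow> divergence_hat F (Inr l) \<xi>)"

lemma integral_linear_combination:
  fixes S :: "'i::finite \<Rightarrow> 'a \<Rightarrow> complex"
  assumes "\<And>l. integrable M (S l)"
  shows "(LINT x|M. (\<Sum>l\<in>UNIV. P l * S l x)) = (\<Sum>l\<in>UNIV. P l * (LINT x|M. S l x))"
  by (subst Bochner_Integration.integral_sum)
    (intro integrable_mult_right assms, simp only: integral_mult_right_zero)

lemma nonlinearity_hat_eq:
  assumes [measurable]: "F \<in> borel_measurable borel"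
    and fin: "(\<integral>\<^sup>+\<eta>. ennreal (norm (F (\<xi> - \<eta>))) * ennreal (norm (F \<eta>)) \<partial>lborel) < \<infinity>"
  shows "integrable lborel (\<lambda>\<eta>. nl \<xi> (F (\<xi> - \<eta>)) (F \<eta>))"
    and "nonlinearity_hat F \<xi> = (LINT \<eta>|lborel. nl \<xi> (F (\<xi> - \<eta>)) (F \<eta>))"
proof -
  have i: "integrable lborel (\<lambda>\<eta>. F (\<xi> - \<eta>) $ a * F \<eta> $ b)" for a b
  proof (rule integrableI_bounded)
    have "(\<integral>\<^sup>+\<eta>. ennreal (norm (F (\<xi> - \<eta>) $ a * F \<eta> $ b)) \<partial>lborel)
        \<le> (\<integral>\<^sup>+\<eta>. ennreal (norm (F (\<xi> - \<eta>))) * ennreal (norm (F \<eta>)) \<partial>lborel)"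
      unfolding norm_mult
      by (intro nn_integral_mono) (simp add: ennreal_leI mult_mono Finite_Cartesian_Product.norm_nth_le flip: ennreal_mult)
    then show "(\<integral>\<^sup>+\<eta>. ennreal (norm (F (\<xi> - \<eta>) $ a * F \<eta> $ b)) \<partial>lborel) < \<infinity>" using fin by (rule le_less_trans)
  qed measurable
  show int: "integrable lborel (\<lambda>\<eta>. nl \<xi> (F (\<xi> - \<eta>)) (F \<eta>))"
  proof (rule integrableI_bounded)
    have "(\<integral>\<^sup>+\<eta>. ennreal (norm (nl \<xi> (F (\<xi> - \<eta>)) (F \<eta>))) \<partial>lborel)
        \<le> (\<integral>\<^sup>+\<eta>. ennreal (\<kappa> * norm \<xi>) * (ennreal (norm (F (\<xi> - \<eta>))) * ennreal (norm (F \<eta>))) \<partial>lborel)"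
      using norm_nl_le[of \<xi>] \<kappa>_pos
      by (intro nn_integral_mono) (simp add: ennreal_leI less_imp_le mult.assoc flip: ennreal_mult)
    also have "\<dots> < \<infinity>" using fin by (simp add: nn_integral_cmult ennreal_mult_less_top)
    finally show "(\<integral>\<^sup>+\<eta>. ennreal (norm (nl \<xi> (F (\<xi> - \<eta>)) (F \<eta>))) \<partial>lborel) < \<infinity>" .
  qed measurable
  have d: "divergence_hat F b \<xi> = of_real (1 / (2 * pi) ^ 3) * (LINT \<eta>|lborel. (\<Sum>m\<in>UNIV. \<i> * of_real (\<xi>$m) * (F (\<xi> - \<eta>) $ Inl m * F \<eta> $ b)))" for b
  proof -
    have "(LINT \<eta>|lborel. (\<Sum>m\<in>UNIV. \<i> * of_real (\<xi>$m) * (F (\<xi> - \<eta>) $ Inl m * F \<eta> $ b)))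
        = (\<Sum>m\<in>UNIV. \<i> * of_real (\<xi>$m) * (LINT \<eta>|lborel. F (\<xi> - \<eta>) $ Inl m * F \<eta> $ b))"
      by (rule integral_linear_combination) (rule i)
    then show ?thesis
      unfolding divergence_hat_def product_hat_def conv_def by (simp only: sum_distrib_left mult.left_commute)
  qed
  have di: "integrable lborel (\<lambda>\<eta>. \<Sum>m\<in>UNIV. \<i> * of_real (\<xi>$m) * (F (\<xi> - \<eta>) $ Inl m * F \<eta> $ b))" for b
    by (intro Bochner_Integration.integrable_sum integrable_mult_right i)
  show "nonlinearity_hat F \<xi> = (LINT \<eta>|lborel. nl \<xi> (F (\<xi> - \<eta>)) (F \<eta>))"
    unfolding vec_eq_iff
  proof
    fix a
    have *: "(LINT \<eta>|lborel. nl \<xi> (F (\<xi> - \<eta>)) (F \<eta>)) $ a = (LINT \<eta>|lborel. nl \<xi> (F (\<xi> - \<eta>)) (F \<eta>) $ a)"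
      by (rule integral_bounded_linear[OF bounded_linear_vec_nth int, symmetric])
    show "nonlinearity_hat F \<xi> $ a = (LINT \<eta>|lborel. nl \<xi> (F (\<xi> - \<eta>)) (F \<eta>)) $ a"
    proof (cases a)
      case (Inl k)
      show ?thesis
        unfolding *
        unfolding Inl nl_def nonlinearity_hat_def vec_lambda_beta sum.case d integral_mult_right_zero
          integral_linear_combination[OF di]
        by (simp only: sum_distrib_left mult.left_commute)
    next
      case (Inr l)
      show ?thesis
        unfolding *
        unfolding Inr nl_def nonlinearity_hat_def vec_lambda_beta sum.case d integral_mult_right_zero ..
    qed
  qed
qed

lemma norm_nonlinearity_hat_le:
  assumes [measurable]: "F \<in> borel_measurable borel"
  shows "ennreal (norm (nonlinearity_hat F \<xi>))
    \<le> ennreal (\<kappa> * norm \<xi>) * (\<integral>\<^sup>+\<eta>. ennreal (norm (F (\<xi> - \<eta>))) * ennreal (norm (F \<eta>)) \<partial>lborel)"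
proof (cases "(\<integral>\<^sup>+\<eta>. ennreal (norm (F (\<xi> - \<eta>))) * ennreal (norm (F \<eta>)) \<partial>lborel) < \<infinity>")
  case True
  note eq = nonlinearity_hat_eq[OF assms True]
  have "ennreal (norm (nonlinearity_hat F \<xi>)) \<le> (\<integral>\<^sup>+\<eta>. ennreal (norm (nl \<xi> (F (\<xi> - \<eta>)) (F \<eta>))) \<partial>lborel)"
    unfolding eq(2) by (rule integral_norm_bound_ennreal[OF eq(1)])
  also have "\<dots> \<le> (\<integral>\<^sup>+\<eta>. ennreal (\<kappa> * norm \<xi>) * (ennreal (norm (F (\<xi> - \<eta>))) * ennreal (norm (F \<eta>))) \<partial>lborel)"
    using norm_nl_le[of \<xi>] \<kappa>_pos
    by (intro nn_integral_mono) (simp add: ennreal_leI less_imp_le mult.assoc flip: ennreal_mult)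
  also have "\<dots> = ennreal (\<kappa> * norm \<xi>) * (\<integral>\<^sup>+\<eta>. ennreal (norm (F (\<xi> - \<eta>))) * ennreal (norm (F \<eta>)) \<partial>lborel)"
    by (rule nn_integral_cmult) measurable
  finally show ?thesis .
next
  case False
  then have top: "(\<integral>\<^sup>+\<eta>. ennreal (norm (F (\<xi> - \<eta>))) * ennreal (norm (F \<eta>)) \<partial>lborel) = top"
    unfolding infinity_ennreal_def less_top[symmetric] by simp
  show ?thesis
  proof (cases "\<xi> = 0")
    case True
    have "nonlinearity_hat F \<xi> $ a = 0" for a
      by (cases a) (simp_all add: True nonlinearity_hat_def divergence_hat_def)
    then have "nonlinearity_hat F \<xi> = 0" by (simp add: vec_eq_iff)
    then show ?thesis by simp
  next
    case False
    then have "ennreal (\<kappa> * norm \<xi>) \<noteq> 0" using \<kappa>_pos by (simp add: ennreal_eq_0_iff not_le)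
    then have "ennreal (\<kappa> * norm \<xi>) * top = top" by (simp only: ennreal_mult_top if_False)
    then show ?thesis unfolding top by simp
  qed
qed

lemma nonlinearity_hat_measurable:
  assumes "jointly_measurable F"
  shows "jointly_measurable (\<lambda>\<tau>. nonlinearity_hat (F \<tau>))"
proof (rule jointly_measurableI)
  note [measurable (raw)] = jointly_measurableD[OF assms]
  have [measurable]: "(\<lambda>z. conv (\<lambda>\<eta>. F (fst z) \<eta> $ a) (\<lambda>\<eta>. F (fst z) \<eta> $ b) (snd z)) \<in> borel_measurable (borel \<Otimes>\<^sub>M borel)" for a b
    unfolding conv_def by (rule lborel.borel_measurable_lebesgue_integral) measurable
  have [measurable]: "(\<lambda>z. divergence_hat (F (fst z)) b (snd z)) \<in> borel_measurable (borel \<Otimes>\<^sub>M borel)" for b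
    unfolding divergence_hat_def product_hat_def by measurable
  show "(\<lambda>z. nonlinearity_hat (F (fst z)) (snd z)) \<in> borel_measurable (borel \<Otimes>\<^sub>M borel)"
  proof (rule measurable_vecI)
    fix a
    show "(\<lambda>z. nonlinearity_hat (F (fst z)) (snd z) $ a) \<in> borel_measurable (borel \<Otimes>\<^sub>M borel)"
      by (cases a) (simp_all add: nonlinearity_hat_def)
  qed
qed

lemma nonlinearity_freq_vec:
  assumes [measurable]: "F \<in> borel_measurable borel" and fin: "(\<integral>\<^sup>+\<xi>. ennreal (norm (F \<xi>)) \<partial>lborel) < \<infinity>"
    and N: "weighted_mass (nonlinearity_hat F) < \<infinity>" and [measurable]: "nonlinearity_hat F \<in> borel_measurable borel"
  shows "nonlinearity (freq_vec F) (freq_vec (nonlinearity_hat F))"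
proof -
  have i: "integrable lborel (\<lambda>\<xi>. F \<xi> $ a)" for a
  proof (rule integrableI_bounded)
    have "(\<integral>\<^sup>+\<xi>. ennreal (norm (F \<xi> $ a)) \<partial>lborel) \<le> (\<integral>\<^sup>+\<xi>. ennreal (norm (F \<xi>)) \<partial>lborel)"
      by (intro nn_integral_mono ennreal_leI Finite_Cartesian_Product.norm_nth_le)
    then show "(\<integral>\<^sup>+\<xi>. ennreal (norm (F \<xi> $ a)) \<partial>lborel) < \<infinity>" using fin by (rule le_less_trans)
  qed measurable
  have pint: "integrable lborel (product_hat F a b)" for a b
    unfolding product_hat_def[abs_def] by (intro integrable_mult_right integrable_conv i)
  have [measurable]: "product_hat F a b \<in> borel_measurable borel" for a b
    using borel_measurable_integrable[OF pint] by simp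
  have adm1: "freq_admissible (\<lambda>\<xi>. \<i> * of_real (\<xi>$m) * product_hat F a b \<xi>)" for m a b
  proof (rule freq_admissibleI)
    have "cmod (\<i> * of_real (\<xi>$m) * product_hat F a b \<xi>) / norm \<xi> \<le> cmod (product_hat F a b \<xi>)" for \<xi>
      using mult_right_mono[OF component_le_norm_cart[of \<xi> m], of "cmod (product_hat F a b \<xi>)"]
      by (cases "\<xi> = 0") (auto simp: norm_mult divide_le_eq mult.commute)
    then have "(\<integral>\<^sup>+\<xi>. ennreal (cmod (\<i> * of_real (\<xi>$m) * product_hat F a b \<xi>) / norm \<xi>) \<partial>lborel)
        \<le> (\<integral>\<^sup>+\<xi>. ennreal (cmod (product_hat F a b \<xi>)) \<partial>lborel)"
      by (intro nn_integral_mono ennreal_leI)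
    also have "\<dots> < \<infinity>" using pint[of a b] by (simp add: integrable_iff_bounded)
    finally show "(\<integral>\<^sup>+\<xi>. ennreal (cmod (\<i> * of_real (\<xi>$m) * product_hat F a b \<xi>) / norm \<xi>) \<partial>lborel) < \<infinity>" .
  qed measurable
  have adm: "freq_admissible (divergence_hat F b)" for b
    using adm1[unfolded freq_admissible_def, of _ "Inl _" b]
    unfolding freq_admissible_def divergence_hat_def[abs_def] sum_divide_distrib
    by (intro Bochner_Integration.integrable_sum)
  have div: "freq_dist (divergence_hat F b) \<phi> = (\<Sum>k\<in>UNIV. dist_deriv k (freq_dist (product_hat F (Inl k) b)) \<phi>)"
    if "schwartz \<phi>" for b \<phi>
    using freq_dist_sum[of UNIV "\<lambda>m \<xi>. \<i> * of_real (\<xi>$m) * product_hat F (Inl m) b \<xi>" \<phi>, OF adm1 that]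
    unfolding divergence_hat_def[abs_def] dist_deriv_freq_dist[OF that] .
  have prod: "dist_product (freq_dist (\<lambda>\<xi>. F \<xi> $ a)) (freq_dist (\<lambda>\<xi>. F \<xi> $ b)) (freq_dist (product_hat F a b))" for a b
    unfolding product_hat_def[abs_def] by (rule dist_product_freq_dist[OF i i])
  have w1: "div_tensor (velocity (freq_vec F)) (velocity (freq_vec F)) (freq_vec (\<lambda>\<xi>. \<chi> l. divergence_hat F (Inl l) \<xi>))"
    unfolding div_tensor_def
    by (rule exI[of _ "\<lambda>k l. freq_dist (product_hat F (Inl k) (Inl l))"]) (simp add: velocity_def prod div)
  have w2: "div_tensor (velocity (freq_vec F)) (microrotation (freq_vec F)) (microrotation (freq_vec (nonlinearity_hat F)))"
    unfolding div_tensor_def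
    by (rule exI[of _ "\<lambda>k l. freq_dist (product_hat F (Inl k) (Inr l))"])
      (simp add: velocity_def microrotation_def prod div nonlinearity_hat_def)
  have l: "leray (freq_vec (\<lambda>\<xi>. \<chi> l. divergence_hat F (Inl l) \<xi>)) (velocity (freq_vec (nonlinearity_hat F)))"
    unfolding leray_def fourier_mult_def
  proof (rule exI[of _ "\<lambda>\<xi>. \<chi> l. divergence_hat F (Inl l) \<xi>"], intro conjI allI)
    fix k :: 3
    show "has_fourier (freq_vec (\<lambda>\<xi>. \<chi> l. divergence_hat F (Inl l) \<xi>) $ k) (\<lambda>\<xi>. (\<chi> l. divergence_hat F (Inl l) \<xi>) $ k)"
      using has_fourier_freq_dist[OF adm[of "Inl k"]] by simp
    have eq: "((\<chi> k l. mat 1 $ k $ l - of_real (\<xi>$k * \<xi>$l / (norm \<xi>)\<^sup>2)) *v (\<chi> l. divergence_hat F (Inl l) \<xi>)) $ k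
        = nonlinearity_hat F \<xi> $ Inl k" for \<xi>
      by (simp add: matrix_vector_mult_def nonlinearity_hat_def)
    show "has_fourier (velocity (freq_vec (nonlinearity_hat F)) $ k)
       (\<lambda>\<xi>. ((\<chi> k l. mat 1 $ k $ l - of_real (\<xi>$k * \<xi>$l / (norm \<xi>)\<^sup>2)) *v (\<chi> l. divergence_hat F (Inl l) \<xi>)) $ k)"
      unfolding eq using has_fourier_freq_dist[OF freq_admissible_component[OF _ N, of "Inl k"]]
      by (simp add: velocity_def)
  qed
  show ?thesis unfolding nonlinearity_def using w1 w2 l by blast
qed

lemma bounded_linear_propagator:
  assumes "s \<ge> 0"
  shows "bounded_linear (propagator s \<xi>)"
  by (rule bounded_linear_intro[where K=1])
    (auto simp: propagator_add propagator_scaleR norm_propagator_le'[OF assms])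

lemma continuous_propagator: "isCont (\<lambda>t. propagator t \<xi> v) s"
  using has_vector_derivative_continuous[OF has_vector_derivative_propagator(1)[of \<xi> v s UNIV]] by simp

lemma convolution_mass_slice:
  fixes M N :: "real^3 \<Rightarrow> ennreal"
  assumes [measurable]: "M \<in> borel_measurable borel" "N \<in> borel_measurable borel"
  shows "(\<integral>\<^sup>+\<xi>. \<integral>\<^sup>+\<eta>. M (\<xi> - \<eta>) * N \<eta> \<partial>lborel \<partial>lborel) = (\<integral>\<^sup>+\<xi>. M \<xi> \<partial>lborel) * (\<integral>\<^sup>+\<xi>. N \<xi> \<partial>lborel)"
proof -
  have "(\<integral>\<^sup>+\<xi>. \<integral>\<^sup>+\<eta>. M (\<xi> - \<eta>) * N \<eta> \<partial>lborel \<partial>lborel) = (\<integral>\<^sup>+\<eta>. \<integral>\<^sup>+\<xi>. M (\<xi> - \<eta>) * N \<eta> \<partial>lborel \<partial>lborel)"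
    by (rule nn_integral_lborel_swap) measurable
  also have "\<dots> = (\<integral>\<^sup>+\<eta>. (\<integral>\<^sup>+\<xi>. M \<xi> \<partial>lborel) * N \<eta> \<partial>lborel)"
    by (simp add: nn_integral_multc nn_integral_translate_reflect)
  finally show ?thesis by (simp add: nn_integral_cmult)
qed

lemma AE_time_neq: "AE z in (lborel :: ((real^3) \<times> (real \<times> (real^3))) measure). fst (snd z) \<noteq> t"
proof -
  have 1: "AE y in (lborel :: (real \<times> (real^3)) measure). fst y \<noteq> t"
    unfolding lborel_prod[symmetric]
  proof (rule lborel_pair.AE_pair_measure)
    show "{y \<in> space ((lborel :: real measure) \<Otimes>\<^sub>M (lborel :: (real^3) measure)). fst y \<noteq> t} \<in> sets (lborel \<Otimes>\<^sub>M lborel)"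
      by measurable
    show "AE x in (lborel :: real measure). AE y in (lborel :: (real^3) measure). fst (x, y) \<noteq> t"
      using AE_lborel_singleton[of t] by eventually_elim simp
  qed
  show ?thesis
    unfolding lborel_prod[where 'a="real^3" and 'b="real \<times> (real^3)", symmetric]
  proof (rule lborel_pair.AE_pair_measure)
    show "{z \<in> space ((lborel :: (real^3) measure) \<Otimes>\<^sub>M (lborel :: (real \<times> (real^3)) measure)). fst (snd z) \<noteq> t}
        \<in> sets (lborel \<Otimes>\<^sub>M lborel)"
      unfolding lborel_prod[where 'a=real and 'b="real^3", symmetric] by measurable
    show "AE x in (lborel :: (real^3) measure). AE y in (lborel :: (real \<times> (real^3)) measure). fst (snd (x, y)) \<noteq> t"
      using 1 by simp
  qed
qed

lemma jointly_measurable_linear_flow: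
  assumes [measurable]: "h \<in> borel_measurable borel"
  shows "jointly_measurable (linear_flow h)"
  by (rule jointly_measurableI) (unfold linear_flow_def, measurable)

lemma jointly_measurable_heat_majorant:
  assumes [measurable]: "h \<in> borel_measurable borel"
  shows "jointly_measurable (heat_majorant h)"
  by (rule jointly_measurableI) (unfold heat_majorant_def, measurable)

lemma linear_flow_le: "ennreal (norm (linear_flow h t \<xi>)) \<le> heat_majorant h t \<xi>"
  using norm_propagator_le[of t \<xi> "h \<xi>"] by (auto simp: linear_flow_def heat_majorant_def intro!: ennreal_leI)

text \<open>Here \<open>h0\<close> is the Fourier transform of the data. The finite weighted mass places them in the
  Fourier-Besov space, without any smallness; small is only the norm of the majorant of their linear
  evolution.\<close>

locale micropolar_data = littlewood_paley_partition \<psi> for \<psi> +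
  fixes h0 :: "real^3 \<Rightarrow> complex^(3+3)"
  assumes h0_meas [measurable]: "h0 \<in> borel_measurable borel"
    and h0_sym: "\<And>\<xi>. h0 (- \<xi>) = vcnj (h0 \<xi>)"
    and h0_mass: "weighted_mass h0 < \<infinity>"
    and h0_small: "ennreal (16 * \<kappa>\<^sup>2) * mixed_sq (heat_majorant h0) \<le> 1"
begin

sublocale picard "linear_flow h0" "heat_majorant h0"
proof
  show "jointly_measurable (linear_flow h0)" by (rule jointly_measurable_linear_flow) measurable
  show "jointly_measurable (heat_majorant h0)" by (rule jointly_measurable_heat_majorant) measurable
  show "linear_flow h0 t (- \<xi>) = vcnj (linear_flow h0 t \<xi>)" for t \<xi>
    by (simp add: linear_flow_def h0_sym propagator_vcnj)
  show "heat_majorant h0 t (- \<xi>) = heat_majorant h0 t \<xi>" for t \<xi>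
    by (simp add: heat_majorant_def h0_sym)
  show "heat_majorant h0 t \<xi> < \<infinity>" for t \<xi> by (simp add: heat_majorant_def)
qed (use h0_small linear_flow_le in auto)

lemma mixed_sq_data_finite: "mixed_sq (heat_majorant h0) < \<infinity>"
proof (rule ccontr)
  assume "\<not> mixed_sq (heat_majorant h0) < \<infinity>"
  then have "mixed_sq (heat_majorant h0) = top" unfolding infinity_ennreal_def less_top[symmetric] by simp
  moreover have "ennreal (16 * \<kappa>\<^sup>2) \<noteq> 0" using \<kappa>_pos by (simp add: ennreal_eq_0_iff not_le)
  then have "ennreal (16 * \<kappa>\<^sup>2) * top = top" by (simp only: ennreal_mult_top if_False)
  ultimately show False using h0_small by (simp add: top_unique)
qed

lemma mixed_sq_Msup_finite: "mixed_sq Msup < \<infinity>"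
  using le_less_trans[OF mixed_sq_Msup] mixed_sq_data_finite by (simp add: ennreal_mult_less_top)

lemma weighted_majorant_finite: "(weighted_integral (majorant Msup Msup t)) < \<infinity>"
proof -
  have "ennreal (\<kappa>\<^sup>2) * (mixed_sq Msup * mixed_sq Msup) < \<infinity>"
    using mixed_sq_Msup_finite by (simp add: ennreal_mult_less_top)
  then have "(weighted_integral (majorant Msup Msup t))\<^sup>2 < \<infinity>"
    using majorant_weighted_bound[OF jm_Msup jm_Msup] le_less_trans by blast
  then show ?thesis by (simp add: power_less_top_ennreal)
qed

lemma sol_measurable [measurable]: "sol t \<in> borel_measurable borel"
  using jointly_measurableD[OF jm_sol, of "\<lambda>_. t" borel "\<lambda>x. x"] by simp

lemma weighted_mass_sol_finite:
  assumes "t \<ge> 0"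
  shows "weighted_mass (sol t) < \<infinity>"
proof -
  note [measurable (raw)] = jointly_measurableD[OF jointly_measurable_majorant[OF jm_Msup jm_Msup]]
  have "ennreal (norm (sol t \<xi>)) \<le> ennreal (norm (h0 \<xi>)) + majorant Msup Msup t \<xi>" for \<xi>
  proof -
    have "norm (sol t \<xi>) \<le> norm (linear_flow h0 t \<xi>) + norm (sol t \<xi> - linear_flow h0 t \<xi>)"
      using norm_triangle_ineq[of "linear_flow h0 t \<xi>" "sol t \<xi> - linear_flow h0 t \<xi>"] by simp
    also have "\<dots> \<le> norm (h0 \<xi>) + norm (sol t \<xi> - linear_flow h0 t \<xi>)"
      using assms by (simp add: linear_flow_def norm_propagator_le')
    finally have "ennreal (norm (sol t \<xi>)) \<le> ennreal (norm (h0 \<xi>)) + ennreal (norm (sol t \<xi> - linear_flow h0 t \<xi>))"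
      by (simp add: ennreal_leI flip: ennreal_plus)
    also have "\<dots> \<le> ennreal (norm (h0 \<xi>)) + majorant Msup Msup t \<xi>" by (intro add_left_mono sol_minus_u_le)
    finally show ?thesis .
  qed
  then have "weighted_mass (sol t) \<le> (\<integral>\<^sup>+\<xi>. ennreal (norm (h0 \<xi>)) * ennreal (1 / norm \<xi>) + majorant Msup Msup t \<xi> * ennreal (1 / norm \<xi>) \<partial>lborel)"
    unfolding weighted_mass_def distrib_right[symmetric] by (intro nn_integral_mono mult_right_mono) auto
  also have "\<dots> = weighted_mass h0 + (weighted_integral (majorant Msup Msup t))"
    unfolding weighted_mass_def by (rule nn_integral_add) measurable
  also have "\<dots> < \<infinity>" using h0_mass weighted_majorant_finite by simp
  finally show ?thesis .
qed

lemma sol_at_0: "sol 0 = h0"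
proof
  fix \<xi>
  have "duhamel_kernel 0 \<xi> \<tau> v w = 0" for \<tau> v w
    by (cases "0 < \<tau>") (auto simp: duhamel_kernel_def)
  then have "bil sol sol 0 \<xi> = 0" unfolding bil_def by simp
  then show "sol 0 \<xi> = h0 \<xi>" using sol_fixed_point[of 0 \<xi>] by (simp add: linear_flow_def)
qed

lemma freq_vec_sol_in_FB: "t \<ge> 0 \<Longrightarrow> freq_vec (sol t) \<in> vec_FB \<psi> (- 1) 1 2"
  unfolding vec_FB_def
  by (auto intro!: freq_dist_in_FB intro: le_less_trans[OF component_weighted_mass weighted_mass_sol_finite])

lemma real_dist_freq_vec_sol:
  assumes "t \<ge> 0"
  shows "real_dist (freq_vec (sol t) $ a)"
  using real_dist_freq_dist[OF freq_admissible_component[OF sol_measurable weighted_mass_sol_finite[OF assms]], of a]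
  by (simp add: sol_sym vcnj_def)

subsection \<open>Continuity in time\<close>

lemma linear_flow_weighted_continuous:
  assumes t: "t0 \<ge> 0" "\<And>n. t n \<ge> 0" "t \<longlonglongrightarrow> t0"
  shows "(\<lambda>n. weighted_mass (\<lambda>\<xi>. linear_flow h0 (t n) \<xi> - linear_flow h0 t0 \<xi>)) \<longlonglongrightarrow> 0"
proof -
  note [measurable (raw)] = jointly_measurableD[OF u]
  have "(\<lambda>n. \<integral>\<^sup>+\<xi>. ennreal (norm (linear_flow h0 (t n) \<xi> - linear_flow h0 t0 \<xi>)) * ennreal (1 / norm \<xi>) \<partial>lborel)
      \<longlonglongrightarrow> integral\<^sup>N (lborel :: (real^3) measure) (\<lambda>_. 0)"
  proof (rule nn_integral_dominated_convergence[where w="\<lambda>\<xi>. 2 * (ennreal (norm (h0 \<xi>)) * ennreal (1 / norm \<xi>))"])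
    show "(\<integral>\<^sup>+\<xi>. 2 * (ennreal (norm (h0 \<xi>)) * ennreal (1 / norm \<xi>)) \<partial>lborel) < \<infinity>"
      using h0_mass unfolding weighted_mass_def by (simp add: nn_integral_cmult ennreal_mult_less_top)
    show "AE \<xi> in lborel. ennreal (norm (linear_flow h0 (t n) \<xi> - linear_flow h0 t0 \<xi>)) * ennreal (1 / norm \<xi>)
        \<le> 2 * (ennreal (norm (h0 \<xi>)) * ennreal (1 / norm \<xi>))" for n
    proof (intro AE_I2)
      fix \<xi> :: "real^3"
      have "norm (linear_flow h0 (t n) \<xi> - linear_flow h0 t0 \<xi>) \<le> 2 * norm (h0 \<xi>)"
        using norm_triangle_ineq4[of "linear_flow h0 (t n) \<xi>" "linear_flow h0 t0 \<xi>"] t(1) t(2)[of n]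
          norm_propagator_le'[of "t n" \<xi> "h0 \<xi>"] norm_propagator_le'[of t0 \<xi> "h0 \<xi>"]
        by (simp add: linear_flow_def)
      then have "ennreal (norm (linear_flow h0 (t n) \<xi> - linear_flow h0 t0 \<xi>)) \<le> ennreal 2 * ennreal (norm (h0 \<xi>))"
        by (subst ennreal_mult[symmetric]) (auto intro: ennreal_leI)
      then have "ennreal (norm (linear_flow h0 (t n) \<xi> - linear_flow h0 t0 \<xi>)) * ennreal (1 / norm \<xi>)
        \<le> ennreal 2 * ennreal (norm (h0 \<xi>)) * ennreal (1 / norm \<xi>)" by (rule mult_right_mono) simp
      then show "ennreal (norm (linear_flow h0 (t n) \<xi> - linear_flow h0 t0 \<xi>)) * ennreal (1 / norm \<xi>)
        \<le> 2 * (ennreal (norm (h0 \<xi>)) * ennreal (1 / norm \<xi>))" by (simp add: mult.assoc)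
    qed
    show "AE \<xi> in lborel. (\<lambda>n. ennreal (norm (linear_flow h0 (t n) \<xi> - linear_flow h0 t0 \<xi>)) * ennreal (1 / norm \<xi>)) \<longlonglongrightarrow> 0"
    proof (intro AE_I2)
      fix \<xi> :: "real^3"
      have "(\<lambda>n. propagator (t n) \<xi> (h0 \<xi>)) \<longlonglongrightarrow> propagator t0 \<xi> (h0 \<xi>)"
        by (rule isCont_tendsto_compose[OF continuous_propagator t(3)])
      then have "(\<lambda>n. linear_flow h0 (t n) \<xi>) \<longlonglongrightarrow> linear_flow h0 t0 \<xi>"
        using t(1) t(2)[THEN leD] by (simp add: linear_flow_def)
      then have "(\<lambda>n. norm (linear_flow h0 (t n) \<xi> - linear_flow h0 t0 \<xi>) * (1 / norm \<xi>)) \<longlonglongrightarrow> 0 * (1 / norm \<xi>)"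
        by (intro tendsto_mult tendsto_const tendsto_norm_zero) (simp add: LIM_zero)
      then have "(\<lambda>n. ennreal (norm (linear_flow h0 (t n) \<xi> - linear_flow h0 t0 \<xi>) * (1 / norm \<xi>))) \<longlonglongrightarrow> ennreal (0 * (1 / norm \<xi>))"
        by (rule tendsto_ennrealI)
      then show "(\<lambda>n. ennreal (norm (linear_flow h0 (t n) \<xi> - linear_flow h0 t0 \<xi>)) * ennreal (1 / norm \<xi>)) \<longlonglongrightarrow> 0"
        by (simp flip: ennreal_mult)
    qed
  qed auto
  then show ?thesis unfolding weighted_mass_def by simp
qed

lemma duhamel_kernel_time_continuous:
  assumes "t \<longlonglongrightarrow> t0" "\<tau> \<noteq> t0"
  shows "(\<lambda>n. duhamel_kernel (t n) \<xi> \<tau> v w) \<longlonglongrightarrow> duhamel_kernel t0 \<xi> \<tau> v w"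
proof (cases "\<tau> < t0")
  case True
  then have "eventually (\<lambda>n. \<tau> < t n) sequentially" using assms(1) by (simp add: order_tendstoD(1))
  then have "eventually (\<lambda>n. (if 0 < \<tau> then propagator (t n - \<tau>) \<xi> (nl \<xi> v w) else 0) = duhamel_kernel (t n) \<xi> \<tau> v w) sequentially"
    by eventually_elim (simp add: duhamel_kernel_def)
  moreover have "(\<lambda>n. if 0 < \<tau> then propagator (t n - \<tau>) \<xi> (nl \<xi> v w) else 0) \<longlonglongrightarrow> (if 0 < \<tau> then propagator (t0 - \<tau>) \<xi> (nl \<xi> v w) else 0)"
    using assms(1) by (cases "0 < \<tau>") (auto intro!: isCont_tendsto_compose[OF continuous_propagator] tendsto_intros)
  ultimately show ?thesis using True by (simp add: duhamel_kernel_def Lim_transform_eventually)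
next
  case False
  then have "eventually (\<lambda>n. t n < \<tau>) sequentially" using assms by (intro order_tendstoD(2)) auto
  then have "eventually (\<lambda>n. 0 = duhamel_kernel (t n) \<xi> \<tau> v w) sequentially"
    by eventually_elim (simp add: duhamel_kernel_def)
  then have "(\<lambda>n. duhamel_kernel (t n) \<xi> \<tau> v w) \<longlonglongrightarrow> 0"
    by (rule Lim_transform_eventually[OF tendsto_const])
  then show ?thesis using False by (simp add: duhamel_kernel_def)
qed

text \<open>Dominated convergence: for fixed \<open>\<tau> \<noteq> t\<close> the kernel depends continuously on \<open>t\<close>.\<close>

lemma bil_weighted_continuous:
  assumes t: "t \<longlonglongrightarrow> t0"
  shows "(\<lambda>n. weighted_mass (\<lambda>\<xi>. bil sol sol (t n) \<xi> - bil sol sol t0 \<xi>)) \<longlonglongrightarrow> 0"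
proof -
  note [measurable (raw)] = jointly_measurableD[OF jm_Msup] jointly_measurableD[OF jm_sol]
  let ?k = "\<lambda>t \<xi> y. duhamel_kernel t \<xi> (fst y) (sol (fst y) (\<xi> - snd y)) (sol (fst y) (snd y))"
  let ?g = "\<lambda>n z. ennreal (norm (?k (t n) (fst z) (snd z) - ?k t0 (fst z) (snd z))) * ennreal (1 / norm (fst z))"
  let ?MM = "\<lambda>\<xi> y. Msup (fst y) (\<xi> - snd y) * Msup (fst y) (snd y)"
  have gm: "?g n \<in> borel_measurable lborel" for n by (simp add: borel_prod[symmetric])
  have k_le: "ennreal (norm (?k t \<xi> y)) * ennreal (1 / norm \<xi>) \<le> ?MM \<xi> y * ennreal \<kappa>" for t \<xi> y
  proof -
    have "ennreal (norm (?k t \<xi> y)) \<le> ?MM \<xi> y * heat_kernel t \<xi> (fst y)"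
      by (intro order_trans[OF norm_duhamel_kernel_le] mult_right_mono mult_mono sol_le_Msup) auto
    then have "ennreal (norm (?k t \<xi> y)) * ennreal (1 / norm \<xi>) \<le> ?MM \<xi> y * heat_kernel t \<xi> (fst y) * ennreal (1 / norm \<xi>)"
      by (rule mult_right_mono) simp
    also have "\<dots> \<le> ?MM \<xi> y * ennreal \<kappa>" unfolding mult.assoc[of "?MM \<xi> y"]
      by (intro mult_left_mono heat_kernel_weighted_le) auto
    finally show ?thesis .
  qed
  have "(\<lambda>n. \<integral>\<^sup>+z. ?g n z \<partial>lborel) \<longlonglongrightarrow> integral\<^sup>N (lborel :: ((real^3) \<times> (real \<times> (real^3))) measure) (\<lambda>_. 0)"
  proof (rule nn_integral_dominated_convergence[where w="\<lambda>z. 2 * (?MM (fst z) (snd z) * ennreal \<kappa>)"])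
    show "(\<lambda>z. 2 * (?MM (fst z) (snd z) * ennreal \<kappa>)) \<in> borel_measurable lborel" by (simp add: borel_prod[symmetric])
    have "(\<integral>\<^sup>+z. 2 * (?MM (fst z) (snd z) * ennreal \<kappa>) \<partial>lborel) = 2 * ((\<integral>\<^sup>+z. ?MM (fst z) (snd z) \<partial>lborel) * ennreal \<kappa>)"
      by (subst nn_integral_cmult, simp add: borel_prod[symmetric], subst nn_integral_multc) (simp_all add: borel_prod[symmetric])
    also have "(\<integral>\<^sup>+z. ?MM (fst z) (snd z) \<partial>lborel) = (\<integral>\<^sup>+\<xi>. \<integral>\<^sup>+y. ?MM \<xi> y \<partial>lborel \<partial>lborel)"
      by (subst nn_integral_lborel_pair) (simp_all add: borel_prod[symmetric])
    finally have eq: "(\<integral>\<^sup>+z. 2 * (?MM (fst z) (snd z) * ennreal \<kappa>) \<partial>lborel) = 2 * ((\<integral>\<^sup>+\<xi>. \<integral>\<^sup>+y. ?MM \<xi> y \<partial>lborel \<partial>lborel) * ennreal \<kappa>)" .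
    have "(\<integral>\<^sup>+\<xi>. \<integral>\<^sup>+y. ?MM \<xi> y \<partial>lborel \<partial>lborel)\<^sup>2 < \<infinity>"
      by (rule le_less_trans[OF convolution_mass[OF jm_Msup jm_Msup]])
        (use mixed_sq_Msup_finite in \<open>simp add: ennreal_mult_less_top\<close>)
    then have "(\<integral>\<^sup>+\<xi>. \<integral>\<^sup>+y. ?MM \<xi> y \<partial>lborel \<partial>lborel) < \<infinity>" by (simp add: power_less_top_ennreal)
    then show "(\<integral>\<^sup>+z. 2 * (?MM (fst z) (snd z) * ennreal \<kappa>) \<partial>lborel) < \<infinity>"
      unfolding eq by (simp add: ennreal_mult_less_top)
    show "AE z in lborel. ?g n z \<le> 2 * (?MM (fst z) (snd z) * ennreal \<kappa>)" for n
    proof (intro AE_I2)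
      fix z :: "(real^3) \<times> (real \<times> (real^3))"
      have "?g n z \<le> (ennreal (norm (?k (t n) (fst z) (snd z))) + ennreal (norm (?k t0 (fst z) (snd z)))) * ennreal (1 / norm (fst z))"
        unfolding ennreal_plus[OF norm_ge_zero norm_ge_zero, symmetric]
        by (intro mult_right_mono ennreal_leI norm_triangle_ineq4) auto
      also have "\<dots> \<le> ?MM (fst z) (snd z) * ennreal \<kappa> + ?MM (fst z) (snd z) * ennreal \<kappa>"
        unfolding distrib_right by (intro add_mono k_le)
      finally show "?g n z \<le> 2 * (?MM (fst z) (snd z) * ennreal \<kappa>)" by (simp only: mult_2)
    qed
    show "AE z in lborel. (\<lambda>n. ?g n z) \<longlonglongrightarrow> 0"
      using AE_time_neq[of t0]
    proof eventually_elim
      case (elim z)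
      have "(\<lambda>n. norm (?k (t n) (fst z) (snd z) - ?k t0 (fst z) (snd z)) * (1 / norm (fst z))) \<longlonglongrightarrow> 0 * (1 / norm (fst z))"
        by (intro tendsto_mult tendsto_const tendsto_norm_zero LIM_zero duhamel_kernel_time_continuous t elim)
      from tendsto_ennrealI[OF this] show ?case by (simp flip: ennreal_mult)
    qed
  qed (use gm in auto)
  then have lim: "(\<lambda>n. \<integral>\<^sup>+z. ?g n z \<partial>lborel) \<longlonglongrightarrow> 0" by simp
  have "weighted_mass (\<lambda>\<xi>. bil sol sol (t n) \<xi> - bil sol sol t0 \<xi>) \<le> (\<integral>\<^sup>+z. ?g n z \<partial>lborel)" for n
  proof -
    have "AE \<xi> in lborel. ennreal (norm (bil sol sol (t n) \<xi> - bil sol sol t0 \<xi>)) * ennreal (1 / norm \<xi>)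
        \<le> (\<integral>\<^sup>+y. ennreal (norm (?k (t n) \<xi> y - ?k t0 \<xi> y)) * ennreal (1 / norm \<xi>) \<partial>lborel)"
      using AE_majorant_Msup_finite[OF mixed_sq_data_finite, of "t n"] AE_majorant_Msup_finite[OF mixed_sq_data_finite, of t0]
    proof eventually_elim
      case (elim \<xi>)
      note i1 = bil_bound(1)[OF jm_sol sol_le_Msup jm_sol sol_le_Msup elim(1)]
      note i2 = bil_bound(1)[OF jm_sol sol_le_Msup jm_sol sol_le_Msup elim(2)]
      have "ennreal (norm (bil sol sol (t n) \<xi> - bil sol sol t0 \<xi>)) \<le> (\<integral>\<^sup>+y. ennreal (norm (?k (t n) \<xi> y - ?k t0 \<xi> y)) \<partial>lborel)"
        unfolding bil_def Bochner_Integration.integral_diff[OF i1 i2, symmetric]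
        by (rule integral_norm_bound_ennreal) (intro Bochner_Integration.integrable_diff i1 i2)
      then have "ennreal (norm (bil sol sol (t n) \<xi> - bil sol sol t0 \<xi>)) * ennreal (1 / norm \<xi>)
          \<le> (\<integral>\<^sup>+y. ennreal (norm (?k (t n) \<xi> y - ?k t0 \<xi> y)) \<partial>lborel) * ennreal (1 / norm \<xi>)" by (rule mult_right_mono) simp
      also have "\<dots> = (\<integral>\<^sup>+y. ennreal (norm (?k (t n) \<xi> y - ?k t0 \<xi> y)) * ennreal (1 / norm \<xi>) \<partial>lborel)"
        by (rule nn_integral_multc[symmetric]) (simp add: borel_prod[symmetric])
      finally show ?case .
    qed
    then show ?thesis unfolding weighted_mass_def
      by (subst nn_integral_lborel_pair) (auto simp: borel_prod[symmetric] intro!: nn_integral_mono_AE)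
  qed
  then show ?thesis by (intro tendsto_sandwich[OF _ _ tendsto_const lim]) auto
qed

lemma sol_weighted_continuous:
  assumes t: "t0 \<ge> 0" "\<And>n. t n \<ge> 0" "t \<longlonglongrightarrow> t0"
  shows "(\<lambda>n. weighted_mass (\<lambda>\<xi>. sol (t n) \<xi> - sol t0 \<xi>)) \<longlonglongrightarrow> 0"
proof -
  note [measurable (raw)] = jointly_measurableD[OF u] jointly_measurableD[OF jointly_measurable_bil[OF jm_sol jm_sol]]
  have "(\<lambda>n. weighted_mass (\<lambda>\<xi>. linear_flow h0 (t n) \<xi> - linear_flow h0 t0 \<xi>)
      + weighted_mass (\<lambda>\<xi>. bil sol sol (t n) \<xi> - bil sol sol t0 \<xi>)) \<longlonglongrightarrow> 0 + 0"
    by (intro tendsto_add linear_flow_weighted_continuous bil_weighted_continuous t)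
  then have lim: "(\<lambda>n. weighted_mass (\<lambda>\<xi>. linear_flow h0 (t n) \<xi> - linear_flow h0 t0 \<xi>)
      + weighted_mass (\<lambda>\<xi>. bil sol sol (t n) \<xi> - bil sol sol t0 \<xi>)) \<longlonglongrightarrow> 0" by simp
  have "weighted_mass (\<lambda>\<xi>. sol (t n) \<xi> - sol t0 \<xi>) \<le> weighted_mass (\<lambda>\<xi>. linear_flow h0 (t n) \<xi> - linear_flow h0 t0 \<xi>)
      + weighted_mass (\<lambda>\<xi>. bil sol sol (t n) \<xi> - bil sol sol t0 \<xi>)" for n
  proof -
    have "AE \<xi> in lborel. ennreal (norm (sol (t n) \<xi> - sol t0 \<xi>)) * ennreal (1 / norm \<xi>)
       \<le> ennreal (norm (linear_flow h0 (t n) \<xi> - linear_flow h0 t0 \<xi>)) * ennreal (1 / norm \<xi>)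
         + ennreal (norm (bil sol sol (t n) \<xi> - bil sol sol t0 \<xi>)) * ennreal (1 / norm \<xi>)"
      using AE_majorant_Msup_finite[OF mixed_sq_data_finite, of "t n"] AE_majorant_Msup_finite[OF mixed_sq_data_finite, of t0]
    proof eventually_elim
      case (elim \<xi>)
      have "sol (t n) \<xi> - sol t0 \<xi> = (linear_flow h0 (t n) \<xi> - linear_flow h0 t0 \<xi>) - (bil sol sol (t n) \<xi> - bil sol sol t0 \<xi>)"
        using sol_fixed_point[OF elim(1)] sol_fixed_point[OF elim(2)] by simp
      then show ?case unfolding distrib_right[symmetric] ennreal_plus[OF norm_ge_zero norm_ge_zero, symmetric]
        by (intro mult_right_mono ennreal_leI) (simp_all add: norm_triangle_ineq4)
    qed
    then show ?thesis unfolding weighted_mass_def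
      by (subst nn_integral_add[symmetric]) (auto intro: nn_integral_mono_AE)
  qed
  then show ?thesis by (intro tendsto_sandwich[OF _ _ tendsto_const lim]) auto
qed

theorem continuous_freq_vec_sol: "continuous_into_FB \<psi> (- 1) 1 2 (\<lambda>t. freq_vec (sol t))"
  unfolding continuous_into_FB_def
proof (intro conjI allI impI)
  show "freq_vec (sol t) \<in> vec_FB \<psi> (- 1) 1 2" if "0 \<le> t" for t by (rule freq_vec_sol_in_FB[OF that])
  fix t0 :: real assume t0: "0 \<le> t0"
  show "((\<lambda>t. vec_FB_norm \<psi> (- 1) 1 2 (freq_vec (sol t) - freq_vec (sol t0))) \<longlongrightarrow> 0) (at t0 within {0..})"
    unfolding tendsto_at_iff_sequentially
  proof (intro allI impI)
    fix t :: "nat \<Rightarrow> real" assume t: "\<forall>i. t i \<in> {0..} - {t0}" "t \<longlonglongrightarrow> t0"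
    then have tpos: "t n \<ge> 0" for n by auto
    let ?W = "\<lambda>n. weighted_mass (\<lambda>\<xi>. sol (t n) \<xi> - sol t0 \<xi>)"
    have W: "?W \<longlonglongrightarrow> 0" by (rule sol_weighted_continuous[OF t0 tpos t(2)])
    have comp: "FB_norm \<psi> (- 1) 1 2 ((freq_vec (sol (t n)) - freq_vec (sol t0)) $ i) \<le> ennreal (8/3) * ?W n" if fin: "?W n < \<infinity>" for n i
    proof -
      have meas: "(\<lambda>\<xi>. sol (t n) \<xi> - sol t0 \<xi>) \<in> borel_measurable borel" by measurable
      have "FB_norm \<psi> (- 1) 1 2 ((freq_vec (sol (t n)) - freq_vec (sol t0)) $ i)
          \<le> ennreal (8/3) * (\<integral>\<^sup>+\<xi>. ennreal (cmod ((sol (t n) \<xi> - sol t0 \<xi>) $ i) / norm \<xi>) \<partial>lborel)"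
      proof (rule FB_norm_le)
        show "freq_admissible (\<lambda>\<xi>. (sol (t n) \<xi> - sol t0 \<xi>) $ i)"
          by (rule freq_admissible_component[OF meas fin])
        fix \<phi> :: "real^3 \<Rightarrow> complex" assume s: "schwartz \<phi>"
        have a: "freq_admissible (\<lambda>\<xi>. sol (t n) \<xi> $ i)" "freq_admissible (\<lambda>\<xi>. sol t0 \<xi> $ i)"
          using freq_admissible_component[OF sol_measurable weighted_mass_sol_finite] tpos t0 by auto
        show "((freq_vec (sol (t n)) - freq_vec (sol t0)) $ i) \<phi> = freq_dist (\<lambda>\<xi>. (sol (t n) \<xi> - sol t0 \<xi>) $ i) \<phi>"
          using freq_dist_integrable(1)[OF a(1) s] freq_dist_integrable(1)[OF a(2) s]
          by (simp add: freq_dist_def left_diff_distrib)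
      qed
      also have "\<dots> \<le> ennreal (8/3) * ?W n" by (intro mult_left_mono component_weighted_mass) auto
      finally show ?thesis .
    qed
    have "eventually (\<lambda>n. ?W n < \<infinity>) sequentially" using W by (rule order_tendstoD) simp
    then have "eventually (\<lambda>n. vec_FB_norm \<psi> (- 1) 1 2 (freq_vec (sol (t n)) - freq_vec (sol t0)) \<le> ennreal 16 * ?W n) sequentially"
    proof eventually_elim
      case (elim n)
      have "vec_FB_norm \<psi> (- 1) 1 2 (freq_vec (sol (t n)) - freq_vec (sol t0)) \<le> (\<Sum>i\<in>(UNIV::(3+3) set). ennreal (8/3) * ?W n)"
        unfolding vec_FB_norm_def by (intro sum_mono comp elim)
      also have "\<dots> = of_nat 6 * ennreal (8/3) * ?W n" by (simp add: mult.assoc)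
      also have "of_nat 6 * ennreal (8/3) = ennreal (6 * (8/3))"
        by (subst ennreal_mult) (auto simp: ennreal_of_nat_eq_real_of_nat)
      finally show ?case by simp
    qed
    moreover have "(\<lambda>n. ennreal 16 * ?W n) \<longlonglongrightarrow> ennreal 16 * 0" by (intro ennreal_tendsto_cmult W) simp
    then have lim: "(\<lambda>n. ennreal 16 * ?W n) \<longlonglongrightarrow> 0" by simp
    ultimately have "(\<lambda>n. vec_FB_norm \<psi> (- 1) 1 2 (freq_vec (sol (t n)) - freq_vec (sol t0))) \<longlonglongrightarrow> 0"
      by (intro tendsto_sandwich[OF _ _ tendsto_const lim]) auto
    then show "((\<lambda>t. vec_FB_norm \<psi> (- 1) 1 2 (freq_vec (sol t) - freq_vec (sol t0))) \<circ> t) \<longlonglongrightarrow> 0"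
      by (simp add: o_def)
  qed
qed

end

context micropolar_data
begin

subsection \<open>The integral equation\<close>

lemma Msup_measurable [measurable]: "Msup t \<in> borel_measurable borel"
  using jointly_measurableD[OF jm_Msup, of "\<lambda>_. t" borel "\<lambda>x. x"] by simp

lemma nonlinearity_hat_sol_measurable [measurable]: "nonlinearity_hat (sol \<tau>) \<in> borel_measurable borel"
  using jointly_measurableD[OF nonlinearity_hat_measurable[OF jm_sol], of "\<lambda>_. \<tau>" borel "\<lambda>x. x"] by simp

lemma norm_nonlinearity_hat_sol_le:
  "ennreal (norm (nonlinearity_hat (sol \<tau>) \<xi>)) \<le> ennreal (\<kappa> * norm \<xi>) * (\<integral>\<^sup>+\<eta>. Msup \<tau> (\<xi> - \<eta>) * Msup \<tau> \<eta> \<partial>lborel)"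
  by (intro order_trans[OF norm_nonlinearity_hat_le] mult_left_mono nn_integral_mono mult_mono sol_le_Msup) auto

lemma weighted_mass_nonlinearity_hat_sol:
  "weighted_mass (nonlinearity_hat (sol \<tau>)) \<le> ennreal \<kappa> * (\<integral>\<^sup>+\<xi>. Msup \<tau> \<xi> \<partial>lborel)\<^sup>2"
proof -
  have "ennreal (norm (nonlinearity_hat (sol \<tau>) \<xi>)) * ennreal (1 / norm \<xi>) \<le> ennreal \<kappa> * (\<integral>\<^sup>+\<eta>. Msup \<tau> (\<xi> - \<eta>) * Msup \<tau> \<eta> \<partial>lborel)" for \<xi>
  proof -
    have "ennreal (norm (nonlinearity_hat (sol \<tau>) \<xi>)) * ennreal (1 / norm \<xi>)
        \<le> (ennreal (\<kappa> * norm \<xi>) * (\<integral>\<^sup>+\<eta>. Msup \<tau> (\<xi> - \<eta>) * Msup \<tau> \<eta> \<partial>lborel)) * ennreal (1 / norm \<xi>)"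
      by (intro mult_right_mono norm_nonlinearity_hat_sol_le) auto
    also have "\<dots> = (ennreal (\<kappa> * norm \<xi>) * ennreal (1 / norm \<xi>)) * (\<integral>\<^sup>+\<eta>. Msup \<tau> (\<xi> - \<eta>) * Msup \<tau> \<eta> \<partial>lborel)"
      by (simp only: mult_ac)
    also have "ennreal (\<kappa> * norm \<xi>) * ennreal (1 / norm \<xi>) \<le> ennreal \<kappa>"
      using \<kappa>_pos by (cases "\<xi> = 0") (auto simp flip: ennreal_mult)
    finally show ?thesis by (simp add: mult_right_mono)
  qed
  then have "weighted_mass (nonlinearity_hat (sol \<tau>)) \<le> (\<integral>\<^sup>+\<xi>. ennreal \<kappa> * (\<integral>\<^sup>+\<eta>. Msup \<tau> (\<xi> - \<eta>) * Msup \<tau> \<eta> \<partial>lborel) \<partial>lborel)"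
    unfolding weighted_mass_def by (intro nn_integral_mono)
  also have "\<dots> = ennreal \<kappa> * (\<integral>\<^sup>+\<xi>. Msup \<tau> \<xi> \<partial>lborel)\<^sup>2"
    by (subst nn_integral_cmult) (auto simp: convolution_mass_slice power2_eq_square)
  finally show ?thesis .
qed

lemma AE_Msup_slice_finite: "AE \<tau> in lborel. (\<integral>\<^sup>+\<xi>. Msup \<tau> \<xi> \<partial>lborel) < \<infinity>"
proof -
  note [measurable (raw)] = jointly_measurableD[OF jm_Msup]
  have "AE \<tau> in lborel. (\<integral>\<^sup>+\<xi>. Msup \<tau> \<xi> \<partial>lborel)\<^sup>2 \<noteq> \<infinity>"
    using mixed_sq_Msup_finite unfolding mixed_sq_def by (intro nn_integral_PInf_AE) auto
  then show ?thesis by eventually_elim (auto simp: power2_eq_square ennreal_mult_eq_top_iff less_top[symmetric])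
qed

definition duhamel_integrand :: "real \<Rightarrow> real \<Rightarrow> real^3 \<Rightarrow> complex^(3+3)" where
  "duhamel_integrand t \<tau> \<xi> = (if 0 < \<tau> \<and> \<tau> < t then propagator (t - \<tau>) \<xi> (nonlinearity_hat (sol \<tau>) \<xi>) else 0)"

lemma norm_duhamel_integrand_le: "norm (duhamel_integrand t \<tau> \<xi>) \<le> norm (nonlinearity_hat (sol \<tau>) \<xi>)"
  by (simp add: duhamel_integrand_def norm_propagator_le')

lemma jm_duhamel_integrand: "jointly_measurable (duhamel_integrand t)"
proof (rule jointly_measurableI)
  note [measurable (raw)] = jointly_measurableD[OF nonlinearity_hat_measurable[OF jm_sol]]
  show "(\<lambda>z. duhamel_integrand t (fst z) (snd z)) \<in> borel_measurable (borel \<Otimes>\<^sub>M borel)"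
    unfolding duhamel_integrand_def by measurable
qed

text \<open>Fubini's theorem and the linearity of the propagator turn the integral over pairs into the Duhamel
  integral of the mild formulation.\<close>

lemma bil_eq_time_integral:
  assumes fin: "majorant Msup Msup t \<xi> < \<infinity>" and "\<xi> \<noteq> 0"
  shows "bil sol sol t \<xi> $ a = (LINT \<tau>|lborel. duhamel_integrand t \<tau> \<xi> $ a)"
proof -
  note [measurable (raw)] = jointly_measurableD[OF jm_Msup] jointly_measurableD[OF jm_sol]
  let ?k = "\<lambda>\<tau> \<eta>. duhamel_kernel t \<xi> \<tau> (sol \<tau> (\<xi> - \<eta>)) (sol \<tau> \<eta>)"
  have "integrable lborel (\<lambda>y. ?k (fst y) (snd y))"
    by (rule bil_bound(1)[OF jm_sol sol_le_Msup jm_sol sol_le_Msup fin])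
  then have i: "integrable (lborel \<Otimes>\<^sub>M lborel) (case_prod ?k)" unfolding lborel_prod by (simp add: case_prod_beta')
  have eq: "bil sol sol t \<xi> = (LINT \<tau>|lborel. LINT \<eta>|lborel. ?k \<tau> \<eta>)"
    using lborel_pair.integral_fst[OF i] unfolding bil_def lborel_prod by (simp add: case_prod_beta')
  have "(\<integral>\<^sup>+\<tau>. \<integral>\<^sup>+\<eta>. Msup \<tau> (\<xi> - \<eta>) * Msup \<tau> \<eta> * heat_kernel t \<xi> \<tau> \<partial>lborel \<partial>lborel) < \<infinity>"
    using fin unfolding majorant_def by (subst (asm) nn_integral_lborel_pair) auto
  then have "AE \<tau> in lborel. (\<integral>\<^sup>+\<eta>. Msup \<tau> (\<xi> - \<eta>) * Msup \<tau> \<eta> * heat_kernel t \<xi> \<tau> \<partial>lborel) \<noteq> \<infinity>"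
    by (intro nn_integral_PInf_AE) auto
  then have ae: "AE \<tau> in lborel. (LINT \<eta>|lborel. ?k \<tau> \<eta>) = duhamel_integrand t \<tau> \<xi>"
  proof eventually_elim
    case (elim \<tau>)
    show ?case
    proof (cases "0 < \<tau> \<and> \<tau> < t")
      case True
      have "heat_kernel t \<xi> \<tau> \<noteq> 0" using True assms(2) \<kappa>_pos
        by (simp add: heat_kernel_def ennreal_eq_0_iff not_le)
      moreover have "(\<integral>\<^sup>+\<eta>. Msup \<tau> (\<xi> - \<eta>) * Msup \<tau> \<eta> \<partial>lborel) * heat_kernel t \<xi> \<tau> \<noteq> top"
        using elim by (subst nn_integral_multc[symmetric]) auto
      ultimately have "(\<integral>\<^sup>+\<eta>. Msup \<tau> (\<xi> - \<eta>) * Msup \<tau> \<eta> \<partial>lborel) < \<infinity>"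
        by (auto simp: ennreal_mult_eq_top_iff less_top[symmetric])
      then have f: "(\<integral>\<^sup>+\<eta>. ennreal (norm (sol \<tau> (\<xi> - \<eta>))) * ennreal (norm (sol \<tau> \<eta>)) \<partial>lborel) < \<infinity>"
        by (rule le_less_trans[rotated]) (intro nn_integral_mono mult_mono sol_le_Msup, auto)
      note nh = nonlinearity_hat_eq[OF sol_measurable f]
      have "(LINT \<eta>|lborel. ?k \<tau> \<eta>) = (LINT \<eta>|lborel. propagator (t - \<tau>) \<xi> (nl \<xi> (sol \<tau> (\<xi> - \<eta>)) (sol \<tau> \<eta>)))"
        using True by (simp add: duhamel_kernel_def)
      also have "\<dots> = propagator (t - \<tau>) \<xi> (nonlinearity_hat (sol \<tau>) \<xi>)"
        unfolding nh(2) by (rule integral_bounded_linear[OF bounded_linear_propagator nh(1)]) (use True in simp)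
      finally show ?thesis using True by (simp add: duhamel_integrand_def)
    next
      case False
      then have "duhamel_kernel t \<xi> \<tau> v w = 0" for v w by (auto simp: duhamel_kernel_def)
      then show ?thesis using False by (auto simp: duhamel_integrand_def)
    qed
  qed
  have [measurable]: "(\<lambda>\<tau>. duhamel_integrand t \<tau> \<xi>) \<in> borel_measurable borel"
    using jointly_measurableD[OF jm_duhamel_integrand, of "\<lambda>x. x" borel "\<lambda>_. \<xi>"] by simp
  have i1: "integrable lborel (\<lambda>\<tau>. LINT \<eta>|lborel. ?k \<tau> \<eta>)" by (rule lborel_pair.integrable_fst[OF i])
  then have i2: "integrable lborel (\<lambda>\<tau>. duhamel_integrand t \<tau> \<xi>)"
    by (rule integrable_cong_AE_imp) (use ae in auto)
  have "bil sol sol t \<xi> = (LINT \<tau>|lborel. duhamel_integrand t \<tau> \<xi>)"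
    unfolding eq by (rule integral_cong_AE) (use ae i1 in auto)
  then show ?thesis
    using integral_bounded_linear[OF bounded_linear_vec_nth i2, of a] by simp
qed

text \<open>The factor \<open>\<bar>\<xi>\<bar>\<close> of the nonlinearity is absorbed by the decay of the transformed test function.\<close>

lemma integrable_duhamel_pairing:
  assumes "schwartz \<phi>"
  shows "integrable (lborel \<Otimes>\<^sub>M lborel) (\<lambda>(\<tau>, \<xi>). duhamel_integrand t \<tau> \<xi> $ a * inv_fourier \<phi> \<xi>)"
proof (rule integrableI_bounded)
  note [measurable (raw)] = jointly_measurableD[OF jm_duhamel_integrand] jointly_measurableD[OF jm_Msup]
  have [measurable]: "\<phi> \<in> borel_measurable borel" by (rule schwartz_measurable[OF assms])
  obtain C where C: "\<And>\<xi>. (1 + norm \<xi>) ^ 1 * cmod (inv_fourier \<phi> \<xi>) \<le> C"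
    using inv_fourier_decay[OF assms, of 1] by blast
  have C': "norm \<xi> * cmod (inv_fourier \<phi> \<xi>) \<le> C" for \<xi>
  proof (rule order_trans[OF _ C])
    show "norm \<xi> * cmod (inv_fourier \<phi> \<xi>) \<le> (1 + norm \<xi>) ^ 1 * cmod (inv_fourier \<phi> \<xi>)"
      by (intro mult_right_mono) auto
  qed
  show "(\<lambda>(\<tau>, \<xi>). duhamel_integrand t \<tau> \<xi> $ a * inv_fourier \<phi> \<xi>) \<in> borel_measurable (lborel \<Otimes>\<^sub>M lborel)"
    by measurable
  let ?c = "\<lambda>\<tau> \<xi>. \<integral>\<^sup>+\<eta>. Msup \<tau> (\<xi> - \<eta>) * Msup \<tau> \<eta> \<partial>lborel"
  have "(\<integral>\<^sup>+z. ennreal (norm (case z of (\<tau>, \<xi>) \<Rightarrow> duhamel_integrand t \<tau> \<xi> $ a * inv_fourier \<phi> \<xi>)) \<partial>(lborel \<Otimes>\<^sub>M lborel))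
    = (\<integral>\<^sup>+\<tau>. \<integral>\<^sup>+\<xi>. ennreal (norm (duhamel_integrand t \<tau> \<xi> $ a * inv_fourier \<phi> \<xi>)) \<partial>lborel \<partial>lborel)"
    by (subst lborel.nn_integral_fst[symmetric]) auto
  also have "\<dots> \<le> (\<integral>\<^sup>+\<tau>. \<integral>\<^sup>+\<xi>. ennreal (\<kappa> * C) * ?c \<tau> \<xi> \<partial>lborel \<partial>lborel)"
  proof (intro nn_integral_mono)
    fix \<tau> :: real and \<xi> :: "real^3"
    have "ennreal (norm (duhamel_integrand t \<tau> \<xi> $ a * inv_fourier \<phi> \<xi>))
        \<le> ennreal (norm (nonlinearity_hat (sol \<tau>) \<xi>)) * ennreal (cmod (inv_fourier \<phi> \<xi>))"
      unfolding norm_mult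
      by (subst ennreal_mult) (auto intro!: mult_right_mono ennreal_leI
          order_trans[OF Finite_Cartesian_Product.norm_nth_le norm_duhamel_integrand_le])
    also have "\<dots> \<le> (ennreal (\<kappa> * norm \<xi>) * ?c \<tau> \<xi>) * ennreal (cmod (inv_fourier \<phi> \<xi>))"
      by (intro mult_right_mono norm_nonlinearity_hat_sol_le) auto
    also have "\<dots> = (ennreal (\<kappa> * norm \<xi>) * ennreal (cmod (inv_fourier \<phi> \<xi>))) * ?c \<tau> \<xi>" by (simp only: mult_ac)
    also have "\<dots> \<le> ennreal (\<kappa> * C) * ?c \<tau> \<xi>"
    proof (rule mult_right_mono)
      have "\<kappa> * (norm \<xi> * cmod (inv_fourier \<phi> \<xi>)) \<le> \<kappa> * C" using C' \<kappa>_pos by (intro mult_left_mono) auto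
      then show "ennreal (\<kappa> * norm \<xi>) * ennreal (cmod (inv_fourier \<phi> \<xi>)) \<le> ennreal (\<kappa> * C)"
        using \<kappa>_pos by (simp add: ennreal_leI mult.assoc flip: ennreal_mult)
    qed simp
    finally show "ennreal (norm (duhamel_integrand t \<tau> \<xi> $ a * inv_fourier \<phi> \<xi>)) \<le> ennreal (\<kappa> * C) * ?c \<tau> \<xi>" .
  qed
  also have "\<dots> = (\<integral>\<^sup>+\<tau>. ennreal (\<kappa> * C) * ((\<integral>\<^sup>+\<xi>. Msup \<tau> \<xi> \<partial>lborel)\<^sup>2) \<partial>lborel)"
    by (subst nn_integral_cmult) (auto simp: convolution_mass_slice power2_eq_square)
  also have "\<dots> = ennreal (\<kappa> * C) * mixed_sq Msup"
    unfolding mixed_sq_def by (rule nn_integral_cmult) measurable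
  also have "\<dots> < \<infinity>" using mixed_sq_Msup_finite by (simp add: ennreal_mult_less_top)
  finally show "(\<integral>\<^sup>+z. ennreal (norm (case z of (\<tau>, \<xi>) \<Rightarrow> duhamel_integrand t \<tau> \<xi> $ a * inv_fourier \<phi> \<xi>)) \<partial>(lborel \<Otimes>\<^sub>M lborel)) < \<infinity>" .
qed

theorem mild_solution_freq_vec_sol: "mild_solution (freq_vec h0) (\<lambda>t. freq_vec (sol t))"
  unfolding mild_solution_def
proof (rule exI[of _ "\<lambda>\<tau>. freq_vec (nonlinearity_hat (sol \<tau>))"], intro conjI allI impI)
  have Nfin: "AE \<tau> in lborel. (\<integral>\<^sup>+\<xi>. ennreal (norm (sol \<tau> \<xi>)) \<partial>lborel) < \<infinity> \<and> weighted_mass (nonlinearity_hat (sol \<tau>)) < \<infinity>"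
    using AE_Msup_slice_finite
  proof eventually_elim
    case (elim \<tau>)
    have "(\<integral>\<^sup>+\<xi>. ennreal (norm (sol \<tau> \<xi>)) \<partial>lborel) < \<infinity>"
      by (rule le_less_trans[OF _ elim]) (intro nn_integral_mono sol_le_Msup)
    moreover have "weighted_mass (nonlinearity_hat (sol \<tau>)) < \<infinity>"
      by (rule le_less_trans[OF weighted_mass_nonlinearity_hat_sol])
        (use elim in \<open>simp add: power2_eq_square ennreal_mult_less_top\<close>)
    ultimately show ?case by blast
  qed
  then show "AE \<tau> in lborel. 0 < \<tau> \<longrightarrow> nonlinearity (freq_vec (sol \<tau>)) (freq_vec (nonlinearity_hat (sol \<tau>)))"
    by eventually_elim (intro impI nonlinearity_freq_vec sol_measurable nonlinearity_hat_sol_measurable, auto)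
  fix t :: real assume t: "0 \<le> t"
  define L where "L = freq_vec (\<lambda>\<xi>. propagator t \<xi> (h0 \<xi>))"
  define D where "D \<tau> = freq_vec (duhamel_integrand t \<tau>)" for \<tau>
  have prop_mass: "weighted_mass (\<lambda>\<xi>. propagator s \<xi> (h \<xi>)) \<le> weighted_mass h" if "s \<ge> 0" for s and h :: "real^3 \<Rightarrow> complex^(3+3)"
    unfolding weighted_mass_def by (intro nn_integral_mono mult_right_mono ennreal_leI norm_propagator_le' that) auto
  have semi: "semigroup_G s (freq_vec h) (freq_vec (\<lambda>\<xi>. propagator s \<xi> (h \<xi>)))"
    if [measurable]: "h \<in> borel_measurable borel" and w: "weighted_mass h < \<infinity>" and s: "s \<ge> 0"
    for s and h :: "real^3 \<Rightarrow> complex^(3+3)"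
    unfolding semigroup_G_def fourier_mult_def
  proof (rule exI[of _ h], intro conjI allI)
    fix i
    show "has_fourier (freq_vec h $ i) (\<lambda>\<xi>. h \<xi> $ i)"
      using has_fourier_freq_dist[OF freq_admissible_component[OF that(1) w]] by simp
    have "has_fourier (freq_vec (\<lambda>\<xi>. propagator s \<xi> (h \<xi>)) $ i) (\<lambda>\<xi>. propagator s \<xi> (h \<xi>) $ i)"
      using has_fourier_freq_dist[OF freq_admissible_component[OF _ le_less_trans[OF prop_mass[OF s] w]], of i] by simp
    then show "has_fourier (freq_vec (\<lambda>\<xi>. propagator s \<xi> (h \<xi>)) $ i) (\<lambda>\<xi>. (mat_exp ((- s) *\<^sub>R A_sym \<xi>) *v h \<xi>) $ i)"
      by (simp add: propagator_def)
  qed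
  have D: "AE \<tau> in lborel. 0 < \<tau> \<and> \<tau> < t \<longrightarrow> semigroup_G (t - \<tau>) (freq_vec (nonlinearity_hat (sol \<tau>))) (D \<tau>)"
    using Nfin
  proof eventually_elim
    case (elim \<tau>)
    show ?case
    proof (intro impI, elim conjE)
      assume \<tau>: "0 < \<tau>" "\<tau> < t"
      then have "D \<tau> = freq_vec (\<lambda>\<xi>. propagator (t - \<tau>) \<xi> (nonlinearity_hat (sol \<tau>) \<xi>))"
        by (simp add: D_def duhamel_integrand_def[abs_def])
      then show "semigroup_G (t - \<tau>) (freq_vec (nonlinearity_hat (sol \<tau>))) (D \<tau>)"
        using semi[OF nonlinearity_hat_sol_measurable, of \<tau> "t - \<tau>"] elim \<tau> by simp
    qed
  qed
  have pair: "set_integrable lborel {0..t} (\<lambda>\<tau>. (D \<tau> $ a) \<phi>)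
      \<and> (freq_vec (sol t) $ a) \<phi> = (L $ a) \<phi> - (LINT \<tau>:{0..t}|lborel. (D \<tau> $ a) \<phi>)" if s: "schwartz \<phi>" for a \<phi>
  proof
    let ?f = "\<lambda>\<tau> \<xi>. duhamel_integrand t \<tau> \<xi> $ a * inv_fourier \<phi> \<xi>"
    note I = integrable_duhamel_pairing[OF s, of t a]
    have Df: "(D \<tau> $ a) \<phi> = (LINT \<xi>|lborel. ?f \<tau> \<xi>)" for \<tau> by (simp add: D_def freq_dist_def)
    have "(D \<tau> $ a) \<phi> = 0" if "\<tau> \<notin> {0..t}" for \<tau>
      using that unfolding Df duhamel_integrand_def by auto
    then have ind: "indicator {0..t} \<tau> *\<^sub>R (D \<tau> $ a) \<phi> = (D \<tau> $ a) \<phi>" for \<tau> by (auto simp: indicator_def)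
    show "set_integrable lborel {0..t} (\<lambda>\<tau>. (D \<tau> $ a) \<phi>)"
      unfolding set_integrable_def ind unfolding Df by (rule lborel_pair.integrable_fst[OF I])
    have "(LINT \<tau>:{0..t}|lborel. (D \<tau> $ a) \<phi>) = (LINT \<tau>|lborel. LINT \<xi>|lborel. ?f \<tau> \<xi>)"
      unfolding set_lebesgue_integral_def ind unfolding Df ..
    also have "\<dots> = (LINT \<xi>|lborel. LINT \<tau>|lborel. ?f \<tau> \<xi>)" by (rule lborel_pair.Fubini_integral[OF I, symmetric])
    finally have E1: "(LINT \<tau>:{0..t}|lborel. (D \<tau> $ a) \<phi>) = (LINT \<xi>|lborel. LINT \<tau>|lborel. ?f \<tau> \<xi>)" .
    have iL: "integrable lborel (\<lambda>\<xi>. propagator t \<xi> (h0 \<xi>) $ a * inv_fourier \<phi> \<xi>)"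
      by (rule freq_dist_integrable(1)[OF freq_admissible_component[OF _ le_less_trans[OF prop_mass[OF t] h0_mass]] s]) measurable
    have iD: "integrable lborel (\<lambda>\<xi>. LINT \<tau>|lborel. ?f \<tau> \<xi>)" by (rule lborel_pair.integrable_snd[OF I])
    have "(freq_vec (sol t) $ a) \<phi> = (LINT \<xi>|lborel. propagator t \<xi> (h0 \<xi>) $ a * inv_fourier \<phi> \<xi> - (LINT \<tau>|lborel. ?f \<tau> \<xi>))"
      unfolding freq_vec_nth freq_dist_def
    proof (rule integral_cong_AE)
      have [measurable]: "\<phi> \<in> borel_measurable borel" by (rule schwartz_measurable[OF s])
      show "(\<lambda>\<xi>. sol t \<xi> $ a * inv_fourier \<phi> \<xi>) \<in> borel_measurable lborel" by measurable
      show "(\<lambda>\<xi>. propagator t \<xi> (h0 \<xi>) $ a * inv_fourier \<phi> \<xi> - (LINT \<tau>|lborel. ?f \<tau> \<xi>)) \<in> borel_measurable lborel"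
        using iL iD by (intro borel_measurable_diff borel_measurable_integrable)
      show "AE \<xi> in lborel. sol t \<xi> $ a * inv_fourier \<phi> \<xi> = propagator t \<xi> (h0 \<xi>) $ a * inv_fourier \<phi> \<xi> - (LINT \<tau>|lborel. ?f \<tau> \<xi>)"
        using AE_majorant_Msup_finite[OF mixed_sq_data_finite, of t] AE_lborel_singleton[of "0::real^3"]
      proof eventually_elim
        case (elim \<xi>)
        have "sol t \<xi> $ a = propagator t \<xi> (h0 \<xi>) $ a - (LINT \<tau>|lborel. duhamel_integrand t \<tau> \<xi> $ a)"
          using sol_fixed_point[OF elim(1)] bil_eq_time_integral[OF elim, of a] t by (simp add: linear_flow_def)
        then show ?case by (simp only: left_diff_distrib integral_mult_left_zero)
      qed
    qed
    also have "\<dots> = (L $ a) \<phi> - (LINT \<xi>|lborel. LINT \<tau>|lborel. ?f \<tau> \<xi>)"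
      unfolding Bochner_Integration.integral_diff[OF iL iD] by (simp add: L_def freq_dist_def)
    finally show "(freq_vec (sol t) $ a) \<phi> = (L $ a) \<phi> - (LINT \<tau>:{0..t}|lborel. (D \<tau> $ a) \<phi>)" unfolding E1 .
  qed
  show "\<exists>L D. semigroup_G t (freq_vec h0) L \<and>
          (AE \<tau> in lborel. 0 < \<tau> \<and> \<tau> < t \<longrightarrow> semigroup_G (t - \<tau>) (freq_vec (nonlinearity_hat (sol \<tau>))) (D \<tau>)) \<and>
          (\<forall>a \<phi>. schwartz \<phi> \<longrightarrow>
             set_integrable lborel {0..t} (\<lambda>\<tau>. (D \<tau> $ a) \<phi>) \<and>
             (freq_vec (sol t) $ a) \<phi> = (L $ a) \<phi> - (LINT \<tau>:{0..t}|lborel. (D \<tau> $ a) \<phi>))"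
    using semi[OF h0_meas h0_mass t] D pair unfolding L_def[symmetric] by blast
qed

end

section \<open>The initial data\<close>

definition e3 :: "real^3" where "e3 = axis 3 1"

definition \<upsilon> :: real where "\<upsilon> = unit_ball_vol 3"

lemma \<upsilon>_pos: "0 < \<upsilon>" by (simp add: \<upsilon>_def)

lemma emeasure_cball_3: "r \<ge> 0 \<Longrightarrow> emeasure lborel (cball (c :: real^3) r) = ennreal (\<upsilon> * r ^ 3)"
  by (simp add: emeasure_cball \<upsilon>_def)

lemma e3_nth [simp]: "e3 $ 1 = 0" "e3 $ 2 = 0" "e3 $ 3 = 1"
  by (simp_all add: e3_def axis_def)

lemma norm_e3 [simp]: "norm e3 = 1"
  by (simp add: e3_def)

text \<open>The velocity and the micro-rotation are both the curl of a wave packet oscillating in the third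
  direction at the frequencies \<open>2\<^sup>k\<close>, \<open>N < k \<le> 2 N\<close>, hence the transversal amplitude.\<close>

definition amplitude :: "real^3 \<Rightarrow> 3 \<Rightarrow> real" where
  "amplitude \<eta> k = (if k = 1 then \<eta>$3 else if k = 3 then - \<eta>$1 else 0)"

definition both :: "3 + 3 \<Rightarrow> 3" where
  "both a = (case a of Inl k \<Rightarrow> k | Inr k \<Rightarrow> k)"

lemma both_simps [simp]: "both (Inl k) = k" "both (Inr k) = k"
  by (auto simp: both_def)

lemma sum_power2_le: "(\<Sum>k\<in>{m..n}. (2::real) ^ k) \<le> 2 * 2 ^ n"
proof (induction n)
  case (Suc n)
  show ?case
  proof (cases "m \<le> Suc n")
    case True
    then have "(\<Sum>k\<in>{m..Suc n}. (2::real) ^ k) = (\<Sum>k\<in>{m..n}. 2 ^ k) + 2 ^ Suc n" by (simp add: sum.nat_ivl_Suc')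
    then show ?thesis using Suc by simp
  qed simp
qed (cases "m = 0"; simp)

text \<open>The frequencies being lacunary, the square of the sum is comparable to the sum of squares after
  weighting with the largest frequency.\<close>

lemma lacunary_square:
  assumes "t \<ge> 0"
  shows "(\<Sum>k\<in>{m..n}. 2 ^ k * exp (- t * 4 ^ k / 16))\<^sup>2 \<le> 4 * (\<Sum>k\<in>{m..n}. (4::real) ^ k * exp (- t * 4 ^ k / 16))"
proof (induction n)
  case 0
  show ?case
  proof (cases "m = 0")
    case True
    have "(exp (- t / 16))\<^sup>2 \<le> 1 * exp (- t / 16)"
      unfolding power2_eq_square using assms by (intro mult_right_mono) auto
    then show ?thesis using True by (simp add: order_trans[of _ "exp (- t / 16)"])
  qed simp
next
  case (Suc n)
  show ?case
  proof (cases "m \<le> Suc n")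
    case True
    let ?x = "\<lambda>k. 2 ^ k * exp (- t * 4 ^ k / 16)"
    let ?s = "\<Sum>k\<in>{m..n}. ?x k"
    have x_le: "?x k \<le> 2 ^ k" for k using assms by (simp add: mult_left_le)
    have s_le: "?s \<le> 2 ^ Suc n"
      using sum_mono[of "{m..n}" ?x "\<lambda>k. 2 ^ k"] x_le sum_power2_le[of m n] by simp
    have "(\<Sum>k\<in>{m..Suc n}. ?x k)\<^sup>2 = (?s + ?x (Suc n))\<^sup>2" using True by (simp add: sum.nat_ivl_Suc' add.commute)
    also have "\<dots> = ?s\<^sup>2 + ?x (Suc n) * (2 * ?s + ?x (Suc n))" by (simp add: power2_eq_square algebra_simps)
    also have "\<dots> \<le> 4 * (\<Sum>k\<in>{m..n}. (4::real) ^ k * exp (- t * 4 ^ k / 16)) + ?x (Suc n) * (2 * 2 ^ Suc n + 2 ^ Suc n)"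
      using s_le x_le[of "Suc n"] by (intro add_mono Suc mult_left_mono) auto
    also have "?x (Suc n) * (2 * 2 ^ Suc n + 2 ^ Suc n) \<le> 4 * (4 ^ Suc n * exp (- t * 4 ^ Suc n / 16))"
    proof -
      have "(4::real) ^ Suc n = 2 ^ Suc n * 2 ^ Suc n" by (simp flip: power_mult_distrib)
      then have "?x (Suc n) * (2 * 2 ^ Suc n + 2 ^ Suc n) = 3 * (4 ^ Suc n * exp (- t * 4 ^ Suc n / 16))"
        by (simp add: algebra_simps)
      then show ?thesis by simp
    qed
    finally have "(\<Sum>k\<in>{m..Suc n}. ?x k)\<^sup>2 \<le> 4 * (\<Sum>k\<in>{m..n}. (4::real) ^ k * exp (- t * 4 ^ k / 16)) + 4 * (4 ^ Suc n * exp (- t * 4 ^ Suc n / 16))"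
      by simp
    then show ?thesis using True by (simp add: sum.nat_ivl_Suc' algebra_simps)
  qed simp
qed

locale inflation_data =
  fixes \<delta> :: real and N :: nat
  assumes \<delta>: "0 < \<delta>" and N: "4 \<le> N"
begin

text \<open>The radius leaves room for \<open>\<eta>\<close> and \<open>\<xi> - \<eta>\<close> to lie in opposite balls, for every \<open>\<xi>\<close> of modulus at most
  8/3.\<close>

definition pair_ball :: "nat \<Rightarrow> (real^3) set" where
  "pair_ball k = cball (2 ^ k *\<^sub>R e3) 3 \<union> cball (- (2 ^ k) *\<^sub>R e3) 3"

definition S :: "(real^3) set" where
  "S = (\<Union>k\<in>{N+1..2*N}. pair_ball k)"

text \<open>The amplitude is normalized so that the square sum over the \<open>N\<close> packets is \<open>\<delta>\<^sup>2\<close>.\<close>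

definition c :: real where "c = \<delta> / sqrt N"

definition h0 :: "real^3 \<Rightarrow> complex^(3+3)" where
  "h0 \<eta> = (\<chi> a. \<i> * of_real (c * indicator S \<eta> * amplitude \<eta> (both a)))"

lemma c_pos: "0 < c" using \<delta> N by (simp add: c_def)

lemma c_sq: "c\<^sup>2 * N = \<delta>\<^sup>2" using N by (simp add: c_def power_divide)

lemma S_borel [measurable]: "S \<in> sets borel"
  unfolding S_def pair_ball_def by (intro sets.finite_UN) auto

lemma pair_ball_borel [measurable]: "pair_ball k \<in> sets borel"
  unfolding pair_ball_def by auto

lemma pow_ge_32: "k \<ge> N + 1 \<Longrightarrow> (32::real) \<le> 2 ^ k"
  using power_increasing[of 5 k "2::real"] N by simp

lemma pair_ball_facts:
  assumes "\<eta> \<in> pair_ball k"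
  shows "2 ^ k - 3 \<le> norm \<eta>" "norm \<eta> \<le> 2 ^ k + 3" "\<bar>\<eta>$1\<bar> \<le> 3" "\<bar>\<eta>$2\<bar> \<le> 3"
proof -
  obtain s :: real where s: "\<bar>s\<bar> = 2 ^ k" "norm (\<eta> - s *\<^sub>R e3) \<le> 3"
    using assms by (auto simp: pair_ball_def dist_norm norm_minus_commute
        intro: that[of "2 ^ k"] that[of "- (2 ^ k)"])
  show "2 ^ k - 3 \<le> norm \<eta>" "norm \<eta> \<le> 2 ^ k + 3"
    using norm_triangle_sub[of \<eta> "s *\<^sub>R e3"] norm_triangle_sub[of "s *\<^sub>R e3" \<eta>] s
    by (auto simp: norm_minus_commute)
  show "\<bar>\<eta>$1\<bar> \<le> 3" "\<bar>\<eta>$2\<bar> \<le> 3"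
    using component_le_norm_cart[of "\<eta> - s *\<^sub>R e3" 1] component_le_norm_cart[of "\<eta> - s *\<^sub>R e3" 2] s(2) by auto
qed

lemma S_facts:
  assumes "\<eta> \<in> S"
  shows "2 ^ N \<le> norm \<eta>" "29 \<le> norm \<eta>" "\<bar>\<eta>$1\<bar> \<le> 3" "\<bar>\<eta>$2\<bar> \<le> 3" "norm \<eta> \<le> 2 * 2 ^ (2 * N)"
proof -
  obtain k where k: "N + 1 \<le> k" "k \<le> 2 * N" "\<eta> \<in> pair_ball k" using assms by (auto simp: S_def)
  have p: "(32::real) \<le> 2 ^ k" by (rule pow_ge_32[OF k(1)])
  have q: "2 * (2::real) ^ N \<le> 2 ^ k" using power_increasing[OF k(1), of "2::real"] by simp
  have r: "(2::real) ^ k \<le> 2 ^ (2 * N)" using power_increasing[OF k(2), of "2::real"] by simp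
  have n: "(16::real) \<le> 2 ^ N" using power_increasing[OF N, of "2::real"] by simp
  note f = pair_ball_facts[OF k(3)]
  show "2 ^ N \<le> norm \<eta>" using f(1) q n by linarith
  show "29 \<le> norm \<eta>" using f(1) p by linarith
  show "\<bar>\<eta>$1\<bar> \<le> 3" "\<bar>\<eta>$2\<bar> \<le> 3" by (fact f)+
  show "norm \<eta> \<le> 2 * 2 ^ (2 * N)" using f(2) p r by linarith
qed

lemma pair_ball_uminus: "- \<eta> \<in> pair_ball k \<longleftrightarrow> \<eta> \<in> pair_ball k"
proof -
  have d: "dist (s *\<^sub>R e3) (- \<eta>) = dist (- s *\<^sub>R e3) \<eta>" for s
  proof -
    have "- s *\<^sub>R e3 - \<eta> = - (s *\<^sub>R e3 - - \<eta>)" by simp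
    then show ?thesis unfolding dist_norm by (simp only: norm_minus_cancel)
  qed
  show ?thesis using d[of "2 ^ k"] d[of "- (2 ^ k)"] by (auto simp: pair_ball_def)
qed

lemma S_uminus: "- \<eta> \<in> S \<longleftrightarrow> \<eta> \<in> S"
  by (simp add: S_def pair_ball_uminus)

lemma emeasure_pair_ball: "emeasure lborel (pair_ball k) \<le> ennreal (54 * \<upsilon>)"
proof -
  have "emeasure lborel (pair_ball k) \<le> ennreal (\<upsilon> * 3 ^ 3) + ennreal (\<upsilon> * 3 ^ 3)"
    unfolding pair_ball_def
    by (rule order_trans[OF emeasure_subadditive]) (auto simp: emeasure_cball_3)
  also have "\<dots> = ennreal (54 * \<upsilon>)" using \<upsilon>_pos by (simp flip: ennreal_plus)
  finally show ?thesis .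
qed

lemma emeasure_S: "emeasure lborel S \<le> ennreal (54 * \<upsilon> * N)"
proof -
  have "emeasure lborel S \<le> (\<Sum>k\<in>{N+1..2*N}. emeasure lborel (pair_ball k))"
    unfolding S_def by (rule emeasure_subadditive_finite) auto
  also have "\<dots> \<le> (\<Sum>k\<in>{N+1..2*N}. ennreal (54 * \<upsilon>))" by (intro sum_mono emeasure_pair_ball)
  also have "\<dots> = ennreal (54 * \<upsilon> * N)"
    using \<upsilon>_pos by (simp add: ennreal_of_nat_eq_real_of_nat mult.commute flip: ennreal_mult)
  finally show ?thesis .
qed

lemma h0_nth: "h0 \<eta> $ a = \<i> * of_real (c * indicator S \<eta> * amplitude \<eta> (both a))"
  by (simp add: h0_def)

lemma h0_outside: "\<eta> \<notin> S \<Longrightarrow> h0 \<eta> = 0"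
  by (simp add: h0_def vec_eq_iff)

lemma h0_measurable [measurable]: "h0 \<in> borel_measurable borel"
  by (rule measurable_vecI) (simp add: h0_nth amplitude_def)

lemma h0_symmetric: "h0 (- \<eta>) = vcnj (h0 \<eta>)"
  by (simp add: h0_def vcnj_def vec_eq_iff amplitude_def S_uminus indicator_def)

lemma norm_h0_le: "norm (h0 \<eta>) \<le> 4 * c * norm \<eta> * indicator S \<eta>"
proof -
  have a: "cmod (h0 \<eta> $ a) = c * indicator S \<eta> * \<bar>amplitude \<eta> (both a)\<bar>" for a
    using c_pos by (simp add: h0_nth norm_mult abs_mult)
  have "norm (h0 \<eta>) \<le> (\<Sum>a\<in>UNIV. cmod (h0 \<eta> $ a))" by (rule norm_le_sum_cmod)
  also have "\<dots> = c * indicator S \<eta> * (2 * (\<bar>\<eta>$3\<bar> + \<bar>\<eta>$1\<bar>))"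
    unfolding a sum_UNIV_Plus sum_3 by (simp add: amplitude_def algebra_simps)
  also have "\<dots> \<le> c * indicator S \<eta> * (2 * (norm \<eta> + norm \<eta>))"
    using c_pos by (intro mult_left_mono add_mono component_le_norm_cart) auto
  finally show ?thesis by (simp add: mult_ac)
qed

lemma weighted_mass_h0: "weighted_mass h0 < \<infinity>"
proof -
  have "weighted_mass h0 \<le> (\<integral>\<^sup>+\<xi>. ennreal (4 * c) * indicator S \<xi> \<partial>lborel)"
    unfolding weighted_mass_def
  proof (rule nn_integral_mono)
    fix \<xi> :: "real^3"
    have "norm (h0 \<xi>) * (1 / norm \<xi>) \<le> 4 * c * norm \<xi> * indicator S \<xi> * (1 / norm \<xi>)"
      by (intro mult_right_mono norm_h0_le) auto
    also have "\<dots> \<le> 4 * c * indicator S \<xi>" using c_pos by (cases "\<xi> = 0") auto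
    finally show "ennreal (norm (h0 \<xi>)) * ennreal (1 / norm \<xi>) \<le> ennreal (4 * c) * indicator S \<xi>"
      using c_pos by (cases "\<xi> \<in> S") (simp_all add: ennreal_leI h0_outside flip: ennreal_mult)
  qed
  also have "\<dots> = ennreal (4 * c) * emeasure lborel S" by (subst nn_integral_cmult_indicator) auto
  also have "\<dots> < \<infinity>" using le_less_trans[OF emeasure_S] by (simp add: ennreal_mult_less_top)
  finally show ?thesis .
qed

lemma divergence_free_h0: "divergence_free (velocity (freq_vec h0))"
  unfolding divergence_free_def
proof (intro allI impI)
  fix \<phi> :: "real^3 \<Rightarrow> complex" assume s: "schwartz \<phi>"
  have adm: "freq_admissible (\<lambda>\<xi>. \<i> * of_real (\<xi>$k) * h0 \<xi> $ Inl k)" for k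
  proof (rule integrable_imp_freq_admissible, rule Bochner_Integration.integrable_bound)
    let ?R = "2 * 2 ^ (2 * N) :: real"
    have "emeasure lborel S < \<infinity>" using le_less_trans[OF emeasure_S] by simp
    then show "integrable lborel (\<lambda>\<xi>. indicator S \<xi> *\<^sub>R (?R * (4 * c * ?R)))"
      by (intro integrable_scaleR_left integrable_real_indicator) auto
    have "norm (\<i> * of_real (\<xi>$k) * h0 \<xi> $ Inl k) \<le> norm (indicator S \<xi> *\<^sub>R (?R * (4 * c * ?R)))" for \<xi>
    proof (cases "\<xi> \<in> S")
      case True
      note R = S_facts(5)[OF True]
      have "cmod (h0 \<xi> $ Inl k) \<le> 4 * c * norm \<xi>"
        using order_trans[OF Finite_Cartesian_Product.norm_nth_le[of "h0 \<xi>" "Inl k"] norm_h0_le[of \<xi>]] True by simp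
      also have "\<dots> \<le> 4 * c * ?R" using R c_pos by (intro mult_left_mono) auto
      finally have "\<bar>\<xi>$k\<bar> * cmod (h0 \<xi> $ Inl k) \<le> ?R * (4 * c * ?R)"
        using R component_le_norm_cart[of \<xi> k] by (intro mult_mono) auto
      then show ?thesis using True c_pos by (simp add: norm_mult)
    qed (simp add: h0_outside)
    then show "AE \<xi> in lborel. norm (\<i> * of_real (\<xi>$k) * h0 \<xi> $ Inl k) \<le> norm (indicator S \<xi> *\<^sub>R (?R * (4 * c * ?R)))"
      by simp
  qed measurable
  have "(\<Sum>k\<in>UNIV. dist_deriv k (velocity (freq_vec h0) $ k) \<phi>) = (\<Sum>k\<in>UNIV. freq_dist (\<lambda>\<xi>. \<i> * of_real (\<xi>$k) * h0 \<xi> $ Inl k) \<phi>)"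
    by (simp add: velocity_def dist_deriv_freq_dist[OF s])
  also have "\<dots> = freq_dist (\<lambda>\<xi>. \<Sum>k\<in>UNIV. \<i> * of_real (\<xi>$k) * h0 \<xi> $ Inl k) \<phi>"
    by (rule freq_dist_sum[OF adm s, symmetric])
  also have "(\<lambda>\<xi>. \<Sum>k\<in>UNIV. \<i> * of_real (\<xi>$k) * h0 \<xi> $ Inl k) = (\<lambda>\<xi>. 0)"
    by (auto simp: sum_3 h0_nth amplitude_def algebra_simps)
  finally show "(\<Sum>k\<in>UNIV. dist_deriv k (velocity (freq_vec h0) $ k) \<phi>) = 0" by (simp add: freq_dist_def)
qed

subsection \<open>Size in the mixed norm\<close>

text \<open>The rate 1/4 instead of 1/2 in the exponent leaves room for the polynomial factors in the
  comparison with the heat flow.\<close>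

definition H :: "real \<Rightarrow> real^3 \<Rightarrow> ennreal" where
  "H t \<xi> = (if t < 0 then 0 else ennreal (exp (- t * (norm \<xi>)\<^sup>2 / 4) * norm (h0 \<xi>)))"

lemma jm_H: "jointly_measurable H"
  by (rule jointly_measurableI) (unfold H_def, measurable)

lemma heat_majorant_le_H: "heat_majorant h0 t \<xi> \<le> H t \<xi>"
  unfolding H_def heat_majorant_def by (auto intro!: ennreal_leI mult_right_mono)

lemma H_slice:
  assumes t: "t \<ge> 0"
  shows "(\<integral>\<^sup>+\<xi>. H t \<xi> \<partial>lborel) \<le> ennreal (432 * \<upsilon> * c * (\<Sum>k\<in>{N+1..2*N}. 2 ^ k * exp (- t * 4 ^ k / 16)))"
proof -
  let ?b = "\<lambda>k. 8 * c * (2 ^ k * exp (- t * 4 ^ k / 16))"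
  have b0: "0 \<le> ?b k" for k using c_pos by simp
  have "(\<integral>\<^sup>+\<xi>. H t \<xi> \<partial>lborel) \<le> (\<integral>\<^sup>+\<xi>. (\<Sum>k\<in>{N+1..2*N}. ennreal (?b k) * indicator (pair_ball k) \<xi>) \<partial>lborel)"
  proof (rule nn_integral_mono)
    fix \<xi> :: "real^3"
    show "H t \<xi> \<le> (\<Sum>k\<in>{N+1..2*N}. ennreal (?b k) * indicator (pair_ball k) \<xi>)"
    proof (cases "\<xi> \<in> S")
      case True
      then obtain k where k: "k \<in> {N+1..2*N}" "\<xi> \<in> pair_ball k" by (auto simp: S_def)
      note f = pair_ball_facts[OF k(2)]
      have p: "(32::real) \<le> 2 ^ k" using k by (intro pow_ge_32) auto
      have "2 ^ k / 2 \<le> norm \<xi>" using f(1) p by linarith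
      then have "(2 ^ k / 2)\<^sup>2 \<le> (norm \<xi>)\<^sup>2" by (intro power_mono) auto
      moreover have "((2::real) ^ k / 2)\<^sup>2 = 4 ^ k / 4" by (simp add: power_divide power2_eq_square flip: power_mult_distrib)
      ultimately have "t * (4 ^ k / 4) \<le> t * (norm \<xi>)\<^sup>2" using t by (intro mult_left_mono) auto
      then have e: "exp (- t * (norm \<xi>)\<^sup>2 / 4) \<le> exp (- t * 4 ^ k / 16)" by simp
      have "norm (h0 \<xi>) \<le> 4 * c * norm \<xi>" using norm_h0_le[of \<xi>] True by simp
      also have "\<dots> \<le> 4 * c * (2 * 2 ^ k)" using f(2) p c_pos by (intro mult_left_mono) auto
      finally have "exp (- t * (norm \<xi>)\<^sup>2 / 4) * norm (h0 \<xi>) \<le> exp (- t * 4 ^ k / 16) * (4 * c * (2 * 2 ^ k))"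
        using e by (intro mult_mono) auto
      then have "H t \<xi> \<le> ennreal (?b k) * indicator (pair_ball k) \<xi>"
        using t k by (simp add: H_def ennreal_leI mult_ac)
      also have "\<dots> \<le> (\<Sum>k\<in>{N+1..2*N}. ennreal (?b k) * indicator (pair_ball k) \<xi>)"
        by (rule member_le_sum[OF k(1)]) auto
      finally show ?thesis .
    qed (simp add: H_def h0_outside)
  qed
  also have "\<dots> = (\<Sum>k\<in>{N+1..2*N}. ennreal (?b k) * emeasure lborel (pair_ball k))"
    by (subst nn_integral_sum) (auto simp: nn_integral_cmult_indicator)
  also have "\<dots> \<le> (\<Sum>k\<in>{N+1..2*N}. ennreal (?b k) * ennreal (54 * \<upsilon>))"
    by (intro sum_mono mult_left_mono emeasure_pair_ball) auto
  also have "\<dots> = (\<Sum>k\<in>{N+1..2*N}. ennreal (?b k * (54 * \<upsilon>)))"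
    using b0 \<upsilon>_pos by (intro sum.cong refl ennreal_mult[symmetric]) auto
  also have "\<dots> = ennreal (\<Sum>k\<in>{N+1..2*N}. ?b k * (54 * \<upsilon>))"
    using c_pos \<upsilon>_pos by (intro sum_ennreal mult_nonneg_nonneg) auto
  also have "(\<Sum>k\<in>{N+1..2*N}. ?b k * (54 * \<upsilon>)) = 432 * \<upsilon> * c * (\<Sum>k\<in>{N+1..2*N}. 2 ^ k * exp (- t * 4 ^ k / 16))"
    unfolding sum_distrib_left by (intro sum.cong) auto
  finally show ?thesis .
qed

lemma nn_integral_exponential:
  assumes "0 < \<rho>"
  shows "(\<integral>\<^sup>+t. ennreal (indicator {0..} t * (\<rho> * exp (- t * \<rho>))) \<partial>lborel) = 1"
proof -
  have "indicator {0..} t * (\<rho> * exp (- t * \<rho>)) = exponential_density \<rho> t" for t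
    by (auto simp: exponential_density_def indicator_def)
  then show ?thesis
    using prob_space.emeasure_space_1[OF prob_space_exponential_density[OF assms]]
    by (simp add: emeasure_density)
qed

text \<open>Each packet contributes a multiple of \<open>c\<^sup>2\<close>, because its linear evolution lives for a time of order
  \<open>4\<^sup>-\<^sup>k\<close>.\<close>

lemma mixed_sq_H: "mixed_sq H \<le> ennreal ((3456 * \<upsilon> * \<delta>)\<^sup>2)"
proof -
  let ?w = "\<lambda>k t. indicator {0..} t * (4 ^ k / 16 * exp (- t * (4 ^ k / 16))) :: real"
  let ?C = "64 * (432 * \<upsilon> * c)\<^sup>2"
  have "mixed_sq H \<le> (\<integral>\<^sup>+t. (\<Sum>k\<in>{N+1..2*N}. ennreal ?C * ennreal (?w k t)) \<partial>lborel)"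
    unfolding mixed_sq_def
  proof (rule nn_integral_mono)
    fix t :: real
    show "(\<integral>\<^sup>+\<xi>. H t \<xi> \<partial>lborel)\<^sup>2 \<le> (\<Sum>k\<in>{N+1..2*N}. ennreal ?C * ennreal (?w k t))"
    proof (cases "t < 0")
      case True
      then show ?thesis by (simp add: H_def)
    next
      case False
      then have t: "0 \<le> t" by simp
      let ?s = "\<Sum>k\<in>{N+1..2*N}. 2 ^ k * exp (- t * 4 ^ k / 16)"
      have s0: "0 \<le> ?s" by (intro sum_nonneg) auto
      have "(\<integral>\<^sup>+\<xi>. H t \<xi> \<partial>lborel)\<^sup>2 \<le> (ennreal (432 * \<upsilon> * c * ?s))\<^sup>2"
        by (intro power_mono H_slice[OF t]) auto
      also have "\<dots> = ennreal ((432 * \<upsilon> * c * ?s)\<^sup>2)"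
        using \<upsilon>_pos c_pos s0 by (intro ennreal_power) auto
      also have "\<dots> \<le> ennreal ((432 * \<upsilon> * c)\<^sup>2 * (4 * (\<Sum>k\<in>{N+1..2*N}. 4 ^ k * exp (- t * 4 ^ k / 16))))"
        unfolding power_mult_distrib[of _ ?s] by (intro ennreal_leI mult_left_mono lacunary_square[OF t]) auto
      also have "(432 * \<upsilon> * c)\<^sup>2 * (4 * (\<Sum>k\<in>{N+1..2*N}. 4 ^ k * exp (- t * 4 ^ k / 16))) = (\<Sum>k\<in>{N+1..2*N}. ?C * ?w k t)"
        using t unfolding sum_distrib_left by (intro sum.cong) auto
      also have "ennreal \<dots> = (\<Sum>k\<in>{N+1..2*N}. ennreal (?C * ?w k t))"
        by (intro sum_ennreal[symmetric] mult_nonneg_nonneg) auto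
      also have "\<dots> = (\<Sum>k\<in>{N+1..2*N}. ennreal ?C * ennreal (?w k t))"
        by (intro sum.cong ennreal_mult) auto
      finally show ?thesis .
    qed
  qed
  also have "\<dots> = (\<Sum>k\<in>{N+1..2*N}. ennreal ?C * (\<integral>\<^sup>+t. ennreal (?w k t) \<partial>lborel))"
    by (subst nn_integral_sum) (auto simp: nn_integral_cmult)
  also have "\<dots> = (\<Sum>k\<in>{N+1..2*N}. ennreal ?C)"
    using nn_integral_exponential[of "4 ^ _ / 16"] by simp
  also have "\<dots> = ennreal (?C * N)"
    by (simp add: ennreal_of_nat_eq_real_of_nat mult.commute flip: ennreal_mult)
  also have "?C * N = (3456 * \<upsilon> * \<delta>)\<^sup>2"
    unfolding power_mult_distrib c_sq[symmetric] by (simp add: power2_eq_square)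
  finally show ?thesis .
qed

lemma mixed_sq_heat_majorant: "mixed_sq (heat_majorant h0) \<le> ennreal ((3456 * \<upsilon> * \<delta>)\<^sup>2)"
  by (rule order_trans[OF mixed_sq_mono[OF heat_majorant_le_H] mixed_sq_H])

end

lemma ennreal_le_of_sq_le:
  assumes "a\<^sup>2 \<le> ennreal (b\<^sup>2)" "0 \<le> b"
  shows "a \<le> ennreal b"
proof (cases a)
  case (real x)
  then have "x\<^sup>2 \<le> b\<^sup>2" using assms by (simp add: ennreal_power ennreal_le_iff)
  then have "x \<le> b" using assms(2) by (rule power2_le_imp_le)
  then show ?thesis using real by (simp add: ennreal_leI)
next
  case top
  then show ?thesis using assms by (simp add: power2_eq_square top_unique)
qed

locale inflation = littlewood_paley_partition \<psi> + inflation_data \<delta> N for \<psi> \<delta> N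
begin

subsection \<open>Size in the Besov norm\<close>

text \<open>A dyadic block meets the packets of at most four of the frequencies \<open>2\<^sup>k\<close>.\<close>

lemma block_mass:
  "(\<integral>\<^sup>+\<xi>. ennreal (\<psi>d j \<xi> * cmod (h0 \<xi> $ a)) \<partial>lborel)
    \<le> (\<Sum>k\<in>{k\<in>{N+1..2*N}. j - 1 \<le> int k \<and> int k \<le> j + 2}. ennreal (576 * \<upsilon> * c * 2 powi j))"
proof -
  let ?K = "{k\<in>{N+1..2*N}. j - 1 \<le> int k \<and> int k \<le> j + 2}"
  let ?B = "32/3 * c * 2 powi j"
  have B: "0 \<le> ?B" using c_pos by simp
  have "(\<integral>\<^sup>+\<xi>. ennreal (\<psi>d j \<xi> * cmod (h0 \<xi> $ a)) \<partial>lborel) \<le> (\<integral>\<^sup>+\<xi>. (\<Sum>k\<in>?K. ennreal ?B * indicator (pair_ball k) \<xi>) \<partial>lborel)"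
  proof (rule nn_integral_mono)
    fix \<xi> :: "real^3"
    show "ennreal (\<psi>d j \<xi> * cmod (h0 \<xi> $ a)) \<le> (\<Sum>k\<in>?K. ennreal ?B * indicator (pair_ball k) \<xi>)"
    proof (cases "\<xi> \<in> S \<and> \<psi>d j \<xi> \<noteq> 0")
      case True
      then obtain k where k: "k \<in> {N+1..2*N}" "\<xi> \<in> pair_ball k" by (auto simp: S_def)
      have p: "(32::real) \<le> 2 ^ k" using k by (intro pow_ge_32) auto
      note f = pair_ball_facts[OF k(2)]
      have s: "3/4 * 2 powi j \<le> norm \<xi>" "norm \<xi> \<le> 8/3 * 2 powi j" using \<psi>d_support[of j \<xi>] True by auto
      have "int k \<le> j + 2"
      proof (rule ccontr)
        assume "\<not> int k \<le> j + 2"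
        then have "(2::real) powi (j + 3) \<le> 2 powi int k" by (intro power_int_increasing) auto
        then have "8 * (2::real) powi j \<le> 2 ^ k" by (simp add: power_int_add)
        then show False using f(1) s(2) p by linarith
      qed
      moreover have "j - 1 \<le> int k"
      proof (rule ccontr)
        assume "\<not> j - 1 \<le> int k"
        then have "(2::real) powi (int k + 2) \<le> 2 powi j" by (intro power_int_increasing) auto
        then have "4 * (2::real) ^ k \<le> 2 powi j" by (simp add: power_int_add)
        then show False using f(2) s(1) p by linarith
      qed
      ultimately have kK: "k \<in> ?K" using k by auto
      have "cmod (h0 \<xi> $ a) \<le> 4 * c * norm \<xi>"
        using order_trans[OF Finite_Cartesian_Product.norm_nth_le[of "h0 \<xi>" a] norm_h0_le[of \<xi>]] True by simp
      also have "\<dots> \<le> 4 * c * (8/3 * 2 powi j)" using s c_pos by (intro mult_left_mono) auto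
      finally have "\<psi>d j \<xi> * cmod (h0 \<xi> $ a) \<le> 1 * (4 * c * (8/3 * 2 powi j))"
        using \<psi>d_le_1 \<psi>d_nonneg by (intro mult_mono) auto
      then have "ennreal (\<psi>d j \<xi> * cmod (h0 \<xi> $ a)) \<le> ennreal ?B * indicator (pair_ball k) \<xi>"
        using k by (simp add: ennreal_leI)
      also have "\<dots> \<le> (\<Sum>k\<in>?K. ennreal ?B * indicator (pair_ball k) \<xi>)"
        by (rule member_le_sum[OF kK]) auto
      finally show ?thesis .
    qed (auto simp: h0_outside)
  qed
  also have "\<dots> = (\<Sum>k\<in>?K. ennreal ?B * emeasure lborel (pair_ball k))"
    by (subst nn_integral_sum) (auto simp: nn_integral_cmult_indicator)
  also have "\<dots> \<le> (\<Sum>k\<in>?K. ennreal ?B * ennreal (54 * \<upsilon>))"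
    by (intro sum_mono mult_left_mono emeasure_pair_ball) auto
  also have "ennreal ?B * ennreal (54 * \<upsilon>) = ennreal (576 * \<upsilon> * c * 2 powi j)"
    using B \<upsilon>_pos by (subst ennreal_mult[symmetric]) auto
  finally show ?thesis .
qed

text \<open>The blocks have equal size of order \<open>c = \<delta> N\<^sup>-\<^sup>1\<^sup>/\<^sup>2\<close>, and there are about \<open>N\<close> of them, so that the
  norm is of order \<open>N\<^sup>1\<^sup>/\<^sup>r\<^sup>-\<^sup>1\<^sup>/\<^sup>2\<close>.\<close>

lemma besov_component:
  assumes r: "r > 0"
  shows "besov_norm \<psi> (- 1) \<infinity> r (freq_dist (\<lambda>\<xi>. h0 \<xi> $ a))
    \<le> ennreal (2304 * \<upsilon> * c * (if r = \<infinity> then 1 else real (N + 3) powr (1 / enn2real r)))"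
proof -
  let ?K = "\<lambda>j. {k\<in>{N+1..2*N}. j - 1 \<le> int k \<and> int k \<le> j + 2}"
  let ?J = "{int N - 1..2 * int N + 1}"
  have adm: "freq_admissible (\<lambda>\<xi>. h0 \<xi> $ a)" by (rule freq_admissible_component[OF h0_measurable weighted_mass_h0])
  have b: "dist_Lnorm \<infinity> (LP_block \<psi> j (freq_dist (\<lambda>\<xi>. h0 \<xi> $ a))) \<le> (\<Sum>k\<in>?K j. ennreal (576 * \<upsilon> * c * 2 powi j))" for j
    by (rule order_trans[OF LP_block_sup_norm_le[OF adm] block_mass])
  have card: "card (?K j) \<le> 4" for j
  proof -
    have "?K j \<subseteq> nat ` {j - 1..j + 2}" by (force simp: image_iff)
    then have "card (?K j) \<le> card (nat ` {j - 1..j + 2})" by (intro card_mono) auto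
    also have "\<dots> \<le> card {j - 1..j + 2}" by (intro card_image_le) auto
    finally show ?thesis by simp
  qed
  have "besov_norm \<psi> (- 1) \<infinity> r (freq_dist (\<lambda>\<xi>. h0 \<xi> $ a))
      \<le> ennreal (2304 * \<upsilon> * c * (if r = \<infinity> then 1 else real (card ?J) powr (1 / enn2real r)))"
    unfolding besov_norm_def
  proof (rule dyadic_norm_finite_support_le)
    show "0 \<le> 2304 * \<upsilon> * c" using \<upsilon>_pos c_pos by simp
    show "dist_Lnorm \<infinity> (LP_block \<psi> j (freq_dist (\<lambda>\<xi>. h0 \<xi> $ a))) = 0" if "j \<notin> ?J" for j
    proof -
      have K: "?K j = {}" using that by auto
      show ?thesis using b[of j] unfolding K by simp
    qed
    show "ennreal (2 powr - real_of_int j) * dist_Lnorm \<infinity> (LP_block \<psi> j (freq_dist (\<lambda>\<xi>. h0 \<xi> $ a))) \<le> ennreal (2304 * \<upsilon> * c)" for j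
    proof -
      have "dist_Lnorm \<infinity> (LP_block \<psi> j (freq_dist (\<lambda>\<xi>. h0 \<xi> $ a))) \<le> ennreal (real (card (?K j)) * (576 * \<upsilon> * c * 2 powi j))"
        using b[of j] \<upsilon>_pos c_pos by (simp add: ennreal_of_nat_eq_real_of_nat ennreal_mult)
      also have "\<dots> \<le> ennreal (4 * (576 * \<upsilon> * c * 2 powi j))"
        using card[of j] \<upsilon>_pos c_pos by (intro ennreal_leI mult_right_mono) auto
      finally have "ennreal (2 powr - real_of_int j) * dist_Lnorm \<infinity> (LP_block \<psi> j (freq_dist (\<lambda>\<xi>. h0 \<xi> $ a)))
          \<le> ennreal (2 powr - real_of_int j) * ennreal (4 * (576 * \<upsilon> * c * 2 powi j))" by (rule mult_left_mono) simp
      also have "\<dots> = ennreal (2 powr - real_of_int j * (4 * (576 * \<upsilon> * c * 2 powi j)))"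
        using \<upsilon>_pos c_pos by (intro ennreal_mult[symmetric]) auto
      also have "2 powr - real_of_int j * (4 * (576 * \<upsilon> * c * 2 powi j)) = 2304 * \<upsilon> * c"
        by (simp add: powr_minus powr_real_of_int')
      finally show ?thesis .
    qed
  qed (use r in auto)
  moreover have card: "card ?J = N + 3" by simp
  ultimately show ?thesis by (simp only: card)
qed

lemma vec_besov_norm_h0:
  assumes r: "r > 0"
  shows "vec_besov_norm \<psi> (- 1) \<infinity> r (freq_vec h0)
    \<le> ennreal (13824 * \<upsilon> * c * (if r = \<infinity> then 1 else real (N + 3) powr (1 / enn2real r)))"
proof -
  let ?x = "if r = \<infinity> then 1 else real (N + 3) powr (1 / enn2real r)"
  have "vec_besov_norm \<psi> (- 1) \<infinity> r (freq_vec h0) \<le> (\<Sum>a\<in>(UNIV::(3+3) set). ennreal (2304 * \<upsilon> * c * ?x))"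
    unfolding vec_besov_norm_def freq_vec_nth by (intro sum_mono besov_component r)
  also have "\<dots> = ennreal (6 * (2304 * \<upsilon> * c * ?x))"
    by (subst ennreal_mult) (use \<upsilon>_pos c_pos in auto)
  finally show ?thesis by (simp add: mult.assoc)
qed

subsection \<open>Comparison with the heat flow\<close>

definition heat_flow :: "real \<Rightarrow> real^3 \<Rightarrow> complex^(3+3)" where
  "heat_flow t \<xi> = (if t < 0 then 0 else exp (- t * (norm \<xi>)\<^sup>2) *\<^sub>R h0 \<xi>)"

lemma jm_heat_flow: "jointly_measurable heat_flow"
  by (rule jointly_measurableI) (unfold heat_flow_def, measurable)

lemma heat_flow_le_H: "ennreal (norm (heat_flow t \<xi>)) \<le> H t \<xi>"
  by (auto simp: heat_flow_def H_def intro!: ennreal_leI mult_right_mono mult_left_mono)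

lemma linear_flow_le_H: "ennreal (norm (linear_flow h0 t \<xi>)) \<le> H t \<xi>"
  by (rule order_trans[OF linear_flow_le heat_majorant_le_H])

text \<open>The data being divergence free, the coupling of the two fields is of first order at most, hence smaller
  than the Laplacian by a factor \<open>2\<^sup>-\<^sup>N\<close> at the frequencies of the packets. The polynomial factor in
  time is absorbed by half of the exponential decay.\<close>

lemma linear_flow_minus_heat_flow:
  "ennreal (norm (linear_flow h0 t \<xi> - heat_flow t \<xi>)) \<le> ennreal (96 / 2 ^ N) * H t \<xi>"
proof (cases "t < 0 \<or> \<xi> \<notin> S")
  case True
  then show ?thesis by (auto simp: linear_flow_def heat_flow_def h0_outside)
next
  case False
  then have t: "0 \<le> t" and \<xi>: "\<xi> \<in> S" by auto
  define \<rho> where "\<rho> = norm \<xi>"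
  have \<rho>: "2 ^ N \<le> \<rho>" "29 \<le> \<rho>" using S_facts[OF \<xi>] by (auto simp: \<rho>_def)
  have div: "(\<Sum>l\<in>UNIV. of_real (\<xi>$l) * h0 \<xi> $ Inr l) = 0"
    by (simp add: sum_3 h0_nth amplitude_def algebra_simps)
  have "norm (propagator t \<xi> (h0 \<xi>) - exp (- \<rho>\<^sup>2 * t) *\<^sub>R h0 \<xi>) \<le> t * exp (- \<rho>\<^sup>2 * t / 2) * norm (A_sym \<xi> *v h0 \<xi> - \<rho>\<^sup>2 *\<^sub>R h0 \<xi>)"
    unfolding \<rho>_def by (rule propagator_compare[OF t]) auto
  also have "\<dots> \<le> t * exp (- \<rho>\<^sup>2 * t / 2) * (12 * (1 + \<rho>) * norm (h0 \<xi>))"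
    unfolding \<rho>_def using t by (intro mult_left_mono A_sym_perturbation_le div) auto
  also have "\<dots> = (t * exp (- t * \<rho>\<^sup>2 / 4) * (12 * (1 + \<rho>))) * (exp (- t * \<rho>\<^sup>2 / 4) * norm (h0 \<xi>))"
  proof -
    have "exp (- \<rho>\<^sup>2 * t / 2) = exp (- t * \<rho>\<^sup>2 / 4) * exp (- t * \<rho>\<^sup>2 / 4)"
      unfolding exp_add[symmetric] by (simp add: field_simps)
    then show ?thesis by simp
  qed
  also have "\<dots> \<le> (96 / 2 ^ N) * (exp (- t * \<rho>\<^sup>2 / 4) * norm (h0 \<xi>))"
  proof (rule mult_right_mono)
    have "t * \<rho>\<^sup>2 / 4 \<le> exp (t * \<rho>\<^sup>2 / 4)" using exp_ge_add_one_self[of "t * \<rho>\<^sup>2 / 4"] by linarith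
    then have "t * \<rho>\<^sup>2 / 4 * exp (- (t * \<rho>\<^sup>2 / 4)) \<le> 1" by (simp add: exp_minus field_simps)
    then have "(t * exp (- t * \<rho>\<^sup>2 / 4)) * \<rho>\<^sup>2 \<le> 4" by (simp add: field_simps)
    then have 1: "t * exp (- t * \<rho>\<^sup>2 / 4) \<le> 4 / \<rho>\<^sup>2" using \<rho> by (subst pos_le_divide_eq) auto
    have "t * exp (- t * \<rho>\<^sup>2 / 4) * (12 * (1 + \<rho>)) \<le> 4 / \<rho>\<^sup>2 * (12 * (2 * \<rho>))"
      using 1 \<rho> by (intro mult_mono) auto
    also have "\<dots> = 96 / \<rho>" using \<rho> by (simp add: power2_eq_square)
    also have "\<dots> \<le> 96 / 2 ^ N" using \<rho> by (intro divide_left_mono) auto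
    finally show "t * exp (- t * \<rho>\<^sup>2 / 4) * (12 * (1 + \<rho>)) \<le> 96 / 2 ^ N" .
  qed auto
  finally have "norm (linear_flow h0 t \<xi> - heat_flow t \<xi>) \<le> (96 / 2 ^ N) * (exp (- t * (norm \<xi>)\<^sup>2 / 4) * norm (h0 \<xi>))"
    using t by (simp add: linear_flow_def heat_flow_def \<rho>_def mult.commute)
  then have "ennreal (norm (linear_flow h0 t \<xi> - heat_flow t \<xi>)) \<le> ennreal ((96 / 2 ^ N) * (exp (- t * (norm \<xi>)\<^sup>2 / 4) * norm (h0 \<xi>)))"
    by (rule ennreal_leI)
  also have "\<dots> = ennreal (96 / 2 ^ N) * H t \<xi>" using t by (subst ennreal_mult) (auto simp: H_def)
  finally show ?thesis .
qed

text \<open>The low frequencies of the second iterate, without the propagator and with the heat flow in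
  place of the linear flow.\<close>

definition interaction :: "real \<Rightarrow> real^3 \<Rightarrow> real \<times> (real^3) \<Rightarrow> complex^(3+3)" where
  "interaction t \<xi> y = (if 0 < fst y \<and> fst y < t
     then nl \<xi> (heat_flow (fst y) (\<xi> - snd y)) (heat_flow (fst y) (snd y)) else 0)"

definition main_term :: "real \<Rightarrow> real^3 \<Rightarrow> complex^(3+3)" where
  "main_term t \<xi> = (LINT y|lborel. interaction t \<xi> y)"

definition mass :: real where "mass = (3456 * \<upsilon> * \<delta>)\<^sup>2"

lemma mass_nonneg: "0 \<le> mass" by (simp add: mass_def)

lemma mixed_sq_H': "mixed_sq H \<le> ennreal mass"
  using mixed_sq_H by (simp add: mass_def)

lemma H_convolution_mass: "(\<integral>\<^sup>+\<xi>. convolved H H \<xi> \<partial>lborel) \<le> ennreal mass"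
proof (rule ennreal_le_of_sq_le)
  have "(\<integral>\<^sup>+\<xi>. convolved H H \<xi> \<partial>lborel)\<^sup>2 \<le> mixed_sq H * mixed_sq H"
    by (rule convolution_mass[OF jm_H jm_H])
  also have "\<dots> \<le> ennreal mass * ennreal mass" by (intro mult_mono mixed_sq_H') auto
  finally show "(\<integral>\<^sup>+\<xi>. convolved H H \<xi> \<partial>lborel)\<^sup>2 \<le> ennreal (mass\<^sup>2)"
    using mass_nonneg by (simp add: power2_eq_square ennreal_mult)
qed (rule mass_nonneg)

lemma H_convolution_measurable:
  "(\<lambda>\<xi>. convolved H H \<xi>) \<in> borel_measurable lborel"
proof -
  note [measurable (raw)] = jointly_measurableD[OF jm_H]
  show ?thesis by (rule lborel.borel_measurable_nn_integral) (unfold lborel_prod[symmetric], measurable)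
qed

lemma AE_H_convolution_finite: "AE \<xi> in lborel. convolved H H \<xi> < \<infinity>"
proof -
  have "AE \<xi> in lborel. convolved H H \<xi> \<noteq> \<infinity>"
    by (rule nn_integral_PInf_AE[OF H_convolution_measurable]) (use H_convolution_mass in \<open>auto simp: top_unique\<close>)
  then show ?thesis by eventually_elim (simp add: less_top)
qed

lemma interaction_measurable: "interaction t \<xi> \<in> borel_measurable lborel"
proof -
  note [measurable (raw)] = jointly_measurableD[OF jm_heat_flow]
  show ?thesis unfolding interaction_def[abs_def] lborel_prod[symmetric] by measurable
qed

lemma interaction_norm_le:
  "ennreal (norm (interaction t \<xi> y)) \<le> ennreal (\<kappa> * norm \<xi>) * (H (fst y) (\<xi> - snd y) * H (fst y) (snd y))"
proof -
  let ?v = "heat_flow (fst y) (\<xi> - snd y)" and ?w = "heat_flow (fst y) (snd y)"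
  have "ennreal (norm (interaction t \<xi> y)) \<le> ennreal (\<kappa> * norm \<xi> * norm ?v * norm ?w)"
    using norm_nl_le[of \<xi> ?v ?w] \<kappa>_pos by (auto simp: interaction_def intro: ennreal_leI)
  also have "\<dots> = ennreal (\<kappa> * norm \<xi>) * (ennreal (norm ?v) * ennreal (norm ?w))"
    using \<kappa>_pos by (simp add: mult.assoc flip: ennreal_mult)
  also have "\<dots> \<le> ennreal (\<kappa> * norm \<xi>) * (H (fst y) (\<xi> - snd y) * H (fst y) (snd y))"
    by (intro mult_left_mono mult_mono heat_flow_le_H) auto
  finally show ?thesis .
qed

lemma integrable_interaction:
  assumes "convolved H H \<xi> < \<infinity>"
  shows "integrable lborel (interaction t \<xi>)"
proof (rule integrableI_bounded[OF interaction_measurable])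
  note [measurable (raw)] = jointly_measurableD[OF jm_H]
  have "(\<integral>\<^sup>+y. ennreal (norm (interaction t \<xi> y)) \<partial>lborel)
      \<le> (\<integral>\<^sup>+y. ennreal (\<kappa> * norm \<xi>) * (H (fst y) (\<xi> - snd y) * H (fst y) (snd y)) \<partial>lborel)"
    by (intro nn_integral_mono interaction_norm_le)
  also have "\<dots> = ennreal (\<kappa> * norm \<xi>) * convolved H H \<xi>"
    by (rule nn_integral_cmult) (unfold lborel_prod[symmetric], measurable)
  also have "\<dots> < \<infinity>" using assms by (simp add: ennreal_mult_less_top)
  finally show "(\<integral>\<^sup>+y. ennreal (norm (interaction t \<xi> y)) \<partial>lborel) < \<infinity>" .
qed

lemma main_term_measurable [measurable]: "main_term t \<in> borel_measurable borel"
proof -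
  note [measurable (raw)] = jointly_measurableD[OF jm_heat_flow]
  have "(\<lambda>\<xi>. LINT y|lborel. interaction t \<xi> y) \<in> borel_measurable borel"
    unfolding interaction_def
    by (rule lborel.borel_measurable_lebesgue_integral) (unfold lborel_prod[symmetric], measurable)
  then show ?thesis by (simp add: main_term_def[abs_def])
qed

text \<open>At bounded frequencies the propagator differs from the identity by a multiple of the elapsed time.\<close>

lemma bil_heat_flow_minus_main_term:
  assumes t: "t \<ge> 0" and \<xi>: "norm \<xi> \<le> 8/3"
    and fin: "convolved H H \<xi> < \<infinity>"
  shows "ennreal (norm (bil heat_flow heat_flow t \<xi> - main_term t \<xi>))
    \<le> ennreal (968 * t * \<kappa> * norm \<xi>) * convolved H H \<xi>"
proof -
  note [measurable (raw)] = jointly_measurableD[OF jm_H]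
  let ?k = "\<lambda>y. duhamel_kernel t \<xi> (fst y) (heat_flow (fst y) (\<xi> - snd y)) (heat_flow (fst y) (snd y))"
  let ?HH = "\<lambda>y. H (fst y) (\<xi> - snd y) * H (fst y) (snd y)"
  have HHm: "?HH \<in> borel_measurable lborel" unfolding lborel_prod[symmetric] by measurable
  have k: "?k y = (if 0 < fst y \<and> fst y < t then propagator (t - fst y) \<xi> (interaction t \<xi> y) else 0)" for y
    by (simp add: duhamel_kernel_def interaction_def)
  have km: "?k \<in> borel_measurable lborel" by (rule bil_integrand_measurable[OF jm_heat_flow jm_heat_flow])
  note i2 = integrable_interaction[OF fin, of t]
  have i1: "integrable lborel ?k"
  proof (rule Bochner_Integration.integrable_bound[OF i2 km])
    show "AE y in lborel. norm (?k y) \<le> norm (interaction t \<xi> y)"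
      by (intro AE_I2) (auto simp: k norm_propagator_le')
  qed
  have "ennreal (norm (?k y - interaction t \<xi> y)) \<le> ennreal (968 * t * \<kappa> * norm \<xi>) * ?HH y" for y
  proof (cases "0 < fst y \<and> fst y < t")
    case True
    let ?w = "interaction t \<xi> y"
    have "norm (?k y - ?w) \<le> (t - fst y) * norm (A_sym \<xi> *v ?w)"
      using propagator_compare[of "t - fst y" 0 \<xi> ?w] True by (simp add: k)
    also have "\<dots> \<le> t * (72 * (1 + 8/3)\<^sup>2 * norm ?w)"
      using True A_sym_bound[OF \<xi>, of ?w] by (intro mult_mono) auto
    also have "\<dots> = 968 * t * norm ?w" by (simp add: power2_eq_square)
    finally have "ennreal (norm (?k y - ?w)) \<le> ennreal (968 * t) * ennreal (norm ?w)"
      using t by (simp add: ennreal_leI flip: ennreal_mult)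
    also have "\<dots> \<le> ennreal (968 * t) * (ennreal (\<kappa> * norm \<xi>) * ?HH y)"
      by (intro mult_left_mono interaction_norm_le) auto
    also have "\<dots> = ennreal (968 * t * \<kappa> * norm \<xi>) * ?HH y"
      using t \<kappa>_pos by (simp add: mult.assoc[symmetric] flip: ennreal_mult)
    finally show ?thesis .
  next
    case False
    then have "?k y - interaction t \<xi> y = 0" by (auto simp: k interaction_def)
    then show ?thesis by simp
  qed
  then have "(\<integral>\<^sup>+y. ennreal (norm (?k y - interaction t \<xi> y)) \<partial>lborel) \<le> (\<integral>\<^sup>+y. ennreal (968 * t * \<kappa> * norm \<xi>) * ?HH y \<partial>lborel)"
    by (rule nn_integral_mono)
  also have "\<dots> = ennreal (968 * t * \<kappa> * norm \<xi>) * (\<integral>\<^sup>+y. ?HH y \<partial>lborel)"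
    by (rule nn_integral_cmult[OF HHm])
  finally have "(\<integral>\<^sup>+y. ennreal (norm (?k y - interaction t \<xi> y)) \<partial>lborel) \<le> ennreal (968 * t * \<kappa> * norm \<xi>) * (\<integral>\<^sup>+y. ?HH y \<partial>lborel)" .
  moreover have "ennreal (norm (bil heat_flow heat_flow t \<xi> - main_term t \<xi>)) \<le> (\<integral>\<^sup>+y. ennreal (norm (?k y - interaction t \<xi> y)) \<partial>lborel)"
    unfolding bil_def main_term_def Bochner_Integration.integral_diff[OF i1 i2, symmetric]
    by (rule integral_norm_bound_ennreal) (intro Bochner_Integration.integrable_diff i1 i2)
  ultimately show ?thesis by (rule order_trans[rotated])
qed

lemma bil_linear_minus_bil_heat:
  "(weighted_integral (\<lambda>\<xi>. ennreal (norm (bil (linear_flow h0) (linear_flow h0) t \<xi> - bil heat_flow heat_flow t \<xi>))))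
    \<le> ennreal (192 / 2 ^ N * \<kappa> * mass)"
proof -
  note [measurable (raw)] = jointly_measurableD[OF jm_H] jointly_measurableD[OF jointly_measurable_majorant[OF jm_H jm_H]]
  let ?e = "96 / 2 ^ N :: real"
  have jD: "jointly_measurable (\<lambda>t \<xi>. ennreal ?e * H t \<xi>)" by (rule jointly_measurableI) measurable
  have jL: "jointly_measurable (linear_flow h0)" by (rule jointly_measurable_linear_flow) measurable
  have W: "(weighted_integral (majorant H H t)) \<le> ennreal (\<kappa> * mass)"
  proof (rule ennreal_le_of_sq_le)
    have "(weighted_integral (majorant H H t))\<^sup>2 \<le> ennreal (\<kappa>\<^sup>2) * (mixed_sq H * mixed_sq H)"
      by (rule majorant_weighted_bound[OF jm_H jm_H])
    also have "\<dots> \<le> ennreal (\<kappa>\<^sup>2) * (ennreal mass * ennreal mass)" by (intro mult_left_mono mult_mono mixed_sq_H') auto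
    also have "\<dots> = ennreal ((\<kappa> * mass)\<^sup>2)"
      using mass_nonneg by (simp add: power2_eq_square mult_ac flip: ennreal_mult)
    finally show "(weighted_integral (majorant H H t))\<^sup>2 \<le> ennreal ((\<kappa> * mass)\<^sup>2)" .
  qed (use \<kappa>_pos mass_nonneg in simp)
  have "(weighted_integral (majorant H H t)) \<noteq> \<infinity>" using W by (auto simp: top_unique)
  then have "AE \<xi> in lborel. majorant H H t \<xi> * ennreal (1 / norm \<xi>) \<noteq> \<infinity>" by (intro nn_integral_PInf_AE) auto
  then have "AE \<xi> in lborel. ennreal (norm (bil (linear_flow h0) (linear_flow h0) t \<xi> - bil heat_flow heat_flow t \<xi>)) * ennreal (1 / norm \<xi>)
      \<le> ennreal (2 * ?e) * (majorant H H t \<xi> * ennreal (1 / norm \<xi>))"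
    using AE_lborel_singleton[of "0 :: real^3"]
  proof eventually_elim
    case (elim \<xi>)
    then have fin: "majorant H H t \<xi> < \<infinity>" by (auto simp: ennreal_mult_eq_top_iff less_top[symmetric])
    have m1: "majorant (\<lambda>t \<xi>. ennreal ?e * H t \<xi>) H t \<xi> = ennreal ?e * majorant H H t \<xi>"
      unfolding majorant_def mult.assoc by (rule nn_integral_cmult) (unfold lborel_prod[symmetric], measurable)
    have m2: "majorant H (\<lambda>t \<xi>. ennreal ?e * H t \<xi>) t \<xi> = ennreal ?e * majorant H H t \<xi>"
      unfolding majorant_def mult.assoc mult.left_commute[of _ "ennreal ?e"]
      by (rule nn_integral_cmult) (unfold lborel_prod[symmetric], measurable)
    have "ennreal (norm (bil (linear_flow h0) (linear_flow h0) t \<xi> - bil heat_flow heat_flow t \<xi>))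
        \<le> ennreal ?e * majorant H H t \<xi> + ennreal ?e * majorant H H t \<xi>"
      using bil_diff_bound[OF jm_heat_flow heat_flow_le_H jL linear_flow_le_H jm_H jD linear_flow_minus_heat_flow fin]
      unfolding m1 m2 .
    also have "\<dots> = ennreal (2 * ?e) * majorant H H t \<xi>"
      by (subst ennreal_mult) (simp_all add: mult_2[symmetric] mult.assoc)
    finally have "ennreal (norm (bil (linear_flow h0) (linear_flow h0) t \<xi> - bil heat_flow heat_flow t \<xi>))
        \<le> ennreal (2 * ?e) * majorant H H t \<xi>" .
    from mult_right_mono[OF this, of "ennreal (1 / norm \<xi>)"] show ?case unfolding mult.assoc by simp
  qed
  then have "(weighted_integral (\<lambda>\<xi>. ennreal (norm (bil (linear_flow h0) (linear_flow h0) t \<xi> - bil heat_flow heat_flow t \<xi>))))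
      \<le> (\<integral>\<^sup>+\<xi>. ennreal (2 * ?e) * (majorant H H t \<xi> * ennreal (1 / norm \<xi>)) \<partial>lborel)" by (rule nn_integral_mono_AE)
  also have "\<dots> = ennreal (2 * ?e) * (weighted_integral (majorant H H t))"
    by (rule nn_integral_cmult) measurable
  also have "\<dots> \<le> ennreal (2 * ?e) * ennreal (\<kappa> * mass)" by (intro mult_left_mono W) auto
  also have "\<dots> = ennreal (192 / 2 ^ N * \<kappa> * mass)"
    using \<kappa>_pos mass_nonneg by (subst ennreal_mult[symmetric]) (auto simp: mult.assoc)
  finally show ?thesis .
qed

end

section \<open>Norm inflation\<close>

lemma integral_pos_of_continuous:
  fixes f :: "real^3 \<Rightarrow> real"
  assumes int: "integrable lborel f" and nonneg: "\<And>x. 0 \<le> f x" and cont: "isCont f x0" and pos: "0 < f x0"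
  shows "0 < (LINT x|lborel. f x)"
proof (rule ccontr)
  assume "\<not> 0 < (LINT x|lborel. f x)"
  then have "(LINT x|lborel. f x) = 0" using nonneg by (simp add: integral_nonneg_AE order.antisym not_less)
  then have ae: "AE x in lborel. f x = 0"
    using integral_nonneg_eq_0_iff_AE[OF int] nonneg by simp
  have "\<forall>\<^sub>F x in at x0. 0 < f x" using cont pos by (simp add: isCont_def order_tendstoD(1))
  then obtain d where d: "0 < d" "\<And>x. x \<noteq> x0 \<Longrightarrow> dist x x0 < d \<Longrightarrow> 0 < f x"
    unfolding eventually_at by auto
  have "AE x in lborel. x \<notin> cball x0 (d / 2)"
    using ae
  proof eventually_elim
    case (elim x)
    then show ?case using d pos by (cases "x = x0") (force simp: dist_commute)+
  qed
  then have "emeasure lborel (cball x0 (d / 2)) = 0" by (subst (asm) AE_iff_measurable) auto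
  then show False using d \<upsilon>_pos by (simp add: emeasure_cball_3)
qed

context littlewood_paley_partition
begin

lemma \<psi>_continuous: "isCont \<psi> \<xi>"
proof -
  have "isCont (\<lambda>\<xi>. complex_of_real (\<psi> \<xi>)) \<xi>"
    using schwartz_continuous[OF schwartz_\<psi>] by (simp add: continuous_on_eq_continuous_at)
  then have "isCont (\<lambda>\<xi>. Re (complex_of_real (\<psi> \<xi>))) \<xi>" by (rule continuous_Re)
  then show ?thesis by simp
qed

lemma \<psi>_integrable: "integrable lborel \<psi>"
  using integrable_Re[OF schwartz_integrable[OF schwartz_\<psi>]] by simp

lemma \<psi>_positive_somewhere: "\<exists>\<xi>. 0 < \<psi> \<xi> \<and> \<xi>$1 \<noteq> 0 \<and> \<xi>$2 \<noteq> 0 \<and> \<xi>$3 \<noteq> 0"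
proof -
  have "((\<lambda>j::int. \<psi> (2 powi (- j) *\<^sub>R e3)) has_sum 1) UNIV"
    using lp norm_e3 unfolding littlewood_paley_def by (metis norm_zero zero_neq_one)
  then have "\<exists>j::int. \<psi> (2 powi (- j) *\<^sub>R e3) \<noteq> 0"
    using has_sum_unique[OF has_sum_0] by (metis zero_neq_one)
  then obtain x0 where x0: "0 < \<psi> x0" using \<psi>_nonneg by (metis less_le)
  have "\<forall>\<^sub>F x in at x0. 0 < \<psi> x" using \<psi>_continuous[of x0] x0 by (simp add: isCont_def order_tendstoD(1))
  then obtain d where d: "0 < d" "\<And>x. x \<noteq> x0 \<Longrightarrow> dist x x0 < d \<Longrightarrow> 0 < \<psi> x"
    unfolding eventually_at by auto
  define y :: "real^3" where "y = (\<chi> i. if x0 $ i = 0 then d / 4 else x0 $ i)"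
  have "norm (y - x0) \<le> (\<Sum>k\<in>UNIV. \<bar>(y - x0) $ k\<bar>)" by (rule norm_le_sum_component)
  also have "\<dots> \<le> (\<Sum>k\<in>(UNIV::3 set). d / 4)" using d by (intro sum_mono) (simp add: y_def)
  also have "\<dots> < d" using d by simp
  finally have "0 < \<psi> y" using d(2)[of y] x0 by (cases "y = x0") (auto simp: dist_norm)
  moreover have "y $ i \<noteq> 0" for i using d by (simp add: y_def)
  ultimately show ?thesis by blast
qed

text \<open>The test function is the derivative in the direction of the amplitude of a bump concentrated at
  distance at most 1/3 from the origin: on the frequencies of the central block its transform is
  \<open>- \<i> \<xi>\<^sub>1\<close> times a function with positive real part.\<close>

definition bump :: "real^3 \<Rightarrow> complex" where
  "bump x = of_real (\<psi> (8 *\<^sub>R x))"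

definition test_fun :: "real^3 \<Rightarrow> complex" where
  "test_fun = pd 1 bump"

definition bump_mass :: real where
  "bump_mass = 1 / (2 * pi) ^ 3 * (LINT x|lborel. \<psi> (8 *\<^sub>R x))"

lemma schwartz_bump: "schwartz bump"
  unfolding bump_def[abs_def] using schwartz_scale[OF schwartz_\<psi>, of 8] by simp

lemma schwartz_test_fun: "schwartz test_fun"
  unfolding test_fun_def by (rule schwartz_pd[OF schwartz_bump])

lemma inv_fourier_test_fun: "inv_fourier test_fun \<xi> = - \<i> * of_real (\<xi>$1) * inv_fourier bump \<xi>"
  unfolding test_fun_def by (rule inv_fourier_pd[OF schwartz_bump])

lemma test_fun_support: "x \<notin> cball 0 (1/3) \<Longrightarrow> test_fun x = 0"
proof -
  assume x: "x \<notin> cball 0 (1/3)"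
  have zero: "bump y = 0" if "y \<notin> cball 0 (1/3)" for y
    using \<psi>_support[of "8 *\<^sub>R y"] that by (force simp: bump_def)
  have "((\<lambda>_. 0) has_derivative (\<lambda>_. 0)) (at x)" by simp
  then have "(bump has_derivative (\<lambda>_. 0)) (at x)"
    by (rule has_derivative_transform_within_open[where s="- cball 0 (1/3)"]) (use x zero in auto)
  then show ?thesis unfolding test_fun_def by (subst pd_eq) auto
qed

lemma integrable_bump: "integrable lborel (\<lambda>x. \<psi> (8 *\<^sub>R x))"
  using integrable_Re[OF schwartz_integrable[OF schwartz_bump]] by (simp add: bump_def)

lemma bump_mass_pos: "0 < bump_mass"
proof -
  obtain \<xi> where \<xi>: "0 < \<psi> \<xi>" using \<psi>_positive_somewhere by blast
  have "0 < (LINT x|lborel. \<psi> (8 *\<^sub>R x))"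
  proof (rule integral_pos_of_continuous[OF integrable_bump])
    show "isCont (\<lambda>x. \<psi> (8 *\<^sub>R x)) (\<xi> /\<^sub>R 8)"
      by (rule isCont_o2[of _ "\<lambda>x. 8 *\<^sub>R x"]) (auto intro!: continuous_intros \<psi>_continuous)
  qed (use \<xi> \<psi>_nonneg in auto)
  then show ?thesis by (simp add: bump_mass_def)
qed

lemma norm_inv_fourier_bump_le: "cmod (inv_fourier bump \<xi>) \<le> bump_mass"
  using cmod_inv_fourier_le[of bump \<xi>] \<psi>_nonneg by (simp add: bump_mass_def bump_def)

lemma cos_ge_half: "\<bar>x\<bar> \<le> 1 \<Longrightarrow> 1 / 2 \<le> cos x" for x :: real
proof -
  assume x: "\<bar>x\<bar> \<le> 1"
  have "\<bar>sin (x / 2)\<bar> \<le> \<bar>x / 2\<bar>" by (rule abs_sin_x_le_abs_x)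
  also have "\<dots> \<le> 1 / 2" using x by simp
  finally have "(sin (x / 2))\<^sup>2 \<le> (1 / 2)\<^sup>2" by (subst power2_le_iff_abs_le) auto
  then show ?thesis using cos_double_sin[of "x / 2"] by (simp add: power2_eq_square)
qed

lemma Re_inv_fourier_bump_ge:
  assumes "norm \<xi> \<le> 8/3"
  shows "bump_mass / 2 \<le> Re (inv_fourier bump \<xi>)"
proof -
  have int: "integrable lborel (\<lambda>x. wave \<xi> x * bump x)"
    by (rule schwartz_integrable[OF schwartz_exp_mult(1)[OF schwartz_bump]])
  have eq: "Re (inv_fourier bump \<xi>) = 1 / (2 * pi) ^ 3 * (LINT x|lborel. Re (wave \<xi> x * bump x))"
    unfolding inv_fourier_def integral_Re[OF int] by (simp only: Re_complex_of_real times_complex.sel Im_complex_of_real)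
  have "(LINT x|lborel. 1/2 * \<psi> (8 *\<^sub>R x)) \<le> (LINT x|lborel. Re (wave \<xi> x * bump x))"
  proof (rule integral_mono)
    show "integrable lborel (\<lambda>x. 1/2 * \<psi> (8 *\<^sub>R x))" using integrable_bump by simp
    show "integrable lborel (\<lambda>x. Re (wave \<xi> x * bump x))" using int by (rule integrable_Re)
    fix x :: "real^3"
    show "1/2 * \<psi> (8 *\<^sub>R x) \<le> Re (wave \<xi> x * bump x)"
    proof (cases "\<psi> (8 *\<^sub>R x) = 0")
      case False
      then have "norm x \<le> 1/3" using \<psi>_support[of "8 *\<^sub>R x"] by simp
      have "\<bar>\<xi> \<bullet> x\<bar> \<le> norm \<xi> * norm x" by (rule Cauchy_Schwarz_ineq2)
      also have "\<dots> \<le> 8/3 * (1/3)" using assms \<open>norm x \<le> 1/3\<close> by (intro mult_mono) auto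
      finally have "1/2 \<le> cos (\<xi> \<bullet> x)" by (intro cos_ge_half) simp
      then have "1/2 * \<psi> (8 *\<^sub>R x) \<le> cos (\<xi> \<bullet> x) * \<psi> (8 *\<^sub>R x)" using \<psi>_nonneg by (intro mult_right_mono) auto
      then show ?thesis by (simp add: bump_def Re_exp)
    qed (simp add: bump_def)
  qed
  then have "1 / (2 * pi) ^ 3 * (LINT x|lborel. 1/2 * \<psi> (8 *\<^sub>R x)) \<le> Re (inv_fourier bump \<xi>)"
    unfolding eq by (rule mult_left_mono) simp
  then show ?thesis by (simp add: bump_mass_def)
qed

lemma test_fun_mass_pos: "0 < (LINT x|lborel. cmod (test_fun x))"
proof (rule ccontr)
  assume "\<not> 0 < (LINT x|lborel. cmod (test_fun x))"
  then have "(LINT x|lborel. cmod (test_fun x)) = 0" by (simp add: integral_nonneg_AE order.antisym not_less)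
  then have "inv_fourier test_fun (axis 1 1) = 0" using cmod_inv_fourier_le[of test_fun "axis 1 1"] by simp
  then have "inv_fourier bump (axis 1 1) = 0" by (simp add: inv_fourier_test_fun)
  then show False using Re_inv_fourier_bump_ge[of "axis 1 1"] bump_mass_pos by simp
qed

text \<open>The diagonal entry of the Leray projection, times one factor \<open>\<xi>\<^sub>1\<close> from the divergence and one from the
  test function.\<close>

definition angular :: "real^3 \<Rightarrow> real" where
  "angular \<xi> = (\<xi>$1)\<^sup>2 * (1 - (\<xi>$1)\<^sup>2 / (norm \<xi>)\<^sup>2)"

lemma leray_diagonal_bounds: "0 \<le> 1 - (\<xi>$1)\<^sup>2 / (norm \<xi>)\<^sup>2" "1 - (\<xi>$1)\<^sup>2 / (norm \<xi>)\<^sup>2 \<le> 1" for \<xi> :: "real^3"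
proof -
  have "(\<xi>$1)\<^sup>2 \<le> (norm \<xi>)\<^sup>2" using component_le_norm_cart[of \<xi> 1] by (simp add: power2_le_iff_abs_le)
  then show "0 \<le> 1 - (\<xi>$1)\<^sup>2 / (norm \<xi>)\<^sup>2" by (cases "\<xi> = 0") (auto simp: divide_le_eq_1)
qed auto

lemma angular_bounds: "0 \<le> angular \<xi>" "angular \<xi> \<le> (\<xi>$1)\<^sup>2"
  using leray_diagonal_bounds[of \<xi>] by (auto simp: angular_def intro: mult_left_le)

lemma angular_measurable [measurable]: "angular \<in> borel_measurable borel"
  unfolding angular_def[abs_def] by measurable

lemma integrable_\<psi>_angular: "integrable lborel (\<lambda>\<xi>. \<psi> \<xi> * angular \<xi>)"
proof (rule Bochner_Integration.integrable_bound)
  show "integrable lborel (\<lambda>\<xi>. 8 * \<psi> \<xi>)" using \<psi>_integrable by simp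
  have "\<psi> \<xi> * angular \<xi> \<le> \<psi> \<xi> * 8" for \<xi>
  proof (cases "\<psi> \<xi> = 0")
    case False
    then have "\<bar>\<xi>$1\<bar> \<le> 8/3" using \<psi>_support[of \<xi>] component_le_norm_cart[of \<xi> 1] by linarith
    then have "(\<xi>$1)\<^sup>2 \<le> (8/3)\<^sup>2" by (simp add: power2_le_iff_abs_le)
    then show ?thesis using angular_bounds[of \<xi>] \<psi>_nonneg by (intro mult_left_mono) (auto simp: power2_eq_square)
  qed simp
  then show "AE \<xi> in lborel. norm (\<psi> \<xi> * angular \<xi>) \<le> norm (8 * \<psi> \<xi>)"
    using \<psi>_nonneg angular_bounds by (intro AE_I2) (simp add: abs_mult mult.commute)
qed measurable

lemma integral_\<psi>_angular_pos: "0 < (LINT \<xi>|lborel. \<psi> \<xi> * angular \<xi>)"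
proof -
  obtain \<xi> where \<xi>: "0 < \<psi> \<xi>" "\<xi>$1 \<noteq> 0" "\<xi>$2 \<noteq> 0" using \<psi>_positive_somewhere by blast
  then have "\<xi> \<noteq> 0" by auto
  show ?thesis
  proof (rule integral_pos_of_continuous[OF integrable_\<psi>_angular])
    have "isCont angular \<xi>" unfolding angular_def[abs_def] using \<open>\<xi> \<noteq> 0\<close> by (intro continuous_intros) auto
    then show "isCont (\<lambda>\<xi>. \<psi> \<xi> * angular \<xi>) \<xi>" by (intro continuous_intros \<psi>_continuous)
    have "(\<xi>$1)\<^sup>2 < (norm \<xi>)\<^sup>2" using \<xi> unfolding norm_sq_3 by (simp add: add_pos_nonneg)
    then have "0 < 1 - (\<xi>$1)\<^sup>2 / (norm \<xi>)\<^sup>2" using \<open>\<xi> \<noteq> 0\<close> by simp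
    then show "0 < \<psi> \<xi> * angular \<xi>" using \<xi> by (simp add: angular_def)
  qed (use \<psi>_nonneg angular_bounds in auto)
qed

end

context inflation_data
begin

text \<open>Opposite packets produce low frequencies: for \<open>\<eta>\<close> and \<open>\<xi> - \<eta>\<close> in the support of the data and
  bounded \<open>\<xi>\<close>, the longitudinal components are almost opposite and dominate.\<close>

lemma opposite_packets:
  assumes \<xi>: "norm \<xi> \<le> 8/3" and S: "\<eta> \<in> S" "\<xi> - \<eta> \<in> S"
  defines "\<mu> \<equiv> (norm (\<xi> - \<eta>))\<^sup>2 + (norm \<eta>)\<^sup>2"
  shows "\<mu> / 4 \<le> - ((\<xi> - \<eta>)$3 * \<eta>$3)" and "norm \<eta> \<le> \<mu> / 2 ^ N" and "norm (\<xi> - \<eta>) \<le> \<mu> / 2 ^ N"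
    and "1 \<le> \<mu> / 2 ^ N"
proof -
  define \<rho> where "\<rho> = norm \<eta>"
  note f = S_facts[OF S(1)] and g = S_facts[OF S(2)]
  have \<rho>: "29 \<le> \<rho>" "2 ^ N \<le> \<rho>" using f by (auto simp: \<rho>_def)
  have n: "(1::real) \<le> 2 ^ N" by simp
  have aux: "x \<le> \<mu> / 2 ^ N" if "2 ^ N \<le> x" "x\<^sup>2 \<le> \<mu>" for x
  proof -
    have "0 \<le> x" using that(1) n by linarith
    then have "x * 2 ^ N \<le> x * x" using that(1) by (intro mult_left_mono)
    also have "\<dots> \<le> \<mu>" using that(2) by (simp add: power2_eq_square)
    finally show ?thesis using n by (simp add: pos_le_divide_eq)
  qed
  show 1: "norm \<eta> \<le> \<mu> / 2 ^ N" by (rule aux[OF f(1)]) (simp add: \<mu>_def)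
  show "norm (\<xi> - \<eta>) \<le> \<mu> / 2 ^ N" by (rule aux[OF g(1)]) (simp add: \<mu>_def)
  show "1 \<le> \<mu> / 2 ^ N" using 1 f(2) by linarith
  have c: "(\<eta>$1)\<^sup>2 \<le> 9" "(\<eta>$2)\<^sup>2 \<le> 9"
    using f(3,4) power2_le_iff_abs_le[of 3 "\<eta>$1"] power2_le_iff_abs_le[of 3 "\<eta>$2"] by auto
  have "\<rho>\<^sup>2 = (\<eta>$1)\<^sup>2 + (\<eta>$2)\<^sup>2 + (\<eta>$3)\<^sup>2" unfolding \<rho>_def by (rule norm_sq_3)
  then have e3: "\<rho>\<^sup>2 - 18 \<le> (\<eta>$3)\<^sup>2" using c by linarith
  have "\<bar>\<xi>$3 * \<eta>$3\<bar> \<le> 8/3 * \<rho>" unfolding abs_mult \<rho>_def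
    using component_le_norm_cart[of \<xi> 3] component_le_norm_cart[of \<eta> 3] \<xi> by (intro mult_mono) auto
  then have x: "\<xi>$3 * \<eta>$3 \<le> 8/3 * \<rho>" by linarith
  have "norm (\<xi> - \<eta>) \<le> \<rho> + 8/3" using norm_triangle_ineq4[of \<xi> \<eta>] \<xi> by (simp add: \<rho>_def)
  then have "(norm (\<xi> - \<eta>))\<^sup>2 \<le> (\<rho> + 8/3)\<^sup>2" by (intro power_mono) auto
  then have m: "\<mu> \<le> 2 * \<rho>\<^sup>2 + 16/3 * \<rho> + 64/9" by (simp add: \<mu>_def \<rho>_def power2_eq_square algebra_simps)
  have r: "29 * \<rho> \<le> \<rho>\<^sup>2" using \<rho> by (simp add: power2_eq_square)
  have "- ((\<xi> - \<eta>)$3 * \<eta>$3) = (\<eta>$3)\<^sup>2 - \<xi>$3 * \<eta>$3" by (simp add: power2_eq_square algebra_simps)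
  then show "\<mu> / 4 \<le> - ((\<xi> - \<eta>)$3 * \<eta>$3)" using e3 x m r \<rho> by linarith
qed

definition overlap :: "real^3 \<Rightarrow> real^3 \<Rightarrow> real" where
  "overlap \<xi> \<eta> = indicator S (\<xi> - \<eta>) * indicator S \<eta>"

definition rate :: "real^3 \<Rightarrow> real^3 \<Rightarrow> real" where
  "rate \<xi> \<eta> = (norm (\<xi> - \<eta>))\<^sup>2 + (norm \<eta>)\<^sup>2"

lemma overlap_measurable [measurable]: "overlap \<xi> \<in> borel_measurable borel"
  unfolding overlap_def[abs_def] by measurable

lemma rate_measurable [measurable]: "rate \<xi> \<in> borel_measurable borel"
  unfolding rate_def[abs_def] by measurable

lemma overlap_nonneg: "0 \<le> overlap \<xi> \<eta>" and rate_nonneg: "0 \<le> rate \<xi> \<eta>"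
  by (auto simp: overlap_def rate_def)

text \<open>For each \<open>k\<close> the ball of radius 1 around \<open>2\<^sup>k e\<^sub>3 + \<xi> / 2\<close> lies in the support of the data together with
  its reflection at \<open>\<xi> / 2\<close>.\<close>

lemma overlap_volume:
  assumes \<xi>: "norm \<xi> \<le> 8/3"
  shows "ennreal (\<upsilon> * N) \<le> (\<integral>\<^sup>+\<eta>. ennreal (overlap \<xi> \<eta>) \<partial>lborel)"
proof -
  let ?B = "\<lambda>k::nat. cball (2 ^ k *\<^sub>R e3 + \<xi> /\<^sub>R 2) 1"
  have sub: "(\<Union>k\<in>{N+1..2*N}. ?B k) \<subseteq> {\<eta>. \<eta> \<in> S \<and> \<xi> - \<eta> \<in> S}"
  proof
    fix \<eta> assume "\<eta> \<in> (\<Union>k\<in>{N+1..2*N}. ?B k)"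
    then obtain k where k: "k \<in> {N+1..2*N}" and h: "norm (2 ^ k *\<^sub>R e3 + \<xi> /\<^sub>R 2 - \<eta>) \<le> 1" by (auto simp: dist_norm)
    have half: "norm (\<xi> /\<^sub>R 2) \<le> 4/3" using \<xi> by simp
    have "norm (2 ^ k *\<^sub>R e3 - \<eta>) \<le> norm (2 ^ k *\<^sub>R e3 + \<xi> /\<^sub>R 2 - \<eta>) + norm (\<xi> /\<^sub>R 2)"
      using norm_triangle_ineq4[of "2 ^ k *\<^sub>R e3 + \<xi> /\<^sub>R 2 - \<eta>" "\<xi> /\<^sub>R 2"] by (simp add: algebra_simps)
    then have 1: "norm (2 ^ k *\<^sub>R e3 - \<eta>) \<le> 3" using h half by linarith
    have "norm (- (2 ^ k) *\<^sub>R e3 - (\<xi> - \<eta>)) \<le> norm (2 ^ k *\<^sub>R e3 + \<xi> /\<^sub>R 2 - \<eta>) + norm (\<xi> /\<^sub>R 2)"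
    proof -
      have "- (2 ^ k) *\<^sub>R e3 - (\<xi> - \<eta>) = - (2 ^ k *\<^sub>R e3 + \<xi> /\<^sub>R 2 - \<eta>) - \<xi> /\<^sub>R 2"
        by (simp add: vec_eq_iff)
      then show ?thesis by (metis norm_minus_cancel norm_triangle_ineq4)
    qed
    then have 2: "norm (- (2 ^ k) *\<^sub>R e3 - (\<xi> - \<eta>)) \<le> 3" using h half by linarith
    have "\<eta> \<in> pair_ball k" "\<xi> - \<eta> \<in> pair_ball k" using 1 2 by (auto simp: pair_ball_def dist_norm)
    then show "\<eta> \<in> {\<eta>. \<eta> \<in> S \<and> \<xi> - \<eta> \<in> S}" using k unfolding S_def by blast
  qed
  have disj: "disjoint_family_on ?B {N+1..2*N}"
    unfolding disjoint_family_on_def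
  proof (intro ballI impI)
    have *: "?B k \<inter> ?B l = {}" if "k \<in> {N+1..2*N}" "k < l" for k l
    proof (rule ccontr)
      assume "?B k \<inter> ?B l \<noteq> {}"
      then obtain \<eta> where "dist (2 ^ k *\<^sub>R e3 + \<xi> /\<^sub>R 2) \<eta> \<le> 1" "dist (2 ^ l *\<^sub>R e3 + \<xi> /\<^sub>R 2) \<eta> \<le> 1" by auto
      then have "dist (2 ^ l *\<^sub>R e3 + \<xi> /\<^sub>R 2) (2 ^ k *\<^sub>R e3 + \<xi> /\<^sub>R 2) \<le> 2"
        using dist_triangle2[of "2 ^ l *\<^sub>R e3 + \<xi> /\<^sub>R 2" "2 ^ k *\<^sub>R e3 + \<xi> /\<^sub>R 2" \<eta>] by linarith
      moreover have "dist (2 ^ l *\<^sub>R e3 + \<xi> /\<^sub>R 2) (2 ^ k *\<^sub>R e3 + \<xi> /\<^sub>R 2) = \<bar>2 ^ l - 2 ^ k\<bar>"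
        by (simp add: dist_norm flip: scaleR_diff_left)
      moreover have "(32::real) \<le> 2 ^ k" using that by (intro pow_ge_32) auto
      moreover have "2 * (2::real) ^ k \<le> 2 ^ l" using power_increasing[of "Suc k" l "2::real"] that by simp
      ultimately show False by linarith
    qed
    fix k l assume "k \<in> {N+1..2*N}" "l \<in> {N+1..2*N}" "k \<noteq> l"
    then show "?B k \<inter> ?B l = {}" using *[of k l] *[of l k] by (metis Int_commute linorder_neqE_nat)
  qed
  have "ennreal (\<upsilon> * N) = (\<Sum>k\<in>{N+1..2*N}. emeasure lborel (?B k))"
    using \<upsilon>_pos by (simp add: emeasure_cball_3 ennreal_of_nat_eq_real_of_nat mult.commute flip: ennreal_mult)
  also have "\<dots> = emeasure lborel (\<Union>k\<in>{N+1..2*N}. ?B k)"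
    by (rule sum_emeasure) (use disj in auto)
  also have "\<dots> = (\<integral>\<^sup>+\<eta>. indicator (\<Union>k\<in>{N+1..2*N}. ?B k) \<eta> \<partial>lborel)"
    by (subst nn_integral_indicator) (auto intro!: sets.finite_UN)
  also have "\<dots> \<le> (\<integral>\<^sup>+\<eta>. ennreal (overlap \<xi> \<eta>) \<partial>lborel)"
  proof (rule nn_integral_mono)
    fix \<eta>
    show "indicator (\<Union>k\<in>{N+1..2*N}. ?B k) \<eta> \<le> ennreal (overlap \<xi> \<eta>)"
    proof (cases "\<eta> \<in> (\<Union>k\<in>{N+1..2*N}. ?B k)")
      case True
      with sub have "\<eta> \<in> S" "\<xi> - \<eta> \<in> S" by (blast dest: subsetD)+
      then show ?thesis using True by (simp add: overlap_def)
    qed simp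
  qed
  finally show ?thesis .
qed

text \<open>The weight of the low frequency interaction; its total mass is comparable to the number of
  packets, because each pair of packets interacts during its full life time.\<close>

definition weight :: "real \<Rightarrow> real^3 \<Rightarrow> real \<times> (real^3) \<Rightarrow> real" where
  "weight t \<xi> y = (if 0 < fst y \<and> fst y < t then overlap \<xi> (snd y) * (rate \<xi> (snd y) * exp (- fst y * rate \<xi> (snd y))) else 0)"

lemma weight_nonneg: "0 \<le> weight t \<xi> y"
  using overlap_nonneg rate_nonneg by (auto simp: weight_def)

lemma weight_measurable: "weight t \<xi> \<in> borel_measurable lborel"
  unfolding weight_def[abs_def] lborel_prod[symmetric] by measurable

lemma weight_mass:
  assumes \<xi>: "norm \<xi> \<le> 8/3" and t: "1 \<le> t * 4 ^ N"
  shows "integrable lborel (weight t \<xi>)"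
    and "\<upsilon> * N / 3 \<le> (LINT y|lborel. weight t \<xi> y)" and "(LINT y|lborel. weight t \<xi> y) \<le> 54 * \<upsilon> * N"
proof -
  have meas: "(\<lambda>z. ennreal (weight t \<xi> (fst z, snd z))) \<in> borel_measurable (borel \<Otimes>\<^sub>M borel)"
    unfolding weight_def by measurable
  have eq: "(\<integral>\<^sup>+y. ennreal (weight t \<xi> y) \<partial>lborel) = (\<integral>\<^sup>+\<eta>. \<integral>\<^sup>+\<tau>. ennreal (weight t \<xi> (\<tau>, \<eta>)) \<partial>lborel \<partial>lborel)"
    using nn_integral_lborel_pair[of "\<lambda>y. ennreal (weight t \<xi> y)"]
      nn_integral_lborel_swap[of "\<lambda>\<tau> \<eta>. ennreal (weight t \<xi> (\<tau>, \<eta>))"] meas by simp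
  have up: "(\<integral>\<^sup>+\<tau>. ennreal (weight t \<xi> (\<tau>, \<eta>)) \<partial>lborel) \<le> ennreal (overlap \<xi> \<eta>)" for \<eta>
  proof (cases "overlap \<xi> \<eta> = 0")
    case True
    then have "weight t \<xi> (\<tau>, \<eta>) = 0" for \<tau> by (simp add: weight_def)
    then show ?thesis by simp
  next
    case False
    then have S: "\<eta> \<in> S" "\<xi> - \<eta> \<in> S" by (auto simp: overlap_def indicator_def split: if_splits)
    have "1 \<le> rate \<xi> \<eta> / 2 ^ N" unfolding rate_def by (rule opposite_packets(4)[OF \<xi> S])
    then have r: "0 < rate \<xi> \<eta>" using rate_nonneg[of \<xi> \<eta>] by (cases "rate \<xi> \<eta> = 0") auto
    have "(\<integral>\<^sup>+\<tau>. ennreal (weight t \<xi> (\<tau>, \<eta>)) \<partial>lborel)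
        \<le> (\<integral>\<^sup>+\<tau>. ennreal (overlap \<xi> \<eta>) * ennreal (indicator {0..} \<tau> * (rate \<xi> \<eta> * exp (- \<tau> * rate \<xi> \<eta>))) \<partial>lborel)"
      using overlap_nonneg r
      by (intro nn_integral_mono) (auto simp: weight_def simp flip: ennreal_mult)
    also have "\<dots> = ennreal (overlap \<xi> \<eta>)"
      using nn_integral_exponential[OF r] by (subst nn_integral_cmult) auto
    finally show ?thesis .
  qed
  have low: "ennreal (1/3) * ennreal (overlap \<xi> \<eta>) \<le> (\<integral>\<^sup>+\<tau>. ennreal (weight t \<xi> (\<tau>, \<eta>)) \<partial>lborel)" for \<eta>
  proof (cases "overlap \<xi> \<eta> = 0")
    case False
    then have S: "\<eta> \<in> S" "\<xi> - \<eta> \<in> S" and o1: "overlap \<xi> \<eta> = 1" by (auto simp: overlap_def indicator_def split: if_splits)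
    define r where "r = rate \<xi> \<eta>"
    have "(2 ^ N)\<^sup>2 \<le> (norm \<eta>)\<^sup>2" using S_facts(1)[OF S(1)] by (intro power_mono) auto
    moreover have "((2::real) ^ N)\<^sup>2 = 4 ^ N" by (simp add: power2_eq_square flip: power_mult_distrib)
    ultimately have r4: "4 ^ N \<le> r" unfolding r_def rate_def by (smt (verit) zero_le_power2)
    have r: "0 < r" using r4 by (smt (verit) zero_less_power)
    have "0 \<le> t" using t by (smt (verit) mult_nonpos_nonneg zero_le_power)
    then have "1 \<le> t * r" using t r4 mult_left_mono[of "4 ^ N" r t] by linarith
    then have tr: "1 / r \<le> t" using r by (simp add: field_simps)
    have "ennreal (1/3) * ennreal (overlap \<xi> \<eta>) = (\<integral>\<^sup>+\<tau>. ennreal (r / 3) * indicator {0<..<1 / r} \<tau> \<partial>lborel)"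
      using r by (simp add: o1 nn_integral_cmult_indicator flip: ennreal_mult)
    also have "\<dots> \<le> (\<integral>\<^sup>+\<tau>. ennreal (weight t \<xi> (\<tau>, \<eta>)) \<partial>lborel)"
    proof (rule nn_integral_mono)
      fix \<tau> :: real
      show "ennreal (r / 3) * indicator {0<..<1 / r} \<tau> \<le> ennreal (weight t \<xi> (\<tau>, \<eta>))"
      proof (cases "\<tau> \<in> {0<..<1 / r}")
        case True
        then have "\<tau> * r \<le> 1" using r by (simp add: field_simps)
        then have "exp (- 1) \<le> exp (- \<tau> * r)" by simp
        moreover have "1 / 3 \<le> exp (- 1 :: real)" using exp_le by (simp add: exp_minus field_simps)
        ultimately have "1 / 3 \<le> exp (- \<tau> * r)" by linarith
        then have "r * (1 / 3) \<le> r * exp (- \<tau> * r)" using r by (intro mult_left_mono) auto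
        then show ?thesis using True tr by (simp add: weight_def o1 ennreal_leI flip: r_def)
      qed simp
    qed
    finally show ?thesis .
  qed simp
  have U: "(\<integral>\<^sup>+y. ennreal (weight t \<xi> y) \<partial>lborel) \<le> ennreal (54 * \<upsilon> * N)"
  proof -
    have "(\<integral>\<^sup>+y. ennreal (weight t \<xi> y) \<partial>lborel) \<le> (\<integral>\<^sup>+\<eta>. indicator S \<eta> \<partial>lborel)"
      unfolding eq by (intro nn_integral_mono order_trans[OF up]) (auto simp: overlap_def split: split_indicator)
    then show ?thesis using emeasure_S by (simp add: order_trans)
  qed
  have L: "ennreal (\<upsilon> * N / 3) \<le> (\<integral>\<^sup>+y. ennreal (weight t \<xi> y) \<partial>lborel)"
  proof -
    have "ennreal (\<upsilon> * N / 3) = ennreal (1/3) * ennreal (\<upsilon> * N)" using \<upsilon>_pos by (simp flip: ennreal_mult)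
    also have "\<dots> \<le> ennreal (1/3) * (\<integral>\<^sup>+\<eta>. ennreal (overlap \<xi> \<eta>) \<partial>lborel)"
      by (intro mult_left_mono overlap_volume \<xi>) auto
    also have "\<dots> = (\<integral>\<^sup>+\<eta>. ennreal (1/3) * ennreal (overlap \<xi> \<eta>) \<partial>lborel)"
      by (rule nn_integral_cmult[symmetric]) measurable
    also have "\<dots> \<le> (\<integral>\<^sup>+y. ennreal (weight t \<xi> y) \<partial>lborel)" unfolding eq by (intro nn_integral_mono low)
    finally show ?thesis .
  qed
  show int: "integrable lborel (weight t \<xi>)"
    by (rule integrableI_bounded[OF weight_measurable])
      (use le_less_trans[OF U] weight_nonneg in simp)
  have I: "(\<integral>\<^sup>+y. ennreal (weight t \<xi> y) \<partial>lborel) = ennreal (LINT y|lborel. weight t \<xi> y)"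
    by (rule nn_integral_eq_integral[OF int]) (use weight_nonneg in simp)
  have "0 \<le> (LINT y|lborel. weight t \<xi> y)" by (intro integral_nonneg_AE AE_I2 weight_nonneg)
  then show "\<upsilon> * N / 3 \<le> (LINT y|lborel. weight t \<xi> y)" using L unfolding I by (subst (asm) ennreal_le_iff)
  have "0 \<le> 54 * \<upsilon> * N" using \<upsilon>_pos by simp
  then show "(LINT y|lborel. weight t \<xi> y) \<le> 54 * \<upsilon> * N" using U unfolding I by (subst (asm) ennreal_le_iff)
qed

end

context inflation
begin

subsection \<open>The low frequencies of the second iterate\<close>

lemma heat_flow_nth:
  "t \<ge> 0 \<Longrightarrow> heat_flow t \<eta> $ a = \<i> * of_real (c * indicator S \<eta> * exp (- t * (norm \<eta>)\<^sup>2) * amplitude \<eta> (both a))"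
  by (simp add: heat_flow_def h0_nth scaleR_conv_of_real[where 'a=complex])

text \<open>The last factor of the interaction; for the velocity it is produced by the Leray projection.\<close>

definition last_factor :: "real^3 \<Rightarrow> real^3 \<Rightarrow> 3 + 3 \<Rightarrow> real" where
  "last_factor \<xi> \<eta> a = (case a of
     Inl _ \<Rightarrow> (1 - (\<xi>$1)\<^sup>2 / (norm \<xi>)\<^sup>2) * \<eta>$3 + \<xi>$1 * \<xi>$3 / (norm \<xi>)\<^sup>2 * \<eta>$1
   | Inr _ \<Rightarrow> \<eta>$3)"

definition density :: "real \<Rightarrow> real^3 \<Rightarrow> 3 + 3 \<Rightarrow> real \<times> (real^3) \<Rightarrow> real" where
  "density t \<xi> a y = (if 0 < fst y \<and> fst y < t
     then overlap \<xi> (snd y) * exp (- fst y * rate \<xi> (snd y))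
       * - (\<xi>$1 * (\<xi>$1 * (\<xi> - snd y)$3 - \<xi>$3 * (\<xi> - snd y)$1) * last_factor \<xi> (snd y) a) else 0)"

text \<open>The factor \<open>\<i> \<xi>\<^sub>1\<close>, which is the symbol of the test function, turns the interaction into a real
  number.\<close>

lemma interaction_nth:
  assumes "a \<in> {Inl 1, Inr 1}"
  shows "interaction t \<xi> y $ a * (\<i> * of_real (\<xi>$1)) = of_real (- (c\<^sup>2 / (2 * pi) ^ 3 * density t \<xi> a y))"
proof (cases "0 < fst y \<and> fst y < t")
  case True
  define z where "z = \<xi> - snd y"
  define \<eta> where "\<eta> = snd y"
  define A where "A = c * indicator S z * exp (- fst y * (norm z)\<^sup>2)"
  define B where "B = c * indicator S \<eta> * exp (- fst y * (norm \<eta>)\<^sup>2)"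
  have AB: "A * B = c\<^sup>2 * (overlap \<xi> \<eta> * exp (- fst y * rate \<xi> \<eta>))"
  proof -
    have "exp (- fst y * rate \<xi> \<eta>) = exp (- fst y * (norm z)\<^sup>2) * exp (- fst y * (norm \<eta>)\<^sup>2)"
      unfolding exp_add[symmetric] rate_def z_def \<eta>_def by (simp add: algebra_simps)
    then show ?thesis by (simp add: A_def B_def overlap_def z_def \<eta>_def power2_eq_square)
  qed
  have inner: "(\<Sum>m\<in>UNIV. \<i> * of_real (\<xi>$m) * (heat_flow (fst y) z $ Inl m * heat_flow (fst y) \<eta> $ b))
      = of_real (- (A * B * (\<xi>$1 * z$3 - \<xi>$3 * z$1) * amplitude \<eta> (both b))) * \<i>" for b
  proof -
    have z: "heat_flow (fst y) z $ b = \<i> * of_real (A * amplitude z (both b))"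
      and \<eta>: "heat_flow (fst y) \<eta> $ b = \<i> * of_real (B * amplitude \<eta> (both b))" for b
      using True by (simp_all add: heat_flow_nth A_def B_def)
    have "\<i> * of_real x * (\<i> * of_real p * (\<i> * of_real q)) = of_real (- (x * p * q)) * \<i>" for x p q :: real
      by (simp add: complex_eq_iff)
    then show ?thesis unfolding z \<eta> sum_3
      by (simp only: flip: distrib_right of_real_add) (simp add: amplitude_def algebra_simps)
  qed
  have i: "of_real w * (of_real x * \<i>) * (\<i> * of_real v) = (of_real (- (w * x * v)) :: complex)" for w x v :: real
    by (simp add: complex_eq_iff)
  have leray: "(\<Sum>l\<in>UNIV. (mat 1 $ 1 $ l - complex_of_real (\<xi>$1 * \<xi>$l / (norm \<xi>)\<^sup>2)) * (of_real (- (W * amplitude \<eta> l)) * \<i>))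
      = of_real (- (W * last_factor \<xi> \<eta> (Inl 1))) * \<i>" for W
    by (simp add: sum_3 mat_def amplitude_def last_factor_def algebra_simps power2_eq_square)
  have "nl \<xi> (heat_flow (fst y) z) (heat_flow (fst y) \<eta>) $ a
      = of_real (1 / (2 * pi) ^ 3) * (of_real (- (A * B * (\<xi>$1 * z$3 - \<xi>$3 * z$1) * last_factor \<xi> \<eta> a)) * \<i>)"
  proof (cases "a = Inl 1")
    case True
    show ?thesis unfolding True nl_def vec_lambda_beta sum.case inner both_simps leray ..
  next
    case False
    then have a: "a = Inr 1" using assms by auto
    show ?thesis unfolding a nl_def vec_lambda_beta sum.case inner both_simps
      by (simp add: last_factor_def amplitude_def)
  qed
  moreover have "interaction t \<xi> y = nl \<xi> (heat_flow (fst y) z) (heat_flow (fst y) \<eta>)"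
    using True by (simp add: interaction_def z_def \<eta>_def)
  ultimately have "interaction t \<xi> y $ a * (\<i> * of_real (\<xi>$1))
      = of_real (- (1 / (2 * pi) ^ 3 * - (A * B * (\<xi>$1 * z$3 - \<xi>$3 * z$1) * last_factor \<xi> \<eta> a) * \<xi>$1))"
    by (simp only: i)
  also have "1 / (2 * pi) ^ 3 * - (A * B * (\<xi>$1 * z$3 - \<xi>$3 * z$1) * last_factor \<xi> \<eta> a) * \<xi>$1
      = c\<^sup>2 / (2 * pi) ^ 3 * density t \<xi> a y"
    using True unfolding AB density_def \<eta>_def[symmetric] unfolding z_def[folded \<eta>_def, symmetric] by (simp add: mult_ac)
  finally show ?thesis .
next
  case False
  then have "interaction t \<xi> y = 0" "density t \<xi> a y = 0" by (auto simp: interaction_def density_def)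
  then show ?thesis by simp
qed

text \<open>Up to a relative error \<open>2\<^sup>-\<^sup>N\<close> the interaction has a sign, given by the product of the large
  components of the two frequencies.\<close>

lemma density_ge:
  assumes \<xi>: "norm \<xi> \<le> 8/3" and a: "a \<in> {Inl 1, Inr 1}"
  shows "(angular \<xi> / 4 - 72 / 2 ^ N) * weight t \<xi> y \<le> density t \<xi> a y"
proof (cases "(0 < fst y \<and> fst y < t) \<and> overlap \<xi> (snd y) \<noteq> 0")
  case True
  define \<eta> where "\<eta> = snd y"
  define z where "z = \<xi> - \<eta>"
  define m where "m = rate \<xi> \<eta> / 2 ^ N"
  define L where "L = 1 - (\<xi>$1)\<^sup>2 / (norm \<xi>)\<^sup>2"
  define q where "q = \<xi>$1 * \<xi>$3 / (norm \<xi>)\<^sup>2"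
  have S: "\<eta> \<in> S" "z \<in> S" using True by (auto simp: overlap_def \<eta>_def z_def indicator_def split: if_splits)
  note o = opposite_packets[OF \<xi> S[unfolded z_def], folded z_def]
  have r: "rate \<xi> \<eta> = (norm z)\<^sup>2 + (norm \<eta>)\<^sup>2" by (simp add: rate_def z_def)
  have m: "1 \<le> m" "norm \<eta> \<le> m" "norm z \<le> m" using o unfolding m_def r by auto
  have x: "\<bar>\<xi>$i * \<xi>$j\<bar> \<le> 8" for i j
  proof -
    have "\<bar>\<xi>$i * \<xi>$j\<bar> \<le> 8/3 * (8/3)" unfolding abs_mult
      using component_le_norm_cart[of \<xi> i] component_le_norm_cart[of \<xi> j] \<xi> by (intro mult_mono) auto
    then show ?thesis by simp
  qed
  have cz: "\<bar>z$1\<bar> \<le> 3" "\<bar>\<eta>$1\<bar> \<le> 3" using S_facts S by auto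
  have n3: "\<bar>\<eta>$3\<bar> \<le> m" "\<bar>z$3\<bar> \<le> m" "\<bar>z$1\<bar> \<le> m"
    using m component_le_norm_cart[of \<eta> 3] component_le_norm_cart[of z 3] component_le_norm_cart[of z 1] by linarith+
  have L: "0 \<le> L" "L \<le> 1" using leray_diagonal_bounds[of \<xi>] by (auto simp: L_def)
  have q: "\<bar>q\<bar> \<le> 1"
  proof (cases "\<xi> = 0")
    case False
    have "\<bar>\<xi>$1 * \<xi>$3\<bar> \<le> norm \<xi> * norm \<xi>" unfolding abs_mult by (intro mult_mono component_le_norm_cart) auto
    then show ?thesis using False by (simp add: q_def power2_eq_square)
  qed (simp add: q_def)
  have "(\<xi>$1)\<^sup>2 * (rate \<xi> \<eta> / 4) \<le> (\<xi>$1)\<^sup>2 * - (z$3 * \<eta>$3)" using o(1) unfolding r by (intro mult_left_mono) auto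
  moreover have "\<bar>\<xi>$1 * \<xi>$3 * (z$1 * \<eta>$3)\<bar> \<le> 8 * (3 * m)"
    using x[of 1 3] cz n3 unfolding abs_mult[of "\<xi>$1 * \<xi>$3"] abs_mult[of "z$1"] by (intro mult_mono) auto
  ultimately have main: "(\<xi>$1)\<^sup>2 * (rate \<xi> \<eta> / 4) - 24 * m \<le> - (\<xi>$1 * (\<xi>$1 * z$3 - \<xi>$3 * z$1) * \<eta>$3)"
    by (simp add: power2_eq_square algebra_simps)
  have "angular \<xi> * (rate \<xi> \<eta> / 4) - 72 * m \<le> - (\<xi>$1 * (\<xi>$1 * z$3 - \<xi>$3 * z$1) * last_factor \<xi> \<eta> a)"
  proof (cases "a = Inr 1")
    case True
    have "angular \<xi> * (rate \<xi> \<eta> / 4) \<le> (\<xi>$1)\<^sup>2 * (rate \<xi> \<eta> / 4)"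
      using angular_bounds(2)[of \<xi>] rate_nonneg by (intro mult_right_mono) auto
    then show ?thesis using main m(1) by (simp add: True last_factor_def)
  next
    case False
    then have a: "a = Inl 1" using assms by auto
    have "L * ((\<xi>$1)\<^sup>2 * (rate \<xi> \<eta> / 4) - 24 * m) \<le> L * - (\<xi>$1 * (\<xi>$1 * z$3 - \<xi>$3 * z$1) * \<eta>$3)"
      using main L by (intro mult_left_mono) auto
    moreover have "L * (24 * m) \<le> 24 * m" using L m by (intro mult_left_le_one_le) auto
    moreover have "\<bar>\<xi>$1 * (\<xi>$1 * z$3 - \<xi>$3 * z$1) * (q * \<eta>$1)\<bar> \<le> (8 * m + 8 * m) * (1 * 3)"
    proof -
      have "\<bar>\<xi>$1 * \<xi>$1 * z$3\<bar> \<le> 8 * m" "\<bar>\<xi>$1 * \<xi>$3 * z$1\<bar> \<le> 8 * m"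
        using x[of 1 1] x[of 1 3] n3 unfolding abs_mult[of "\<xi>$1 * \<xi>$1"] abs_mult[of "\<xi>$1 * \<xi>$3"] by (intro mult_mono; simp)+
      then have "\<bar>\<xi>$1 * (\<xi>$1 * z$3 - \<xi>$3 * z$1)\<bar> \<le> 8 * m + 8 * m" by (simp add: algebra_simps)
      moreover have "\<bar>q * \<eta>$1\<bar> \<le> 1 * 3" unfolding abs_mult using q cz by (intro mult_mono) auto
      ultimately show ?thesis unfolding abs_mult[of "_ * (_ - _)"] by (intro mult_mono) auto
    qed
    moreover have "last_factor \<xi> \<eta> a = L * \<eta>$3 + q * \<eta>$1" by (simp add: a last_factor_def L_def q_def)
    moreover have "angular \<xi> = L * (\<xi>$1)\<^sup>2" by (simp add: angular_def L_def)
    ultimately show ?thesis by (simp add: algebra_simps)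
  qed
  then have *: "(angular \<xi> / 4 - 72 / 2 ^ N) * rate \<xi> \<eta> \<le> - (\<xi>$1 * (\<xi>$1 * z$3 - \<xi>$3 * z$1) * last_factor \<xi> \<eta> a)"
    by (simp add: m_def algebra_simps)
  have "overlap \<xi> \<eta> * exp (- fst y * rate \<xi> \<eta>) * ((angular \<xi> / 4 - 72 / 2 ^ N) * rate \<xi> \<eta>)
      \<le> overlap \<xi> \<eta> * exp (- fst y * rate \<xi> \<eta>) * - (\<xi>$1 * (\<xi>$1 * z$3 - \<xi>$3 * z$1) * last_factor \<xi> \<eta> a)"
    using * overlap_nonneg by (intro mult_left_mono) auto
  then show ?thesis using True by (simp add: weight_def density_def \<eta>_def z_def mult_ac)
qed (auto simp: weight_def density_def)

definition strength :: real where
  "strength = \<delta>\<^sup>2 * \<upsilon> / (2 * pi) ^ 3"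

lemma main_term_nth:
  assumes \<xi>: "norm \<xi> \<le> 8/3" and t: "1 \<le> t * 4 ^ N" and a: "a \<in> {Inl 1, Inr 1}"
    and fin: "convolved H H \<xi> < \<infinity>"
  shows "\<exists>Y. main_term t \<xi> $ a * (\<i> * of_real (\<xi>$1)) = of_real (- Y) \<and> strength * (angular \<xi> / 12 - 3888 / 2 ^ N) \<le> Y"
proof -
  let ?A = "c\<^sup>2 / (2 * pi) ^ 3"
  have A: "0 < ?A" using c_pos by simp
  have bl: "bounded_linear (\<lambda>v::complex^(3+3). v $ a * (\<i> * of_real (\<xi>$1)))"
    by (intro bounded_linear_mult_const bounded_linear_vec_nth)
  note int = integrable_interaction[OF fin, of t]
  have i: "integrable lborel (\<lambda>y. complex_of_real (- (?A * density t \<xi> a y)))"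
    using integrable_bounded_linear[OF bl int] unfolding interaction_nth[OF a] .
  have "main_term t \<xi> $ a * (\<i> * of_real (\<xi>$1)) = (LINT y|lborel. interaction t \<xi> y $ a * (\<i> * of_real (\<xi>$1)))"
    unfolding main_term_def by (rule integral_bounded_linear[OF bl int, symmetric])
  also have "\<dots> = (LINT y|lborel. complex_of_real (- (?A * density t \<xi> a y)))" unfolding interaction_nth[OF a] ..
  also have "\<dots> = of_real (- (?A * (LINT y|lborel. density t \<xi> a y)))" by simp
  finally have eq: "main_term t \<xi> $ a * (\<i> * of_real (\<xi>$1)) = of_real (- (?A * (LINT y|lborel. density t \<xi> a y)))" .
  have di: "integrable lborel (density t \<xi> a)"
  proof -
    have "integrable lborel (\<lambda>y. - ((2 * pi) ^ 3) / c\<^sup>2 * Re (of_real (- (?A * density t \<xi> a y))))"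
      by (intro integrable_mult_right integrable_Re i)
    also have "(\<lambda>y. - ((2 * pi) ^ 3) / c\<^sup>2 * Re (of_real (- (?A * density t \<xi> a y)))) = density t \<xi> a"
      using c_pos by auto
    finally show ?thesis .
  qed
  note w = weight_mass[OF \<xi> t]
  have "\<upsilon> * N * (angular \<xi> / 12 - 3888 / 2 ^ N) \<le> (angular \<xi> / 4 - 72 / 2 ^ N) * (LINT y|lborel. weight t \<xi> y)"
  proof -
    have "angular \<xi> / 4 * (\<upsilon> * N / 3) \<le> angular \<xi> / 4 * (LINT y|lborel. weight t \<xi> y)"
      using w(2) angular_bounds by (intro mult_left_mono) auto
    moreover have "72 / 2 ^ N * (LINT y|lborel. weight t \<xi> y) \<le> 72 / 2 ^ N * (54 * \<upsilon> * N)"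
      using w(3) by (intro mult_left_mono) auto
    ultimately show ?thesis by (simp add: algebra_simps)
  qed
  also have "\<dots> = (LINT y|lborel. (angular \<xi> / 4 - 72 / 2 ^ N) * weight t \<xi> y)" by simp
  also have "\<dots> \<le> (LINT y|lborel. density t \<xi> a y)"
    by (intro integral_mono density_ge[OF \<xi> a] di integrable_mult_right w(1))
  finally have "?A * (\<upsilon> * N * (angular \<xi> / 12 - 3888 / 2 ^ N)) \<le> ?A * (LINT y|lborel. density t \<xi> a y)"
    using A by (intro mult_left_mono) auto
  also have "?A * (\<upsilon> * N * (angular \<xi> / 12 - 3888 / 2 ^ N)) = strength * (angular \<xi> / 12 - 3888 / 2 ^ N)"
    unfolding strength_def c_sq[symmetric] by simp
  finally show ?thesis using eq by blast
qed

end

text \<open>Below this size the data generate a global solution.\<close>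

locale small_inflation = inflation +
  assumes small: "16 * \<kappa>\<^sup>2 * mass \<le> 1"
begin

sublocale micropolar_data \<psi> h0
proof
  have "ennreal (16 * \<kappa>\<^sup>2) * mixed_sq (heat_majorant h0) \<le> ennreal (16 * \<kappa>\<^sup>2) * ennreal mass"
    using mixed_sq_heat_majorant by (intro mult_left_mono) (auto simp: mass_def)
  also have "\<dots> = ennreal (16 * \<kappa>\<^sup>2 * mass)" using mass_nonneg by (simp add: ennreal_mult)
  also have "\<dots> \<le> 1" using small ennreal_leI by fastforce
  finally show "ennreal (16 * \<kappa>\<^sup>2) * mixed_sq (heat_majorant h0) \<le> 1" .
  show "weighted_mass h0 < \<infinity>" by (rule weighted_mass_h0)
qed (auto simp: h0_symmetric)

text \<open>Only the frequencies of the central block matter, and only for bounded frequencies is the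
  propagator comparable to the identity.\<close>

definition error :: "real \<Rightarrow> real^3 \<Rightarrow> real" where
  "error t \<xi> = (if norm \<xi> \<le> 8/3 then norm (bil sol sol t \<xi> - main_term t \<xi>) * (1 / norm \<xi>) else 0)"

definition error_bound :: "real \<Rightarrow> real" where
  "error_bound t = 16 * \<kappa>\<^sup>2 * (3456 * \<upsilon> * \<delta>) ^ 3 + 192 / 2 ^ N * \<kappa> * mass + 968 * t * \<kappa> * mass"

lemma error_nonneg: "0 \<le> error t \<xi>"
  by (simp add: error_def)

lemma error_measurable [measurable]: "error t \<in> borel_measurable borel"
proof -
  note [measurable (raw)] = jointly_measurableD[OF jointly_measurable_bil[OF jm_sol jm_sol]]
  show ?thesis unfolding error_def[abs_def] by measurable
qed

lemma error_mass:
  assumes t: "t \<ge> 0"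
  shows "(\<integral>\<^sup>+\<xi>. ennreal (error t \<xi>) \<partial>lborel) \<le> ennreal (error_bound t)"
proof -
  note [measurable (raw)] = jointly_measurableD[OF jointly_measurable_bil[OF jm_sol jm_sol]]
    jointly_measurableD[OF jointly_measurable_bil[OF jm_heat_flow jm_heat_flow]]
    jointly_measurableD[OF jointly_measurable_bil[OF u u]] jointly_measurableD[OF jm_H]
  let ?e1 = "\<lambda>\<xi>. ennreal (norm (bil sol sol t \<xi> - bil (linear_flow h0) (linear_flow h0) t \<xi>)) * ennreal (1 / norm \<xi>)"
  let ?e2 = "\<lambda>\<xi>. ennreal (norm (bil (linear_flow h0) (linear_flow h0) t \<xi> - bil heat_flow heat_flow t \<xi>)) * ennreal (1 / norm \<xi>)"
  let ?HH = "\<lambda>\<xi>. convolved H H \<xi>"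
  let ?e3 = "\<lambda>\<xi>. ennreal (968 * t * \<kappa>) * ?HH \<xi>"
  have HHm [measurable]: "?HH \<in> borel_measurable borel" using H_convolution_measurable by simp
  have "AE \<xi> in lborel. ennreal (error t \<xi>) \<le> ?e1 \<xi> + ?e2 \<xi> + ?e3 \<xi>"
    using AE_H_convolution_finite
  proof eventually_elim
    case (elim \<xi>)
    show ?case
    proof (cases "norm \<xi> \<le> 8/3")
      case True
      let ?a = "bil sol sol t \<xi>" and ?b = "bil (linear_flow h0) (linear_flow h0) t \<xi>" and ?c = "bil heat_flow heat_flow t \<xi>"
      have "norm (?a - main_term t \<xi>) \<le> norm (?a - ?b) + norm (?b - ?c) + norm (?c - main_term t \<xi>)"
        using norm_triangle_ineq[of "?a - ?b" "?b - ?c"] norm_triangle_ineq[of "?a - ?c" "?c - main_term t \<xi>"] by simp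
      then have "error t \<xi> \<le> (norm (?a - ?b) + norm (?b - ?c) + norm (?c - main_term t \<xi>)) * (1 / norm \<xi>)"
        unfolding error_def using True by (simp add: divide_right_mono)
      then have "ennreal (error t \<xi>) \<le> ?e1 \<xi> + ?e2 \<xi> + ennreal (norm (?c - main_term t \<xi>)) * ennreal (1 / norm \<xi>)"
        unfolding distrib_right by (subst (asm) ennreal_le_iff[symmetric]) (auto simp: ennreal_plus simp flip: ennreal_mult)
      also have "ennreal (norm (?c - main_term t \<xi>)) * ennreal (1 / norm \<xi>) \<le> ?e3 \<xi>"
      proof -
        have "ennreal (norm (?c - main_term t \<xi>)) * ennreal (1 / norm \<xi>) \<le> ennreal (968 * t * \<kappa> * norm \<xi>) * ?HH \<xi> * ennreal (1 / norm \<xi>)"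
          by (intro mult_right_mono bil_heat_flow_minus_main_term[OF t True elim]) auto
        also have "\<dots> = ennreal (968 * t * \<kappa> * norm \<xi> * (1 / norm \<xi>)) * ?HH \<xi>"
        proof -
          have "ennreal p * X * ennreal q = ennreal (p * q) * X" if "0 \<le> p" "0 \<le> q" for p q X
            using that by (simp add: ennreal_mult mult_ac)
          then show ?thesis using t \<kappa>_pos by simp
        qed
        also have "\<dots> \<le> ?e3 \<xi>" using t \<kappa>_pos by (intro mult_right_mono ennreal_leI) (cases "\<xi> = 0"; simp)+
        finally show ?thesis .
      qed
      finally show ?thesis by (simp add: add_left_mono)
    qed (simp add: error_def)
  qed
  then have "(\<integral>\<^sup>+\<xi>. ennreal (error t \<xi>) \<partial>lborel) \<le> (\<integral>\<^sup>+\<xi>. ?e1 \<xi> + ?e2 \<xi> + ?e3 \<xi> \<partial>lborel)" by (rule nn_integral_mono_AE)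
  also have "\<dots> = (\<integral>\<^sup>+\<xi>. ?e1 \<xi> \<partial>lborel) + (\<integral>\<^sup>+\<xi>. ?e2 \<xi> \<partial>lborel) + (\<integral>\<^sup>+\<xi>. ?e3 \<xi> \<partial>lborel)"
    by (subst nn_integral_add, measurable)+
  also have "\<dots> \<le> ennreal (16 * \<kappa>\<^sup>2 * (3456 * \<upsilon> * \<delta>) ^ 3) + ennreal (192 / 2 ^ N * \<kappa> * mass) + ennreal (968 * t * \<kappa> * mass)"
  proof (intro add_mono)
    show "(\<integral>\<^sup>+\<xi>. ?e1 \<xi> \<partial>lborel) \<le> ennreal (16 * \<kappa>\<^sup>2 * (3456 * \<upsilon> * \<delta>) ^ 3)"
    proof (rule ennreal_le_of_sq_le)
      have "(\<integral>\<^sup>+\<xi>. ?e1 \<xi> \<partial>lborel)\<^sup>2 \<le> ennreal (256 * \<kappa> ^ 4) * mixed_sq (heat_majorant h0) ^ 3"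
        by (rule third_order_remainder[OF mixed_sq_data_finite])
      also have "\<dots> \<le> ennreal (256 * \<kappa> ^ 4) * ennreal mass ^ 3"
        using mixed_sq_heat_majorant by (intro mult_left_mono power_mono) (auto simp: mass_def)
      also have "\<dots> = ennreal (256 * \<kappa> ^ 4 * mass ^ 3)" using mass_nonneg by (simp add: ennreal_power ennreal_mult)
      also have "256 * \<kappa> ^ 4 * mass ^ 3 = (16 * \<kappa>\<^sup>2 * (3456 * \<upsilon> * \<delta>) ^ 3)\<^sup>2"
        unfolding mass_def power_mult_distrib by (simp flip: power_mult)
      finally show "(\<integral>\<^sup>+\<xi>. ?e1 \<xi> \<partial>lborel)\<^sup>2 \<le> ennreal ((16 * \<kappa>\<^sup>2 * (3456 * \<upsilon> * \<delta>) ^ 3)\<^sup>2)" .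
    qed (use \<upsilon>_pos \<delta> in simp)
    show "(\<integral>\<^sup>+\<xi>. ?e2 \<xi> \<partial>lborel) \<le> ennreal (192 / 2 ^ N * \<kappa> * mass)" by (rule bil_linear_minus_bil_heat)
    have "(\<integral>\<^sup>+\<xi>. ?e3 \<xi> \<partial>lborel) = ennreal (968 * t * \<kappa>) * (\<integral>\<^sup>+\<xi>. ?HH \<xi> \<partial>lborel)" by (rule nn_integral_cmult) simp
    also have "\<dots> \<le> ennreal (968 * t * \<kappa>) * ennreal mass" by (intro mult_left_mono H_convolution_mass) auto
    also have "\<dots> = ennreal (968 * t * \<kappa> * mass)" using t \<kappa>_pos mass_nonneg by (simp add: ennreal_mult)
    finally show "(\<integral>\<^sup>+\<xi>. ?e3 \<xi> \<partial>lborel) \<le> ennreal (968 * t * \<kappa> * mass)" .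
  qed
  also have "\<dots> = ennreal (error_bound t)"
    unfolding error_bound_def using t \<kappa>_pos mass_nonneg \<upsilon>_pos \<delta> by (simp add: ennreal_plus)
  finally show ?thesis .
qed

text \<open>The packets do not meet the central block, so that the solution is there the Duhamel term with a
  minus sign. Its main part pairs with the test function to a real quantity of one sign, up to the
  factor \<open>inv_fourier bump\<close>, whose real part is bounded below.\<close>

lemma block_pairing_ge:
  assumes t: "0 \<le> t" "1 \<le> t * 4 ^ N" and a: "a \<in> {Inl 1, Inr 1}"
  shows "bump_mass * (strength * ((LINT \<xi>|lborel. \<psi> \<xi> * angular \<xi>) / 24 - 3888 / 2 ^ N * (LINT \<xi>|lborel. \<psi> \<xi>)) - 8 * error_bound t)
    \<le> cmod (LP_block \<psi> 0 (freq_vec (sol t) $ a) test_fun)"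
proof -
  let ?f = "\<lambda>\<xi>. of_real (\<psi> \<xi>) * sol t \<xi> $ a * inv_fourier test_fun \<xi>"
  let ?g = "\<lambda>\<xi>. bump_mass * (strength * (\<psi> \<xi> * angular \<xi> / 24 - 3888 / 2 ^ N * \<psi> \<xi>) - 8 * error t \<xi>)"
  have strength: "0 \<le> strength" using \<upsilon>_pos by (simp add: strength_def)
  have ei: "integrable lborel (error t)"
    by (rule integrableI_bounded) (use le_less_trans[OF error_mass[OF t(1)]] error_nonneg in auto)
  have e: "(LINT \<xi>|lborel. error t \<xi>) \<le> error_bound t"
  proof -
    have "ennreal (LINT \<xi>|lborel. error t \<xi>) \<le> ennreal (error_bound t)"
      using error_mass[OF t(1)] nn_integral_eq_integral[OF ei] error_nonneg by simp
    moreover have "0 \<le> error_bound t"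
      unfolding error_bound_def using t \<kappa>_pos mass_nonneg \<upsilon>_pos \<delta> by simp
    ultimately show ?thesis by simp
  qed
  have adm: "freq_admissible (\<lambda>\<xi>. sol t \<xi> $ a)"
    by (rule freq_admissible_component[OF sol_measurable weighted_mass_sol_finite[OF t(1)]])
  have fi: "integrable lborel ?f"
    using freq_dist_integrable(1)[OF integrable_imp_freq_admissible[OF integrable_\<psi>d_mult[OF adm, of 0]] schwartz_test_fun]
    by (simp add: \<psi>d_def)
  have P: "LP_block \<psi> 0 (freq_vec (sol t) $ a) test_fun = (LINT \<xi>|lborel. ?f \<xi>)"
    unfolding freq_vec_nth LP_block_freq_dist[OF schwartz_test_fun] by (simp add: freq_dist_def \<psi>d_def)
  have "AE \<xi> in lborel. ?g \<xi> \<le> - Re (?f \<xi>)"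
    using AE_majorant_Msup_finite[OF mixed_sq_data_finite, of t] AE_H_convolution_finite
  proof eventually_elim
    case (elim \<xi>)
    show ?case
    proof (cases "\<psi> \<xi> = 0")
      case True
      then show ?thesis using error_nonneg bump_mass_pos by simp
    next
      case False
      then have \<xi>: "3/4 \<le> norm \<xi>" "norm \<xi> \<le> 8/3" using \<psi>_support by auto
      have "\<xi> \<notin> S" using S_facts(2) \<xi> by fastforce
      then have "linear_flow h0 t \<xi> = 0" by (simp add: linear_flow_def h0_outside)
      then have sol: "sol t \<xi> = - bil sol sol t \<xi>" using sol_fixed_point[OF elim(1)] by simp
      obtain Y where Y: "main_term t \<xi> $ a * (\<i> * of_real (\<xi>$1)) = of_real (- Y)"
        "strength * (angular \<xi> / 12 - 3888 / 2 ^ N) \<le> Y"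
        using main_term_nth[OF \<xi>(2) t(2) a elim(2)] by blast
      define m where "m = inv_fourier bump \<xi>"
      define w where "w = (bil sol sol t \<xi> - main_term t \<xi>) $ a * (\<i> * of_real (\<xi>$1)) * m"
      have f: "?f \<xi> = of_real (\<psi> \<xi>) * (of_real (- Y) * m + w)"
      proof -
        have "sol t \<xi> $ a * inv_fourier test_fun \<xi> = (main_term t \<xi> $ a * (\<i> * of_real (\<xi>$1))) * m + w"
          by (simp add: sol inv_fourier_test_fun w_def m_def algebra_simps)
        then show ?thesis unfolding Y(1) by (simp add: mult.assoc)
      qed
      have w: "cmod w \<le> 8 * error t \<xi> * bump_mass"
      proof -
        have "norm \<xi> * norm \<xi> \<le> 8/3 * (8/3)" using \<xi> by (intro mult_mono) auto
        then have n: "norm \<xi> \<le> 8 / norm \<xi>" using \<xi> by (subst pos_le_divide_eq) auto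
        have "\<bar>\<xi>$1\<bar> \<le> norm \<xi>" by (rule component_le_norm_cart)
        also have "\<dots> \<le> 8 * (1 / norm \<xi>)" using n by simp
        finally have x: "\<bar>\<xi>$1\<bar> \<le> 8 * (1 / norm \<xi>)" .
        have "cmod w = cmod ((bil sol sol t \<xi> - main_term t \<xi>) $ a) * \<bar>\<xi>$1\<bar> * cmod m"
          by (simp add: w_def norm_mult)
        also have "\<dots> \<le> norm (bil sol sol t \<xi> - main_term t \<xi>) * (8 * (1 / norm \<xi>)) * bump_mass"
          unfolding m_def using x
          by (intro mult_mono Finite_Cartesian_Product.norm_nth_le norm_inv_fourier_bump_le) auto
        finally show ?thesis using \<xi> by (simp add: error_def mult_ac)
      qed
      have m: "bump_mass / 2 \<le> Re m" "Re m \<le> bump_mass"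
        unfolding m_def using Re_inv_fourier_bump_ge[OF \<xi>(2)] norm_inv_fourier_bump_le[of \<xi>] complex_Re_le_cmod[of "inv_fourier bump \<xi>"] by auto
      have "strength * (angular \<xi> / 12) \<le> Y + strength * (3888 / 2 ^ N)" using Y(2) by (simp add: algebra_simps)
      moreover have "0 \<le> strength * (angular \<xi> / 12)" using strength angular_bounds[of \<xi>] by simp
      ultimately have "strength * (angular \<xi> / 12) * (bump_mass / 2) \<le> (Y + strength * (3888 / 2 ^ N)) * Re m"
        using m bump_mass_pos by (intro mult_mono) auto
      moreover have "strength * (3888 / 2 ^ N) * Re m \<le> strength * (3888 / 2 ^ N) * bump_mass"
        using m strength by (intro mult_left_mono) auto
      ultimately have "strength * (angular \<xi> / 12) * (bump_mass / 2) - strength * (3888 / 2 ^ N) * bump_mass \<le> Y * Re m"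
        unfolding distrib_right by linarith
      also have "strength * (angular \<xi> / 12) * (bump_mass / 2) - strength * (3888 / 2 ^ N) * bump_mass
          = bump_mass * (strength * (angular \<xi> / 24 - 3888 / 2 ^ N))" by (simp add: algebra_simps)
      finally have "bump_mass * (strength * (angular \<xi> / 24 - 3888 / 2 ^ N)) \<le> Y * Re m" .
      moreover have "Re w \<le> 8 * error t \<xi> * bump_mass" using w complex_Re_le_cmod[of w] by linarith
      ultimately have "bump_mass * (strength * (angular \<xi> / 24 - 3888 / 2 ^ N)) - 8 * error t \<xi> * bump_mass \<le> - Re (of_real (- Y) * m + w)"
        by simp
      then have "\<psi> \<xi> * (bump_mass * (strength * (angular \<xi> / 24 - 3888 / 2 ^ N)) - 8 * error t \<xi> * bump_mass)
          \<le> \<psi> \<xi> * - Re (of_real (- Y) * m + w)" by (intro mult_left_mono \<psi>_nonneg)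
      also have "\<dots> = - Re (?f \<xi>)" unfolding f by (simp add: algebra_simps)
      finally have 1: "bump_mass * (strength * (\<psi> \<xi> * angular \<xi> / 24 - 3888 / 2 ^ N * \<psi> \<xi>)) - \<psi> \<xi> * (8 * error t \<xi> * bump_mass) \<le> - Re (?f \<xi>)"
        by (simp add: algebra_simps)
      have "\<psi> \<xi> * (8 * error t \<xi> * bump_mass) \<le> 1 * (8 * error t \<xi> * bump_mass)"
        using \<psi>d_le_1[of 0 \<xi>] error_nonneg bump_mass_pos by (intro mult_right_mono) (auto simp: \<psi>d_def)
      then show ?thesis using 1 by (simp add: algebra_simps)
    qed
  qed
  moreover have "integrable lborel ?g"
    by (intro integrable_mult_right Bochner_Integration.integrable_diff integrable_divide ei \<psi>_integrable integrable_\<psi>_angular)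
  moreover have "integrable lborel (\<lambda>\<xi>. - Re (?f \<xi>))" by (intro integrable_minus integrable_Re fi)
  ultimately have "(LINT \<xi>|lborel. ?g \<xi>) \<le> (LINT \<xi>|lborel. - Re (?f \<xi>))" by (intro integral_mono_AE)
  also have "\<dots> = - Re (LINT \<xi>|lborel. ?f \<xi>)" unfolding Bochner_Integration.integral_minus integral_Re[OF fi] ..
  also have "\<dots> \<le> cmod (LINT \<xi>|lborel. ?f \<xi>)" using abs_Re_le_cmod[of "LINT \<xi>|lborel. ?f \<xi>"] by linarith
  finally have "(LINT \<xi>|lborel. ?g \<xi>) \<le> cmod (LP_block \<psi> 0 (freq_vec (sol t) $ a) test_fun)" unfolding P .
  moreover have "(LINT \<xi>|lborel. ?g \<xi>) = bump_mass * (strength * ((LINT \<xi>|lborel. \<psi> \<xi> * angular \<xi>) / 24 - 3888 / 2 ^ N * (LINT \<xi>|lborel. \<psi> \<xi>)) - 8 * (LINT \<xi>|lborel. error t \<xi>))"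
    using ei \<psi>_integrable integrable_\<psi>_angular by (simp add: Bochner_Integration.integral_diff)
  moreover have "bump_mass * (8 * (LINT \<xi>|lborel. error t \<xi>)) \<le> bump_mass * (8 * error_bound t)"
    using e bump_mass_pos by (intro mult_left_mono) auto
  ultimately show ?thesis by (simp add: algebra_simps)
qed

end

subsection \<open>Choice of the parameters\<close>

context small_inflation
begin

lemma component_besov_norm_ge:
  assumes p: "p \<le> bump_mass * (strength * ((LINT \<xi>|lborel. \<psi> \<xi> * angular \<xi>) / 24 - 3888 / 2 ^ N * (LINT \<xi>|lborel. \<psi> \<xi>)) - 8 * error_bound (1 / 2 ^ N))"
    and a: "a \<in> {Inl 1, Inr 1}" and r: "r > 0"
  shows "ennreal (p / (LINT x|lborel. cmod (test_fun x))) \<le> besov_norm \<psi> (- 1) \<infinity> r (freq_vec (sol (1 / 2 ^ N)) $ a)"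
proof (cases "0 \<le> p")
  case True
  let ?T = "freq_vec (sol (1 / 2 ^ N)) $ a" and ?m = "LINT x|lborel. cmod (test_fun x)"
  have "(4::real) ^ N = 2 ^ N * 2 ^ N" by (simp flip: power_mult_distrib)
  then have "p \<le> cmod (LP_block \<psi> 0 ?T test_fun)"
    by (intro order_trans[OF p] block_pairing_ge a) auto
  then have "ennreal p \<le> besov_norm \<psi> (- 1) \<infinity> r ?T * ennreal ?m"
    using besov_norm_ge[OF schwartz_test_fun compact_cball test_fun_support test_fun_mass_pos r, where s'="- 1" and T = ?T]
    by (meson ennreal_leI order_trans)
  then have "ennreal p / ennreal ?m \<le> besov_norm \<psi> (- 1) \<infinity> r ?T * ennreal ?m / ennreal ?m"
    by (rule divide_right_mono_ennreal)
  then show ?thesis using True test_fun_mass_pos by (simp add: divide_ennreal ennreal_mult_divide_eq)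
next
  case False
  then have "p / (LINT x|lborel. cmod (test_fun x)) \<le> 0" using test_fun_mass_pos by (simp add: divide_le_0_iff)
  then show ?thesis by (simp add: ennreal_neg)
qed

lemma inflating_solution:
  assumes "p \<le> bump_mass * (strength * ((LINT \<xi>|lborel. \<psi> \<xi> * angular \<xi>) / 24 - 3888 / 2 ^ N * (LINT \<xi>|lborel. \<psi> \<xi>)) - 8 * error_bound (1 / 2 ^ N))"
    and r: "r > 0"
  shows "\<exists>(f :: tdist^(3 + 3)) U.
      f \<in> vec_FB \<psi> (- 1) 1 2 \<and> (\<forall>a. real_dist (f $ a)) \<and> divergence_free (velocity f) \<and>
      vec_besov_norm \<psi> (- 1) \<infinity> r f \<le> ennreal (13824 * \<upsilon> * (\<delta> / sqrt N) * real (N + 3) powr (if r = \<infinity> then 0 else 1 / enn2real r)) \<and>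
      continuous_into_FB \<psi> (- 1) 1 2 U \<and> (\<forall>s\<ge>0. \<forall>a. real_dist (U s $ a)) \<and> mild_solution f U \<and> U 0 = f \<and>
      ennreal (p / (LINT x|lborel. cmod (test_fun x))) \<le> vec_besov_norm \<psi> (- 1) \<infinity> r (velocity (U (1 / 2 ^ N))) \<and>
      ennreal (p / (LINT x|lborel. cmod (test_fun x))) \<le> vec_besov_norm \<psi> (- 1) \<infinity> r (microrotation (U (1 / 2 ^ N)))"
proof -
  let ?U = "\<lambda>s. freq_vec (sol s)"
  have "besov_norm \<psi> (- 1) \<infinity> r (?U s $ Inl 1) \<le> vec_besov_norm \<psi> (- 1) \<infinity> r (velocity (?U s))"
    "besov_norm \<psi> (- 1) \<infinity> r (?U s $ Inr 1) \<le> vec_besov_norm \<psi> (- 1) \<infinity> r (microrotation (?U s))" for s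
    using member_le_sum[of 1 UNIV "\<lambda>i. besov_norm \<psi> (- 1) \<infinity> r (velocity (?U s) $ i)"]
      member_le_sum[of 1 UNIV "\<lambda>i. besov_norm \<psi> (- 1) \<infinity> r (microrotation (?U s) $ i)"]
    by (simp_all add: vec_besov_norm_def velocity_def microrotation_def)
  then have large: "ennreal (p / (LINT x|lborel. cmod (test_fun x))) \<le> vec_besov_norm \<psi> (- 1) \<infinity> r (velocity (?U (1 / 2 ^ N)))"
      "ennreal (p / (LINT x|lborel. cmod (test_fun x))) \<le> vec_besov_norm \<psi> (- 1) \<infinity> r (microrotation (?U (1 / 2 ^ N)))"
    using component_besov_norm_ge[OF assms(1) _ r] by (blast intro: order_trans)+
  have small_data: "vec_besov_norm \<psi> (- 1) \<infinity> r (freq_vec h0)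
      \<le> ennreal (13824 * \<upsilon> * (\<delta> / sqrt N) * real (N + 3) powr (if r = \<infinity> then 0 else 1 / enn2real r))"
  proof -
    have "(if r = \<infinity> then 1 else real (N + 3) powr (1 / enn2real r)) = real (N + 3) powr (if r = \<infinity> then 0 else 1 / enn2real r)"
      by simp
    then show ?thesis using vec_besov_norm_h0[OF r] unfolding c_def by (simp only:)
  qed
  have "freq_vec h0 \<in> vec_FB \<psi> (- 1) 1 2" "\<And>a. real_dist (freq_vec h0 $ a)"
    using freq_vec_sol_in_FB[of 0] real_dist_freq_vec_sol[of 0] by (simp_all only: sol_at_0 order_refl)
  then show ?thesis
    using small_data large divergence_free_h0 continuous_freq_vec_sol real_dist_freq_vec_sol mild_solution_freq_vec_sol sol_at_0
    by (intro exI[of _ "freq_vec h0"] exI[of _ ?U]) auto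
qed

end

text \<open>The second order effect is quadratic in \<open>\<delta>\<close> and the error of the Picard iteration is cubic, so
  that \<open>\<delta>\<close> can be chosen once and for all; the remaining errors vanish as \<open>N \<rightarrow> \<infinity>\<close>.\<close>

lemma (in littlewood_paley_partition) inflation_parameters:
  "\<exists>\<delta>>0. \<exists>p>0. \<exists>N0\<ge>4. \<forall>N\<ge>N0. small_inflation \<psi> \<delta> N \<and>
     p \<le> bump_mass * (inflation.strength \<delta> * ((LINT \<xi>|lborel. \<psi> \<xi> * angular \<xi>) / 24 - 3888 / 2 ^ N * (LINT \<xi>|lborel. \<psi> \<xi>))
        - 8 * small_inflation.error_bound \<delta> N (1 / 2 ^ N))"
proof -
  define Q where "Q = (LINT \<xi>|lborel. \<psi> \<xi> * angular \<xi>)"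
  define Z where "Z = (LINT \<xi>|lborel. \<psi> \<xi>)"
  define X where "X = \<upsilon> / (2 * pi) ^ 3"
  define b where "b = 3456 * \<upsilon>"
  have pos: "0 < Q" "0 < X" "0 < b" "0 < \<kappa>"
    using integral_\<psi>_angular_pos \<upsilon>_pos \<kappa>_pos by (simp_all add: Q_def X_def b_def)
  define \<delta> where "\<delta> = min (1 / (4 * \<kappa> * b)) (X * Q / (96 * 128 * \<kappa>\<^sup>2 * b ^ 3))"
  have \<delta>: "0 < \<delta>" using pos by (simp add: \<delta>_def)
  have s1: "4 * \<kappa> * b * \<delta> \<le> 1" 
  proof -
    have "\<delta> \<le> 1 / (4 * \<kappa> * b)" by (simp add: \<delta>_def)
    then show ?thesis using pos by (simp add: pos_le_divide_eq mult_ac)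
  qed
  have s2: "128 * \<kappa>\<^sup>2 * b ^ 3 * \<delta> \<le> X * Q / 96"
  proof -
    have "\<delta> \<le> X * Q / (96 * 128 * \<kappa>\<^sup>2 * b ^ 3)" by (simp add: \<delta>_def)
    then show ?thesis using pos by (simp add: pos_le_divide_eq mult_ac)
  qed
  define R where "R = 3888 * (\<delta>\<^sup>2 * X) * Z + 9280 * \<kappa> * (b * \<delta>)\<^sup>2"
  have "(\<lambda>N. R * (1 / 2) ^ N) \<longlonglongrightarrow> R * 0" by (intro tendsto_mult tendsto_const LIMSEQ_power_zero) simp
  then have "eventually (\<lambda>N. R * (1 / 2) ^ N < \<delta>\<^sup>2 * (X * Q / 96)) sequentially"
    using pos \<delta> by (intro order_tendstoD) auto
  then obtain N1 where N1: "\<And>N. N \<ge> N1 \<Longrightarrow> R * (1 / 2) ^ N < \<delta>\<^sup>2 * (X * Q / 96)"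
    unfolding eventually_sequentially by blast
  show ?thesis
  proof (rule exI[of _ \<delta>], intro conjI \<delta>, rule exI[of _ "bump_mass * (\<delta>\<^sup>2 * (X * Q / 48))"], intro conjI,
      use bump_mass_pos \<delta> pos in simp, rule exI[of _ "max 4 N1"], intro conjI allI impI)
    fix N assume Nmax: "max 4 N1 \<le> N"
    interpret inflation \<psi> \<delta> N by unfold_locales (use \<delta> Nmax in auto)
    have N': "N1 \<le> N" using Nmax by simp
    have m: "mass = (b * \<delta>)\<^sup>2" by (simp add: mass_def b_def)
    have "(4 * \<kappa> * b * \<delta>)\<^sup>2 \<le> 1\<^sup>2" using s1 pos \<delta> by (intro power_mono) auto
    then have sm: "16 * \<kappa>\<^sup>2 * mass \<le> 1" unfolding m by (simp add: power_mult_distrib mult_ac)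
    interpret small_inflation \<psi> \<delta> N by unfold_locales (rule sm)
    show "small_inflation \<psi> \<delta> N" by unfold_locales
    have st: "strength = \<delta>\<^sup>2 * X" by (simp add: strength_def X_def)
    have eb: "error_bound (1 / 2 ^ N) = 16 * \<kappa>\<^sup>2 * (b * \<delta>) ^ 3 + 1160 * \<kappa> * (b * \<delta>)\<^sup>2 * (1 / 2) ^ N"
    proof -
      have "192 * y * \<kappa> * B + 968 * y * \<kappa> * B = 1160 * \<kappa> * B * y" for y B by simp
      from this[of "1 / 2 ^ N" "(b * \<delta>)\<^sup>2"] show ?thesis
        unfolding error_bound_def m b_def[symmetric] power_one_over by simp
    qed
    have "128 * \<kappa>\<^sup>2 * (b * \<delta>) ^ 3 = \<delta>\<^sup>2 * (128 * \<kappa>\<^sup>2 * b ^ 3 * \<delta>)"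
      by (simp add: power2_eq_square power3_eq_cube)
    also have "\<dots> \<le> \<delta>\<^sup>2 * (X * Q / 96)" using s2 by (intro mult_left_mono) auto
    finally have "\<delta>\<^sup>2 * (X * Q / 48) \<le> \<delta>\<^sup>2 * (X * Q / 24) - 128 * \<kappa>\<^sup>2 * (b * \<delta>) ^ 3 - R * (1 / 2) ^ N"
      using N1[OF N'] by linarith
    also have "\<dots> = strength * (Q / 24 - 3888 / 2 ^ N * Z) - 8 * error_bound (1 / 2 ^ N)"
    proof -
      have "d * (x * v / 24) - 128 * k\<^sup>2 * B ^ 3 - (3888 * (d * x) * z + 9280 * k * B\<^sup>2) * y
          = d * x * (v / 24 - 3888 * y * z) - 8 * (16 * k\<^sup>2 * B ^ 3 + 1160 * k * B\<^sup>2 * y)" for d x v k B z y :: real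
        by (simp add: algebra_simps)
      from this[of "\<delta>\<^sup>2" X Q \<kappa> "b * \<delta>" Z "(1 / 2) ^ N"] show ?thesis
        unfolding st eb R_def by (simp add: power_one_over)
    qed
    finally show "bump_mass * (\<delta>\<^sup>2 * (X * Q / 48)) \<le> bump_mass * (strength * ((LINT \<xi>|lborel. \<psi> \<xi> * angular \<xi>) / 24 - 3888 / 2 ^ N * (LINT \<xi>|lborel. \<psi> \<xi>)) - 8 * error_bound (1 / 2 ^ N))"
      unfolding Q_def[symmetric] Z_def[symmetric] using bump_mass_pos by (intro mult_left_mono) auto
  qed auto
qed

text \<open>With \<open>q = 1 / r\<close>, and \<open>q = 0\<close> for \<open>r = \<infinity>\<close>, the condition is \<open>r > 2\<close>.\<close>

lemma data_size_tendsto_0: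
  assumes "0 \<le> q" "q < 1 / 2"
  shows "(\<lambda>n. C * (\<delta> / sqrt (real n)) * real (n + 3) powr q) \<longlonglongrightarrow> 0"
proof -
  have "(\<lambda>n. real n powr (q - 1 / 2)) \<longlonglongrightarrow> 0"
    by (rule tendsto_neg_powr[OF _ filterlim_real_sequentially]) (use assms in simp)
  then have "(\<lambda>n. \<bar>C * \<delta>\<bar> * 4 powr q * real n powr (q - 1 / 2)) \<longlonglongrightarrow> 0"
    by (rule tendsto_mult_right_zero)
  then show ?thesis
  proof (rule Lim_null_comparison[rotated, where g="\<lambda>n. \<bar>C * \<delta>\<bar> * 4 powr q * real n powr (q - 1 / 2)"])
    show "eventually (\<lambda>n. norm (C * (\<delta> / sqrt (real n)) * real (n + 3) powr q) \<le> \<bar>C * \<delta>\<bar> * 4 powr q * real n powr (q - 1 / 2)) sequentially"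
      using eventually_ge_at_top[of 1]
    proof eventually_elim
      case (elim n)
      have "real (n + 3) powr q \<le> (4 * real n) powr q" using elim assms(1) by (intro powr_mono2) auto
      also have "\<dots> = 4 powr q * real n powr q" by (rule powr_mult)
      finally have "\<bar>C * \<delta>\<bar> / sqrt (real n) * real (n + 3) powr q \<le> \<bar>C * \<delta>\<bar> / sqrt (real n) * (4 powr q * real n powr q)"
        by (intro mult_left_mono) auto
      also have "\<dots> = \<bar>C * \<delta>\<bar> * 4 powr q * real n powr (q - 1 / 2)"
        using elim by (simp add: powr_diff powr_half_sqrt)
      finally show ?case by (simp add: abs_mult)
    qed
  qed
qed

theorem theorem1p6:
  fixes \<psi> :: "real^3 \<Rightarrow> real" and r :: ennreal
  assumes "littlewood_paley \<psi>"
    and "2 < r"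
  shows "\<exists>(f :: nat \<Rightarrow> tdist^(3 + 3)) (t :: nat \<Rightarrow> real) (U :: nat \<Rightarrow> real \<Rightarrow> tdist^(3 + 3)) (c\<^sub>0 :: real).
    (\<forall>N\<ge>1. f N \<in> vec_FB \<psi> (- 1) 1 2 \<and> (\<forall>a. real_dist (f N $ a)) \<and>
            divergence_free (velocity (f N))) \<and>
    (\<lambda>N. vec_besov_norm \<psi> (- 1) \<infinity> r (f N)) \<longlonglongrightarrow> 0 \<and>
    (\<forall>N\<ge>1. 0 < t N) \<and> t \<longlonglongrightarrow> 0 \<and>
    (\<forall>N\<ge>1. continuous_into_FB \<psi> (- 1) 1 2 (U N) \<and> (\<forall>s\<ge>0. \<forall>a. real_dist (U N s $ a)) \<and>
            mild_solution (f N) (U N) \<and> U N 0 = f N) \<and>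
    0 < c\<^sub>0 \<and>
    (\<forall>N\<ge>1. ennreal c\<^sub>0 \<le> vec_besov_norm \<psi> (- 1) \<infinity> r (velocity (U N (t N))) \<and>
            ennreal c\<^sub>0 \<le> vec_besov_norm \<psi> (- 1) \<infinity> r (microrotation (U N (t N))))"
proof -
  interpret littlewood_paley_partition \<psi> by unfold_locales (rule assms(1))
  have r: "0 < r" using assms(2) by (rule less_trans[rotated]) simp
  define q where "q = (if r = \<infinity> then 0 else 1 / enn2real r)"
  have q: "0 \<le> q" "q < 1 / 2"
  proof -
    show "0 \<le> q" by (simp add: q_def)
    show "q < 1 / 2"
    proof (cases r)
      case (real x)
      then have "ennreal 2 < ennreal x" using assms(2) by simp
      then have "2 < x" by (simp add: ennreal_less_iff)
      then show ?thesis using real by (simp add: q_def field_simps)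
    qed (simp add: q_def)
  qed
  obtain \<delta> p N0 where \<delta>: "0 < \<delta>" and p: "0 < p" and N0: "4 \<le> N0"
    and par: "\<And>N. N0 \<le> N \<Longrightarrow> small_inflation \<psi> \<delta> N \<and>
       p \<le> bump_mass * (inflation.strength \<delta> * ((LINT \<xi>|lborel. \<psi> \<xi> * angular \<xi>) / 24 - 3888 / 2 ^ N * (LINT \<xi>|lborel. \<psi> \<xi>))
        - 8 * small_inflation.error_bound \<delta> N (1 / 2 ^ N))"
    using inflation_parameters by blast
  define c\<^sub>0 where "c\<^sub>0 = p / (LINT x|lborel. cmod (test_fun x))"
  define g where "g n = 13824 * \<upsilon> * (\<delta> / sqrt (real n)) * real (n + 3) powr q" for n
  define t :: "nat \<Rightarrow> real" where "t N = 1 / 2 ^ (N + N0)" for N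
  have "\<forall>N. \<exists>(f :: tdist^(3 + 3)) U.
      f \<in> vec_FB \<psi> (- 1) 1 2 \<and> (\<forall>a. real_dist (f $ a)) \<and> divergence_free (velocity f) \<and>
      vec_besov_norm \<psi> (- 1) \<infinity> r f \<le> ennreal (g (N + N0)) \<and>
      continuous_into_FB \<psi> (- 1) 1 2 U \<and> (\<forall>s\<ge>0. \<forall>a. real_dist (U s $ a)) \<and> mild_solution f U \<and> U 0 = f \<and>
      ennreal c\<^sub>0 \<le> vec_besov_norm \<psi> (- 1) \<infinity> r (velocity (U (t N))) \<and>
      ennreal c\<^sub>0 \<le> vec_besov_norm \<psi> (- 1) \<infinity> r (microrotation (U (t N)))"
  proof
    fix N
    have n: "N0 \<le> N + N0" by simp
    interpret small_inflation \<psi> \<delta> "N + N0" using par[OF n] by blast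
    show "\<exists>(f :: tdist^(3 + 3)) U.
      f \<in> vec_FB \<psi> (- 1) 1 2 \<and> (\<forall>a. real_dist (f $ a)) \<and> divergence_free (velocity f) \<and>
      vec_besov_norm \<psi> (- 1) \<infinity> r f \<le> ennreal (g (N + N0)) \<and>
      continuous_into_FB \<psi> (- 1) 1 2 U \<and> (\<forall>s\<ge>0. \<forall>a. real_dist (U s $ a)) \<and> mild_solution f U \<and> U 0 = f \<and>
      ennreal c\<^sub>0 \<le> vec_besov_norm \<psi> (- 1) \<infinity> r (velocity (U (t N))) \<and>
      ennreal c\<^sub>0 \<le> vec_besov_norm \<psi> (- 1) \<infinity> r (microrotation (U (t N)))"
      unfolding c\<^sub>0_def g_def t_def q_def by (rule inflating_solution[OF _ r]) (use par[OF n] in blast)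
  qed
  then obtain f :: "nat \<Rightarrow> tdist^(3 + 3)" and U where fU: "\<And>N.
      f N \<in> vec_FB \<psi> (- 1) 1 2 \<and> (\<forall>a. real_dist (f N $ a)) \<and> divergence_free (velocity (f N)) \<and>
      vec_besov_norm \<psi> (- 1) \<infinity> r (f N) \<le> ennreal (g (N + N0)) \<and>
      continuous_into_FB \<psi> (- 1) 1 2 (U N) \<and> (\<forall>s\<ge>0. \<forall>a. real_dist (U N s $ a)) \<and> mild_solution (f N) (U N) \<and> U N 0 = f N \<and>
      ennreal c\<^sub>0 \<le> vec_besov_norm \<psi> (- 1) \<infinity> r (velocity (U N (t N))) \<and>
      ennreal c\<^sub>0 \<le> vec_besov_norm \<psi> (- 1) \<infinity> r (microrotation (U N (t N)))"
    by metis
  have "(\<lambda>N. g (N + N0)) \<longlonglongrightarrow> 0"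
    unfolding g_def by (rule LIMSEQ_ignore_initial_segment[OF data_size_tendsto_0[OF q]])
  then have g: "(\<lambda>N. ennreal (g (N + N0))) \<longlonglongrightarrow> 0" using tendsto_ennrealI by fastforce
  have "(\<lambda>N. vec_besov_norm \<psi> (- 1) \<infinity> r (f N)) \<longlonglongrightarrow> 0"
    by (rule tendsto_sandwich[OF _ _ tendsto_const g]) (use fU in auto)
  moreover have "t \<longlonglongrightarrow> 0"
    using LIMSEQ_ignore_initial_segment[OF LIMSEQ_power_zero[of "1 / 2 :: real"], of N0]
    by (simp add: t_def[abs_def] power_one_over)
  moreover have "0 < t N" for N by (simp add: t_def)
  moreover have "0 < c\<^sub>0" using p test_fun_mass_pos by (simp add: c\<^sub>0_def)
  ultimately show ?thesis
    using fU by (intro exI[of _ f] exI[of _ t] exI[of _ U] exI[of _ c\<^sub>0]) simp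
qed

end
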